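(* Let $W=G(e,e,2)$, with the root lattice $L_0$. (i) The subgroup $G(d,d,2)$ of $G(e,e,2)$ is pseudoparabolic if and only if $d$ satisfies one of the following conditions: $d=1$; $d=e$; $d$ divides $e$ and is a power of a prime number. (ii) If $e$ is even, $G'(d,d,2)$ is pseudoparabolic if and only if $e/d$ is an even integer and one of the following conditions holds: $d=1$; $d<e/2$ and $d$ is a power of a prime number. (iii) If $e>2$, the set of Springer representations of $G(e,e,2)$ is $$\{\chi^{(e)}_0,\chi^{(e)}_1,\chi^{(e)}_e\}\cup\{\chi^{(e)}_d\mid d\text{ divides }e\text{ and is a power of a prime number}\}.$$ In particular, if $e$ is even and greater than $2$, $\chi^{(e)\prime}_{e/2}$ is not a Springer representation. (iv) Every irreducible representation of $G(2,2,2)$ is a Springer representation.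
   Context: **Group and subgroups.** Let $e$ be a positive integer, $\zeta$ a primitive $e$-th root of unity, $K=\mathbb Q(\zeta)$, $K_0=\mathbb Q(\zeta+\zeta^{-1})$, $\mathbb Z_K=\mathbb Z[\zeta]$, $V=Ke_1\oplus Ke_2$; a bar denotes complex conjugation. $G(e,e,2)$ is the dihedral group of order $2e$ of monomial $2\times2$ matrices whose nonzero entries are $e$-th roots of unity with product $1$. Put $s_i=\begin{pmatrix}0&\zeta^i\\ \zeta^{-i}&0\end{pmatrix}$. For $d\mid e$, $G(d,d,2)$ denotes the subgroup generated by $s_0$ and $s_{e/d}$; if $e/d$ is even, $G'(d,d,2)$ denotes the subgroup generated by $s_1$ and $s_{e/d+1}$ (isomorphic but not conjugate to $G(d,d,2)$). Every nontrivial reflection subgroup of $W$ is conjugate to one of these. **Irreducible representations.** Those of $G(e,e,2)$ are denoted $\chi^{(e)}_0,\chi^{(e)}_1,\dots,\chi^{(e)}_{\lfloor (e-1)/2\rfloor}$, $\chi^{(e)}_e$, and, if $e$ is even, also $\chi^{(e)}_{e/2},\chi^{(e)\prime}_{e/2}$; the lower indices are the values of the function $b$ defined below. Here $\chi_0^{(e)}$ is the trivial representation, $\chi_1^{(e)}$ the reflection representation (for $e>2$) and $\chi_e^{(e)}$ the sign representation. The representations $\chi^{(e)}_{e/2},\chi^{(e)\prime}_{e/2}$ are distinguished by $j_{G(e/2,e/2,2)}^{G(e,e,2)}\chi^{(e/2)}_{e/2}=\chi^{(e)}_{e/2}$ and $j_{G'(e/2,e/2,2)}^{G(e,e,2)}\chi^{(e/2)}_{e/2}=\chi^{(e)\prime}_{e/2}$,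 where $\chi^{(e/2)}_{e/2}$ is the sign representation of the subgroup and $j$ is truncated induction (defined below). **Root lattice.** $V_0=\{v_1e_1+v_2e_2\in V\mid v_2=-\bar v_1\}$, a $K_0$-subspace of $V$ stable under $G(e,e,2)$, and $L_0=\{v_1e_1-\bar v_1e_2\in V_0\mid v_1\in\mathbb Z_K\}$, a lattice in $V_0$ stable under $G(e,e,2)$. **Pseudoparabolic subgroups and Springer representations.** A root is an eigenvector of a reflection for a nontrivial eigenvalue. Let $\tilde W$ be the group generated by $W$ and every other reflection that preserves $L_0$ and has a root in $L_0$; for $W=G(e,e,2)$ one has $\tilde W=W$. For $x\in V_0/L_0$ let $\tilde W^x$ be its stabilizer in $\tilde W$ and $\tilde W^x_{\mathrm{refl}}$ the subgroup generated by the reflections in $\tilde W^x$. A reflection subgroup $W'\subset\tilde W$ is full if, for every reflection $s\in\tilde W$ and every integer $a$, $s^a\in W'$ and $s^a\ne1$ imply $s\in W'$. Let $\tilde W^x_{\mathrm{plein}}$ be a maximal parabolic subgroup of $\tilde W^x_{\mathrm{refl}}$ among those that are full in $\tilde W$ (it is defined only up to conjugation), and $\tilde W^x_{\mathrm{spets}}$ the largest full spetsial subgroup of $\tilde W^x_{\mathrm{plein}}$. A subgroup $W'\subset W$ is pseudoparabolic (with respect to $L_0$) if $W'=W\cap\tilde W^x_{\mathrm{spets}}$ for some $x\in V_0/L_0$ and some such group $\tilde W^x_{\mathrm{spets}}$. A Springer representation is an irreducible representation of $W$ of the form $j_{W'}^W(E')$ with $W'$ pseudoparabolic and $E'$ a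 special representation of $W'$. **Auxiliary notions.** $b(E)$ is the least degree in which $E$ occurs in the symmetric algebra $S(V)$; $a(E)$ is the order of vanishing at $q=0$ of the generic degree of the corresponding representation of the one-parameter Hecke algebra with relations $(s-q)(s+1)=0$ for the generating reflections; $E$ is special if $a(E)=b(E)$; a group is spetsial if $a(E)\le b(E)$ for all its irreducible representations $E$. If $E'\in\mathrm{Irr}(W')$ occurs with multiplicity $1$ in $S^{b(E')}(V)$, $j_{W'}^W(E')$ is the $W$-submodule of $S^{b(E')}(V)$ generated by this copy of $E'$; it is irreducible.
   Formalization: In (i) the single case e=2, d=1 is excluded, because the claim is false there: for e=2 the reflection s_1 acts trivially on V_0, so every pseudoparabolic subgroup contains s_1 and G(1,1,2)={1,s_0} is not pseudoparabolic. *)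

theory Defs
  imports
    "Jordan_Normal_Form.VS_Connect"
    "HOL-Algebra.Multiplicative_Group"
    "HOL-Number_Theory.Prime_Powers"
    "HOL-Computational_Algebra.Fraction_Field"
begin

section \<open>Groups of matrices, reflections\<close>

definition GL :: "nat \<Rightarrow> complex mat monoid" where
  "GL n = units_of (ring_mat TYPE(complex) n ())"

text \<open>All reflections here act on a plane, so the fixed hyperplane is a line.\<close>

definition reflection :: "complex mat \<Rightarrow> bool" where
  "reflection s \<longleftrightarrow> s \<in> carrier (GL 2) \<and> s \<noteq> 1\<^sub>m 2 \<and> (\<exists>k>0. s ^\<^sub>m k = 1\<^sub>m 2) \<and>
     (\<exists>v\<in>carrier_vec 2. v \<noteq> 0\<^sub>v 2 \<and> s *\<^sub>v v = v)"

definition refl_part :: "complex mat set \<Rightarrow> complex mat set" where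
  "refl_part H = generate (GL 2) {s \<in> H. reflection s}"

definition reflection_group :: "complex mat set \<Rightarrow> bool" where
  "reflection_group H \<longleftrightarrow> finite H \<and> refl_part H = H"

definition parabolic :: "complex vec set \<Rightarrow> complex mat set \<Rightarrow> complex mat set \<Rightarrow> bool" where
  "parabolic V R P \<longleftrightarrow> (\<exists>X\<subseteq>V. P = {g \<in> R. \<forall>v\<in>X. g *\<^sub>v v = v})"

definition full :: "complex mat set \<Rightarrow> complex mat set \<Rightarrow> bool" where
  "full Wt H \<longleftrightarrow> H \<subseteq> Wt \<and> reflection_group H \<and>
     (\<forall>s\<in>Wt. reflection s \<longrightarrow>
        (\<forall>a::int. s [^]\<^bsub>GL 2\<^esub> a \<in> H \<and> s [^]\<^bsub>GL 2\<^esub> a \<noteq> 1\<^sub>m 2 \<longrightarrow> s \<in> H))"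


section \<open>Representations and truncated induction\<close>

text \<open>A representation of a subgroup G of GL 2 is a matrix representation over the
  complex numbers; its values outside G are irrelevant.\<close>

definition deg :: "(complex mat \<Rightarrow> complex mat) \<Rightarrow> nat" where
  "deg E = dim_row (E (1\<^sub>m 2))"

definition rep :: "complex mat set \<Rightarrow> (complex mat \<Rightarrow> complex mat) \<Rightarrow> bool" where
  "rep G E \<longleftrightarrow> E \<in> hom ((GL 2)\<lparr>carrier := G\<rparr>) (GL (deg E))"

definition irr :: "complex mat set \<Rightarrow> (complex mat \<Rightarrow> complex mat) \<Rightarrow> bool" where
  "irr G E \<longleftrightarrow> rep G E \<and> deg E > 0 \<and>
     (\<forall>U. VectorSpace.subspace class_ring U (module_vec TYPE(complex) (deg E)) \<and>
          (\<forall>g\<in>G. \<forall>u\<in>U. E g *\<^sub>v u \<in> U)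
        \<longrightarrow> U = {0\<^sub>v (deg E)} \<or> U = carrier_vec (deg E))"

definition intertwiner ::
  "complex mat set \<Rightarrow> (complex mat \<Rightarrow> complex mat) \<Rightarrow> (complex mat \<Rightarrow> complex mat) \<Rightarrow> complex mat \<Rightarrow> bool" where
  "intertwiner G E F T \<longleftrightarrow> T \<in> carrier_mat (deg F) (deg E) \<and> (\<forall>g\<in>G. T * E g = F g * T)"

text \<open>The action of a matrix on the component of degree n of the symmetric algebra of the
  plane, in the basis e1^i e2^(n-i) for i = 0, ..., n. The column of index
  j holds the coefficients of (g e1)^j (g e2)^(n-j), read off after setting
  e1 to the indeterminate and e2 to 1.\<close>

definition sym_pow :: "nat \<Rightarrow> complex mat \<Rightarrow> complex mat" where
  "sym_pow n g = mat (n + 1) (n + 1) (\<lambda>(i, j).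
     Polynomial.coeff ([:g $$ (1, 0), g $$ (0, 0):] ^ j * [:g $$ (1, 1), g $$ (0, 1):] ^ (n - j)) i)"

definition b_value :: "complex mat set \<Rightarrow> (complex mat \<Rightarrow> complex mat) \<Rightarrow> nat" where
  "b_value G E =
     (LEAST n. \<exists>T. intertwiner G E (sym_pow n) T \<and> T \<noteq> 0\<^sub>m (n + 1) (deg E))"

text \<open>trunc_ind W W' E' E: the truncated induction of E' from W' to
  W is defined and isomorphic to E. Multiplicity one of the irreducible
  representation E' in degree b(E') says that the intertwiners form a line, spanned
  by T; the copy of E' is the image of T, and R is an isomorphism from
  E to the submodule that this copy generates.\<close>

definition trunc_ind ::
  "complex mat set \<Rightarrow> complex mat set \<Rightarrow> (complex mat \<Rightarrow> complex mat) \<Rightarrow> (complex mat \<Rightarrow> complex mat) \<Rightarrow> bool" where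
  "trunc_ind W W' E' E \<longleftrightarrow> irr W' E' \<and> rep W E \<and>
     (let n = b_value W' E' in
       \<exists>T R. intertwiner W' E' (sym_pow n) T \<and> T \<noteq> 0\<^sub>m (n + 1) (deg E') \<and>
         (\<forall>T'. intertwiner W' E' (sym_pow n) T' \<longrightarrow> (\<exists>c. T' = c \<cdot>\<^sub>m T)) \<and>
         intertwiner W E (sym_pow n) R \<and>
         inj_on (\<lambda>u. R *\<^sub>v u) (carrier_vec (deg E)) \<and>
         (\<lambda>u. R *\<^sub>v u) ` carrier_vec (deg E) =
           LinearCombinations.module.span class_ring (module_vec TYPE(complex) (n + 1))
             {sym_pow n g *\<^sub>v (T *\<^sub>v u) | g u. g \<in> W \<and> u \<in> carrier_vec (deg E')})"


section \<open>Generic degrees, special representations\<close>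

text \<open>All reflections of G(e,e,2) have order 2 and all its reflection subgroups are Coxeter
  groups, so the generating reflections are taken to be Coxeter generators. The word
  [s1, ..., sk] stands for the product s1 ... sk.\<close>

definition word_prod :: "nat \<Rightarrow> (complex mat \<Rightarrow> 'a::comm_ring_1 mat) \<Rightarrow> complex mat list \<Rightarrow> 'a mat" where
  "word_prod n M us = foldr (\<lambda>s A. M s * A) us (1\<^sub>m n)"

definition word_length :: "complex mat set \<Rightarrow> complex mat \<Rightarrow> nat" where
  "word_length S w = (LEAST k. \<exists>us. set us \<subseteq> S \<and> length us = k \<and> word_prod 2 id us = w)"

definition reduced :: "complex mat set \<Rightarrow> complex mat list \<Rightarrow> bool" where
  "reduced S us \<longleftrightarrow> set us \<subseteq> S \<and> word_length S (word_prod 2 id us) = length us"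

text \<open>The last condition is the exchange condition.\<close>

definition coxeter_generators :: "complex mat set \<Rightarrow> complex mat set \<Rightarrow> bool" where
  "coxeter_generators G S \<longleftrightarrow> finite G \<and> generate (GL 2) S = G \<and>
     (\<forall>s\<in>S. reflection s \<and> s * s = 1\<^sub>m 2) \<and>
     (\<forall>us. \<forall>s\<in>S. reduced S us \<and> word_length S (word_prod 2 id (s # us)) \<le> length us \<longrightarrow>
        (\<exists>i<length us. word_prod 2 id (s # us) = word_prod 2 id (take i us @ drop (Suc i) us)))"

fun alternating :: "nat \<Rightarrow> 'a \<Rightarrow> 'a \<Rightarrow> 'a list" where
  "alternating 0 s t = []"
| "alternating (Suc m) s t = s # alternating m t s"

definition hecke_q :: "complex poly fract" where
  "hecke_q = Fract [:0, 1:] 1"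

text \<open>Representations of degree n, over the field of rational functions in q, of the
  Hecke algebra of the Coxeter system with generators S. This field is a splitting field
  for the Hecke algebras of dihedral groups with equal parameters.\<close>

definition hecke_rep :: "complex mat set \<Rightarrow> nat \<Rightarrow> (complex mat \<Rightarrow> complex poly fract mat) \<Rightarrow> bool" where
  "hecke_rep S n M \<longleftrightarrow>
     (\<forall>s\<in>S. M s \<in> carrier_mat n n \<and> (M s - hecke_q \<cdot>\<^sub>m 1\<^sub>m n) * (M s + 1\<^sub>m n) = 0\<^sub>m n n) \<and>
     (\<forall>s\<in>S. \<forall>t\<in>S. s \<noteq> t \<longrightarrow>
        (let m = group.ord (GL 2) (s * t)
         in word_prod n M (alternating m s t) = word_prod n M (alternating m t s)))"

definition mat_trace :: "'a::comm_ring_1 mat \<Rightarrow> 'a" where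
  "mat_trace A = (\<Sum>i<dim_row A. A $$ (i, i))"

text \<open>Value at w of the character of M, i.e. at the standard basis element given by a
  reduced expression of w.\<close>

definition hecke_char ::
  "complex mat set \<Rightarrow> nat \<Rightarrow> (complex mat \<Rightarrow> complex poly fract mat) \<Rightarrow> complex mat \<Rightarrow> complex poly fract" where
  "hecke_char S n M w =
     mat_trace (word_prod n M (SOME us. reduced S us \<and> word_prod 2 id us = w))"

text \<open>The generic degree is the Poincare polynomial divided by the Schur element with respect to the
  canonical symmetrizing trace; the dual of the basis element of w is
  q^(-l(w)) times the basis element of the inverse of w.\<close>

definition generic_degree ::
  "complex mat set \<Rightarrow> complex mat set \<Rightarrow> nat \<Rightarrow> (complex mat \<Rightarrow> complex poly fract mat) \<Rightarrow> complex poly fract" where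
  "generic_degree G S n M =
     (\<Sum>w\<in>G. hecke_q ^ word_length S w) * of_nat n /
     (\<Sum>w\<in>G. hecke_char S n M w * hecke_char S n M (inv\<^bsub>GL 2\<^esub> w) / hecke_q ^ word_length S w)"

definition value_at_1 :: "complex poly fract \<Rightarrow> complex \<Rightarrow> bool" where
  "value_at_1 f z \<longleftrightarrow> (\<exists>a b. f = Fract a b \<and> poly b 1 \<noteq> 0 \<and> z = poly a 1 / poly b 1)"

definition vanishing_order_at_0 :: "complex poly fract \<Rightarrow> int \<Rightarrow> bool" where
  "vanishing_order_at_0 f k \<longleftrightarrow>
     (\<exists>a b. f = Fract a b \<and> a \<noteq> 0 \<and> b \<noteq> 0 \<and> k = int (Polynomial.order 0 a) - int (Polynomial.order 0 b))"

text \<open>The representation of the Hecke algebra corresponding to E is the one whose character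
  specializes at q = 1 to that of E.\<close>

definition a_value :: "complex mat set \<Rightarrow> (complex mat \<Rightarrow> complex mat) \<Rightarrow> int" where
  "a_value G E = (THE k. \<exists>S M. coxeter_generators G S \<and> hecke_rep S (deg E) M \<and>
     (\<forall>w\<in>G. value_at_1 (hecke_char S (deg E) M w) (mat_trace (E w))) \<and>
     vanishing_order_at_0 (generic_degree G S (deg E) M) k)"

definition special :: "complex mat set \<Rightarrow> (complex mat \<Rightarrow> complex mat) \<Rightarrow> bool" where
  "special G E \<longleftrightarrow> irr G E \<and> a_value G E = int (b_value G E)"

definition spetsial :: "complex mat set \<Rightarrow> bool" where
  "spetsial G \<longleftrightarrow> reflection_group G \<and> (\<forall>E. irr G E \<longrightarrow> a_value G E \<le> int (b_value G E))"


section \<open>Pseudoparabolic subgroups, Springer representations\<close>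

text \<open>The stabilizer of the class of x modulo L.\<close>

definition class_stabilizer :: "complex vec set \<Rightarrow> complex mat set \<Rightarrow> complex vec \<Rightarrow> complex mat set" where
  "class_stabilizer L Wt x = {g \<in> Wt. g *\<^sub>v x - x \<in> L}"

definition plein :: "complex vec set \<Rightarrow> complex mat set \<Rightarrow> complex mat set \<Rightarrow> complex mat set \<Rightarrow> bool" where
  "plein V Wt R P \<longleftrightarrow> parabolic V R P \<and> full Wt P \<and>
     (\<forall>P'. parabolic V R P' \<and> full Wt P' \<and> P \<subseteq> P' \<longrightarrow> P' = P)"

definition largest_full_spetsial :: "complex mat set \<Rightarrow> complex mat set \<Rightarrow> complex mat set \<Rightarrow> bool" where
  "largest_full_spetsial Wt P Q \<longleftrightarrow> Q \<subseteq> P \<and> full Wt Q \<and> spetsial Q \<and>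
     (\<forall>Q'. Q' \<subseteq> P \<and> full Wt Q' \<and> spetsial Q' \<longrightarrow> Q' \<subseteq> Q)"

definition pseudoparabolic ::
  "complex vec set \<Rightarrow> complex vec set \<Rightarrow> complex vec set \<Rightarrow> complex mat set \<Rightarrow> complex mat set \<Rightarrow> complex mat set \<Rightarrow> bool" where
  "pseudoparabolic V V0 L0 Wt W W' \<longleftrightarrow>
     (\<exists>x\<in>V0. \<exists>P Q. plein V Wt (refl_part (class_stabilizer L0 Wt x)) P \<and>
        largest_full_spetsial Wt P Q \<and> W' = W \<inter> Q)"


section \<open>The groups G(e,e,2) and their root lattices\<close>

definition primitive_root_of_unity :: "nat \<Rightarrow> complex \<Rightarrow> bool" where
  "primitive_root_of_unity e \<zeta> \<longleftrightarrow> \<zeta> ^ e = 1 \<and> (\<forall>k. 0 < k \<and> k < e \<longrightarrow> \<zeta> ^ k \<noteq> 1)"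

definition mat2 :: "complex \<Rightarrow> complex \<Rightarrow> complex \<Rightarrow> complex \<Rightarrow> complex mat" where
  "mat2 a b c d = mat_of_rows_list 2 [[a, b], [c, d]]"

definition Gee2 :: "nat \<Rightarrow> complex mat set" where
  "Gee2 e = {mat2 a 0 0 b | a b. a ^ e = 1 \<and> b ^ e = 1 \<and> a * b = 1} \<union>
            {mat2 0 a b 0 | a b. a ^ e = 1 \<and> b ^ e = 1 \<and> a * b = 1}"

definition refl :: "complex \<Rightarrow> nat \<Rightarrow> complex mat" where
  "refl \<zeta> i = mat2 0 (\<zeta> ^ i) (inverse \<zeta> ^ i) 0"

definition Gdd2 :: "nat \<Rightarrow> complex \<Rightarrow> nat \<Rightarrow> complex mat set" where
  "Gdd2 e \<zeta> d = generate (GL 2) {refl \<zeta> 0, refl \<zeta> (e div d)}"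

definition Gdd2' :: "nat \<Rightarrow> complex \<Rightarrow> nat \<Rightarrow> complex mat set" where
  "Gdd2' e \<zeta> d = generate (GL 2) {refl \<zeta> 1, refl \<zeta> (e div d + 1)}"

definition cyclotomic_field :: "complex \<Rightarrow> complex set" where
  "cyclotomic_field \<zeta> = {poly (map_poly of_rat f) \<zeta> / poly (map_poly of_rat g) \<zeta> | f g :: rat poly. True}"

definition cyclotomic_integers :: "complex \<Rightarrow> complex set" where
  "cyclotomic_integers \<zeta> = {poly (map_poly of_int f) \<zeta> | f :: int poly. True}"

definition space_V :: "complex \<Rightarrow> complex vec set" where
  "space_V \<zeta> = {v \<in> carrier_vec 2. v $ 0 \<in> cyclotomic_field \<zeta> \<and> v $ 1 \<in> cyclotomic_field \<zeta>}"

definition space_V0 :: "complex \<Rightarrow> complex vec set" where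
  "space_V0 \<zeta> = {v \<in> space_V \<zeta>. v $ 1 = - cnj (v $ 0)}"

definition lattice_L0 :: "complex \<Rightarrow> complex vec set" where
  "lattice_L0 \<zeta> = {v \<in> space_V0 \<zeta>. v $ 0 \<in> cyclotomic_integers \<zeta>}"

text \<open>The argument Wt of pseudoparabolic is the group generated by W and the further reflections
  attached to the root lattice; for W = G(e,e,2) this group is W itself.\<close>

definition pseudoparabolic_Gee2 :: "nat \<Rightarrow> complex \<Rightarrow> complex mat set \<Rightarrow> bool" where
  "pseudoparabolic_Gee2 e \<zeta> W' \<longleftrightarrow>
     pseudoparabolic (space_V \<zeta>) (space_V0 \<zeta>) (lattice_L0 \<zeta>) (Gee2 e) (Gee2 e) W'"

definition springer_reps :: "nat \<Rightarrow> complex \<Rightarrow> (complex mat \<Rightarrow> complex mat) set" where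
  "springer_reps e \<zeta> = {E. irr (Gee2 e) E \<and>
     (\<exists>W' E'. pseudoparabolic_Gee2 e \<zeta> W' \<and> special W' E' \<and> trunc_ind (Gee2 e) W' E' E)}"

text \<open>For groups generated by reflections of order 2 the sign representation is the determinant.\<close>

definition sign_rep :: "complex mat \<Rightarrow> complex mat" where
  "sign_rep g = mat 1 1 (\<lambda>_. det g)"

text \<open>The isomorphism class of the irreducible representation of G(e,e,2) with label
  k, as a set of matrix representations: the label is the value of b, which
  determines the representation unless k = e/2; in that case the two representations with
  this value are told apart by truncated induction from G(e/2,e/2,2) (chi) and
  G'(e/2,e/2,2) (chi').\<close>

definition chi :: "nat \<Rightarrow> complex \<Rightarrow> nat \<Rightarrow> (complex mat \<Rightarrow> complex mat) set" where
  "chi e \<zeta> k = {E. irr (Gee2 e) E \<and> b_value (Gee2 e) E = k \<and>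
     (2 * k = e \<longrightarrow> trunc_ind (Gee2 e) (Gdd2 e \<zeta> k) sign_rep E)}"

definition chi' :: "nat \<Rightarrow> complex \<Rightarrow> (complex mat \<Rightarrow> complex mat) set" where
  "chi' e \<zeta> = {E. irr (Gee2 e) E \<and> trunc_ind (Gee2 e) (Gdd2' e \<zeta> (e div 2)) sign_rep E}"

end

theory Submission
  imports Defs "Jordan_Normal_Form.Spectral_Radius"
begin

text \<open>All reflections of G(e,e,2) have order 2 and every reflection subgroup is trivial or dihedral,
  hence full and spetsial; so the pseudoparabolic subgroups are the groups generated by the reflections
  in the stabilizers of the classes of \<open>V\<^sub>0\<close> modulo \<open>L\<^sub>0\<close>. The reflection \<open>refl \<zeta> i\<close> stabilizes the
  class of \<open>(x, - cnj x)\<close> if and only if \<open>x + \<zeta> ^ i * cnj x\<close> is integral. Two such reflections i and j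
  force \<open>(1 - \<zeta> ^ (j - i)) * x\<close> to be integral; as \<open>1 - \<zeta> ^ k\<close> is a unit unless the order of \<open>\<zeta> ^ k\<close> is a
  prime power, the subgroup has order 1, 2, 2e or twice a prime power. Conversely, for a prime power d
  the choices \<open>x = 1 / (1 - \<zeta> ^ (e div d))\<close> and \<open>x = (1 + \<zeta>) / (1 - \<zeta> ^ (e div d))\<close> give G(d,d,2) and
  G'(d,d,2).

  The irreducible representations of a dihedral group of order 2m have degree 1 or 2. The invariant a is
  0 for the trivial one, m for the sign and 1 for all the others, so that the special ones are those with
  b equal to 0, 1 or m. Truncated induction preserves b, which determines the Springer representations
  except for \<open>b = e div 2\<close>; there G'(e/2,e/2,2) is not pseudoparabolic, whereas G(e/2,e/2,2)
  is if e/2 is a prime power.\<close>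

section \<open>Divisibility of cyclotomic integers\<close>

text \<open>The arithmetic uses neither ideals nor norms: everything is divisibility in
  \<open>Z\<close>, and every negative statement comes down to 1/N not being an algebraic integer
  for N > 1. Divisibility of one 1 - \<zeta>^i by another is governed by the quotients (1 - \<nu>^h)
  / (1 - \<nu>) with h > 1, which are not units when \<nu> has order h * p^a with a > 0. The
  delicate half is G'(d,d,2): its class needs the extra numerator 1 + \<zeta>, which might absorb
  part of the denominator. For 2d = e it does, since (1 + \<zeta>) / (1 - \<zeta>^2) = 1 / (1 -
  \<zeta>); this is the source of the asymmetry between G and G'. For 2d < e absorption has to be
  excluded prime by prime. On the Hecke side the obstacle is that \<open>a_value\<close> is a
  definite description over all generating sets and all matrix representations that specialize to
  the given character. So the Coxeter generating sets must be classified, and a two-dimensional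
  representation must be shown to be rigid, its traces being determined by the values at q = 1. Only
  then does one computation of the generic degree yield a.\<close>

locale cyclotomic =
  fixes e :: nat and \<zeta> :: complex
  assumes e_pos: "e > 0" and primitive: "primitive_root_of_unity e \<zeta>"
begin

abbreviation Z :: "complex set" where "Z \<equiv> cyclotomic_integers \<zeta>"

lemma zeta_pow_e [simp]: "\<zeta> ^ e = 1"
  using primitive by (simp add: primitive_root_of_unity_def)

lemma zeta_nonzero [simp]: "\<zeta> \<noteq> 0"
  using zeta_pow_e e_pos by (metis power_0_left zero_neq_one not_gr_zero)

lemma zeta_pow_mod: "\<zeta> ^ (k mod e) = \<zeta> ^ k"
proof -
  have "\<zeta> ^ k = \<zeta> ^ (e * (k div e) + k mod e)" by simp
  also have "\<dots> = \<zeta> ^ (k mod e)" unfolding power_add power_mult by simp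
  finally show ?thesis by simp
qed

lemma zeta_pow_eq_1_iff: "\<zeta> ^ k = 1 \<longleftrightarrow> e dvd k"
proof
  assume "\<zeta> ^ k = 1"
  hence "\<zeta> ^ (k mod e) = 1" by (simp add: zeta_pow_mod)
  moreover have "k mod e < e" using e_pos by simp
  ultimately have "k mod e = 0"
    using primitive unfolding primitive_root_of_unity_def by (metis gr0I)
  thus "e dvd k" by auto
next
  assume "e dvd k" thus "\<zeta> ^ k = 1" by (auto simp: power_mult)
qed

section \<open>The ring of cyclotomic integers and its integrality\<close>

lemma Z_of_int [simp]: "of_int n \<in> Z"
  unfolding cyclotomic_integers_def by (auto intro!: exI[of _ "[:n:]"] simp: of_int_hom.map_poly_pCons_hom)
lemma Z_0 [simp]: "0 \<in> Z" using Z_of_int[of 0] by simp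
lemma Z_1 [simp]: "1 \<in> Z" using Z_of_int[of 1] by simp
lemma Z_of_nat [simp]: "of_nat n \<in> Z" using Z_of_int[of "int n"] by simp
lemma Z_zeta [simp]: "\<zeta> \<in> Z"
  unfolding cyclotomic_integers_def by (auto intro!: exI[of _ "[:0,1:]"])
lemma Z_add [simp, intro]: "x \<in> Z \<Longrightarrow> y \<in> Z \<Longrightarrow> x + y \<in> Z"
  unfolding cyclotomic_integers_def
  by (auto, metis of_int_hom.map_poly_hom_add poly_add)
lemma Z_mult [simp, intro]: "x \<in> Z \<Longrightarrow> y \<in> Z \<Longrightarrow> x * y \<in> Z"
  unfolding cyclotomic_integers_def
  by (auto, metis of_int_poly_hom.hom_mult poly_mult)
lemma Z_minus [simp, intro]: "x \<in> Z \<Longrightarrow> - x \<in> Z"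
  using Z_mult[of "-1" x] Z_of_int[of "-1"] by simp
lemma Z_diff [simp, intro]: "x \<in> Z \<Longrightarrow> y \<in> Z \<Longrightarrow> x - y \<in> Z"
  using Z_add[of x "-y"] by simp
lemma Z_power [simp, intro]: "x \<in> Z \<Longrightarrow> x ^ n \<in> Z"
  by (induction n) auto
lemma Z_sum [simp, intro]: "(\<And>i. i \<in> A \<Longrightarrow> f i \<in> Z) \<Longrightarrow> sum f A \<in> Z"
  by (induction A rule: infinite_finite_induct) auto

lemma inverse_zeta: "inverse \<zeta> = \<zeta> ^ (e - 1)"
  using zeta_pow_e e_pos by (metis inverse_unique power_minus_mult mult.commute)

lemma norm_zeta: "norm \<zeta> = 1"
  using zeta_pow_e e_pos by (metis norm_ge_zero norm_one norm_power power_eq_imp_eq_base power_one)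

lemma cnj_zeta: "cnj \<zeta> = inverse \<zeta>"
  using norm_zeta by (metis complex_div_cnj divide_inverse complex_mod_mult_cnj inverse_unique mult.right_neutral of_real_1 power_one complex_norm_square)

lemma Z_cnj [simp, intro]: assumes "z \<in> Z" shows "cnj z \<in> Z"
proof -
  obtain f where f: "z = poly (map_poly of_int f) \<zeta>"
    using assms unfolding cyclotomic_integers_def by auto
  have *: "poly (map_poly of_int f) (w :: complex) \<in> Z" if "w \<in> Z" for w
    using that by (induction f) (auto simp: of_int_hom.map_poly_pCons_hom)
  have "cnj z = poly (map_poly of_int f) (cnj \<zeta>)"
    unfolding f by (induction f) (auto simp: of_int_hom.map_poly_pCons_hom)
  thus ?thesis using * by (simp add: cnj_zeta inverse_zeta)
qed

text \<open>Exhibits z as an eigenvalue of an integer matrix, hence as an algebraic integer.\<close>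

lemma Z_int_matrix:
  assumes "z \<in> Z"
  obtains M :: "int mat" where "M \<in> carrier_mat e e"
    "map_mat of_int M *\<^sub>v vec e (\<lambda>i. \<zeta> ^ i) = z \<cdot>\<^sub>v vec e (\<lambda>i. \<zeta> ^ i)"
proof -
  let ?v = "vec e (\<lambda>i. \<zeta> ^ i)"
  \<comment> \<open>The cyclic shift. The vector of powers of \<zeta> is an eigenvector for \<zeta>;
    the last row agrees because \<zeta>^e = 1.\<close>
  define P :: "int mat" where "P = mat e e (\<lambda>(i, j). if j = Suc i mod e then 1 else 0)"
  have P: "P \<in> carrier_mat e e" by (simp add: P_def)
  have Pv: "map_mat of_int P *\<^sub>v ?v = \<zeta> \<cdot>\<^sub>v ?v"
  proof (rule eq_vecI)
    fix i assume "i < dim_vec (\<zeta> \<cdot>\<^sub>v ?v)"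
    hence i: "i < e" by simp
    have "(map_mat of_int P *\<^sub>v ?v) $ i
        = (\<Sum>j<e. (if j = Suc i mod e then 1 else 0) * \<zeta> ^ j)"
      using i by (simp add: P_def scalar_prod_def lessThan_atLeast0 if_distrib cong: if_cong)
    also have "\<dots> = (\<Sum>j<e. if j = Suc i mod e then \<zeta> ^ j else 0)"
      by (rule sum.cong) auto
    also have "\<dots> = \<zeta> ^ (Suc i mod e)" using e_pos by simp
    also have "\<dots> = \<zeta> ^ Suc i" by (rule zeta_pow_mod)
    finally show "(map_mat of_int P *\<^sub>v ?v) $ i = (\<zeta> \<cdot>\<^sub>v ?v) $ i" using i by simp
  qed (simp add: P_def)
  obtain f where f: "z = poly (map_poly of_int f) \<zeta>"
    using assms unfolding cyclotomic_integers_def by auto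
  \<comment> \<open>Horner's scheme: if M realizes f(\<zeta>), then a + M * P realizes a + \<zeta> *
    f(\<zeta>), because P acts on the eigenvector by \<zeta>.\<close>
  have "\<exists>M \<in> carrier_mat e e.
      map_mat of_int M *\<^sub>v ?v = poly (map_poly of_int f) \<zeta> \<cdot>\<^sub>v ?v"
  proof (induction f)
    case 0
    show ?case
      by (rule bexI[of _ "0\<^sub>m e e"]) (auto intro!: eq_vecI simp: scalar_prod_def)
  next
    case (pCons a f)
    then obtain M where M: "M \<in> carrier_mat e e"
      and Mv: "map_mat of_int M *\<^sub>v ?v = poly (map_poly of_int f) \<zeta> \<cdot>\<^sub>v ?v" by auto
    have 1: "map_mat (of_int :: int \<Rightarrow> complex) (a \<cdot>\<^sub>m 1\<^sub>m e + M * P)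
        = of_int a \<cdot>\<^sub>m 1\<^sub>m e + map_mat of_int M * map_mat of_int P"
      using M P by (simp add: of_int_hom.mat_hom_mult[OF M P, symmetric])
        (auto intro!: eq_matI)
    have c: "map_mat of_int M \<in> carrier_mat e e" "map_mat of_int P \<in> carrier_mat e e"
      "?v \<in> carrier_vec e" using M P by auto
    have "(of_int a \<cdot>\<^sub>m 1\<^sub>m e + map_mat of_int M * map_mat of_int P) *\<^sub>v ?v
        = of_int a \<cdot>\<^sub>v ?v + map_mat of_int M *\<^sub>v (map_mat of_int P *\<^sub>v ?v)"
      using c by (simp add: add_mult_distrib_mat_vec[of _ e e] assoc_mult_mat_vec[of _ e e])
         (auto intro!: eq_vecI simp: scalar_prod_def mult.assoc if_distrib[where f="\<lambda>x. x * _"]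
           sum_distrib_left[symmetric] cong: if_cong)
    also have "\<dots> = of_int a \<cdot>\<^sub>v ?v + \<zeta> \<cdot>\<^sub>v (poly (map_poly of_int f) \<zeta> \<cdot>\<^sub>v ?v)"
      unfolding Pv using c Mv by (simp add: mult_mat_vec[of _ e e])
    also have "\<dots> = poly (map_poly of_int (pCons a f)) \<zeta> \<cdot>\<^sub>v ?v"
      by (auto intro!: eq_vecI simp: of_int_hom.map_poly_pCons_hom algebra_simps)
    finally show ?case using M P unfolding 1[symmetric]
      by (intro bexI[of _ "a \<cdot>\<^sub>m 1\<^sub>m e + M * P"]) auto
  qed
  thus ?thesis using that unfolding f by auto
qed

lemma Z_algebraic_int: assumes "z \<in> Z" shows "algebraic_int z"
proof -
  let ?v = "vec e (\<lambda>i. \<zeta> ^ i)"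
  obtain M :: "int mat" where M: "M \<in> carrier_mat e e"
    and Mv: "map_mat of_int M *\<^sub>v ?v = z \<cdot>\<^sub>v ?v" by (rule Z_int_matrix[OF assms])
  have c: "map_mat (of_int :: int \<Rightarrow> complex) M \<in> carrier_mat e e" using M by simp
  have "?v \<noteq> 0\<^sub>v e" using e_pos by (auto dest: arg_cong[where f="\<lambda>v. v $ 0"])
  hence "eigenvalue (map_mat of_int M) z"
    unfolding eigenvalue_def eigenvector_def using M Mv by (intro exI[of _ ?v]) auto
  hence "poly (char_poly (map_mat of_int M)) z = 0"
    using eigenvalue_root_char_poly[OF c] by simp
  hence "poly (map_poly of_int (char_poly M)) z = 0"
    by (simp add: of_int_hom.char_poly_hom[OF M])
  moreover have "lead_coeff (char_poly M) = 1"
    using degree_monic_char_poly[OF M] by simp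
  ultimately show ?thesis by (auto simp: algebraic_int_altdef_ipoly)
qed

text \<open>A rational algebraic integer is an integer. All later proofs that something is not a
  unit or not integral end here.\<close>

lemma inverse_int_notin_Z: assumes "N \<ge> 2" shows "1 / of_nat N \<notin> Z"
proof
  assume "1 / of_nat N \<in> Z"
  hence "algebraic_int (1 / of_nat N :: complex)" by (rule Z_algebraic_int)
  moreover have "(1 / of_nat N :: complex) \<in> \<rat>" by auto
  ultimately have "(1 / of_nat N :: complex) \<in> \<int>" by (rule rational_algebraic_int_is_int)
  then obtain n :: int where "1 / of_nat N = (of_int n :: complex)" by (auto elim: Ints_cases)
  hence "(of_int (n * int N) :: complex) = of_int 1" using assms by (simp add: field_simps)
  hence "n * int N = 1" by (simp only: of_int_eq_iff)
  thus False using assms by (auto simp: zmult_eq_1_iff)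
qed

text \<open>Neither side has to lie in \<open>Z\<close>. Thus \<open>1 zdvd b\<close> says that b is
  integral, and the gcd argument below serves both for divisibility in \<open>Z\<close> and for
  elements of the field.\<close>

definition zdvd :: "complex \<Rightarrow> complex \<Rightarrow> bool" (infix "zdvd" 50) where
  "a zdvd b \<longleftrightarrow> (\<exists>c\<in>Z. b = a * c)"

lemma zdvdI: "c \<in> Z \<Longrightarrow> b = a * c \<Longrightarrow> a zdvd b" by (auto simp: zdvd_def)
lemma zdvd_refl [simp]: "a zdvd a" by (rule zdvdI[of 1]) auto
lemma zdvd_0 [simp]: "a zdvd 0" by (rule zdvdI[of 0]) auto
lemma zdvd_trans [trans]: "a zdvd b \<Longrightarrow> b zdvd c \<Longrightarrow> a zdvd c"
  unfolding zdvd_def by (metis Z_mult mult.assoc)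
lemma zdvd_add: "a zdvd b \<Longrightarrow> a zdvd c \<Longrightarrow> a zdvd b + c"
  unfolding zdvd_def by (metis Z_add distrib_left)
lemma zdvd_mult: "a zdvd b \<Longrightarrow> c \<in> Z \<Longrightarrow> a zdvd b * c"
  unfolding zdvd_def by (metis Z_mult mult.assoc)
lemma zdvd_mult2: "a zdvd b \<Longrightarrow> c \<in> Z \<Longrightarrow> a zdvd c * b"
  using zdvd_mult[of a b c] by (simp add: mult.commute)
lemma zdvd_minus: "a zdvd b \<Longrightarrow> a zdvd - b"
  using zdvd_mult[of a b "-1"] by simp
lemma zdvd_diff: "a zdvd b \<Longrightarrow> a zdvd c \<Longrightarrow> a zdvd b - c"
  using zdvd_add[of a b "-c"] zdvd_minus by simp
lemma zdvd_sum: "(\<And>i. i \<in> A \<Longrightarrow> a zdvd f i) \<Longrightarrow> a zdvd sum f A"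
  by (induction A rule: infinite_finite_induct) (auto intro: zdvd_add)
lemma zdvd_mult_mono: "a zdvd b \<Longrightarrow> c zdvd d \<Longrightarrow> a * c zdvd b * d"
  unfolding zdvd_def by (metis (no_types, lifting) Z_mult mult.assoc mult.left_commute)
lemma zdvd_cancel: "c \<noteq> 0 \<Longrightarrow> c * a zdvd c * b \<longleftrightarrow> a zdvd b"
  unfolding zdvd_def by auto
lemma zdvd_power_mono: "a zdvd b \<Longrightarrow> a ^ n zdvd b ^ n"
  by (induction n) (auto intro: zdvd_mult_mono)
lemma zdvd_triv: "c \<in> Z \<Longrightarrow> a zdvd a * c" by (auto simp: zdvd_def)
lemma zdvd_left: "a * b zdvd c \<Longrightarrow> b \<in> Z \<Longrightarrow> a zdvd c"
  by (rule zdvd_trans[OF zdvd_triv])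

text \<open>The quotient (1 - x^h) / (1 - x), written as a geometric sum so that it is visibly
  integral and makes sense at x = 1.\<close>

definition psi :: "nat \<Rightarrow> complex \<Rightarrow> complex" where "psi h x = (\<Sum>j<h. x ^ j)"

lemma psi_mult: "(1 - x) * psi h x = 1 - x ^ h"
  unfolding psi_def by (rule one_diff_power_eq[symmetric])
lemma psi_Z [simp, intro]: "x \<in> Z \<Longrightarrow> psi h x \<in> Z"
  by (auto simp: psi_def)
lemma one_minus_zdvd: "x \<in> Z \<Longrightarrow> 1 - x zdvd 1 - x ^ n"
  by (rule zdvdI[of "psi n x"]) (auto simp: psi_mult)
text \<open>Every power of x is congruent to 1 modulo 1 - x, so the geometric sum is congruent to
  its number of terms.\<close>

lemma psi_zdvd: "x \<in> Z \<Longrightarrow> 1 - x zdvd of_nat h - psi h x"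
proof -
  assume x: "x \<in> Z"
  have "of_nat h - psi h x = (\<Sum>j<h. 1 - x ^ j)" by (simp add: psi_def sum_subtractf)
  thus ?thesis using x by (auto intro!: zdvd_sum one_minus_zdvd)
qed

section \<open>Units and non-units among 1 - w and \<open>psi h w\<close> for roots of unity
  w\<close>

definition has_ord :: "complex \<Rightarrow> nat \<Rightarrow> bool" where
  "has_ord w n \<longleftrightarrow> w \<in> Z \<and> n > 0 \<and> (\<forall>j. w ^ j = 1 \<longleftrightarrow> n dvd j)"

lemma has_ordD: "has_ord w n \<Longrightarrow> w ^ j = 1 \<longleftrightarrow> n dvd j" by (auto simp: has_ord_def)
lemma has_ord_Z: "has_ord w n \<Longrightarrow> w \<in> Z" by (auto simp: has_ord_def)
lemma has_ord_neq_1: "has_ord w n \<Longrightarrow> n > 1 \<Longrightarrow> w \<noteq> 1"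
  using has_ordD[of w n 1] by auto

lemma has_ord_power: "has_ord w n \<Longrightarrow> g dvd n \<Longrightarrow> has_ord (w ^ g) (n div g)"
  unfolding has_ord_def
  by (auto simp: power_mult[symmetric] elim!: dvdE)

lemma has_ord_zeta: "has_ord \<zeta> e"
  using e_pos by (simp add: has_ord_def zeta_pow_eq_1_iff)

text \<open>The power w^(n/p) is a nontrivial p-th root of unity, so its geometric sum of length p
  vanishes; that sum is also congruent to p modulo 1 - w^(n/p), a multiple of 1 - w.\<close>

lemma prime_in_ideal:
  assumes "has_ord w n" "prime p" "p dvd n"
  shows "1 - w zdvd of_nat p"
proof -
  obtain k where n: "n = k * p" using assms(3) by (metis dvd_div_mult_self)
  have k: "k > 0" "w \<in> Z" using assms(1) n by (auto simp: has_ord_def)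
  have p: "p > 1" using assms(2) prime_gt_1_nat by blast
  have "w ^ k \<noteq> 1" using has_ordD[OF assms(1), of k] n k p
    by (metis dvd_imp_le mult.right_neutral mult_less_cancel1 not_less)
  moreover have "(w ^ k) ^ p = 1"
    using has_ordD[OF assms(1), of n] n by (simp add: power_mult[symmetric])
  ultimately have "psi p (w ^ k) = 0" using psi_mult[of "w^k" p] by auto
  hence "1 - w ^ k zdvd of_nat p" using psi_zdvd[of "w ^ k" p] k by auto
  thus ?thesis using one_minus_zdvd zdvd_trans k by blast
qed

text \<open>Two different primes divide n. Both are multiples of 1 - w, and by Bezout so is
  1.\<close>

lemma one_minus_unit:
  assumes "has_ord w n" "n > 1" "\<not> primepow n"
  shows "1 - w zdvd 1"
proof -
  obtain p where p: "prime p" "p dvd n" using assms(2) by (metis prime_factor_nat less_not_refl)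
  \<comment> \<open>The part of n prime to p. It exceeds 1 since n is not a power of p, and supplies
    the second prime.\<close>
  define q where "q = n div p ^ multiplicity p n"
  have n: "n = p ^ multiplicity p n * q" by (simp add: q_def multiplicity_dvd)
  have "multiplicity p n > 0" using p assms(2) by (simp add: prime_multiplicity_gt_zero_iff)
  hence "q \<noteq> 1" using assms(3) n p by (metis mult.right_neutral primepow_def)
  then obtain r where r: "prime r" "r dvd q" by (metis prime_factor_nat)
  have "\<not> p dvd q" using assms(2) p unfolding q_def
    by (metis multiplicity_decompose' not_prime_unit dvd_div_mult_self less_not_refl mult.commute
        multiplicity_dvd nonzero_mult_div_cancel_left not_less_zero power_not_zero not_prime_0)
  hence "coprime p r" using p r by (metis primes_coprime)
  moreover have "r dvd n" using r n by (metis dvd_mult)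
  ultimately obtain a b :: int where ab: "a * int p + b * int r = 1"
    using bezout_int[of "int p" "int r"] by (auto simp: coprime_iff_gcd_eq_1)
  have "1 - w zdvd of_int a * of_nat p + of_int b * of_nat r"
    using prime_in_ideal[OF assms(1)] p r \<open>r dvd n\<close>
    by (auto intro!: zdvd_add zdvd_mult2)
  also have "of_int a * of_nat p + of_int b * of_nat r = (of_int (a * int p + b * int r) :: complex)"
    by simp
  finally show ?thesis by (simp add: ab)
qed

text \<open>Binomial congruence modulo p, iterated. For y of order p^a the subtracted term vanishes
  and p divides (1 - y)^(p^a).\<close>

lemma frobenius:
  assumes p: "prime p" and y: "y \<in> Z"
  shows "of_nat p zdvd (1 - y) ^ (p ^ a) - (1 - y ^ (p ^ a))"
  using y
proof (induction a arbitrary: y)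
  case (Suc a)
  have p2: "p \<ge> 2" using p prime_ge_2_nat by auto
  have step: "of_nat p zdvd (1 - y) ^ p - (1 - y ^ p)" if y: "y \<in> Z" for y
  proof -
    have "(1 - y) ^ p = (\<Sum>k\<le>p. of_nat (p choose k) * (- y) ^ k)"
      using binomial_ring[of "-y" 1 p] by simp
    also have "{..p} = {0, p} \<union> {0<..<p}" using p2 by auto
    also have "(\<Sum>k\<in>{0, p} \<union> {0<..<p}. of_nat (p choose k) * (- y) ^ k)
       = 1 + (- y) ^ p + (\<Sum>k\<in>{0<..<p}. of_nat (p choose k) * (- y) ^ k)"
      using p2 by (subst sum.union_disjoint) auto
    finally have 1: "(1 - y) ^ p - (1 - y ^ p) = ((- y) ^ p + y ^ p) +
      (\<Sum>k\<in>{0<..<p}. of_nat (p choose k) * (- y) ^ k)" by simp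
    have "of_nat p zdvd (\<Sum>k\<in>{0<..<p}. of_nat (p choose k) * (- y) ^ k)"
    proof (intro zdvd_sum zdvd_mult)
      fix k assume "k \<in> {0<..<p}"
      hence "p dvd (p choose k)" using p by (intro dvd_choose_prime) auto
      then obtain c where "p choose k = p * c" by auto
      thus "of_nat p zdvd of_nat (p choose k)" by (auto simp: intro: zdvdI[of "of_nat c"])
    qed (use y in auto)
    \<comment> \<open>The sum of the two extreme terms: zero for odd p, and 2 * y^2 for p =
      2.\<close>
    moreover have "of_nat p zdvd (- y) ^ p + y ^ p"
    proof (cases "p = 2")
      case True thus ?thesis using y by (intro zdvdI[of "y^2"]) auto
    next
      case False
      hence "odd p" using p prime_odd_nat p2 by auto
      thus ?thesis by simp
    qed
    ultimately show ?thesis unfolding 1 by (metis zdvd_add)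
  qed
  define u where "u = (1 - y) ^ (p ^ a)"
  define v where "v = 1 - y ^ (p ^ a)"
  have uv: "u \<in> Z" "v \<in> Z" using Suc.prems by (auto simp: u_def v_def)
  have "u ^ p - v ^ p = (u - v) * (\<Sum>i<p. v ^ (p - Suc i) * u ^ i)" by (rule power_diff_sumr2)
  moreover have "of_nat p zdvd u - v" using Suc unfolding u_def v_def by blast
  ultimately have 1: "of_nat p zdvd u ^ p - v ^ p" using uv by (auto intro!: zdvd_mult)
  have "of_nat p zdvd (u ^ p - v ^ p) + (v ^ p - (1 - (y ^ (p ^ a)) ^ p))"
    using 1 step[of "y ^ (p ^ a)"] Suc.prems unfolding v_def by (intro zdvd_add) auto
  thus ?case by (simp add: u_def power_mult[symmetric] mult.commute algebra_simps)
qed auto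

text \<open>By the Frobenius congruence p divides (1 - w)^(p^a). If 1 - w were a unit, 1/p would be
  integral.\<close>

lemma one_minus_not_unit:
  assumes "has_ord w (p ^ a)" "prime p"
  shows "\<not> 1 - w zdvd 1"
proof
  assume "1 - w zdvd 1"
  hence "(1 - w) ^ (p ^ a) zdvd 1" using zdvd_power_mono[of "1 - w" 1 "p ^ a"] by simp
  moreover have "w ^ (p ^ a) = 1" using has_ordD[OF assms(1)] by simp
  hence "of_nat p zdvd (1 - w) ^ (p ^ a)"
    using frobenius[OF assms(2) has_ord_Z[OF assms(1)], of a] by simp
  ultimately have "of_nat p zdvd 1" using zdvd_trans by blast
  then obtain c where c: "c \<in> Z" "1 = of_nat p * c" by (auto simp: zdvd_def)
  have p: "p \<ge> 2" using assms(2) prime_ge_2_nat by auto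
  hence "c = 1 / of_nat p" using c(2) by (simp add: field_simps)
  thus False using c(1) inverse_int_notin_Z[OF p] by simp
qed

text \<open>If the order p^a * h is not a prime power, then 1 - \<nu> is a unit while 1 - \<nu>^h is
  not, as \<nu>^h has order p^a. Otherwise h is a multiple of p, so 1 - \<nu> divides h; it also
  divides h - \<open>psi h \<nu>\<close>, hence \<open>psi h \<nu>\<close>, and 1 - \<nu> is not a
  unit.\<close>

lemma psi_not_unit:
  assumes nu: "has_ord \<nu> (p ^ a * h)" and p: "prime p" and a: "a > 0" and h: "h > 1"
  shows "\<not> psi h \<nu> zdvd 1"
proof
  assume unit: "psi h \<nu> zdvd 1"
  have nuZ: "\<nu> \<in> Z" using has_ord_Z[OF nu] .
  have p1: "p > 1" using p prime_gt_1_nat by blast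
  have pa: "p ^ a > 1" using p1 a by (metis one_less_power)
  have n1: "p ^ a * h > 1" using pa h by (metis less_1_mult)
  show False
  proof (cases "primepow (p ^ a * h)")
    case False
    have "(1 - \<nu>) * psi h \<nu> zdvd 1 * 1"
      by (rule zdvd_mult_mono[OF one_minus_unit[OF nu n1 False] unit])
    hence "1 - \<nu> ^ h zdvd 1" by (simp add: psi_mult)
    moreover have "has_ord (\<nu> ^ h) (p ^ a)" using has_ord_power[OF nu, of h] h by simp
    ultimately show False using one_minus_not_unit p by blast
  next
    case True
    then obtain r c where rc: "prime r" "c > 0" "p ^ a * h = r ^ c" by (auto simp: primepow_def)
    have "p dvd r ^ c" unfolding rc(3)[symmetric] using a by (simp add: dvd_power)
    hence "p = r" using p rc(1) by (metis prime_dvd_power primes_dvd_imp_eq)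
    have "h dvd p ^ c" using rc(3) \<open>p = r\<close> by (metis dvd_triv_right)
    then obtain i where "h = p ^ i" using p by (metis divides_primepow_nat)
    hence "p dvd h" using h by (cases i) auto
    then obtain g where g: "h = p * g" by auto
    have "1 - \<nu> zdvd of_nat p" using prime_in_ideal[OF nu p] a by (simp add: dvd_power)
    hence "1 - \<nu> zdvd of_nat h" unfolding g by (auto intro: zdvd_mult)
    hence "1 - \<nu> zdvd of_nat h - (of_nat h - psi h \<nu>)"
      by (rule zdvd_diff) (rule psi_zdvd[OF nuZ])
    hence "1 - \<nu> zdvd psi h \<nu>" by simp
    hence "1 - \<nu> zdvd 1" using unit by (rule zdvd_trans)
    moreover have "has_ord \<nu> (p ^ c)" using nu rc(3) \<open>p = r\<close> by simp
    ultimately show False using one_minus_not_unit p by blast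
  qed
qed

text \<open>Summation by parts shows that 1 - w times the sum of the j * w^j for j < e equals
  -e.\<close>

lemma one_minus_zdvd_e:
  assumes "w \<in> Z" "w ^ e = 1" "w \<noteq> 1"
  shows "1 - w zdvd of_nat e"
proof (rule zdvdI[of "- (\<Sum>j<e. of_nat j * w ^ j)"])
  have *: "(1 - w) * (\<Sum>j<n. of_nat j * w ^ j) = psi n w - 1 - (of_nat n - 1) * w ^ n" if "n > 0" for n
    using that by (induction n rule: nat_induct_non_zero)
      (auto simp: psi_def algebra_simps)
  have "psi e w = 0" using psi_mult[of w e] assms by simp
  thus "of_nat e = (1 - w) * - (\<Sum>j<e. of_nat j * w ^ j)"
    using *[OF e_pos] assms by (simp add: algebra_simps)
qed (use assms in auto)

text \<open>The exponents i for which a divides (1 - \<zeta>^i) * w are closed under gcd. With i * x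
  = j * y + gcd i j, the product of \<zeta>^(j*y) and 1 - \<zeta>^(gcd i j) is the difference of 1 -
  \<zeta>^(i*x) and 1 - \<zeta>^(j*y).\<close>

lemma one_minus_gcd_zdvd:
  assumes "a zdvd (1 - \<zeta> ^ i) * w" "a zdvd (1 - \<zeta> ^ j) * w" "i > 0"
  shows "a zdvd (1 - \<zeta> ^ gcd i j) * w"
proof -
  obtain x y where xy: "i * x = j * y + gcd i j" using bezout_nat[of i j] assms(3) by auto
  have "(1 - \<zeta> ^ gcd i j) * w * \<zeta> ^ (j * y) =
      (1 - \<zeta> ^ i ^ 1) * 0 + (1 - \<zeta> ^ i) * w * psi x (\<zeta> ^ i) - (1 - \<zeta> ^ j) * w * psi y (\<zeta> ^ j)"
  proof -
    have "(1 - \<zeta> ^ i) * w * psi x (\<zeta> ^ i) = w * (1 - \<zeta> ^ (i * x))"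
      using psi_mult[of "\<zeta>^i" x] by (simp add: power_mult mult.commute mult.left_commute)
    moreover have "(1 - \<zeta> ^ j) * w * psi y (\<zeta> ^ j) = w * (1 - \<zeta> ^ (j * y))"
      using psi_mult[of "\<zeta>^j" y] by (simp add: power_mult mult.commute mult.left_commute)
    ultimately show ?thesis unfolding xy by (simp add: power_add right_diff_distrib left_diff_distrib)
  qed
  hence "a zdvd (1 - \<zeta> ^ gcd i j) * w * \<zeta> ^ (j * y)"
    using assms(1,2) by (auto intro!: zdvd_diff zdvd_mult)
  hence "a zdvd (1 - \<zeta> ^ gcd i j) * w * \<zeta> ^ (j * y) * (\<zeta> ^ (e - 1)) ^ (j * y)"
    by (rule zdvd_mult) auto
  also have "(1 - \<zeta> ^ gcd i j) * w * \<zeta> ^ (j * y) * (\<zeta> ^ (e - 1)) ^ (j * y) = (1 - \<zeta> ^ gcd i j) * w"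
    unfolding inverse_zeta[symmetric] by (simp add: power_inverse)
  finally show ?thesis .
qed


lemma zeta_pow_neq_1: "0 < k \<Longrightarrow> k < e \<Longrightarrow> \<zeta> ^ k \<noteq> 1"
  by (auto simp: zeta_pow_eq_1_iff dest: dvd_imp_le)

text \<open>Replacing j by g = gcd (e div d) j and cancelling 1 - \<zeta>^g leaves a quotient
  \<open>psi h (\<zeta> ^ g)\<close> dividing w. Here h > 1 exactly because e div d does not divide
  j. The resulting statement is the one to be refuted for w = 1 and for w = 1 + \<zeta>.\<close>

lemma one_minus_zdvd_gcd:
  assumes d: "d dvd e" and w: "w \<in> Z" and j: "1 - \<zeta> ^ (e div d) zdvd (1 - \<zeta> ^ j) * w"
    and nj: "\<not> e div d dvd j"
  obtains g h where "e div d = g * h" "h > 1" "psi h (\<zeta> ^ g) zdvd w" "has_ord (\<zeta> ^ g) (d * h)"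
proof -
  define q where "q = e div d"
  have e: "e = d * q" using d by (simp add: q_def)
  have pos: "d > 0" "q > 0" using e e_pos by auto
  define g where "g = gcd q j"
  obtain h where h: "q = g * h" using gcd_dvd1[of q j] unfolding g_def by (elim dvdE) auto
  have gpos: "g > 0" "h > 0" using h pos by auto
  have "h \<noteq> 1"
  proof
    assume "h = 1"
    hence "q = g" using h by simp
    moreover have "g dvd j" by (simp add: g_def)
    ultimately show False using nj unfolding q_def by metis
  qed
  have "g * 1 < g * h" using gpos \<open>h \<noteq> 1\<close> by simp
  also have "g * h \<le> d * (g * h)" using pos by simp
  finally have "g < e" using e h by simp
  hence g1: "1 - \<zeta> ^ g \<noteq> 0" using zeta_pow_neq_1[of g] gpos by auto
  have "1 - \<zeta> ^ q zdvd (1 - \<zeta> ^ g) * w"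
    unfolding g_def using j pos w by (intro one_minus_gcd_zdvd) (auto simp: q_def intro!: zdvd_triv)
  moreover have "1 - \<zeta> ^ q = (1 - \<zeta> ^ g) * psi h (\<zeta> ^ g)"
    by (simp add: psi_mult h power_mult)
  ultimately have "psi h (\<zeta> ^ g) zdvd w" using g1 by (simp add: zdvd_cancel)
  moreover have "has_ord (\<zeta> ^ g) (d * h)"
    using has_ord_power[OF has_ord_zeta, of g] e h gpos by (simp add: ac_simps)
  ultimately show thesis using that[of g h] h \<open>h \<noteq> 1\<close> gpos by (auto simp: q_def)
qed

text \<open>The case w = 1, needed for the class of 1 / (1 - \<zeta>^(e div d)): the remaining
  quotient would be a unit.\<close>

lemma one_minus_zdvd_one_minus:
  assumes "d dvd e" "primepow d" "1 - \<zeta> ^ (e div d) zdvd 1 - \<zeta> ^ j"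
  shows "e div d dvd j"
proof (rule ccontr)
  assume "\<not> e div d dvd j"
  then obtain g h where "h > 1" "psi h (\<zeta> ^ g) zdvd 1" "has_ord (\<zeta> ^ g) (d * h)"
    using assms by (elim one_minus_zdvd_gcd[of d 1 j, rotated 3]) auto
  moreover obtain p a where "prime p" "a > 0" "d = p ^ a" using assms(2) by (auto simp: primepow_def)
  ultimately show False using psi_not_unit by blast
qed

text \<open>Expand \<open>psi p\<close> around 1 to second order. The constant term p, the linear
  term and the remainder are all multiples of (1 - \<theta>)^2; for the linear term this uses that
  an odd p divides p choose 2.\<close>

lemma psi_prime_dvd:
  assumes th: "has_ord \<theta> (p ^ n)" and p: "prime p" and n: "n > 0" and odd: "p \<noteq> 2"
  shows "(1 - \<theta>)\<^sup>2 zdvd psi p \<theta>"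
proof -
  have "\<exists>c\<in>Z. psi k x = of_nat k - of_nat (k choose 2) * (1 - x) + (1 - x)\<^sup>2 * c"
    if x: "x \<in> Z" for x k
  proof (induction k)
    case (Suc k)
    then obtain c where c: "c \<in> Z"
      "psi k x = of_nat k - of_nat (k choose 2) * (1 - x) + (1 - x)\<^sup>2 * c" by auto
    have "psi (Suc k) x = 1 + x * psi k x"
      unfolding psi_def by (subst sum.lessThan_Suc_shift) (simp add: sum_distrib_left)
    also have "\<dots> = of_nat (Suc k) - of_nat (Suc k choose 2) * (1 - x)
        + (1 - x)\<^sup>2 * (of_nat (k choose 2) + x * c)"
      unfolding c(2) by (simp add: numeral_2_eq_2 algebra_simps)
    finally show ?case using c x by (intro bexI[of _ "of_nat (k choose 2) + x * c"]) auto
  qed (auto simp: psi_def intro: bexI[of _ 0])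
  note expand = this
  have thZ: "\<theta> \<in> Z" using th by (rule has_ord_Z)
  have p2: "p > 2" using p odd prime_ge_2_nat[OF p] by auto
  have "p dvd p choose 2" using p p2 by (intro dvd_choose_prime) auto
  then obtain t where t: "p choose 2 = p * t" by auto
  have ipp: "1 - \<theta> zdvd of_nat p" using prime_in_ideal[OF th p] n by (simp add: dvd_power)
  have sq: "(1 - \<theta>)\<^sup>2 zdvd of_nat (p choose 2) * (1 - \<theta>)"
    unfolding power2_eq_square t of_nat_mult by (intro zdvd_mult_mono zdvd_mult ipp) auto
  \<comment> \<open>A power of \<theta> of order exactly p. At \<omega> the sum \<open>psi p\<close>
    vanishes, so the expansion there expresses p itself as a multiple of (1 - \<theta>)^2.\<close>
  define \<omega> where "\<omega> = \<theta> ^ p ^ (n - 1)"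
  have om: "has_ord \<omega> p"
    using has_ord_power[OF th, of "p ^ (n - 1)"] n p2
    by (cases n) (auto simp: \<omega>_def)
  hence omZ: "\<omega> \<in> Z" by (rule has_ord_Z)
  have "\<omega> \<noteq> 1" using has_ord_neq_1[OF om] p2 by simp
  hence "psi p \<omega> = 0" using psi_mult[of \<omega> p] has_ordD[OF om, of p] by auto
  moreover obtain c where c: "c \<in> Z"
    "psi p \<omega> = of_nat p - of_nat (p choose 2) * (1 - \<omega>) + (1 - \<omega>)\<^sup>2 * c"
    using expand[OF omZ] by blast
  ultimately have peq: "of_nat p = of_nat (p choose 2) * (1 - \<omega>) - (1 - \<omega>)\<^sup>2 * c"
    by (simp add: algebra_simps)
  have dv: "1 - \<theta> zdvd 1 - \<omega>" unfolding \<omega>_def by (rule one_minus_zdvd[OF thZ])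
  have "(1 - \<theta>) * (1 - \<theta>) zdvd of_nat (p choose 2) * (1 - \<omega>)"
    unfolding t of_nat_mult by (intro zdvd_mult_mono zdvd_mult ipp dv) auto
  moreover have "(1 - \<theta>)\<^sup>2 zdvd (1 - \<omega>)\<^sup>2 * c" using zdvd_power_mono[OF dv] c by (auto intro: zdvd_mult)
  ultimately have "(1 - \<theta>)\<^sup>2 zdvd of_nat p"
    unfolding peq power2_eq_square[of "1 - \<theta>"] by (intro zdvd_diff) (auto simp: power2_eq_square)
  moreover obtain c' where c': "c' \<in> Z"
    "psi p \<theta> = of_nat p - of_nat (p choose 2) * (1 - \<theta>) + (1 - \<theta>)\<^sup>2 * c'"
    using expand[OF thZ] by blast
  ultimately show ?thesis unfolding c'(2) using sq c'(1)
    by (metis zdvd_add zdvd_diff zdvd_triv)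
qed

lemma one_plus_factor:
  "1 - \<zeta> ^ (2 * g) = (1 + \<zeta>) * ((1 - \<zeta>) * psi g (\<zeta>\<^sup>2))"
proof -
  have "1 - \<zeta> ^ (2 * g) = (1 - \<zeta>\<^sup>2) * psi g (\<zeta>\<^sup>2)" by (simp add: psi_mult power_mult)
  thus ?thesis by (simp add: power2_eq_square algebra_simps)
qed

text \<open>If d is a power of p, the assumption forces \<open>psi k \<theta>\<close> to divide \<open>1 + \<zeta>\<close> for a prime k, where \<open>\<theta>\<close>
  has order \<open>d * k\<close>; the cases \<open>k \<noteq> p\<close>, \<open>k = p\<close> odd and \<open>k = p = 2\<close> need different arguments.\<close>

lemma one_minus_zdvd_one_plus:
  assumes e: "e = 2 * d * h'" and h': "h' > 1" and d: "primepow d"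
    and j: "1 - \<zeta> ^ (e div d) zdvd (1 - \<zeta> ^ j) * (1 + \<zeta>)"
  shows "e div d dvd j"
proof (rule ccontr)
  assume "\<not> e div d dvd j"
  moreover have dde: "d dvd e" using e by auto
  ultimately obtain g h where gh: "e div d = g * h" "h > 1" "psi h (\<zeta> ^ g) zdvd 1 + \<zeta>"
    "has_ord (\<zeta> ^ g) (d * h)"
    using one_minus_zdvd_gcd[of d "1 + \<zeta>" j] j by auto
  obtain p a where pa: "prime p" "a > 0" "d = p ^ a" using d by (auto simp: primepow_def)
  have p2: "p \<ge> 2" using pa(1) by (rule prime_ge_2_nat)
  have d1: "d > 1" using p2 pa by (metis one_less_power prime_gt_1_nat)
  have e4: "e > 2" using e h' d1
    by (metis less_1_mult mult.assoc mult_less_cancel1 nat_mult_1_right zero_less_numeral)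
  have zeta2: "\<zeta>\<^sup>2 \<noteq> 1" using zeta_pow_neq_1[of 2] e4 by simp
  have nz: "1 + \<zeta> \<noteq> 0" using zeta2 by (metis add_eq_0_iff power2_minus power_one)
  have ord2: "has_ord (\<zeta>\<^sup>2) (p ^ a * h')"
    using has_ord_power[OF has_ord_zeta, of 2] e pa by simp
  \<comment> \<open>One prime factor of h suffices: with h = h1 * k, the sum of length h factors as
    \<open>psi k \<theta> * psi h1 (\<zeta> ^ g)\<close>.\<close>
  obtain k where k: "prime k" "k dvd h" using gh(2) by (metis prime_factor_nat less_not_refl)
  then obtain h1 where h1: "h = h1 * k" by (metis dvd_div_mult_self)
  define \<theta> where "\<theta> = (\<zeta> ^ g) ^ h1"
  have h1pos: "h1 > 0" using h1 gh(2) by (cases h1) auto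
  have th: "has_ord \<theta> (d * k)"
    using has_ord_power[OF gh(4), of h1] h1pos h1 by (simp add: \<theta>_def ac_simps)
  have thZ: "\<theta> \<in> Z" using th by (rule has_ord_Z)
  have g1: "1 - \<zeta> ^ g \<noteq> 0"
    using has_ord_neq_1[OF gh(4)] d1 gh(2) by (metis eq_iff_diff_eq_0 less_1_mult)
  have "(1 - \<zeta> ^ g) * psi h (\<zeta> ^ g) = (1 - \<zeta> ^ g) * (psi h1 (\<zeta> ^ g) * psi k \<theta>)"
    unfolding mult.assoc[symmetric] psi_mult \<theta>_def h1
    by (simp add: psi_mult power_mult)
  hence "psi h (\<zeta> ^ g) = psi k \<theta> * psi h1 (\<zeta> ^ g)" using g1 by simp
  hence psik: "psi k \<theta> zdvd 1 + \<zeta>" using gh(3) by (metis zdvd_left psi_Z Z_power Z_zeta)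
  have th_eq: "\<theta> = \<zeta> ^ (g * h1)" by (simp add: \<theta>_def power_mult)
  have dk: "g * h1 * (d * k) = e" using gh(1) h1 dde by (metis dvd_div_mult_self mult.assoc mult.commute)
  have dk1: "d * k > 1" using d1 k(1) by (metis less_1_mult prime_gt_1_nat)
  show False
  proof (cases "k = p")
    case False
    \<comment> \<open>The order of \<theta> has the two prime factors p and k, so 1 - \<theta> is a
      unit and 1 - \<theta>^k = 1 - \<zeta>^(2*h') still divides 1 + \<zeta>. Cancelling 1 + \<zeta>
      makes \<open>psi h' (\<zeta>\<^sup>2)\<close> a unit.\<close>
    have "\<not> primepow (d * k)"
    proof
      assume "primepow (d * k)"
      then obtain r c where "prime r" "d * k = r ^ c" by (auto simp: primepow_def)
      moreover from this have "p dvd r ^ c" "k dvd r ^ c" using pa by (metis dvd_mult2 dvd_power, metis dvd_triv_right)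
      ultimately show False using False pa k by (metis prime_dvd_power primes_dvd_imp_eq)
    qed
    hence "1 - \<theta> zdvd 1" using one_minus_unit[OF th dk1] by blast
    hence "(1 - \<theta>) * psi k \<theta> zdvd 1 * (1 + \<zeta>)" using psik by (rule zdvd_mult_mono)
    hence 1: "1 - \<theta> ^ k zdvd 1 + \<zeta>" by (simp add: psi_mult)
    have "\<theta> ^ k = \<zeta> ^ (2 * h')" using dk e d1 unfolding th_eq power_mult[symmetric]
      by (intro arg_cong[where f="\<lambda>n. \<zeta> ^ n"]) (auto simp: ac_simps)
    hence "(1 + \<zeta>) * ((1 - \<zeta>) * psi h' (\<zeta>\<^sup>2)) zdvd (1 + \<zeta>) * 1"
      using 1 one_plus_factor by simp
    hence "(1 - \<zeta>) * psi h' (\<zeta>\<^sup>2) zdvd 1" using nz zdvd_cancel by blast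
    hence "psi h' (\<zeta>\<^sup>2) zdvd 1" by (auto intro: zdvd_left simp: mult.commute)
    thus False using psi_not_unit[OF ord2 pa(1,2) h'] by blast
  next
    case True
    have thp: "has_ord \<theta> (p ^ Suc a)" using th True pa by (simp add: mult.commute)
    show False
    proof (cases "p = 2")
      case False
      \<comment> \<open>As e is even, the exponent of \<zeta> in \<theta> is then even, and 1 +
        \<zeta> divides 1 - \<theta>. Together with the square dividing
        \<open>psi p \<theta>\<close>, this makes (1 - \<theta>)^2 a divisor of 1 -
        \<theta>.\<close>
      hence "odd (d * k)" using True pa prime_odd_nat[OF pa(1)] p2 by auto
      hence "even (g * h1)" using dk e by (metis dvd_triv_left even_mult_iff)
      then obtain g' where g': "g * h1 = 2 * g'" by auto
      have f: "1 - \<theta> = (1 + \<zeta>) * ((1 - \<zeta>) * psi g' (\<zeta>\<^sup>2))" unfolding th_eq g' by (rule one_plus_factor)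
      have "(1 - \<theta>) * (1 - \<theta>) zdvd psi p \<theta>"
        using psi_prime_dvd[OF thp pa(1)] False by (simp add: power2_eq_square)
      also have "psi p \<theta> zdvd 1 + \<zeta>" using psik True by simp
      also have "1 + \<zeta> zdvd (1 - \<theta>) * 1" unfolding f by (auto intro: zdvd_triv)
      finally have "1 - \<theta> zdvd 1" using zdvd_cancel has_ord_neq_1[OF th dk1]
        by (metis eq_iff_diff_eq_0)
      thus False using one_minus_not_unit[OF thp pa(1)] by blast
    next
      case p_two: True
      have "g * h1 = h'" using dk e True p_two d1 by simp
      hence th_eq: "\<theta> = \<zeta> ^ h'" using th_eq by simp
      have div: "1 + \<theta> zdvd 1 + \<zeta>" using psik True p_two by (simp add: psi_def numeral_2_eq_2)
      show False
      proof (cases "even h'")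
        case True
        then obtain g' where g': "h' = 2 * g'" by auto
        \<comment> \<open>Since \<theta>^(2^a) = -1, the number 1 + \<theta> equals 1 -
          \<theta>^(2^a + 1) and is divisible by 1 - \<theta>, which has the factor 1 + \<zeta>
          because h' is even. After cancellation 1 - \<zeta> and
          \<open>psi g' (\<zeta>\<^sup>2)\<close> are units.\<close>
        have "\<theta> ^ 2 ^ a \<noteq> 1" using has_ordD[OF thp, of "2 ^ a"] p_two by (auto dest: dvd_imp_le)
        moreover have "(\<theta> ^ 2 ^ a)\<^sup>2 = 1" using has_ordD[OF thp, of "2 ^ Suc a"] p_two
          by (simp add: power_mult[symmetric] mult.commute)
        ultimately have "\<theta> ^ 2 ^ a = -1" by (simp add: power2_eq_1_iff)
        hence "1 - \<theta> ^ (Suc (2 ^ a)) = 1 + \<theta>" by simp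
        hence "1 - \<theta> zdvd 1 + \<theta>" using one_minus_zdvd[OF thZ] by metis
        hence "1 - \<theta> zdvd (1 + \<zeta>) * 1" using div zdvd_trans by simp
        hence "(1 - \<zeta>) * psi g' (\<zeta>\<^sup>2) zdvd 1"
          unfolding th_eq g' one_plus_factor using nz zdvd_cancel by blast
        hence u: "1 - \<zeta> zdvd 1" "psi g' (\<zeta>\<^sup>2) zdvd 1"
          by (auto intro: zdvd_left simp: mult.commute)
        show False
        proof (cases "g' = 1")
          case True
          hence "e = 2 ^ (a + 2)" using e g' pa p_two by simp
          hence "has_ord \<zeta> (2 ^ (a + 2))" using has_ord_zeta by simp
          thus False using one_minus_not_unit[of \<zeta> 2 "a + 2"] u(1) by (simp add: two_is_prime_nat)
        next
          case False
          hence "g' > 1" using g' h' by auto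
          moreover have "has_ord (\<zeta>\<^sup>2) (2 ^ (Suc a) * g')" using ord2 g' p_two by (simp add: ac_simps)
          ultimately show False using psi_not_unit u(2) two_is_prime_nat by blast
        qed
      next
        case False
        have e': "e = 2 ^ Suc a * h'" using e pa p_two by simp
        have half: "\<zeta> ^ (e div 2) = -1"
        proof -
          have "e div 2 * 2 = e" using e by simp
          hence "(\<zeta> ^ (e div 2))\<^sup>2 = 1" by (metis power_mult zeta_pow_e)
          moreover have "\<zeta> ^ (e div 2) \<noteq> 1" using zeta_pow_neq_1[of "e div 2"] e4 by auto
          ultimately show ?thesis by (simp add: power2_eq_1_iff)
        qed
        \<comment> \<open>Here -\<zeta> = \<zeta>^s. As e div 2 is even, s is coprime to e and
          -\<zeta> is again primitive of order e, so for odd h' the quotient (1 + \<theta>) / (1 +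
          \<zeta>) is \<open>psi h' (- \<zeta>)\<close>.\<close>
        define s where "s = e div 2 + 1"
        have s: "\<zeta> ^ s = - \<zeta>" using half by (simp add: s_def)
        have "coprime s e"
        proof -
          have ev: "even (e div 2)" using e' pa(2) by (cases a) auto
          have "coprime s (e div 2)" unfolding s_def by simp
          moreover have "coprime s 2" using ev unfolding s_def by simp
          ultimately have "coprime s (2 * (e div 2))" by simp
          thus ?thesis using e by simp
        qed
        hence ordm: "has_ord (- \<zeta>) (2 ^ Suc a * h')"
          unfolding s[symmetric] has_ord_def e'[symmetric] power_mult[symmetric]
          using e_pos by (auto simp: zeta_pow_eq_1_iff coprime_commute coprime_dvd_mult_right_iff)
        have "(1 + \<zeta>) * psi h' (- \<zeta>) = 1 + \<theta>"
          using psi_mult[of "-\<zeta>" h'] False by (simp add: th_eq)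
        hence "(1 + \<zeta>) * psi h' (- \<zeta>) zdvd (1 + \<zeta>) * 1" using div by simp
        hence "psi h' (- \<zeta>) zdvd 1" using nz zdvd_cancel by blast
        thus False using psi_not_unit[OF ordm two_is_prime_nat _ h'] by blast
      qed
    qed
  qed
qed


text \<open>The condition that \<open>refl \<zeta> i\<close> stabilize the class of \<open>(x, - cnj x)\<close> modulo the lattice.\<close>

definition fixes_class :: "complex \<Rightarrow> nat \<Rightarrow> bool" where
  "fixes_class x i \<longleftrightarrow> x + \<zeta> ^ i * cnj x \<in> Z"

text \<open>The condition that the rotation by \<zeta>^j, a product of two reflections, stabilize
  the class of x.\<close>

definition annihilates :: "complex \<Rightarrow> nat \<Rightarrow> bool" where
  "annihilates x j \<longleftrightarrow> (1 - \<zeta> ^ j) * x \<in> Z"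

section \<open>The set of reflections stabilizing a class\<close>

lemma Z_unit_cancel: "\<zeta> ^ i * y \<in> Z \<longleftrightarrow> y \<in> Z"
proof
  assume "\<zeta> ^ i * y \<in> Z"
  hence "(\<zeta> ^ (e - 1)) ^ i * (\<zeta> ^ i * y) \<in> Z" by auto
  also have "(\<zeta> ^ (e - 1)) ^ i * (\<zeta> ^ i * y) = y"
    unfolding inverse_zeta[symmetric] by (simp add: power_inverse)
  finally show "y \<in> Z" .
qed auto

lemma cnj_in_Z_iff: "cnj y \<in> Z \<longleftrightarrow> y \<in> Z"
  using Z_cnj[of y] Z_cnj[of "cnj y"] by auto


text \<open>Conjugating (1 - \<zeta>^j) * x gives (1 - \<zeta>^j) * cnj x up to the unit
  -\<zeta>^(-j). The difference of two reflection conditions involves cnj x, hence this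
  form.\<close>

lemma annihilates_cnj: "annihilates x j \<longleftrightarrow> (1 - \<zeta> ^ j) * cnj x \<in> Z"
proof -
  have "\<zeta> ^ j * cnj (\<zeta> ^ j) = 1" by (simp add: cnj_zeta power_inverse)
  hence "\<zeta> ^ j * cnj ((1 - \<zeta> ^ j) * x) = - ((1 - \<zeta> ^ j) * cnj x)"
    by (simp add: algebra_simps)
  moreover have "annihilates x j \<longleftrightarrow> \<zeta> ^ j * cnj ((1 - \<zeta> ^ j) * x) \<in> Z"
    unfolding annihilates_def Z_unit_cancel cnj_in_Z_iff ..
  ultimately show ?thesis using Z_minus by (metis minus_minus)
qed

text \<open>Subtracting the conditions for i and i + j leaves \<zeta>^i * (1 - \<zeta>^j) * cnj x.
  So the stabilizing exponents, if there are any, form a coset of the annihilating ones.\<close>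

lemma fixes_class_add:
  assumes "fixes_class x i"
  shows "fixes_class x (i + j) \<longleftrightarrow> annihilates x j"
proof -
  have "fixes_class x (i + j) \<longleftrightarrow> (x + \<zeta> ^ i * cnj x) - (x + \<zeta> ^ (i + j) * cnj x) \<in> Z"
    using assms unfolding fixes_class_def by (metis Z_diff diff_diff_eq2 add_diff_cancel_left')
  also have "(x + \<zeta> ^ i * cnj x) - (x + \<zeta> ^ (i + j) * cnj x) = \<zeta> ^ i * ((1 - \<zeta> ^ j) * cnj x)"
    by (simp add: algebra_simps power_add)
  finally show ?thesis by (simp only: Z_unit_cancel annihilates_cnj)
qed

lemma fixes_class_mod: "fixes_class x (i mod e) \<longleftrightarrow> fixes_class x i"
  by (simp add: fixes_class_def zeta_pow_mod)

lemma annihilates_zdvd: "annihilates x j \<longleftrightarrow> 1 zdvd (1 - \<zeta> ^ j) * x"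
  by (auto simp: annihilates_def zdvd_def)

text \<open>Closure under gcd makes the least positive annihilating exponent g a generator. If 1 -
  \<zeta>^g is a unit, x is already integral and g = 1; otherwise \<zeta>^g has order 1 or a prime
  power.\<close>

lemma annihilators:
  obtains g where "g dvd e" "\<And>j. annihilates x j \<longleftrightarrow> g dvd j"
    "g = 1 \<or> g = e \<or> primepow (e div g)"
proof -
  have Ae: "annihilates x e" by (simp add: annihilates_def)
  define g where "g = (LEAST j. j > 0 \<and> annihilates x j)"
  have g: "g > 0 \<and> annihilates x g" unfolding g_def by (rule LeastI[of _ e]) (use Ae e_pos in auto)
  have gmin: "g \<le> j" if "j > 0" "annihilates x j" for j
    unfolding g_def using that by (intro Least_le) auto
  have iff: "annihilates x j \<longleftrightarrow> g dvd j" for j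
  proof
    assume "annihilates x j"
    hence "annihilates x (gcd g j)" using g one_minus_gcd_zdvd[of 1 g x j] by (simp add: annihilates_zdvd)
    hence "g \<le> gcd g j" using g by (intro gmin) auto
    moreover have "gcd g j \<le> g" using g by (intro gcd_le1_nat) auto
    ultimately have "gcd g j = g" by simp
    thus "g dvd j" by (metis gcd_dvd2)
  next
    assume "g dvd j"
    then obtain t where t: "j = g * t" by auto
    have "1 zdvd (1 - \<zeta> ^ g) * x * psi t (\<zeta> ^ g)" using g by (auto simp: annihilates_zdvd intro: zdvd_mult)
    also have "(1 - \<zeta> ^ g) * x * psi t (\<zeta> ^ g) = (1 - \<zeta> ^ j) * x"
      using psi_mult[of "\<zeta>^g" t] by (simp add: t power_mult mult.commute mult.left_commute)
    finally show "annihilates x j" by (simp add: annihilates_zdvd)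
  qed
  have ge: "g dvd e" using iff Ae by blast
  moreover have "g = 1 \<or> g = e \<or> primepow (e div g)"
  proof (rule ccontr)
    assume A: "\<not> ?thesis"
    have gt1: "e div g > 1" using ge e_pos g A by (auto elim!: dvdE)
    have "1 - \<zeta> ^ g zdvd 1"
      using one_minus_unit[OF has_ord_power[OF has_ord_zeta ge] gt1] A by blast
    then obtain c where c: "c \<in> Z" "1 = (1 - \<zeta> ^ g) * c" by (auto simp: zdvd_def)
    have "c * ((1 - \<zeta> ^ g) * x) \<in> Z" using c g by (auto simp: annihilates_def)
    also have "c * ((1 - \<zeta> ^ g) * x) = x" using c(2) by (metis mult.assoc mult.commute mult_1)
    finally have "annihilates x 1" by (auto simp: annihilates_def)
    thus False using iff A by simp
  qed
  ultimately show thesis using that iff by blast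
qed

section \<open>Explicit classes with a prescribed stabilizer\<close>

lemma fixes_class_prime_power:
  assumes d: "d dvd e" "primepow d"
  shows "fixes_class (1 / (1 - \<zeta> ^ (e div d))) i \<longleftrightarrow> e div d dvd i"
proof -
  define \<eta> where "\<eta> = \<zeta> ^ (e div d)"
  have d1: "d > 1" using d(2) by (rule primepow_gt_Suc_0[unfolded One_nat_def[symmetric]])
  have "has_ord \<eta> d"
    using has_ord_power[OF has_ord_zeta, of "e div d"] d e_pos unfolding \<eta>_def
    by (metis div_div_eq_right dvd_div_mult_self div_by_1 dvd_triv_left e_pos nonzero_mult_div_cancel_left not_gr_zero div_dvd_div dvd_div_eq_0_iff)
  hence eta: "\<eta> \<noteq> 1" using has_ord_neq_1 d1 by blast
  have cnj: "cnj \<eta> = inverse \<eta>" by (simp add: \<eta>_def cnj_zeta power_inverse)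
  have nz: "\<eta> \<noteq> 0" by (simp add: \<eta>_def)
  \<comment> \<open>For \<eta> \<noteq> 1 on the unit circle, 1 / (1 - \<eta>) has real part
    1/2.\<close>
  have "1 / (1 - \<eta>) + cnj (1 / (1 - \<eta>)) = 1"
    using eta nz by (simp add: cnj divide_simps) (simp add: algebra_simps)
  hence "fixes_class (1 / (1 - \<eta>)) 0" by (simp add: fixes_class_def)
  hence "fixes_class (1 / (1 - \<eta>)) i \<longleftrightarrow> annihilates (1 / (1 - \<eta>)) i"
    using fixes_class_add[of _ 0 i] by simp
  also have "\<dots> \<longleftrightarrow> 1 - \<eta> zdvd 1 - \<zeta> ^ i"
    using eta unfolding annihilates_def by (auto simp: zdvd_def intro: bexI[of _ "(1 - \<zeta> ^ i) / (1 - \<eta>)"])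
  also have "\<dots> \<longleftrightarrow> e div d dvd i"
  proof
    assume "e div d dvd i"
    then obtain t where "i = e div d * t" by auto
    thus "1 - \<eta> zdvd 1 - \<zeta> ^ i" unfolding \<eta>_def by (auto simp: power_mult intro!: one_minus_zdvd)
  qed (use one_minus_zdvd_one_minus[OF d] in \<open>auto simp: \<eta>_def\<close>)
  finally show ?thesis by (simp add: \<eta>_def)
qed

lemma fixes_class_prime_power':
  assumes e: "e = 2 * d * h'" and h': "h' > 1" and d: "primepow d"
  shows "fixes_class ((1 + \<zeta>) / (1 - \<zeta> ^ (e div d))) (1 + i) \<longleftrightarrow> e div d dvd i"
proof -
  define \<eta> where "\<eta> = \<zeta> ^ (e div d)"
  have d1: "d > 1" using d by (rule primepow_gt_Suc_0[unfolded One_nat_def[symmetric]])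
  hence q: "e div d = 2 * h'" using e by simp
  have "has_ord \<eta> d"
    using has_ord_power[OF has_ord_zeta, of "2 * h'"] e h' unfolding \<eta>_def q by simp
  hence eta: "\<eta> \<noteq> 1" using has_ord_neq_1 d1 by blast
  have cnj: "cnj \<eta> = inverse \<eta>" by (simp add: \<eta>_def cnj_zeta power_inverse)
  have nz: "\<eta> \<noteq> 0" by (simp add: \<eta>_def)
  let ?x = "(1 + \<zeta>) / (1 - \<eta>)"
  \<comment> \<open>The numerator 1 + \<zeta> is fixed by z -> \<zeta> * cnj z, so only the sum of 1
    / (1 - \<eta>) and its conjugate remains, which is 1.\<close>
  have "?x + \<zeta> * cnj ?x = 1 + \<zeta>"
    using eta nz by (simp add: cnj cnj_zeta divide_simps) (simp add: algebra_simps)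
  hence "fixes_class ?x 1" by (auto simp: fixes_class_def)
  hence "fixes_class ?x (1 + i) \<longleftrightarrow> annihilates ?x i" by (rule fixes_class_add)
  also have "\<dots> \<longleftrightarrow> 1 - \<eta> zdvd (1 - \<zeta> ^ i) * (1 + \<zeta>)"
    using eta unfolding annihilates_def
    by (auto simp: zdvd_def intro!: bexI[of _ "(1 - \<zeta> ^ i) * (1 + \<zeta>) / (1 - \<eta>)"])
  also have "\<dots> \<longleftrightarrow> e div d dvd i"
  proof
    assume "e div d dvd i"
    then obtain t where "i = e div d * t" by auto
    thus "1 - \<eta> zdvd (1 - \<zeta> ^ i) * (1 + \<zeta>)"
      unfolding \<eta>_def by (auto simp: power_mult intro!: one_minus_zdvd zdvd_mult)
  qed (use one_minus_zdvd_one_plus[OF e h' d] in \<open>auto simp: \<eta>_def\<close>)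
  finally show ?thesis by (simp add: \<eta>_def)
qed

text \<open>The denominator N = e^2 + 1 is prime to e. As (1 - \<zeta>^j) * (1 - \<zeta>^k) divides
  e^2, integrality would carry over to e^2 / N = 1 - 1/N.\<close>

lemma not_annihilates_small:
  assumes j: "annihilates ((1 - \<zeta> ^ k) * \<zeta> ^ l / of_nat (e\<^sup>2 + 1)) j" and k: "\<zeta> ^ k \<noteq> 1"
  shows "\<zeta> ^ j = 1"
proof (rule ccontr)
  assume nj: "\<zeta> ^ j \<noteq> 1"
  have pe: "(\<zeta> ^ t) ^ e = 1" for t
    by (metis mult.commute power_mult power_one zeta_pow_e)
  define N where "N = e\<^sup>2 + 1"
  have N: "N \<ge> 2" using e_pos by (simp add: N_def Suc_le_eq)
  have "\<zeta> ^ l * (((1 - \<zeta> ^ j) * (1 - \<zeta> ^ k)) * (1 / of_nat N)) \<in> Z"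
    using j unfolding annihilates_def N_def by (simp add: mult.commute mult.left_commute)
  hence 1: "((1 - \<zeta> ^ j) * (1 - \<zeta> ^ k)) * (1 / of_nat N) \<in> Z" by (simp only: Z_unit_cancel)
  have "(1 - \<zeta> ^ j) * (1 - \<zeta> ^ k) zdvd of_nat e * of_nat e"
    by (intro zdvd_mult_mono one_minus_zdvd_e) (use pe k nj in auto)
  then obtain c where c: "c \<in> Z" "of_nat e * of_nat e = (1 - \<zeta> ^ j) * (1 - \<zeta> ^ k) * c"
    by (auto simp: zdvd_def)
  have "c * (((1 - \<zeta> ^ j) * (1 - \<zeta> ^ k)) * (1 / of_nat N)) \<in> Z" using 1 c(1) by blast
  also have "c * (((1 - \<zeta> ^ j) * (1 - \<zeta> ^ k)) * (1 / of_nat N)) = of_nat e * of_nat e * (1 / of_nat N)"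
    unfolding c(2) by (simp only: mult.commute mult.left_commute)
  also have "\<dots> = 1 - 1 / of_nat N"
  proof -
    have "(of_nat N :: complex) \<noteq> 0" using N by simp
    moreover have "(of_nat N :: complex) = of_nat e * of_nat e + 1" by (simp add: N_def power2_eq_square)
    ultimately show ?thesis by (simp add: field_simps)
  qed
  finally have "1 - (1 - 1 / of_nat N) \<in> Z" by (rule Z_diff[OF Z_1])
  thus False using inverse_int_notin_Z[OF N] by simp
qed

lemma fixes_class_small:
  assumes "e > 2"
  shows "fixes_class ((1 - \<zeta>\<^sup>2) * \<zeta> ^ (e - 1) / of_nat (e\<^sup>2 + 1)) i \<longleftrightarrow> e dvd i"
proof -
  let ?x = "(1 - \<zeta>\<^sup>2) * \<zeta> ^ (e - 1) / of_nat (e\<^sup>2 + 1)"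
  have "\<zeta>\<^sup>2 \<noteq> 1" using zeta_pow_neq_1[of 2] assms by simp
  \<comment> \<open>The numerator is \<zeta>^(-1) - \<zeta>, purely imaginary, and nonzero because e
    > 2. Hence \<open>refl \<zeta> 0\<close> fixes x itself and not just its class.\<close>
  have "(1 - \<zeta>\<^sup>2) * \<zeta> ^ (e - 1) + cnj ((1 - \<zeta>\<^sup>2) * \<zeta> ^ (e - 1)) = 0"
    unfolding inverse_zeta[symmetric] by (simp add: cnj_zeta field_simps power2_eq_square)
  hence "?x + cnj ?x = 0" by (simp add: add_divide_distrib[symmetric])
  hence "fixes_class ?x 0" by (simp add: fixes_class_def)
  hence "fixes_class ?x i \<longleftrightarrow> annihilates ?x i" using fixes_class_add[of _ 0 i] by simp
  also have "\<dots> \<longleftrightarrow> e dvd i"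
    using not_annihilates_small[of 2 "e - 1" i] \<open>\<zeta>\<^sup>2 \<noteq> 1\<close>
    by (auto simp: zeta_pow_eq_1_iff) (auto simp: annihilates_def zeta_pow_eq_1_iff[THEN iffD2])
  finally show ?thesis .
qed

lemma fixes_class_small':
  assumes "e > 1"
  shows "fixes_class ((1 - \<zeta>) / of_nat (e\<^sup>2 + 1)) (1 + i) \<longleftrightarrow> e dvd i"
proof -
  let ?x = "(1 - \<zeta>) / of_nat (e\<^sup>2 + 1)"
  have "\<zeta> \<noteq> 1" using zeta_pow_neq_1[of 1] assms by simp
  \<comment> \<open>The numerator 1 - \<zeta> is negated by z -> \<zeta> * cnj z, so
    \<open>refl \<zeta> 1\<close> fixes x exactly.\<close>
  have "(1 - \<zeta>) + \<zeta> * cnj (1 - \<zeta>) = 0"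
    by (simp add: cnj_zeta field_simps)
  hence "?x + \<zeta> * cnj ?x = 0" by (simp add: add_divide_distrib[symmetric])
  hence "fixes_class ?x 1" by (simp add: fixes_class_def)
  hence "fixes_class ?x (1 + i) \<longleftrightarrow> annihilates ?x i" by (rule fixes_class_add)
  also have "\<dots> \<longleftrightarrow> e dvd i"
    using not_annihilates_small[of 1 0 i] \<open>\<zeta> \<noteq> 1\<close>
    by (auto simp: zeta_pow_eq_1_iff) (auto simp: annihilates_def zeta_pow_eq_1_iff[THEN iffD2])
  finally show ?thesis .
qed

text \<open>Modulo 1 - zeta^2 every integer is congruent to some alpha + beta zeta, on which complex
  conjugation acts trivially.\<close>

lemma fixes_class_half:
  assumes e: "e > 2" and x1: "fixes_class x 1" and x2: "annihilates x 2"
  shows "annihilates x 1"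
proof -
  have z2: "1 - \<zeta>\<^sup>2 \<noteq> 0" using zeta_pow_neq_1[of 2] e by simp
  have fact: "1 - \<zeta>\<^sup>2 = (1 - \<zeta>) * (1 + \<zeta>)" by (simp add: power2_eq_square algebra_simps)
  have nz: "1 - \<zeta> \<noteq> 0" "1 + \<zeta> \<noteq> 0" using z2 fact by auto
  define z where "z = (1 - \<zeta>\<^sup>2) * x"
  have zZ: "z \<in> Z" using x2 by (simp add: z_def annihilates_def)
  have x: "x = z / (1 - \<zeta>\<^sup>2)" using z2 by (simp add: z_def)
  have red: "\<exists>a b :: int. 1 - \<zeta>\<^sup>2 zdvd w - (of_int a + of_int b * \<zeta>)" if w: "w \<in> Z" for w
  proof -
    obtain f where f: "w = poly (map_poly of_int f) \<zeta>"
      using w unfolding cyclotomic_integers_def by auto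
    show ?thesis unfolding f
    proof (induction f)
      case 0 show ?case by (intro exI[of _ 0]) simp
    next
      case (pCons c f)
      then obtain a b :: int where
        ab: "1 - \<zeta>\<^sup>2 zdvd poly (map_poly of_int f) \<zeta> - (of_int a + of_int b * \<zeta>)" by blast
      have "1 - \<zeta>\<^sup>2 zdvd \<zeta> * (poly (map_poly of_int f) \<zeta> - (of_int a + of_int b * \<zeta>))
        - (1 - \<zeta>\<^sup>2) * of_int b"
        using ab by (auto intro!: zdvd_diff zdvd_mult2 zdvd_triv)
      also have "\<zeta> * (poly (map_poly of_int f) \<zeta> - (of_int a + of_int b * \<zeta>)) - (1 - \<zeta>\<^sup>2) * of_int b
        = poly (map_poly of_int (pCons c f)) \<zeta> - (of_int (c + b) + of_int a * \<zeta>)"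
        by (simp add: of_int_hom.map_poly_pCons_hom algebra_simps power2_eq_square)
      finally show ?case by blast
    qed
  qed
  obtain a b :: int where ab: "1 - \<zeta>\<^sup>2 zdvd z - (of_int a + of_int b * \<zeta>)" using red[OF zZ] by blast
  then obtain c where c: "c \<in> Z" "z = of_int a + of_int b * \<zeta> + (1 - \<zeta>\<^sup>2) * c"
    by (auto simp: zdvd_def algebra_simps)
  \<comment> \<open>The conjugate of 1 - \<zeta>^2 is -\<zeta>^(-2) times itself, which turns the
    condition on x into a congruence for z modulo 1 - \<zeta>^2.\<close>
  have "x + \<zeta> * cnj x = (z - \<zeta> ^ 3 * cnj z) / (1 - \<zeta>\<^sup>2)"
    unfolding x using z2
    by (simp add: cnj_zeta divide_simps power_inverse) (simp add: power2_eq_square power3_eq_cube algebra_simps)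
  hence "(z - \<zeta> ^ 3 * cnj z) / (1 - \<zeta>\<^sup>2) \<in> Z" using x1 by (simp add: fixes_class_def)
  hence 1: "1 - \<zeta>\<^sup>2 zdvd z - \<zeta> ^ 3 * cnj z" using z2
    by (intro zdvdI[of "(z - \<zeta> ^ 3 * cnj z) / (1 - \<zeta>\<^sup>2)"]) auto
  have cnjz: "\<zeta> ^ 3 * cnj z = of_int a * \<zeta> ^ 3 + of_int b * \<zeta>\<^sup>2 - \<zeta> * ((1 - \<zeta>\<^sup>2) * cnj c)"
    unfolding c(2) by (simp add: cnj_zeta field_simps power2_eq_square power3_eq_cube)
  have "z - \<zeta> ^ 3 * cnj z = of_int (a - b) * (1 - \<zeta>)
     + (1 - \<zeta>\<^sup>2) * (of_int b + of_int a * \<zeta> + c + \<zeta> * cnj c)"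
    unfolding cnjz unfolding c(2) by (simp add: algebra_simps power2_eq_square power3_eq_cube)
  hence "of_int (a - b) * (1 - \<zeta>) = (z - \<zeta> ^ 3 * cnj z)
     - (1 - \<zeta>\<^sup>2) * (of_int b + of_int a * \<zeta> + c + \<zeta> * cnj c)" by (simp add: algebra_simps)
  moreover have "1 - \<zeta>\<^sup>2 zdvd (z - \<zeta> ^ 3 * cnj z)
     - (1 - \<zeta>\<^sup>2) * (of_int b + of_int a * \<zeta> + c + \<zeta> * cnj c)"
    by (rule zdvd_diff[OF 1 zdvd_triv]) (use c(1) in auto)
  ultimately have "(1 - \<zeta>) * (1 + \<zeta>) zdvd (1 - \<zeta>) * of_int (a - b)"
    by (simp only: fact mult.commute)
  hence 2: "1 + \<zeta> zdvd of_int (a - b)" using nz zdvd_cancel by blast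
  \<comment> \<open>Modulo 1 + \<zeta> the number z is congruent to a + b * \<zeta>, hence to a - b,
    hence to 0. So z / (1 + \<zeta>) = (1 - \<zeta>) * x is integral.\<close>
  have "1 + \<zeta> zdvd of_int (a - b) + (1 + \<zeta>) * (of_int b + (1 - \<zeta>) * c)"
    using 2 c(1) by (intro zdvd_add zdvd_triv) auto
  also have "of_int (a - b) + (1 + \<zeta>) * (of_int b + (1 - \<zeta>) * c) = z"
    unfolding c(2) fact by (simp add: algebra_simps)
  finally obtain y where "y \<in> Z" "z = (1 + \<zeta>) * y" by (auto simp: zdvd_def)
  hence "(1 - \<zeta>) * x \<in> Z" unfolding x fact using nz by simp
  thus ?thesis by (simp add: annihilates_def)
qed

lemma Z_quotient_in_field: "a \<in> Z \<Longrightarrow> b \<in> Z \<Longrightarrow> a / b \<in> cyclotomic_field \<zeta>"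
proof -
  assume "a \<in> Z" "b \<in> Z"
  then obtain f g :: "int poly" where fg: "a = poly (map_poly of_int f) \<zeta>" "b = poly (map_poly of_int g) \<zeta>"
    unfolding cyclotomic_integers_def by auto
  have "poly (map_poly of_rat (map_poly of_int h)) \<zeta> = poly (map_poly of_int h) \<zeta>" for h :: "int poly"
    by (subst map_poly_map_poly) (auto simp: o_def)
  thus ?thesis unfolding cyclotomic_field_def fg by (metis (mono_tags, lifting) mem_Collect_eq)
qed

end

section \<open>Dihedral groups and stabilizers of classes\<close>

text \<open>For nonzero parameters \<open>rot a\<close> and \<open>ref a\<close> make up the
  orthogonal group of the quadratic form xy; all groups below are computed in these
  coordinates.\<close>

definition rot :: "complex \<Rightarrow> complex mat" where "rot a = mat2 a 0 0 (inverse a)"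
definition ref :: "complex \<Rightarrow> complex mat" where "ref a = mat2 0 a (inverse a) 0"

lemma mat2_carrier [simp]: "mat2 a b c d \<in> carrier_mat 2 2"
  by (simp add: mat2_def mat_of_rows_list_def numeral_2_eq_2)

lemma mat2_index [simp]:
  "mat2 a b c d $$ (0, 0) = a" "mat2 a b c d $$ (0, Suc 0) = b"
  "mat2 a b c d $$ (Suc 0, 0) = c" "mat2 a b c d $$ (Suc 0, Suc 0) = d"
  "mat2 a b c d $$ (0, 1) = b" "mat2 a b c d $$ (1, 0) = c" "mat2 a b c d $$ (1, 1) = d"
  by (simp_all add: mat2_def mat_of_rows_list_def)

lemma mat2_dim [simp]: "dim_row (mat2 a b c d) = 2" "dim_col (mat2 a b c d) = 2"
  by (rule carrier_matD[OF mat2_carrier])+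

lemma less_2_cases': "i < 2 \<Longrightarrow> i = 0 \<or> i = Suc 0" for i :: nat
  by auto

lemma mat_2_eqI:
  assumes "A \<in> carrier_mat 2 2" "B \<in> carrier_mat 2 2"
    "A $$ (0,0) = B $$ (0,0)" "A $$ (0,1) = B $$ (0,1)" "A $$ (1,0) = B $$ (1,0)" "A $$ (1,1) = B $$ (1,1)"
  shows "A = B"
  using assms by (intro eq_matI) (auto dest!: less_2_cases')

lemma vec_2_eqI:
  assumes "u \<in> carrier_vec 2" "v \<in> carrier_vec 2" "u $ 0 = v $ 0" "u $ 1 = v $ 1"
  shows "u = v"
  using assms by (intro eq_vecI) (auto dest!: less_2_cases')

definition vec2 :: "complex \<Rightarrow> complex \<Rightarrow> complex vec" where
  "vec2 x y = vec 2 (\<lambda>i. if i = 0 then x else y)"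

lemma vec2_simps [simp]: "vec2 x y \<in> carrier_vec 2" "vec2 x y $ 0 = x" "vec2 x y $ 1 = y"
   "vec2 x y $ Suc 0 = y"
  by (auto simp: vec2_def)

lemma mult_vec_carrier_2: "A \<in> carrier_mat 2 2 \<Longrightarrow> A *\<^sub>v v \<in> carrier_vec 2"
  by (metis carrier_vecI dim_mult_mat_vec carrier_matD(1))

lemma index_mult_2:
  assumes "A \<in> carrier_mat 2 2" "B \<in> carrier_mat 2 2" "i < 2" "j < 2"
  shows "(A * B) $$ (i, j) = A $$ (i, 0) * B $$ (0, j) + A $$ (i, 1) * B $$ (1, j)"
proof -
  have "{0..<2::nat} = {0, 1}" by auto
  thus ?thesis using assms by (simp add: scalar_prod_def)
qed

lemma index_mult_vec_2:
  assumes "A \<in> carrier_mat 2 2" "v \<in> carrier_vec 2" "i < 2"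
  shows "(A *\<^sub>v v) $ i = A $$ (i, 0) * v $ 0 + A $$ (i, 1) * v $ 1"
proof -
  have "{0..<2::nat} = {0, 1}" by auto
  thus ?thesis using assms by (simp add: scalar_prod_def)
qed

lemma mat2_mult: "mat2 a b c d * mat2 a' b' c' d' =
    mat2 (a * a' + b * c') (a * b' + b * d') (c * a' + d * c') (c * b' + d * d')"
  by (rule mat_2_eqI) (auto simp: index_mult_2 simp del: index_mult_mat(1))

lemma mat2_eq_iff: "mat2 a b c d = mat2 a' b' c' d' \<longleftrightarrow> a = a' \<and> b = b' \<and> c = c' \<and> d = d'"
proof
  assume "mat2 a b c d = mat2 a' b' c' d'"
  hence "\<forall>i j. mat2 a b c d $$ (i, j) = mat2 a' b' c' d' $$ (i, j)" by simp
  thus "a = a' \<and> b = b' \<and> c = c' \<and> d = d'" by (metis mat2_index(1-4))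
qed auto

lemma one_mat2: "1\<^sub>m 2 = mat2 1 0 0 1"
  by (rule mat_2_eqI) auto

lemma rot_carrier [simp]: "rot a \<in> carrier_mat 2 2" by (simp add: rot_def)
lemma ref_carrier [simp]: "ref a \<in> carrier_mat 2 2" by (simp add: ref_def)
lemma rot_rot [simp]: "rot a * rot b = rot (a * b)" by (simp add: rot_def mat2_mult)
lemma rot_ref [simp]: "rot a * ref b = ref (a * b)" by (simp add: rot_def ref_def mat2_mult)
lemma ref_rot [simp]: "ref a * rot b = ref (a / b)"
  by (simp add: rot_def ref_def mat2_mult divide_inverse)
lemma ref_ref [simp]: "ref a * ref b = rot (a / b)"
  by (simp add: rot_def ref_def mat2_mult divide_inverse)
lemma rot_1 [simp]: "rot 1 = 1\<^sub>m 2" by (simp add: rot_def one_mat2)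
lemma rot_eq_iff [simp]: "rot a = rot b \<longleftrightarrow> a = b" by (auto simp: rot_def mat2_eq_iff)
lemma ref_eq_iff [simp]: "ref a = ref b \<longleftrightarrow> a = b" by (auto simp: ref_def mat2_eq_iff)
lemma rot_eq_1_iff [simp]: "rot a = 1\<^sub>m 2 \<longleftrightarrow> a = 1" using rot_eq_iff[of a 1] by simp
text \<open>With \<open>inverse 0 = 0\<close>, both \<open>rot 0\<close> and \<open>ref 0\<close>
  are the zero matrix; this is why parameters are kept nonzero throughout.\<close>

lemma rot_neq_ref: "a \<noteq> 0 \<Longrightarrow> rot a \<noteq> ref b" by (auto simp: rot_def ref_def mat2_eq_iff)
lemma ref_neq_rot: "b \<noteq> 0 \<Longrightarrow> ref b \<noteq> rot a" by (auto simp: rot_def ref_def mat2_eq_iff)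
lemma ref_neq_1 [simp]: "ref b \<noteq> 1\<^sub>m 2" by (auto simp: ref_def one_mat2 mat2_eq_iff)

lemma carrier_GL: "carrier (GL n) = {A \<in> carrier_mat n n. \<exists>B\<in>carrier_mat n n. B * A = 1\<^sub>m n \<and> A * B = 1\<^sub>m n}"
  by (auto simp: GL_def units_of_def Units_def ring_mat_simps)
lemma mult_GL [simp]: "x \<otimes>\<^bsub>GL n\<^esub> y = x * y"
  by (simp add: GL_def units_of_def ring_mat_simps)
lemma one_GL [simp]: "\<one>\<^bsub>GL n\<^esub> = 1\<^sub>m n"
  by (simp add: GL_def units_of_def ring_mat_simps)

lemma group_GL: "group (GL n)"
proof -
  interpret ring "ring_mat TYPE(complex) n ()" by (rule ring_mat)
  show ?thesis unfolding GL_def by (rule units_group)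
qed

interpretation GL: group "GL n" for n by (rule group_GL)

lemma rot_in_GL [simp]: "a \<noteq> 0 \<Longrightarrow> rot a \<in> carrier (GL 2)"
  unfolding carrier_GL by (auto intro!: bexI[of _ "rot (inverse a)"])
lemma ref_in_GL [simp]: "a \<noteq> 0 \<Longrightarrow> ref a \<in> carrier (GL 2)"
  unfolding carrier_GL by (auto intro!: bexI[of _ "ref a"])
lemma inv_rot [simp]: "a \<noteq> 0 \<Longrightarrow> inv\<^bsub>GL 2\<^esub> (rot a) = rot (inverse a)"
  by (rule GL.inv_equality) auto
lemma inv_ref [simp]: "a \<noteq> 0 \<Longrightarrow> inv\<^bsub>GL 2\<^esub> (ref a) = ref a"
  by (rule GL.inv_equality) auto

lemma rot_pow [simp]: "rot a [^]\<^bsub>GL 2\<^esub> (k::nat) = rot (a ^ k)"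
  by (induction k) (auto simp: mult.commute)

lemma rot_apply: "v \<in> carrier_vec 2 \<Longrightarrow> (rot a *\<^sub>v v) $ 0 = a * v $ 0"
   "v \<in> carrier_vec 2 \<Longrightarrow> (rot a *\<^sub>v v) $ Suc 0 = inverse a * v $ 1"
  by (auto simp: index_mult_vec_2 rot_def simp del: index_mult_mat_vec)
lemma ref_apply: "v \<in> carrier_vec 2 \<Longrightarrow> (ref a *\<^sub>v v) $ 0 = a * v $ 1"
   "v \<in> carrier_vec 2 \<Longrightarrow> (ref a *\<^sub>v v) $ Suc 0 = inverse a * v $ 0"
  by (auto simp: index_mult_vec_2 ref_def simp del: index_mult_mat_vec)

lemma reflection_ref [simp]: assumes "a \<noteq> 0" shows "reflection (ref a)"
proof -
  let ?v = "vec2 a 1"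
  have v: "?v \<in> carrier_vec 2" by simp
  have "ref a *\<^sub>v ?v = ?v"
    using v assms ref_apply[OF v, of a]
    by (intro vec_2_eqI) (auto intro: mult_vec_carrier_2 simp del: index_mult_mat_vec)
  moreover have "?v \<noteq> 0\<^sub>v 2" by (auto dest: arg_cong[where f="\<lambda>v. v $ 1"])
  moreover have "ref a ^\<^sub>m 2 = 1\<^sub>m 2" using assms by (simp add: numeral_2_eq_2)
  ultimately show ?thesis unfolding reflection_def using v assms
    by (auto intro: exI[of _ 2])
qed

lemma not_reflection_rot [simp]: assumes "a \<noteq> 0" shows "\<not> reflection (rot a)"
proof
  assume A: "reflection (rot a)"
  then obtain v where v: "v \<in> carrier_vec 2" "v \<noteq> 0\<^sub>v 2" "rot a *\<^sub>v v = v"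
    by (auto simp: reflection_def)
  have "a * v $ 0 = v $ 0" "inverse a * v $ 1 = v $ 1" using rot_apply[OF v(1), of a] v(3) by auto
  moreover have "v $ 0 \<noteq> 0 \<or> v $ 1 \<noteq> 0" using v(1,2) vec_2_eqI[of v "0\<^sub>v 2"] by auto
  ultimately have "a = 1" by auto
  thus False using A by (simp add: reflection_def)
qed

text \<open>The parameter a0 selects the coset of m-th roots of unity that parametrizes the
  reflections. Inside G(e,e,2) the choices 1 and \<zeta> give G(d,d,2) and G'(d,d,2).\<close>

definition Dih :: "nat \<Rightarrow> complex \<Rightarrow> complex mat set" where
  "Dih m a0 = {rot a | a. a ^ m = 1} \<union> {ref (a0 * a) | a. a ^ m = 1}"

lemma Dih_rot_iff: "m > 0 \<Longrightarrow> a0 \<noteq> 0 \<Longrightarrow> rot a \<in> Dih m a0 \<longleftrightarrow> a ^ m = 1"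
  by (auto simp: Dih_def ref_neq_rot[symmetric] power_0_left)
     (metis mult_eq_0_iff power_0_left rot_def ref_def mat2_eq_iff zero_neq_one)

lemma Dih_ref_iff: "m > 0 \<Longrightarrow> a0 \<noteq> 0 \<Longrightarrow> ref a \<in> Dih m a0 \<longleftrightarrow> (a / a0) ^ m = 1"
proof
  assume "m > 0" "a0 \<noteq> 0" "ref a \<in> Dih m a0"
  thus "(a / a0) ^ m = 1" unfolding Dih_def
    by (auto simp: power_0_left) (metis rot_neq_ref power_0_left zero_neq_one less_irrefl)
next
  assume "m > 0" "a0 \<noteq> 0" "(a / a0) ^ m = 1"
  hence "ref (a0 * (a / a0)) \<in> Dih m a0" unfolding Dih_def by blast
  thus "ref a \<in> Dih m a0" using \<open>a0 \<noteq> 0\<close> by simp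
qed

lemma DihE:
  assumes "g \<in> Dih m a0" "m > 0"
  obtains a where "a \<noteq> 0" "a ^ m = 1" "g = rot a" | a where "a \<noteq> 0" "a ^ m = 1" "g = ref (a0 * a)"
  using assms unfolding Dih_def by (auto simp: power_0_left) (metis power_0_left less_irrefl zero_neq_one)+

lemma Dih_subgroup: assumes m: "m > 0" and a0: "a0 \<noteq> 0" shows "subgroup (Dih m a0) (GL 2)"
proof
  show "Dih m a0 \<subseteq> carrier (GL 2)" using assms by (auto elim!: DihE)
  show "\<one>\<^bsub>GL 2\<^esub> \<in> Dih m a0" by (auto simp: Dih_def intro!: exI[of _ 1])
  fix x y assume "x \<in> Dih m a0" "y \<in> Dih m a0"
  thus "x \<otimes>\<^bsub>GL 2\<^esub> y \<in> Dih m a0" using assms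
    by (auto elim!: DihE simp: Dih_rot_iff Dih_ref_iff power_mult_distrib power_divide)
next
  fix x assume "x \<in> Dih m a0"
  thus "inv\<^bsub>GL 2\<^esub> x \<in> Dih m a0" using assms
    by (auto elim!: DihE simp: Dih_rot_iff Dih_ref_iff power_mult_distrib power_divide power_inverse)
qed

lemma finite_Dih: "m > 0 \<Longrightarrow> finite (Dih m a0)"
proof -
  assume m: "m > 0"
  have "finite {a :: complex. a ^ m = 1}" using finite_roots_unity[of m] m by simp
  moreover have "Dih m a0 = rot ` {a. a ^ m = 1} \<union> (\<lambda>a. ref (a0 * a)) ` {a. a ^ m = 1}"
    by (auto simp: Dih_def)
  ultimately show ?thesis by simp
qed

text \<open>Every rotation is a product of two reflections, so only reflections have to be
  reached.\<close>

lemma generate_Dih: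
  assumes m: "m > 0" and a0: "a0 \<noteq> 0" and S: "S \<subseteq> Dih m a0"
    and ref: "\<And>a. a ^ m = 1 \<Longrightarrow> ref (a0 * a) \<in> generate (GL 2) S"
  shows "generate (GL 2) S = Dih m a0"
proof
  show "generate (GL 2) S \<subseteq> Dih m a0"
    using GL.generate_subgroup_incl[OF S Dih_subgroup[OF m a0]] .
  show "Dih m a0 \<subseteq> generate (GL 2) S"
  proof
    fix g assume "g \<in> Dih m a0"
    thus "g \<in> generate (GL 2) S"
    proof (rule DihE[OF _ m])
      fix a assume a: "a ^ m = 1" "g = rot a"
      have "ref (a0 * a) \<otimes>\<^bsub>GL 2\<^esub> ref (a0 * 1) \<in> generate (GL 2) S"
        by (rule generate.eng[OF ref ref]) (use a in auto)
      thus ?thesis using a a0 by simp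
    qed (use ref in auto)
  qed
qed

lemma generate_refs:
  assumes "m > 0" "a0 \<noteq> 0"
  shows "generate (GL 2) {ref (a0 * a) | a. a ^ m = 1} = Dih m a0"
  by (rule generate_Dih[OF assms]) (auto simp: Dih_def intro!: generate.incl)

text \<open>The product of the two generators is \<open>rot w\<close>; multiplying by it repeatedly
  moves \<open>ref a0\<close> through all reflections.\<close>

lemma generate_two:
  assumes m: "m > 0" and a0: "a0 \<noteq> 0" and w: "w ^ m = 1" and roots: "\<And>a. a ^ m = 1 \<Longrightarrow> \<exists>k. a = w ^ k"
  shows "generate (GL 2) {ref a0, ref (a0 * w)} = Dih m a0"
proof (rule generate_Dih[OF m a0])
  show "{ref a0, ref (a0 * w)} \<subseteq> Dih m a0" using assms by (auto simp: Dih_ref_iff)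
  have wnz: "w \<noteq> 0" using w m by (auto simp: power_0_left)
  let ?S = "generate (GL 2) {ref a0, ref (a0 * w)}"
  have r0: "ref a0 \<in> ?S" "ref (a0 * w) \<in> ?S" by (auto intro: generate.incl)
  have "ref (a0 * w) \<otimes>\<^bsub>GL 2\<^esub> ref a0 \<in> ?S" by (rule generate.eng[OF r0(2,1)])
  hence rw: "rot w \<in> ?S" using a0 by simp
  have "ref (a0 * w ^ k) \<in> ?S" for k
  proof (induction k)
    case (Suc k)
    have "rot w \<otimes>\<^bsub>GL 2\<^esub> ref (a0 * w ^ k) \<in> ?S" by (rule generate.eng[OF rw Suc])
    thus ?case by (simp add: ac_simps)
  qed (use r0 in auto)
  thus "ref (a0 * a) \<in> ?S" if "a ^ m = 1" for a using roots[OF that] by auto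
qed

lemma reflections_Dih:
  "m > 0 \<Longrightarrow> a0 \<noteq> 0 \<Longrightarrow> {s \<in> Dih m a0. reflection s} = {ref (a0 * a) | a. a ^ m = 1}"
  by (auto elim!: DihE simp: Dih_ref_iff power_0_left)
     (metis mult_eq_0_iff power_0_left reflection_ref less_irrefl zero_neq_one)

lemma refl_part_Dih: "m > 0 \<Longrightarrow> a0 \<noteq> 0 \<Longrightarrow> refl_part (Dih m a0) = Dih m a0"
  unfolding refl_part_def by (simp add: reflections_Dih generate_refs)

lemma reflection_group_Dih: "m > 0 \<Longrightarrow> a0 \<noteq> 0 \<Longrightarrow> reflection_group (Dih m a0)"
  by (simp add: reflection_group_def refl_part_Dih finite_Dih)

lemma generate_empty_GL: "generate (GL n) {} = {1\<^sub>m n}"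
  using GL.generate_empty[of n] by simp

lemma reflection_group_trivial: "reflection_group {1\<^sub>m 2}"
proof -
  have "{s \<in> {1\<^sub>m 2}. reflection s} = {}" by (auto simp: reflection_def)
  hence "refl_part {1\<^sub>m 2} = {1\<^sub>m 2}" unfolding refl_part_def by (simp only: generate_empty_GL)
  thus ?thesis by (simp add: reflection_group_def)
qed

text \<open>Counting rotations recovers m, and the reflections recover a0 up to an m-th root of
  unity. This tells which subgroup a stabilizer is, not merely its isomorphism type.\<close>

lemma Dih_eq_iff:
  assumes "m > 0" "a0 \<noteq> 0" "m' > 0" "a0' \<noteq> 0"
  shows "Dih m a0 = Dih m' a0' \<longleftrightarrow> m = m' \<and> (a0 / a0') ^ m = 1"
proof
  assume eq: "Dih m a0 = Dih m' a0'"
  hence "rot a \<in> Dih m a0 \<longleftrightarrow> rot a \<in> Dih m' a0'" for a by simp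
  hence "a ^ m = 1 \<longleftrightarrow> a ^ m' = 1" for a :: complex using assms by (simp add: Dih_rot_iff)
  hence "card {a::complex. a ^ m = 1} = card {a::complex. a ^ m' = 1}" by simp
  hence "m = m'" using card_roots_unity_eq[of m] card_roots_unity_eq[of m'] assms by metis
  moreover have "ref a0 \<in> Dih m a0" using assms by (simp add: Dih_ref_iff)
  hence "(a0 / a0') ^ m' = 1" using assms eq by (simp add: Dih_ref_iff)
  ultimately show "m = m' \<and> (a0 / a0') ^ m = 1" by simp
next
  assume A: "m = m' \<and> (a0 / a0') ^ m = 1"
  have "ref (a0 * a) = ref (a0' * (a0 / a0' * a))" for a using assms by simp
  moreover have "ref (a0' * a) = ref (a0 * (a0' / a0 * a))" for a using assms by simp
  moreover have "(a0 / a0' * a) ^ m = 1" "(a0' / a0 * a) ^ m = 1" if "a ^ m = 1" for a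
    using A that assms by (auto simp: power_mult_distrib power_divide)
  ultimately show "Dih m a0 = Dih m' a0'" using A unfolding Dih_def by blast
qed

lemma Gee2_eq_Dih: "e > 0 \<Longrightarrow> Gee2 e = Dih e 1"
proof -
  assume e: "e > 0"
  have *: "a * b = 1 \<longleftrightarrow> b = inverse a \<and> a \<noteq> 0" for a b :: complex
    by (metis inverse_unique left_inverse mult.commute mult_zero_left zero_neq_one)
  have "a \<noteq> 0" "inverse a ^ e = 1" if "a ^ e = 1" for a :: complex
    using that e by (auto simp: power_0_left power_inverse)
  thus ?thesis unfolding Gee2_def Dih_def rot_def ref_def * by auto
qed

context cyclotomic
begin

lemma roots_dvd:
  assumes d: "d dvd e" and a: "a ^ d = 1"
  shows "\<exists>k. a = (\<zeta> ^ (e div d)) ^ k"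
proof -
  have d0: "d > 0" "e div d * d = e" using d e_pos by auto
  define w where "w = \<zeta> ^ (e div d)"
  have inj: "inj_on (\<lambda>k. w ^ k) {..<d}"
  proof (rule linorder_inj_onI')
    fix i j assume ij: "i \<in> {..<d}" "j \<in> {..<d}" "i < j"
    show "w ^ i \<noteq> w ^ j"
    proof
      assume "w ^ i = w ^ j"
      moreover have "w ^ j = w ^ i * w ^ (j - i)" using ij by (simp flip: power_add)
      moreover have "w ^ i \<noteq> 0" by (simp add: w_def)
      ultimately have "w ^ (j - i) = 1" by (metis mult_cancel_left1)
      hence "e dvd e div d * (j - i)" by (simp add: w_def zeta_pow_eq_1_iff flip: power_mult)
      hence "e div d * d dvd e div d * (j - i)" using d0 by simp
      moreover have "e div d \<noteq> 0" using d0 e_pos by (metis less_irrefl mult_zero_left)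
      ultimately have "d dvd j - i" by simp
      thus False using ij by (auto dest: dvd_imp_le)
    qed
  qed
  have sub: "(\<lambda>k. w ^ k) ` {..<d} \<subseteq> {z. z ^ d = 1}"
  proof -
    have "w ^ d = 1" using d0 by (simp add: w_def flip: power_mult)
    thus ?thesis by (auto simp: power_mult[symmetric] mult.commute[of _ d]) (simp add: power_mult)
  qed
  have "(\<lambda>k. w ^ k) ` {..<d} = {z. z ^ d = 1}"
    using sub by (rule card_subset_eq[rotated])
      (use d0 in \<open>auto simp: card_image[OF inj] card_roots_unity_eq intro!: finite_roots_unity\<close>)
  hence "a \<in> (\<lambda>k. w ^ k) ` {..<d}" using a by simp
  thus ?thesis by (auto simp: w_def)
qed

section \<open>The reflection subgroups that occur in stabilizers of classes\<close>

lemma refl_eq_ref: "refl \<zeta> i = ref (\<zeta> ^ i)"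
  by (simp add: refl_def ref_def power_inverse)

lemma Gdd2_eq: assumes "d dvd e" shows "Gdd2 e \<zeta> d = Dih d 1"
proof -
  have d: "d > 0" "e div d * d = e" using assms e_pos by auto
  have "generate (GL 2) {ref 1, ref (1 * \<zeta> ^ (e div d))} = Dih d 1"
    by (rule generate_two) (use d roots_dvd[OF assms] in \<open>auto simp flip: power_mult\<close>)
  thus ?thesis by (simp add: Gdd2_def refl_eq_ref)
qed

lemma Gdd2'_eq: assumes "d dvd e" shows "Gdd2' e \<zeta> d = Dih d \<zeta>"
proof -
  have d: "d > 0" "e div d * d = e" using assms e_pos by auto
  have "generate (GL 2) {ref \<zeta>, ref (\<zeta> * \<zeta> ^ (e div d))} = Dih d \<zeta>"
    by (rule generate_two) (use d roots_dvd[OF assms] in \<open>auto simp flip: power_mult\<close>)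
  thus ?thesis by (simp add: Gdd2'_def refl_eq_ref)
qed

text \<open>The argument is the first coordinate, which determines a vector of
  \<open>space_V0 \<zeta>\<close>.\<close>

definition stab_refl :: "complex \<Rightarrow> complex mat set" where
  "stab_refl v = generate (GL 2) {ref (\<zeta> ^ i) | i. fixes_class v i}"

lemma Z_in_field: "z \<in> Z \<Longrightarrow> z \<in> cyclotomic_field \<zeta>"
  using Z_quotient_in_field[of z 1] by simp

lemma reflections_stabilizer:
  assumes "x \<in> space_V0 \<zeta>"
  shows "{s \<in> class_stabilizer (lattice_L0 \<zeta>) (Gee2 e) x. reflection s} =
    {ref (\<zeta> ^ i) | i. fixes_class (x $ 0) i}" (is "?L = ?R")
proof -
  have x: "x \<in> carrier_vec 2" "x $ 1 = - cnj (x $ 0)"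
    using assms by (auto simp: space_V0_def space_V_def)
  have stab: "ref (\<zeta> ^ i) *\<^sub>v x - x \<in> lattice_L0 \<zeta> \<longleftrightarrow> fixes_class (x $ 0) i" for i
  proof -
    define y where "y = ref (\<zeta> ^ i) *\<^sub>v x - x"
    have yc: "y \<in> carrier_vec 2" using x mult_vec_carrier_2[of "ref (\<zeta> ^ i)" x] by (simp add: y_def)
    have c0: "ref (\<zeta> ^ i) *\<^sub>v x \<in> carrier_vec 2" by (simp add: mult_vec_carrier_2)
    have y0: "y $ 0 = - (x $ 0 + \<zeta> ^ i * cnj (x $ 0))"
      using x c0 unfolding y_def by (subst index_minus_vec) (auto simp: ref_apply simp del: index_mult_mat_vec)
    \<comment> \<open>The difference stays in \<open>space_V0 \<zeta>\<close>, so its first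
      coordinate alone decides membership in the lattice.\<close>
    have y1: "y $ 1 = - cnj (y $ 0)"
      using x c0 unfolding y0 unfolding y_def
      by (subst index_minus_vec) (auto simp: ref_apply cnj_zeta power_inverse simp del: index_mult_mat_vec)
    have "y \<in> lattice_L0 \<zeta> \<longleftrightarrow> y $ 0 \<in> Z"
      using yc y1 by (auto simp: lattice_L0_def space_V0_def space_V_def Z_in_field)
    also have "\<dots> \<longleftrightarrow> fixes_class (x $ 0) i"
      unfolding y0 fixes_class_def by (metis Z_minus minus_minus)
    finally show ?thesis by (simp add: y_def)
  qed
  have refl: "{s \<in> Gee2 e. reflection s} = {ref (\<zeta> ^ i) | i. True}"
  proof -
    have "{s \<in> Gee2 e. reflection s} = {ref a | a. a ^ e = 1}"
      using reflections_Dih[of e 1] e_pos by (simp add: Gee2_eq_Dih)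
    also have "\<dots> = {ref (\<zeta> ^ i) | i. True}"
    proof -
      have "\<exists>i. a = \<zeta> ^ i" if "a ^ e = 1" for a using roots_dvd[of e a] that e_pos by auto
      moreover have "(\<zeta> ^ i) ^ e = 1" for i by (metis mult.commute power_mult power_one zeta_pow_e)
      ultimately show ?thesis by auto
    qed
    finally show ?thesis .
  qed
  have "?L = {s \<in> {s \<in> Gee2 e. reflection s}. s *\<^sub>v x - x \<in> lattice_L0 \<zeta>}"
    by (auto simp: class_stabilizer_def)
  also have "\<dots> = ?R" unfolding refl using stab by auto
  finally show ?thesis .
qed

lemma refl_part_stabilizer:
  assumes "x \<in> space_V0 \<zeta>"
  shows "refl_part (class_stabilizer (lattice_L0 \<zeta>) (Gee2 e) x) = stab_refl (x $ 0)"
  using reflections_stabilizer[OF assms] by (simp add: refl_part_def stab_refl_def)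

lemma space_V0_obtain:
  assumes "a \<in> Z" "b \<in> Z"
  obtains x where "x \<in> space_V0 \<zeta>" "x $ 0 = a / b"
proof -
  let ?x = "vec2 (a / b) (- cnj (a / b))"
  have "(- cnj a) / cnj b \<in> cyclotomic_field \<zeta>" using assms by (intro Z_quotient_in_field) auto
  hence "?x \<in> space_V0 \<zeta>" using Z_quotient_in_field[OF assms]
    by (auto simp: space_V0_def space_V_def)
  thus thesis using that[of ?x] by simp
qed

lemma stab_refl_eq_Dih:
  assumes coset: "\<And>j. fixes_class v (i0 + j) \<longleftrightarrow> g dvd j" and g: "g dvd e"
  shows "stab_refl v = Dih (e div g) (\<zeta> ^ i0)"
proof -
  have pos: "e div g > 0" "g > 0" "g * (e div g) = e" using g e_pos by auto
  have "{ref (\<zeta> ^ i) | i. fixes_class v i} = {ref (\<zeta> ^ i0 * a) | a. a ^ (e div g) = 1}" (is "?L = ?R")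
  proof
    show "?L \<subseteq> ?R"
    proof
      fix s assume "s \<in> ?L"
      then obtain i where i: "s = ref (\<zeta> ^ i)" "fixes_class v i" by auto
      \<comment> \<open>A natural number congruent to i - i0 modulo e.\<close>
      define j where "j = i + (e - 1) * i0"
      have ij: "i0 + j = i + e * i0" using e_pos by (cases e) (auto simp: j_def)
      have "fixes_class v (i0 + j)" using i(2) unfolding ij by (metis fixes_class_mod mod_mult_self2)
      hence "g dvd j" using coset by simp
      hence "e dvd j * (e div g)" using pos by (metis mult.commute mult_dvd_mono dvd_refl)
      hence "(\<zeta> ^ j) ^ (e div g) = 1" by (simp add: zeta_pow_eq_1_iff flip: power_mult)
      moreover have "\<zeta> ^ i = \<zeta> ^ i0 * \<zeta> ^ j"
        unfolding power_add[symmetric] ij by (simp add: power_add power_mult)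
      ultimately show "s \<in> ?R" using i(1) by auto
    qed
    show "?R \<subseteq> ?L"
    proof
      fix s assume "s \<in> ?R"
      then obtain a where a: "s = ref (\<zeta> ^ i0 * a)" "a ^ (e div g) = 1" by auto
      have "e div (e div g) = g" using g e_pos by (auto elim!: dvdE)
      then obtain k where "a = (\<zeta> ^ g) ^ k" using roots_dvd[of "e div g" a] a(2) g
        by (metis dvd_div_mult_self dvd_triv_left)
      hence "\<zeta> ^ i0 * a = \<zeta> ^ (i0 + g * k)" by (simp add: power_add power_mult)
      moreover have "fixes_class v (i0 + g * k)" using coset by simp
      ultimately show "s \<in> ?L" using a(1) by auto
    qed
  qed
  thus ?thesis unfolding stab_refl_def using generate_refs[of "e div g" "\<zeta> ^ i0"] pos by simp
qed

lemma stab_refl_cases: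
  obtains "stab_refl v = {1\<^sub>m 2}"
  | i0 g where "stab_refl v = Dih (e div g) (\<zeta> ^ i0)" "g dvd e" "g = 1 \<or> g = e \<or> primepow (e div g)"
      "\<And>j. annihilates v j \<longleftrightarrow> g dvd j" "fixes_class v i0"
proof (cases "\<exists>i. fixes_class v i")
  case False
  hence "stab_refl v = {1\<^sub>m 2}" by (simp add: stab_refl_def generate_empty_GL)
  thus ?thesis using that by blast
next
  case True
  then obtain i0 where i0: "fixes_class v i0" by blast
  obtain g where g: "g dvd e" "\<And>j. annihilates v j \<longleftrightarrow> g dvd j" "g = 1 \<or> g = e \<or> primepow (e div g)"
    using annihilators[of v] by blast
  have "stab_refl v = Dih (e div g) (\<zeta> ^ i0)"
    by (rule stab_refl_eq_Dih) (use g fixes_class_add[OF i0] in auto)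
  thus ?thesis using that(2) g i0 by blast
qed

text \<open>Shown equivalent to pseudoparabolicity in \<open>pseudoparabolic_Gee2_iff\<close>; until
  then only the arithmetic of classes is needed.\<close>

definition is_stab_refl :: "complex mat set \<Rightarrow> bool" where
  "is_stab_refl H \<longleftrightarrow> (\<exists>x\<in>space_V0 \<zeta>. H = stab_refl (x $ 0))"

lemma is_stab_reflI:
  assumes "\<And>j. fixes_class (a / b) (i0 + j) \<longleftrightarrow> g dvd j" "g dvd e" "a \<in> Z" "b \<in> Z"
  shows "is_stab_refl (Dih (e div g) (\<zeta> ^ i0))"
proof -
  obtain x where "x \<in> space_V0 \<zeta>" "x $ 0 = a / b" using space_V0_obtain assms(3,4) by blast
  thus ?thesis using stab_refl_eq_Dih[OF assms(1,2)] unfolding is_stab_refl_def by metis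
qed

lemma Dih_neq_trivial: "m > 0 \<Longrightarrow> a0 \<noteq> 0 \<Longrightarrow> Dih m a0 \<noteq> {1\<^sub>m 2}"
  using Dih_ref_iff[of m a0 a0] ref_neq_1[of a0] by auto

lemma is_stab_refl_full: "is_stab_refl (Dih e 1)"
  using is_stab_reflI[of 0 1 0 1] by (simp add: fixes_class_def)

text \<open>For e = 2 one has \<zeta> = -1 and every x is rational, so \<open>refl \<zeta> 1\<close>
  fixes every class and the group generated by \<open>refl \<zeta> 0\<close> never occurs by itself;
  this is the excluded pair. For d = 1 and e > 2 the class with denominator e^2 + 1 is used.\<close>

lemma is_stab_refl_iff:
  assumes d: "d dvd e" and ne: "(e, d) \<noteq> (2, 1)"
  shows "is_stab_refl (Dih d 1) \<longleftrightarrow> d = 1 \<or> d = e \<or> primepow d"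
proof
  assume "is_stab_refl (Dih d 1)"
  then obtain v where v: "Dih d 1 = stab_refl v" by (auto simp: is_stab_refl_def)
  have d0: "d > 0" using d e_pos by (auto intro: gr0I)
  show "d = 1 \<or> d = e \<or> primepow d"
  proof (cases rule: stab_refl_cases[of v])
    case 1 thus ?thesis using v Dih_neq_trivial[OF d0, of 1] by simp
  next
    case (2 i0 g)
    have "e div g > 0" using 2 e_pos by (auto elim!: dvdE)
    hence "d = e div g" using v 2(1) d0 by (auto simp: Dih_eq_iff)
    thus ?thesis using 2 e_pos by auto
  qed
next
  assume A: "d = 1 \<or> d = e \<or> primepow d"
  have d0: "d > 0" using d e_pos by (auto intro: gr0I)
  have dd: "e div (e div d) = d" "e div d dvd e" using d e_pos by (auto elim!: dvdE)
  show "is_stab_refl (Dih d 1)"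
  proof (cases "d = e")
    case True thus ?thesis using is_stab_refl_full by simp
  next
    case False
    hence A: "d = 1 \<or> primepow d" using A by simp
    thus ?thesis
    proof
      assume "d = 1"
      hence "e > 2" using False ne e_pos by auto
      thus ?thesis
        using is_stab_reflI[of "(1 - \<zeta>\<^sup>2) * \<zeta> ^ (e - 1)" "of_nat (e\<^sup>2 + 1)" 0 e]
          fixes_class_small \<open>d = 1\<close> e_pos Z_of_nat[of "e\<^sup>2 + 1"] by auto
    next
      assume "primepow d"
      thus ?thesis using is_stab_reflI[of 1 "1 - \<zeta> ^ (e div d)" 0 "e div d"]
          fixes_class_prime_power[OF d] dd by auto
    qed
  qed
qed

text \<open>What differs from the unprimed case is 2 * d = e with d > 1: a stabilizer whose
  reflections are the odd exponents contains 1 and is annihilated by 2, and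
  \<open>fixes_class_half\<close> then makes it the whole group.\<close>

lemma is_stab_refl_iff':
  assumes d: "d dvd e" and ev: "even (e div d)"
  shows "is_stab_refl (Dih d \<zeta>) \<longleftrightarrow> d = 1 \<or> (2 * d < e \<and> primepow d)"
proof
  assume "is_stab_refl (Dih d \<zeta>)"
  then obtain v where v: "Dih d \<zeta> = stab_refl v" by (auto simp: is_stab_refl_def)
  have d0: "d > 0" using d e_pos by (auto intro: gr0I)
  obtain h where h: "e = 2 * d * h" using d ev d0 by (auto elim!: dvdE evenE)
  have hpos: "h > 0" using h e_pos by auto
  show "d = 1 \<or> (2 * d < e \<and> primepow d)"
  proof (cases rule: stab_refl_cases[of v])
    case 1 thus ?thesis using v Dih_neq_trivial[OF d0, of \<zeta>] by simp
  next
    case (2 i0 g)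
    have "e div g > 0" using 2 e_pos by (auto elim!: dvdE)
    hence eq: "d = e div g" "(\<zeta> / \<zeta> ^ i0) ^ d = 1" using v 2(1) d0 by (auto simp: Dih_eq_iff)
    have "g = 2 * h" using h 2(2) eq(1) d0 by (metis dvd_div_mult_self mult.assoc mult.commute mult_cancel1 less_irrefl)
    hence A: "g = e \<or> primepow d" using 2(3) eq by auto
    show ?thesis
    proof (cases "g = e")
      case True thus ?thesis using eq e_pos by simp
    next
      case False
      hence pp: "primepow d" using A by simp
      have "h \<noteq> 1"
      proof
        assume h1: "h = 1"
        hence g2: "g = 2" using \<open>g = 2 * h\<close> by simp
        have e2: "e > 2" using h h1 primepow_gt_Suc_0[OF pp] by simp
        have "\<zeta> ^ d = \<zeta> ^ (i0 * d)" using eq(2) by (simp add: power_divide power_mult)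
        \<comment> \<open>An even i0 would give \<zeta>^d = \<zeta>^(i0*d) = 1, contrary to 0 < d <
          e.\<close>
        have "odd i0"
        proof
          assume "even i0"
          hence "e dvd i0 * d" using h h1 by auto
          hence "\<zeta> ^ d = 1" using \<open>\<zeta> ^ d = \<zeta> ^ (i0 * d)\<close> by (simp add: zeta_pow_eq_1_iff)
          thus False using zeta_pow_neq_1[of d] h h1 d0 by simp
        qed
        have "fixes_class v (i0 + (i0 + 1))"
          using fixes_class_add[OF 2(5), of "i0 + 1"] 2(4) g2 \<open>odd i0\<close> by simp
        \<comment> \<open>An even shift, written without negative numbers, that moves i0 to an
          exponent congruent to 1 modulo e.\<close>
        have "fixes_class v (i0 + (e + 1 - i0 mod e))"
        proof -
          have "i0 mod e \<le> e" using e_pos by (simp add: less_imp_le)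
          moreover have "odd (i0 mod e)" using \<open>odd i0\<close> h
            by (metis dvd_mod_iff dvd_mult_left dvd_triv_left mult.assoc)
          ultimately have "even (e + 1 - i0 mod e)" using h by simp
          thus ?thesis using fixes_class_add[OF 2(5)] 2(4) g2 by simp
        qed
        moreover have "(i0 + (e + 1 - i0 mod e)) mod e = 1 mod e"
        proof -
          have "i0 mod e \<le> e + 1" using e_pos by (simp add: less_imp_le le_SucI)
          hence "i0 + (e + 1 - i0 mod e) = e * (i0 div e) + (e + 1)"
            using mult_div_mod_eq[of e i0] by linarith
          thus ?thesis by (metis mod_add_self1 mod_mult_self4)
        qed
        ultimately have "fixes_class v 1" by (metis fixes_class_mod)
        moreover have "annihilates v 2" using 2(4) g2 by simp
        ultimately have "annihilates v 1" using fixes_class_half e2 by blast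
        thus False using 2(4) g2 by simp
      qed
      thus ?thesis using pp h hpos d0 by simp
    qed
  qed
next
  assume A: "d = 1 \<or> (2 * d < e \<and> primepow d)"
  have d0: "d > 0" using d e_pos by (auto intro: gr0I)
  have dd: "e div (e div d) = d" "e div d dvd e" using d e_pos by (auto elim!: dvdE)
  obtain h where h: "e = 2 * d * h" using d ev d0 by (auto elim!: dvdE evenE)
  show "is_stab_refl (Dih d \<zeta>)"
  proof (cases "d = 1")
    case True
    have "e > 1" using h e_pos by (cases h) auto
    thus ?thesis
      using is_stab_reflI[of "1 - \<zeta>" "of_nat (e\<^sup>2 + 1)" 1 e]
        fixes_class_small' True e_pos Z_of_nat[of "e\<^sup>2 + 1"] by auto
  next
    case False
    hence "primepow d" "h > 1" using A h by auto
    thus ?thesis using is_stab_reflI[of "1 + \<zeta>" "1 - \<zeta> ^ (e div d)" 1 "e div d"]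
        fixes_class_prime_power'[OF h] dd by auto
  qed
qed

end

section \<open>Irreducible representations of dihedral groups\<close>

lemma mult_zero_vec: "A \<in> carrier_mat n k \<Longrightarrow> A *\<^sub>v 0\<^sub>v k = 0\<^sub>v n"
  by (intro eq_vecI) (auto simp: scalar_prod_def)

lemma subspaceI:
  assumes "U \<subseteq> carrier_vec n" "0\<^sub>v n \<in> U"
    "\<And>u v. u \<in> U \<Longrightarrow> v \<in> U \<Longrightarrow> u + v \<in> U" "\<And>c u. u \<in> U \<Longrightarrow> c \<cdot>\<^sub>v u \<in> U"
  shows "VectorSpace.subspace class_ring U (module_vec TYPE(complex) n)"
proof -
  interpret vs: vec_space "TYPE(complex)" n .
  show ?thesis
    unfolding VectorSpace.subspace_def submodule_def
    using assms vec_vs[of n, where 'a=complex] vs.module_axioms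
    by (auto simp: module_vec_simps class_ring_simps)
qed

text \<open>Combinations of two elements of S are enough here, because the representations concerned
  have degree at most 2.\<close>

lemma span_eqI:
  assumes U: "U \<subseteq> carrier_vec n" "0\<^sub>v n \<in> U"
    "\<And>u v. u \<in> U \<Longrightarrow> v \<in> U \<Longrightarrow> u + v \<in> U" "\<And>c u. u \<in> U \<Longrightarrow> c \<cdot>\<^sub>v u \<in> U"
    and S: "S \<subseteq> U"
    and gen: "\<And>u. u \<in> U \<Longrightarrow> \<exists>a b s t. s \<in> S \<and> t \<in> S \<and> u = a \<cdot>\<^sub>v s + b \<cdot>\<^sub>v t"
  shows "LinearCombinations.module.span class_ring (module_vec TYPE(complex) n) S = U"
proof -
  interpret vs: vec_space "TYPE(complex)" n .
  have sub: "submodule class_ring U vs.V"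
    using subspaceI[OF U] by (simp add: VectorSpace.subspace_def)
  have Sc: "S \<subseteq> carrier_vec n" using S U(1) by auto
  have "vs.span S \<subseteq> U" by (rule vs.span_is_subset[OF S sub])
  moreover have "U \<subseteq> vs.span S"
  proof
    fix u assume "u \<in> U"
    then obtain a b s t where st: "s \<in> S" "t \<in> S" "u = a \<cdot>\<^sub>v s + b \<cdot>\<^sub>v t" using gen by blast
    have "s \<in> vs.span S" "t \<in> vs.span S" using st vs.in_own_span[OF Sc] by auto
    hence "a \<cdot>\<^sub>v s \<in> vs.span S" "b \<cdot>\<^sub>v t \<in> vs.span S" using Sc by (auto intro: vs.smult_in_span)
    thus "u \<in> vs.span S" unfolding st(3) using vs.span_add1[OF Sc] by blast
  qed
  ultimately show ?thesis by blast
qed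

text \<open>Otherwise a 3 by 3 identity block would be a sum of two matrices of rank at most one,
  whose determinant vanishes.\<close>

lemma carrier_vec_le_2:
  assumes "v \<in> carrier_vec n" "w \<in> carrier_vec n"
    "\<And>u. u \<in> carrier_vec n \<Longrightarrow> \<exists>x y. u = x \<cdot>\<^sub>v v + y \<cdot>\<^sub>v (w :: complex vec)"
  shows "n \<le> 2"
proof (rule ccontr)
  assume n: "\<not> n \<le> 2"
  have "\<forall>i. \<exists>x y. unit_vec n i = x \<cdot>\<^sub>v v + y \<cdot>\<^sub>v w" using assms(3)[OF unit_vec_carrier] by blast
  then obtain x y where xy: "\<And>i. unit_vec n i = x i \<cdot>\<^sub>v v + y i \<cdot>\<^sub>v w" by metis
  have e: "(if j = i then 1 else 0) = x i * v $ j + y i * w $ j" if "j < n" "i < n" for i j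
    using arg_cong[OF xy[of i], of "\<lambda>v. v $ j"] that assms(1,2) by simp
  have l: "0 < n" "1 < n" "2 < n" using n by auto
  define M where "M i j = x i * v $ j + y i * w $ j" for i j
  have "M 0 0 * (M 1 1 * M 2 2 - M 1 2 * M 2 1) - M 0 1 * (M 1 0 * M 2 2 - M 1 2 * M 2 0)
      + M 0 2 * (M 1 0 * M 2 1 - M 1 1 * M 2 0) = 0"
    unfolding M_def by (simp add: algebra_simps)
  moreover have "M 0 0 = 1" "M 1 1 = 1" "M 2 2 = 1" "M 1 2 = 0" "M 2 1 = 0" "M 0 1 = 0" "M 0 2 = 0"
    unfolding M_def using e[of 0 0] e[of 1 1] e[of 2 2] e[of 2 1] e[of 1 2] e[of 1 0] e[of 2 0] l by auto
  ultimately show False by simp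
qed

locale dihedral =
  fixes m :: nat and a0 :: complex
  assumes m: "m > 0" and a0 [simp]: "a0 \<noteq> 0"
begin

abbreviation D :: "complex mat set" where "D \<equiv> Dih m a0"

text \<open>A primitive m-th root of unity, chosen independently of \<zeta> so that the locale
  applies to the whole group and to its subgroups.\<close>

definition w :: complex where "w = cis (2 * pi / m)"

lemma roots: assumes "a ^ m = 1" shows "\<exists>k<m. a = w ^ k"
proof -
  have "bij_betw (\<lambda>k. cis (2 * pi * real k / real m)) {..<m} {z. z ^ m = 1}"
    using m by (rule bij_betw_roots_unity)
  hence "a \<in> (\<lambda>k. cis (2 * pi * real k / real m)) ` {..<m}"
    using assms by (auto simp: bij_betw_def)
  thus ?thesis by (auto simp: w_def DeMoivre mult_ac)
qed

lemma w_pow_m [simp]: "w ^ m = 1"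
  using m by (simp add: w_def DeMoivre)
lemma w_nonzero [simp]: "w \<noteq> 0" by (simp add: w_def)

lemma w_pow_eq_1_iff: "w ^ k = 1 \<longleftrightarrow> m dvd k"
proof
  assume k: "w ^ k = 1"
  have bij: "bij_betw (\<lambda>k. cis (2 * pi * real k / real m)) {..<m} {z. z ^ m = 1}"
    using m by (rule bij_betw_roots_unity)
  hence inj: "inj_on (\<lambda>k. w ^ k) {..<m}"
    by (auto simp: bij_betw_def w_def DeMoivre mult_ac)
  have "w ^ k = w ^ (m * (k div m) + k mod m)" by simp
  also have "\<dots> = w ^ (k mod m)" unfolding power_add power_mult by simp
  finally have "w ^ (k mod m) = w ^ 0" using k by simp
  hence "k mod m = 0" using inj_onD[OF inj, of "k mod m" 0] m by auto
  thus "m dvd k" by auto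
qed (auto simp: power_mult)

lemma w_pow_eq: assumes "w ^ i = w ^ j" shows "int m dvd int i - int j"
proof -
  have *: "int m dvd int i - int j" if "w ^ i = w ^ j" "j \<le> i" for i j
  proof -
    have "w ^ i = w ^ j * w ^ (i - j)" using that by (simp flip: power_add)
    hence "w ^ (i - j) = 1" using that by simp
    hence "int m dvd int (i - j)" by (simp add: w_pow_eq_1_iff)
    thus ?thesis using that by (simp add: of_nat_diff)
  qed
  show ?thesis using *[of i j] *[of j i] assms by (cases "j \<le> i") (auto simp: dvd_diff_commute)
qed

lemma root_nonzero: "a ^ m = 1 \<Longrightarrow> a \<noteq> 0" for a :: complex
  using m by (auto simp: power_0_left)

lemma rot_in: "a ^ m = 1 \<Longrightarrow> rot a \<in> D" using m by (simp add: Dih_rot_iff)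
lemma ref_in: "a ^ m = 1 \<Longrightarrow> ref (a0 * a) \<in> D" using m by (simp add: Dih_ref_iff)
lemma one_in: "1\<^sub>m 2 \<in> D" using rot_in[of 1] by simp

lemma D_cases:
  assumes "g \<in> D"
  obtains a where "a ^ m = 1" "g = rot a" | a where "a ^ m = 1" "g = ref (a0 * a)"
  using assms by (auto simp: Dih_def)

lemma ball_D: "(\<forall>g\<in>D. Q g) \<longleftrightarrow> (\<forall>a. a ^ m = 1 \<longrightarrow> Q (rot a) \<and> Q (ref (a0 * a)))"
  using rot_in ref_in by (auto elim: D_cases)

lemma group_D: "group ((GL 2)\<lparr>carrier := D\<rparr>)"
  using subgroup.subgroup_is_group[OF Dih_subgroup[OF m a0] group_GL] .

lemma rep_carrier: "rep D E \<Longrightarrow> g \<in> D \<Longrightarrow> E g \<in> carrier_mat (deg E) (deg E)"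
  by (auto simp: rep_def hom_def carrier_GL Pi_def)

lemma rep_mult: "rep D E \<Longrightarrow> g \<in> D \<Longrightarrow> h \<in> D \<Longrightarrow> E (g * h) = E g * E h"
  by (auto simp: rep_def hom_def)

lemma rep_one: "rep D E \<Longrightarrow> E (1\<^sub>m 2) = 1\<^sub>m (deg E)"
  using hom_one[OF _ group_D group_GL, of E "deg E"] by (simp add: rep_def)

lemma irr_invariant:
  assumes E: "irr D E" and U: "U \<subseteq> carrier_vec (deg E)" "0\<^sub>v (deg E) \<in> U"
    "\<And>u v. u \<in> U \<Longrightarrow> v \<in> U \<Longrightarrow> u + v \<in> U" "\<And>c u. u \<in> U \<Longrightarrow> c \<cdot>\<^sub>v u \<in> U"
    and inv: "\<And>g u. g \<in> D \<Longrightarrow> u \<in> U \<Longrightarrow> E g *\<^sub>v u \<in> U"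
    and v: "v \<in> U" "v \<noteq> 0\<^sub>v (deg E)"
  shows "U = carrier_vec (deg E)"
  using E subspaceI[OF U] inv v unfolding irr_def by blast

text \<open>For h = 0 these are the trivial and the sign representation; for 2 * h = m they are the
  two further characters of even m. The number \<epsilon> is the value at
  \<open>ref a0\<close>.\<close>

definition one_form :: "(complex mat \<Rightarrow> complex mat) \<Rightarrow> nat \<Rightarrow> complex \<Rightarrow> bool" where
  "one_form E h \<epsilon> \<longleftrightarrow> deg E = 1 \<and> (\<epsilon> = 1 \<or> \<epsilon> = -1) \<and> (h = 0 \<or> 2 * h = m) \<and>
     (\<forall>a. a ^ m = 1 \<longrightarrow> E (rot a) = mat 1 1 (\<lambda>_. a ^ h) \<and> E (ref (a0 * a)) = mat 1 1 (\<lambda>_. \<epsilon> * a ^ h))"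

text \<open>P changes to a basis in which the rotations are diagonal with eigenvalues a^k and
  a^(-k), exchanged by the reflections. The range of k omits the reducible cases k = 0 and 2 * k = m
  and the repetitions k -> m - k.\<close>

definition two_form :: "(complex mat \<Rightarrow> complex mat) \<Rightarrow> nat \<Rightarrow> complex mat \<Rightarrow> complex mat \<Rightarrow> bool" where
  "two_form E k P Q \<longleftrightarrow> deg E = 2 \<and> 0 < k \<and> 2 * k < m \<and> P \<in> carrier_mat 2 2 \<and> Q \<in> carrier_mat 2 2 \<and>
     P * Q = 1\<^sub>m 2 \<and> Q * P = 1\<^sub>m 2 \<and>
     (\<forall>a. a ^ m = 1 \<longrightarrow> E (rot a) = P * rot (a ^ k) * Q \<and> E (ref (a0 * a)) = P * ref (a ^ k) * Q)"

lemma mat_1_eqI: "A \<in> carrier_mat 1 1 \<Longrightarrow> A $$ (0,0) = c \<Longrightarrow> A = mat 1 1 (\<lambda>_. c)"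
  by (rule eq_matI) auto

text \<open>The span of v and u is invariant, hence everything; in the basis v, u the representation
  is the monomial one, and P has v and u as columns.\<close>

lemma invariant_lines:
  assumes E: "irr D E" and v: "v \<in> carrier_vec (deg E)" "v \<noteq> 0\<^sub>v (deg E)"
    and u: "u \<in> carrier_vec (deg E)"
    and rotv: "\<And>a. a ^ m = 1 \<Longrightarrow> E (rot a) *\<^sub>v v = a ^ k \<cdot>\<^sub>v v"
    and rotu: "\<And>a. a ^ m = 1 \<Longrightarrow> E (rot a) *\<^sub>v u = inverse (a ^ k) \<cdot>\<^sub>v u"
    and ref: "E (ref a0) *\<^sub>v v = u" "E (ref a0) *\<^sub>v u = v"
    and deg: "deg E = 2" and k: "2 * k < m"
  shows "\<exists>P Q. two_form E k P Q"
proof -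
  have rep: "rep D E" using E by (simp add: irr_def)
  have refa: "E (ref (a0 * a)) = E (rot a) * E (ref a0)" if "a ^ m = 1" for a
    using rep_mult[OF rep rot_in[OF that] ref_in[of 1]] by (simp add: mult.commute)
  have refv: "E (ref (a0 * a)) *\<^sub>v v = inverse (a ^ k) \<cdot>\<^sub>v u"
    and refu: "E (ref (a0 * a)) *\<^sub>v u = a ^ k \<cdot>\<^sub>v v" if "a ^ m = 1" for a
    using rep_carrier[OF rep rot_in[OF that]] rep_carrier[OF rep ref_in[of 1]] v u ref rotv rotu that
    by (simp_all add: refa)
  have lin: "A *\<^sub>v (x \<cdot>\<^sub>v v + y \<cdot>\<^sub>v u) = x \<cdot>\<^sub>v (A *\<^sub>v v) + y \<cdot>\<^sub>v (A *\<^sub>v u)"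
    if "A \<in> carrier_mat (deg E) (deg E)" for A x y
    using that v u by (simp add: mult_add_distrib_mat_vec[of _ "deg E" "deg E"] mult_mat_vec[of _ "deg E" "deg E"])
  define U where "U = {x \<cdot>\<^sub>v v + y \<cdot>\<^sub>v u | x y. True}"
  have U_I: "x \<cdot>\<^sub>v v + y \<cdot>\<^sub>v u \<in> U" for x y by (auto simp: U_def)
  have Ucarr: "U = carrier_vec (deg E)"
  proof (rule irr_invariant[OF E])
    show "U \<subseteq> carrier_vec (deg E)" using v u by (auto simp: U_def)
    have "0\<^sub>v (deg E) = 0 \<cdot>\<^sub>v v + 0 \<cdot>\<^sub>v u" using v u by (intro eq_vecI) auto
    thus "0\<^sub>v (deg E) \<in> U" using U_I by metis
    have "v = 1 \<cdot>\<^sub>v v + 0 \<cdot>\<^sub>v u" using v u by (intro eq_vecI) auto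
    thus "v \<in> U" using U_I by metis
    fix x y c assume "x \<in> U"
    then obtain p q where x: "x = p \<cdot>\<^sub>v v + q \<cdot>\<^sub>v u" by (auto simp: U_def)
    have "c \<cdot>\<^sub>v x = (c * p) \<cdot>\<^sub>v v + (c * q) \<cdot>\<^sub>v u" unfolding x using v u
      by (intro eq_vecI) (auto simp: algebra_simps)
    thus "c \<cdot>\<^sub>v x \<in> U" using U_I by metis
    {
      assume "y \<in> U"
      then obtain p' q' where y: "y = p' \<cdot>\<^sub>v v + q' \<cdot>\<^sub>v u" by (auto simp: U_def)
      have "x + y = (p + p') \<cdot>\<^sub>v v + (q + q') \<cdot>\<^sub>v u" unfolding x y using v u
        by (intro eq_vecI) (auto simp: algebra_simps)
      thus "x + y \<in> U" using U_I by metis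
    }
    fix g assume g: "g \<in> D"
    show "E g *\<^sub>v x \<in> U"
    proof (rule D_cases[OF g])
      fix a assume a: "a ^ m = 1" "g = rot a"
      have "E g *\<^sub>v x = (p * a ^ k) \<cdot>\<^sub>v v + (q * inverse (a ^ k)) \<cdot>\<^sub>v u"
        unfolding x using lin[OF rep_carrier[OF rep g]] rotv rotu a v u by (simp add: smult_smult_assoc)
      thus ?thesis using U_I by metis
    next
      fix a assume a: "a ^ m = 1" "g = ref (a0 * a)"
      have "E g *\<^sub>v x = (p * inverse (a ^ k)) \<cdot>\<^sub>v u + (q * a ^ k) \<cdot>\<^sub>v v"
        unfolding x using lin[OF rep_carrier[OF rep g]] refv refu a v u by (simp add: smult_smult_assoc)
      also have "\<dots> = (q * a ^ k) \<cdot>\<^sub>v v + (p * inverse (a ^ k)) \<cdot>\<^sub>v u"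
        using v u by (intro comm_add_vec[of _ "deg E"]) auto
      finally show ?thesis using U_I by metis
    qed
  qed (use v in auto)
  have v2: "v \<in> carrier_vec 2" "u \<in> carrier_vec 2" using v u deg by auto
  have comb: "\<exists>x y. z = x \<cdot>\<^sub>v v + y \<cdot>\<^sub>v u" if "z \<in> carrier_vec 2" for z
    using that Ucarr deg by (auto simp: U_def)
  obtain q00 q10 where q0: "vec2 1 0 = q00 \<cdot>\<^sub>v v + q10 \<cdot>\<^sub>v u" using comb[of "vec2 1 0"] by auto
  obtain q01 q11 where q1: "vec2 0 1 = q01 \<cdot>\<^sub>v v + q11 \<cdot>\<^sub>v u" using comb[of "vec2 0 1"] by auto
  define P where "P = mat2 (v $ 0) (u $ 0) (v $ 1) (u $ 1)"
  define Q where "Q = mat2 q00 q01 q10 q11"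
  have c: "P \<in> carrier_mat 2 2" "Q \<in> carrier_mat 2 2" by (simp_all add: P_def Q_def)
  have qq: "q00 * v $ 0 + q10 * u $ 0 = 1" "q00 * v $ 1 + q10 * u $ 1 = 0"
    "q01 * v $ 0 + q11 * u $ 0 = 0" "q01 * v $ 1 + q11 * u $ 1 = 1"
    using arg_cong[OF q0, of "\<lambda>v. v $ 0"] arg_cong[OF q0, of "\<lambda>v. v $ 1"]
      arg_cong[OF q1, of "\<lambda>v. v $ 0"] arg_cong[OF q1, of "\<lambda>v. v $ 1"] v2 by auto
  have PQ: "P * Q = 1\<^sub>m 2"
    unfolding P_def Q_def mat2_mult one_mat2 mat2_eq_iff using qq by (simp add: mult.commute)
  hence QP: "Q * P = 1\<^sub>m 2" using mat_mult_left_right_inverse[OF c] by blast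
  have key: "A = P * mat2 p 0 0 q * Q"
    if "A \<in> carrier_mat 2 2" "A *\<^sub>v v = p \<cdot>\<^sub>v v" "A *\<^sub>v u = q \<cdot>\<^sub>v u" for A p q
  proof -
    have "A * P = P * mat2 p 0 0 q"
      using c that(1) arg_cong[OF that(2), of "\<lambda>v. v $ 0"] arg_cong[OF that(2), of "\<lambda>v. v $ 1"]
        arg_cong[OF that(3), of "\<lambda>v. v $ 0"] arg_cong[OF that(3), of "\<lambda>v. v $ 1"] v2
      by (intro mat_2_eqI) (auto simp: index_mult_2 index_mult_vec_2 P_def mult.commute
          simp del: index_mult_mat(1) index_mult_mat_vec)
    hence "A * P * Q = P * mat2 p 0 0 q * Q" by simp
    thus ?thesis using c that(1) PQ by (simp add: assoc_mult_mat[of _ 2 2 _ 2 _ 2])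
  qed
  have key': "A = P * mat2 0 p q 0 * Q"
    if "A \<in> carrier_mat 2 2" "A *\<^sub>v v = q \<cdot>\<^sub>v u" "A *\<^sub>v u = p \<cdot>\<^sub>v v" for A p q
  proof -
    have "A * P = P * mat2 0 p q 0"
      using c that(1) arg_cong[OF that(2), of "\<lambda>v. v $ 0"] arg_cong[OF that(2), of "\<lambda>v. v $ 1"]
        arg_cong[OF that(3), of "\<lambda>v. v $ 0"] arg_cong[OF that(3), of "\<lambda>v. v $ 1"] v2
      by (intro mat_2_eqI) (auto simp: index_mult_2 index_mult_vec_2 P_def mult.commute
          simp del: index_mult_mat(1) index_mult_mat_vec)
    hence "A * P * Q = P * mat2 0 p q 0 * Q" by simp
    thus ?thesis using c that(1) PQ by (simp add: assoc_mult_mat[of _ 2 2 _ 2 _ 2])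
  qed
  have indep: "x = 0 \<and> y = 0" if "x \<cdot>\<^sub>v v + y \<cdot>\<^sub>v u = 0\<^sub>v 2" for x y
  proof -
    have "P *\<^sub>v vec2 x y = 0\<^sub>v 2"
      using arg_cong[OF that, of "\<lambda>v. v $ 0"] arg_cong[OF that, of "\<lambda>v. v $ 1"] v2 c
      by (intro vec_2_eqI) (auto simp: index_mult_vec_2 P_def mult.commute simp del: index_mult_mat_vec
          intro!: mult_vec_carrier_2)
    hence "Q *\<^sub>v (P *\<^sub>v vec2 x y) = 0\<^sub>v 2" using c by (simp add: mult_zero_vec)
    hence "vec2 x y = 0\<^sub>v 2" using c QP by (simp flip: assoc_mult_mat_vec[of _ 2 2 _ 2])
    hence "vec2 x y $ 0 = 0" "vec2 x y $ 1 = 0" by simp_all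
    thus ?thesis by simp
  qed
  \<comment> \<open>For k = 0 the vector v + u is fixed by the group, and its line would be a proper
    invariant subspace.\<close>
  have "k \<noteq> 0"
  proof
    assume k0: "k = 0"
    define z where "z = v + u"
    have zc: "z \<in> carrier_vec (deg E)" using v u by (simp add: z_def)
    have znz: "z \<noteq> 0\<^sub>v (deg E)" using indep[of 1 1] deg v2 by (auto simp: z_def)
    have Ez: "E g *\<^sub>v z = z" if g: "g \<in> D" for g
    proof (rule D_cases[OF g])
      fix a assume "a ^ m = 1" "g = rot a"
      thus ?thesis unfolding z_def using rep_carrier[OF rep g] v u rotv rotu k0
        by (simp add: mult_add_distrib_mat_vec[of _ "deg E" "deg E"])
    next
      fix a assume "a ^ m = 1" "g = ref (a0 * a)"
      thus ?thesis unfolding z_def using rep_carrier[OF rep g] v u refv refu k0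
        by (simp add: mult_add_distrib_mat_vec[of _ "deg E" "deg E"] comm_add_vec[of _ "deg E"])
    qed
    have "{c \<cdot>\<^sub>v z | c. True} = carrier_vec (deg E)"
    proof (rule irr_invariant[OF E, of _ z])
      show "0\<^sub>v (deg E) \<in> {c \<cdot>\<^sub>v z | c. True}" using zc by (auto intro!: exI[of _ 0])
      show "z \<in> {c \<cdot>\<^sub>v z | c. True}" using zc by (auto intro!: exI[of _ 1])
      fix g x assume "g \<in> D" "x \<in> {c \<cdot>\<^sub>v z | c. True}"
      thus "E g *\<^sub>v x \<in> {c \<cdot>\<^sub>v z | c. True}" using rep_carrier[OF rep] zc Ez
        by (auto simp: mult_mat_vec[of _ "deg E" "deg E"])
    qed (use zc znz in \<open>auto simp: smult_smult_assoc simp flip: add_smult_distrib_vec\<close>)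
    then obtain x where x: "v = x \<cdot>\<^sub>v z" using v by auto
    have "v $ i = x * (v $ i + u $ i)" if "i < 2" for i
      using arg_cong[OF x, of "\<lambda>v. v $ i"] v2 that by (simp add: z_def)
    hence "(1 - x) \<cdot>\<^sub>v v + (- x) \<cdot>\<^sub>v u = 0\<^sub>v 2" using v2
      by (intro eq_vecI) (auto simp: algebra_simps)
    thus False using indep by fastforce
  qed
  hence "two_form E k P Q" unfolding two_form_def
    using deg k c PQ QP rotv rotu refv refu rep_carrier[OF rep rot_in] rep_carrier[OF rep ref_in]
    by (auto simp: rot_def ref_def intro!: key key')
  thus ?thesis by blast
qed

text \<open>Take an eigenvector v of the generating rotation and its image u under a reflection.
  Their span is invariant, so the degree is at most 2, and the eigenvalue determines the
  form.\<close>

lemma irr_form: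
  assumes E: "irr D E"
  obtains h \<epsilon> where "one_form E h \<epsilon>" | k P Q where "two_form E k P Q"
proof -
  have rep: "rep D E" and pos: "deg E > 0" using E by (auto simp: irr_def)
  define n where "n = deg E"
  have c: "E g \<in> carrier_mat n n" if "g \<in> D" for g using rep_carrier[OF rep that] by (simp add: n_def)
  have "spectrum (E (rot w)) \<noteq> {}" using spectrum_non_empty[OF c[OF rot_in]] pos by (simp add: n_def)
  then obtain l v where v: "v \<in> carrier_vec n" "v \<noteq> 0\<^sub>v n" "E (rot w) *\<^sub>v v = l \<cdot>\<^sub>v v"
    using c[OF rot_in[of w]] by (auto simp: spectrum_def eigenvalue_def eigenvector_def)
  have pw: "E (rot (w ^ j)) *\<^sub>v v = l ^ j \<cdot>\<^sub>v v" for j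
  proof (induction j)
    case 0 show ?case using rep_one[OF rep] v by (simp add: n_def)
  next
    case (Suc j)
    have wj: "(w ^ j) ^ m = 1" by (metis mult.commute power_mult power_one w_pow_m)
    have "E (rot (w ^ Suc j)) = E (rot w) * E (rot (w ^ j))"
      using rep_mult[OF rep rot_in[OF w_pow_m] rot_in[OF wj]] by simp
    thus ?case using Suc c[OF rot_in[OF w_pow_m]] c[OF rot_in[OF wj]] v
      by (simp add: mult_mat_vec[of _ n n] smult_smult_assoc mult.commute)
  qed
  have "l ^ m = 1"
  proof -
    have "l ^ m \<cdot>\<^sub>v v = 1 \<cdot>\<^sub>v v" using pw[of m] pw[of 0] by simp
    moreover obtain i where "i < n" "v $ i \<noteq> 0" using v(1,2) by (metis carrier_vecD eq_vecI index_zero_vec)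
    ultimately show ?thesis using v(1) by (metis carrier_vecD index_smult_vec(1) mult_cancel_right)
  qed
  then obtain k where k: "k < m" "l = w ^ k" using roots by blast
  have rotv: "E (rot a) *\<^sub>v v = a ^ k \<cdot>\<^sub>v v" if "a ^ m = 1" for a
  proof -
    obtain j where "a = w ^ j" using roots[OF \<open>a ^ m = 1\<close>] by blast
    thus ?thesis using pw[of j] k by (simp add: mult.commute flip: power_mult)
  qed
  have cr: "E (ref a0) \<in> carrier_mat n n" using c[OF ref_in[of 1]] by simp
  define u where "u = E (ref a0) *\<^sub>v v"
  have u: "u \<in> carrier_vec n" using cr v by (simp add: u_def)
  have r0: "ref a0 \<in> D" using ref_in[of 1] by simp
  have uv: "E (ref a0) *\<^sub>v u = v"
  proof -
    have "E (ref a0) * E (ref a0) = 1\<^sub>m n" using rep_mult[OF rep r0 r0] rep_one[OF rep] by (simp add: n_def)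
    thus ?thesis unfolding u_def using cr v by (simp flip: assoc_mult_mat_vec[of _ n n _ n])
  qed
  have unz: "u \<noteq> 0\<^sub>v n" using uv v cr mult_zero_vec[OF cr] by metis
  have rotu: "E (rot a) *\<^sub>v u = inverse (a ^ k) \<cdot>\<^sub>v u" if a: "a ^ m = 1" for a
  proof -
    have ai: "inverse a ^ m = 1" using a by (simp add: power_inverse)
    have "E (rot a) * E (ref a0) = E (ref a0) * E (rot (inverse a))"
      using rep_mult[OF rep rot_in[OF a] r0] rep_mult[OF rep r0 rot_in[OF ai]]
      by (simp add: divide_inverse mult.commute)
    moreover have "E (rot a) *\<^sub>v u = (E (rot a) * E (ref a0)) *\<^sub>v v"
      unfolding u_def by (rule assoc_mult_mat_vec[symmetric, OF c[OF rot_in[OF a]] cr v(1)])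
    moreover have "(E (ref a0) * E (rot (inverse a))) *\<^sub>v v = E (ref a0) *\<^sub>v (E (rot (inverse a)) *\<^sub>v v)"
      by (rule assoc_mult_mat_vec[OF cr c[OF rot_in[OF ai]] v(1)])
    ultimately have "E (rot a) *\<^sub>v u = E (ref a0) *\<^sub>v (E (rot (inverse a)) *\<^sub>v v)" by simp
    also have "\<dots> = inverse a ^ k \<cdot>\<^sub>v u" using rotv[OF ai] cr v by (simp add: u_def mult_mat_vec[of _ n n])
    finally show ?thesis by (simp add: power_inverse)
  qed
  have refa: "E (ref (a0 * a)) = E (rot a) * E (ref a0)" if "a ^ m = 1" for a
    using rep_mult[OF rep rot_in[OF that] r0] by (simp add: mult.commute)
  have lin: "A *\<^sub>v (x \<cdot>\<^sub>v v + y \<cdot>\<^sub>v u) = x \<cdot>\<^sub>v (A *\<^sub>v v) + y \<cdot>\<^sub>v (A *\<^sub>v u)"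
    if "A \<in> carrier_mat n n" for A x y
    using that v u by (simp add: mult_add_distrib_mat_vec[of _ n n] mult_mat_vec[of _ n n])
  define U where "U = {x \<cdot>\<^sub>v v + y \<cdot>\<^sub>v u | x y. True}"
  have U_I: "x \<cdot>\<^sub>v v + y \<cdot>\<^sub>v u \<in> U" for x y by (auto simp: U_def)
  have "U = carrier_vec n"
  proof (rule irr_invariant[OF E, of U v, folded n_def])
    show "U \<subseteq> carrier_vec n" using v u by (auto simp: U_def)
    have "0\<^sub>v n = 0 \<cdot>\<^sub>v v + 0 \<cdot>\<^sub>v u" using v u by (intro eq_vecI) auto
    thus "0\<^sub>v n \<in> U" using U_I by metis
    have "v = 1 \<cdot>\<^sub>v v + 0 \<cdot>\<^sub>v u" using v u by (intro eq_vecI) auto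
    thus "v \<in> U" using U_I by metis
    fix x y c' assume "x \<in> U"
    then obtain p q where x: "x = p \<cdot>\<^sub>v v + q \<cdot>\<^sub>v u" by (auto simp: U_def)
    have "c' \<cdot>\<^sub>v x = (c' * p) \<cdot>\<^sub>v v + (c' * q) \<cdot>\<^sub>v u" unfolding x using v u
      by (intro eq_vecI) (auto simp: algebra_simps)
    thus "c' \<cdot>\<^sub>v x \<in> U" using U_I by metis
    {
      assume "y \<in> U"
      then obtain p' q' where y: "y = p' \<cdot>\<^sub>v v + q' \<cdot>\<^sub>v u" by (auto simp: U_def)
      have "x + y = (p + p') \<cdot>\<^sub>v v + (q + q') \<cdot>\<^sub>v u" unfolding x y using v u
        by (intro eq_vecI) (auto simp: algebra_simps)
      thus "x + y \<in> U" using U_I by metis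
    }
    have rotU: "E (rot a) *\<^sub>v (p \<cdot>\<^sub>v v + q \<cdot>\<^sub>v u) \<in> U" if a: "a ^ m = 1" for a p q
    proof -
      have "E (rot a) *\<^sub>v (p \<cdot>\<^sub>v v + q \<cdot>\<^sub>v u) = (p * a ^ k) \<cdot>\<^sub>v v + (q * inverse (a ^ k)) \<cdot>\<^sub>v u"
        using lin[OF c[OF rot_in[OF a]]] rotv rotu a v u by (simp add: smult_smult_assoc)
      thus ?thesis using U_I by metis
    qed
    fix g assume g: "g \<in> D"
    show "E g *\<^sub>v x \<in> U"
    proof (rule D_cases[OF g])
      fix a assume a: "a ^ m = 1" "g = ref (a0 * a)"
      have "E (ref a0) *\<^sub>v x = p \<cdot>\<^sub>v u + q \<cdot>\<^sub>v v" unfolding x lin[OF cr] uv by (simp add: u_def)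
      also have "\<dots> = q \<cdot>\<^sub>v v + p \<cdot>\<^sub>v u" using v u by (intro comm_add_vec[of _ n]) auto
      finally have "E g *\<^sub>v x = E (rot a) *\<^sub>v (q \<cdot>\<^sub>v v + p \<cdot>\<^sub>v u)"
        unfolding a(2) refa[OF a(1)] using x cr c[OF rot_in[OF a(1)]] v u by simp
      thus ?thesis using rotU a(1) by metis
    qed (use rotU x in auto)
  qed (use v in auto)
  hence comb: "\<exists>x y. z = x \<cdot>\<^sub>v v + y \<cdot>\<^sub>v u" if "z \<in> carrier_vec n" for z
    using that by (auto simp: U_def n_def)
  have "n \<le> 2" using carrier_vec_le_2[OF v(1) u comb] .
  hence "n = 1 \<or> n = 2" using pos by (auto simp: n_def)
  thus thesis
  proof
    assume n1: "n = 1"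
    have v0: "v $ 0 \<noteq> 0" using v n1 by (auto simp: eq_vecI)
    have ent: "A = mat 1 1 (\<lambda>_. x)" if "A \<in> carrier_mat n n" "A *\<^sub>v v = x \<cdot>\<^sub>v v" for A x
    proof (rule mat_1_eqI)
      have "(A *\<^sub>v v) $ 0 = A $$ (0,0) * v $ 0" using that(1) v n1 by (simp add: scalar_prod_def)
      thus "A $$ (0,0) = x" using that v n1 v0 by simp
    qed (use that n1 in auto)
    define \<epsilon> where "\<epsilon> = u $ 0 / v $ 0"
    have ueps: "u = \<epsilon> \<cdot>\<^sub>v v" using v u n1 v0 by (intro eq_vecI) (auto simp: \<epsilon>_def)
    have "v = E (ref a0) *\<^sub>v (\<epsilon> \<cdot>\<^sub>v v)" using uv ueps by metis
    also have "\<dots> = \<epsilon> \<cdot>\<^sub>v (E (ref a0) *\<^sub>v v)" by (rule mult_mat_vec[OF cr v(1)])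
    also have "\<dots> = \<epsilon> \<cdot>\<^sub>v (\<epsilon> \<cdot>\<^sub>v v)" using ueps u_def by metis
    finally have "v = (\<epsilon> * \<epsilon>) \<cdot>\<^sub>v v" by (simp add: smult_smult_assoc)
    hence "v $ 0 = \<epsilon> * \<epsilon> * v $ 0" using v n1 by (metis carrier_vecD index_smult_vec(1) less_one)
    hence "\<epsilon> * \<epsilon> = 1" using v0 by simp
    hence eps: "\<epsilon> = 1 \<or> \<epsilon> = -1" by (simp add: square_eq_1_iff)
    \<comment> \<open>In degree 1 the lines of v and u coincide, so the eigenvalues w^k and w^(-k)
      agree and m divides 2k.\<close>
    have "w ^ k \<cdot>\<^sub>v u = inverse (w ^ k) \<cdot>\<^sub>v u"
      using rotu[OF w_pow_m] rotv[OF w_pow_m] c[OF rot_in[OF w_pow_m]] v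
      unfolding ueps by (simp add: mult_mat_vec[of _ n n] smult_smult_assoc mult.commute)
    hence "w ^ k * u $ 0 = inverse (w ^ k) * u $ 0" using u n1 by (metis carrier_vecD index_smult_vec(1) less_one)
    moreover have "u $ 0 \<noteq> 0" using unz u n1 by (auto simp: eq_vecI)
    ultimately have "w ^ k * w ^ k = 1" by (simp add: field_simps)
    hence "m dvd 2 * k" by (simp add: mult_2 power_add flip: w_pow_eq_1_iff)
    then obtain q where q: "2 * k = m * q" by auto
    hence "m * q < m * 2" using k(1) by linarith
    hence "q < 2" by (simp only: mult_less_cancel1)
    hence "q = 0 \<or> q = 1" by auto
    hence "k = 0 \<or> 2 * k = m" using q by auto
    moreover have "E (rot a) = mat 1 1 (\<lambda>_. a ^ k)" if "a ^ m = 1" for a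
      by (rule ent[OF c[OF rot_in] rotv]) (use that in auto)
    moreover have "E (ref (a0 * a)) = mat 1 1 (\<lambda>_. \<epsilon> * a ^ k)" if "a ^ m = 1" for a
    proof (rule ent[OF c[OF ref_in[OF that]]])
      show "E (ref (a0 * a)) *\<^sub>v v = (\<epsilon> * a ^ k) \<cdot>\<^sub>v v"
        using refa[OF that] c[OF rot_in[OF that]] cr v rotv[OF that]
        by (simp add: u_def[symmetric] ueps mult_mat_vec[of _ n n] smult_smult_assoc)
    qed
    ultimately have "one_form E k \<epsilon>" using eps n1 by (auto simp: one_form_def n_def)
    thus thesis using that by blast
  next
    assume n2: "n = 2"
    note vu = v(1,2)[unfolded n_def] u[unfolded n_def] unz[unfolded n_def]
    consider "2 * k < m" | "2 * k > m" | "2 * k = m" by linarith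
    thus thesis
    proof cases
      case 1
      hence "\<exists>P Q. two_form E k P Q"
        by (intro invariant_lines[OF E vu(1,2,3) rotv rotu u_def[symmetric] uv]) (use n2 n_def in auto)
      thus thesis using that by blast
    next
      case 2
      \<comment> \<open>Exchange v and u: the eigenvalue of u is a^(-k) = a^(m - k), which lies in
        the admissible range.\<close>
      have "\<exists>P Q. two_form E (m - k) P Q"
      proof (rule invariant_lines[OF E vu(3,4,1) _ _ uv u_def[symmetric]])
        fix a :: complex assume a: "a ^ m = 1"
        have "a ^ (m - k) = inverse (a ^ k)" using a k(1) root_nonzero[OF a]
          by (simp add: power_diff field_simps)
        thus "E (rot a) *\<^sub>v u = a ^ (m - k) \<cdot>\<^sub>v u" "E (rot a) *\<^sub>v v = inverse (a ^ (m - k)) \<cdot>\<^sub>v v"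
          using rotu[OF a] rotv[OF a] by auto
      qed (use 2 k n2 n_def in auto)
      thus thesis using that by blast
    next
      case 3
      \<comment> \<open>For 2 * k = m each rotation acts by a scalar, so v + u spans an invariant
        line, or v itself does if u = -v. This contradicts irreducibility in degree 2.\<close>
      define z where "z = (if v + u = 0\<^sub>v n then v else v + u)"
      have zc: "z \<in> carrier_vec n" using v u by (simp add: z_def)
      have znz: "z \<noteq> 0\<^sub>v n" using v by (auto simp: z_def)
      have inv: "inverse (a ^ k) = a ^ k" if a: "a ^ m = 1" for a :: complex
      proof -
        have "a ^ k * a ^ k = 1" using a 3 by (simp add: mult_2 flip: power_add)
        thus ?thesis by (metis inverse_unique)
      qed
      have neg: "u = (-1) \<cdot>\<^sub>v v" if vu0: "v + u = 0\<^sub>v n"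
      proof (rule eq_vecI)
        fix i assume "i < dim_vec ((-1) \<cdot>\<^sub>v v)"
        hence "v $ i + u $ i = 0" using arg_cong[OF vu0, of "\<lambda>v. v $ i"] v u by simp
        thus "u $ i = ((-1) \<cdot>\<^sub>v v) $ i" using v u \<open>i < _\<close> by (simp add: add_eq_0_iff)
      qed (use v u in auto)
      have rz: "E (ref a0) *\<^sub>v z = (if v + u = 0\<^sub>v n then -1 else 1) \<cdot>\<^sub>v z"
        using neg uv cr v u
        by (auto simp: z_def mult_add_distrib_mat_vec[of _ n n] u_def[symmetric] comm_add_vec[of _ n])
      have Ez: "\<exists>c. E g *\<^sub>v z = c \<cdot>\<^sub>v z" if g: "g \<in> D" for g
      proof -
        have rot: "E (rot a) *\<^sub>v z = a ^ k \<cdot>\<^sub>v z" if a: "a ^ m = 1" for a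
          using c[OF rot_in[OF a]] v u rotv[OF a] rotu[OF a] inv[OF a]
          by (auto simp: z_def mult_add_distrib_mat_vec[of _ n n] smult_add_distrib_vec[of _ n])
        show ?thesis
        proof (rule D_cases[OF g])
          fix a assume a: "a ^ m = 1" "g = ref (a0 * a)"
          thus ?thesis using refa[OF a(1)] c[OF rot_in[OF a(1)]] cr zc rot[OF a(1)] rz
            by (auto simp: mult_mat_vec[of _ n n] smult_smult_assoc)
        qed (use rot in auto)
      qed
      have "{c \<cdot>\<^sub>v z | c. True} = carrier_vec n"
      proof (rule irr_invariant[OF E, of _ z, folded n_def])
        show "0\<^sub>v n \<in> {c \<cdot>\<^sub>v z | c. True}" using zc by (auto intro!: exI[of _ 0])
        show "z \<in> {c \<cdot>\<^sub>v z | c. True}" using zc by (auto intro!: exI[of _ 1])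
        fix g x assume g: "g \<in> D" and x: "x \<in> {c \<cdot>\<^sub>v z | c. True}"
        then obtain p q where "x = p \<cdot>\<^sub>v z" "E g *\<^sub>v z = q \<cdot>\<^sub>v z" using Ez by blast
        hence "E g *\<^sub>v x = (p * q) \<cdot>\<^sub>v z" using c[OF g] zc by (simp add: mult_mat_vec[of _ n n] smult_smult_assoc)
        thus "E g *\<^sub>v x \<in> {c \<cdot>\<^sub>v z | c. True}" by blast
      qed (use zc znz in \<open>auto simp: smult_smult_assoc simp flip: add_smult_distrib_vec\<close>)
      hence line: "\<exists>x. y = x \<cdot>\<^sub>v z" if "y \<in> carrier_vec n" for y using that by (auto simp: n_def)
      obtain x y where xy: "vec2 1 0 = x \<cdot>\<^sub>v z" "vec2 0 1 = y \<cdot>\<^sub>v z"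
        using line[of "vec2 1 0"] line[of "vec2 0 1"] n2 by auto
      have "1 = x * z $ 0" "0 = x * z $ 1" "1 = y * z $ 1"
        using arg_cong[OF xy(1), of "\<lambda>v. v $ 0"] arg_cong[OF xy(1), of "\<lambda>v. v $ 1"]
          arg_cong[OF xy(2), of "\<lambda>v. v $ 1"] zc n2 by auto
      thus thesis by auto
    qed
  qed
qed

end

section \<open>Symmetric powers\<close>

text \<open>The weight a^(2i - n) of the monomial e1^i e2^(n-i) under \<open>rot a\<close>, written
  with natural exponents.\<close>

definition wt :: "nat \<Rightarrow> complex \<Rightarrow> nat \<Rightarrow> complex" where
  "wt n a i = a ^ i * inverse a ^ (n - i)"

lemma wt_1 [simp]: "wt n 1 i = 1" by (simp add: wt_def)
lemma wt_top [simp]: "wt n a n = a ^ n" by (simp add: wt_def)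
lemma wt_0 [simp]: "wt n a 0 = inverse (a ^ n)" by (simp add: wt_def power_inverse)
lemma wt_middle: "a \<noteq> 0 \<Longrightarrow> 2 * i = n \<Longrightarrow> wt n a i = 1"
  by (auto simp: wt_def mult_2 simp flip: power_mult_distrib)


lemma pCons_power: "[:0, a:] ^ j = Polynomial.monom (a ^ j) j" "[:a:] ^ j = [:a ^ j:]" for a :: complex
proof -
  show "[:0, a:] ^ j = Polynomial.monom (a ^ j) j"
    by (induction j) (auto simp: monom_Suc one_pCons monom_0 smult_monom)
  show "[:a:] ^ j = [:a ^ j:]" by (induction j) (auto simp: one_pCons)
qed

lemma deg_sym_pow [simp]: "deg (sym_pow n) = n + 1" by (simp add: deg_def sym_pow_def)
lemma sym_pow_carrier: "sym_pow n g \<in> carrier_mat (n + 1) (n + 1)" by (simp add: sym_pow_def)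

lemma sym_pow_rot:
  "i \<le> n \<Longrightarrow> j \<le> n \<Longrightarrow> sym_pow n (rot a) $$ (i, j) = (if j = i then wt n a i else 0)"
  unfolding sym_pow_def rot_def wt_def
  by (simp add: pCons_power smult_monom mult.commute power_inverse)
lemma sym_pow_ref:
  "i \<le> n \<Longrightarrow> j \<le> n \<Longrightarrow> sym_pow n (ref a) $$ (i, j) = (if j = n - i then wt n a i else 0)"
  unfolding sym_pow_def ref_def wt_def
  by (auto simp: pCons_power smult_monom mult.commute power_inverse)

lemma sym_rot_mult:
  assumes "M \<in> carrier_mat (n + 1) q" "i \<le> n" "j < q"
  shows "(sym_pow n (rot a) * M) $$ (i, j) = wt n a i * M $$ (i, j)"
proof -
  have "(sym_pow n (rot a) * M) $$ (i, j) = (\<Sum>k<n+1. sym_pow n (rot a) $$ (i, k) * M $$ (k, j))"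
    using assms sym_pow_carrier[of n "rot a"] by (simp add: scalar_prod_def lessThan_atLeast0)
  also have "\<dots> = (\<Sum>k<n+1. if k = i then wt n a i * M $$ (k, j) else 0)"
    by (rule sum.cong) (use assms in \<open>auto simp: sym_pow_rot\<close>)
  finally show ?thesis using assms by simp
qed

lemma sym_ref_mult:
  assumes "M \<in> carrier_mat (n + 1) q" "i \<le> n" "j < q"
  shows "(sym_pow n (ref a) * M) $$ (i, j) = wt n a i * M $$ (n - i, j)"
proof -
  have "(sym_pow n (ref a) * M) $$ (i, j) = (\<Sum>k<n+1. sym_pow n (ref a) $$ (i, k) * M $$ (k, j))"
    using assms sym_pow_carrier[of n "ref a"] by (simp add: scalar_prod_def lessThan_atLeast0)
  also have "\<dots> = (\<Sum>k<n+1. if k = n - i then wt n a i * M $$ (k, j) else 0)"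
    by (rule sum.cong) (use assms in \<open>auto simp: sym_pow_ref\<close>)
  finally show ?thesis using assms by simp
qed

lemma sym_rot_vec:
  assumes "f \<in> carrier_vec (n + 1)" "i \<le> n"
  shows "(sym_pow n (rot a) *\<^sub>v f) $ i = wt n a i * f $ i"
proof -
  have "(sym_pow n (rot a) *\<^sub>v f) $ i = (\<Sum>k<n+1. sym_pow n (rot a) $$ (i, k) * f $ k)"
    using assms sym_pow_carrier[of n "rot a"] by (simp add: scalar_prod_def lessThan_atLeast0)
  also have "\<dots> = (\<Sum>k<n+1. if k = i then wt n a i * f $ k else 0)"
    by (rule sum.cong) (use assms in \<open>auto simp: sym_pow_rot\<close>)
  finally show ?thesis using assms by simp
qed

lemma sym_ref_vec:
  assumes "f \<in> carrier_vec (n + 1)" "i \<le> n"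
  shows "(sym_pow n (ref a) *\<^sub>v f) $ i = wt n a i * f $ (n - i)"
proof -
  have "(sym_pow n (ref a) *\<^sub>v f) $ i = (\<Sum>k<n+1. sym_pow n (ref a) $$ (i, k) * f $ k)"
    using assms sym_pow_carrier[of n "ref a"] by (simp add: scalar_prod_def lessThan_atLeast0)
  also have "\<dots> = (\<Sum>k<n+1. if k = n - i then wt n a i * f $ k else 0)"
    by (rule sum.cong) (use assms in \<open>auto simp: sym_pow_ref\<close>)
  finally show ?thesis using assms by simp
qed

text \<open>Occurrence in degree N, multiplicity one there, and absence in lower degrees: what both
  \<open>b_value\<close> and \<open>trunc_ind\<close> ask for.\<close>

definition first_copy ::
  "complex mat set \<Rightarrow> (complex mat \<Rightarrow> complex mat) \<Rightarrow> nat \<Rightarrow> complex mat \<Rightarrow> bool" where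
  "first_copy G E N T \<longleftrightarrow> intertwiner G E (sym_pow N) T \<and> T \<noteq> 0\<^sub>m (N + 1) (deg E) \<and>
     (\<forall>T'. intertwiner G E (sym_pow N) T' \<longrightarrow> (\<exists>c. T' = c \<cdot>\<^sub>m T)) \<and>
     (\<forall>n<N. \<forall>T'. intertwiner G E (sym_pow n) T' \<longrightarrow> T' = 0\<^sub>m (n + 1) (deg E))"

lemma b_value_eq: "first_copy G E N T \<Longrightarrow> b_value G E = N"
  unfolding first_copy_def b_value_def
  by (intro Least_equality) (auto simp: not_less[symmetric])

section \<open>First copies of the irreducible representations, and the values of b\<close>

context dihedral
begin

lemma intertwiner_one:
  assumes E: "one_form E h \<epsilon>" and T: "T \<in> carrier_mat (n + 1) 1"
  shows "intertwiner D E (sym_pow n) T \<longleftrightarrow> (\<forall>a. a ^ m = 1 \<longrightarrow> (\<forall>i\<le>n.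
     wt n a i * T $$ (i, 0) = a ^ h * T $$ (i, 0) \<and>
     wt n (a0 * a) i * T $$ (n - i, 0) = \<epsilon> * a ^ h * T $$ (i, 0)))"
proof -
  have deg: "deg E = 1" using E by (simp add: one_form_def)
  have c1: "T * mat 1 1 (\<lambda>_. c) \<in> carrier_mat (n + 1) 1" for c using T by simp
  have e1: "(T * mat 1 1 (\<lambda>_. c)) $$ (i, 0) = c * T $$ (i, 0)" if "i \<le> n" for c i
    using T that by (simp add: scalar_prod_def mult.commute)
  have eq: "T * mat 1 1 (\<lambda>_. c) = sym_pow n g * T \<longleftrightarrow>
     (\<forall>i\<le>n. (sym_pow n g * T) $$ (i, 0) = c * T $$ (i, 0))" for c g
  proof
    assume "T * mat 1 1 (\<lambda>_. c) = sym_pow n g * T"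
    thus "\<forall>i\<le>n. (sym_pow n g * T) $$ (i, 0) = c * T $$ (i, 0)" using e1 by metis
  next
    assume "\<forall>i\<le>n. (sym_pow n g * T) $$ (i, 0) = c * T $$ (i, 0)"
    thus "T * mat 1 1 (\<lambda>_. c) = sym_pow n g * T"
      using T c1[of c] sym_pow_carrier[of n g] e1 by (intro eq_matI) auto
  qed
  have "intertwiner D E (sym_pow n) T \<longleftrightarrow> (\<forall>a. a ^ m = 1 \<longrightarrow>
      T * E (rot a) = sym_pow n (rot a) * T \<and> T * E (ref (a0 * a)) = sym_pow n (ref (a0 * a)) * T)"
    using T deg by (simp add: intertwiner_def ball_D)
  also have "\<dots> \<longleftrightarrow> (\<forall>a. a ^ m = 1 \<longrightarrow>
      T * mat 1 1 (\<lambda>_. a ^ h) = sym_pow n (rot a) * T \<and>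
      T * mat 1 1 (\<lambda>_. \<epsilon> * a ^ h) = sym_pow n (ref (a0 * a)) * T)"
    using E by (auto simp: one_form_def)
  also have "\<dots> \<longleftrightarrow> (\<forall>a. a ^ m = 1 \<longrightarrow> (\<forall>i\<le>n.
     wt n a i * T $$ (i, 0) = a ^ h * T $$ (i, 0) \<and>
     wt n (a0 * a) i * T $$ (n - i, 0) = \<epsilon> * a ^ h * T $$ (i, 0)))"
    unfolding eq using T by (simp add: sym_rot_mult[OF T] sym_ref_mult[OF T]) blast
  finally show ?thesis .
qed

lemma wt_w_dvd:
  assumes "wt n w i = w ^ h" "i \<le> n"
  shows "int m dvd 2 * int i - int n - int h"
proof -
  have "w ^ i = wt n w i * w ^ (n - i)" by (simp add: wt_def power_inverse)
  hence "w ^ i = w ^ (h + (n - i))" using assms(1) by (simp only: power_add)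
  hence "int m dvd int i - int (h + (n - i))" by (rule w_pow_eq)
  thus ?thesis using assms by (simp add: of_nat_diff algebra_simps)
qed

lemma small_dvd: "int m dvd x \<Longrightarrow> \<bar>x\<bar> < int m \<Longrightarrow> x = 0"
  using m by (metis dvd_imp_le_int linorder_not_less abs_of_nat)

text \<open>The value of b, by \<open>b_value_one\<close>.\<close>

definition label_one :: "nat \<Rightarrow> complex \<Rightarrow> nat" where
  "label_one h \<epsilon> = (if h = 0 then if \<epsilon> = 1 then 0 else m else h)"

text \<open>The weight exponent 2i - n must be congruent to h modulo m. In degrees up to the label
  this leaves only the two extreme monomials, apart from the middle one, which the reflections
  exclude for the sign representation.\<close>

lemma one_form_support:
  assumes E: "one_form E h \<epsilon>" and n: "n \<le> label_one h \<epsilon>"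
    and f: "\<forall>a. a ^ m = 1 \<longrightarrow> (\<forall>i\<le>n. wt n a i * f i = a ^ h * f i \<and>
     wt n (a0 * a) i * f (n - i) = \<epsilon> * a ^ h * f i)"
    and i: "i \<le> n" "f i \<noteq> (0::complex)"
  shows "n = label_one h \<epsilon>" "i = 0 \<or> i = n"
proof -
  have eps: "\<epsilon> = 1 \<or> \<epsilon> = -1" and h: "h = 0 \<or> 2 * h = m" using E by (auto simp: one_form_def)
  have "wt n w i = w ^ h" using f[rule_format, of w i] i by simp
  hence d: "int m dvd 2 * int i - int n - int h" using i wt_w_dvd by blast
  \<comment> \<open>The monomial with 2i = n is fixed by \<open>ref a0\<close>, which acts on the
    copy by \<epsilon>.\<close>
  have mid: "\<epsilon> = 1" if "2 * i = n"
  proof -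
    have "n - i = i" using that by simp
    thus ?thesis using f[rule_format, of 1 i] wt_middle[of a0 i n] i that a0 by simp
  qed
  have "n = label_one h \<epsilon> \<and> (i = 0 \<or> i = n)"
  proof (cases "h = 0")
    case True
    show ?thesis
    proof (cases "\<epsilon> = 1")
      case True thus ?thesis using n i \<open>h = 0\<close> by (simp add: label_one_def)
    next
      case False
      hence ne: "2 * int i - int n \<noteq> 0" using mid by auto
      have nm: "n \<le> m" using n True False by (simp add: label_one_def)
      have "\<not> \<bar>2 * int i - int n\<bar> < int m" using small_dvd[of "2 * int i - int n"] d True ne by auto
      hence "i = 0 \<or> i = n" "n = m" using nm i by auto
      thus ?thesis using True False by (simp add: label_one_def)
    qed
  next
    case False
    hence h2: "2 * h = m" "n \<le> h" "h > 0" using h n by (auto simp: label_one_def)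
    show ?thesis
    proof (cases "2 * int i - int n - int h = 0")
      case True thus ?thesis using i h2 by (auto simp: label_one_def)
    next
      case False
      hence "\<not> \<bar>2 * int i - int n - int h\<bar> < int m" using small_dvd d by blast
      hence "n = h \<and> i = 0" using h2 i by auto
      thus ?thesis using h2 by (simp add: label_one_def)
    qed
  qed
  thus "n = label_one h \<epsilon>" "i = 0 \<or> i = n" by auto
qed

text \<open>The form e1^n + \<epsilon> * a0^(-n) * e2^n, and the constant 1 for n = 0.\<close>

definition copy_one :: "nat \<Rightarrow> complex \<Rightarrow> complex mat" where
  "copy_one n \<epsilon> = mat (n + 1) 1 (\<lambda>(i, j). if i = n then 1 else if i = 0 then \<epsilon> * inverse (a0 ^ n) else 0)"

lemma root_pow_label:
  assumes E: "one_form E h \<epsilon>" and a: "(a :: complex) ^ m = 1"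
  shows "a ^ label_one h \<epsilon> = a ^ h" "inverse (a ^ label_one h \<epsilon>) = a ^ h"
proof -
  have h: "h = 0 \<or> 2 * h = m" using E by (auto simp: one_form_def)
  have "a ^ h * a ^ h = 1" using h a by (auto simp: mult_2 simp flip: power_add)
  moreover show "a ^ label_one h \<epsilon> = a ^ h" using a by (simp add: label_one_def)
  ultimately show "inverse (a ^ label_one h \<epsilon>) = a ^ h" by (metis inverse_unique)
qed

lemma first_copy_one:
  assumes E: "one_form E h \<epsilon>"
  shows "first_copy D E (label_one h \<epsilon>) (copy_one (label_one h \<epsilon>) \<epsilon>)"
proof -
  let ?N = "label_one h \<epsilon>"
  let ?T = "copy_one ?N \<epsilon>"
  have deg: "deg E = 1" using E by (simp add: one_form_def)
  have eps: "\<epsilon> * \<epsilon> = 1" using E by (auto simp: one_form_def)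
  have T: "?T \<in> carrier_mat (?N + 1) 1" by (simp add: copy_one_def)
  have Ti: "?T $$ (i, 0) = (if i = ?N then 1 else if i = 0 then \<epsilon> * inverse (a0 ^ ?N) else 0)"
    if "i \<le> ?N" for i using that by (simp add: copy_one_def)
  have N0: "\<epsilon> = 1 \<and> h = 0" if "?N = 0" using that m E by (auto simp: label_one_def one_form_def split: if_splits)
  have 1: "intertwiner D E (sym_pow ?N) ?T"
    unfolding intertwiner_one[OF E T]
  proof (intro allI impI)
    fix a :: complex and i assume a: "a ^ m = 1" and i: "i \<le> ?N"
    have anz: "a \<noteq> 0" using root_nonzero[OF a] .
    consider "i = ?N" | "i = 0" "?N > 0" | "0 < i" "i < ?N" using i by linarith
    thus "wt ?N a i * ?T $$ (i, 0) = a ^ h * ?T $$ (i, 0) \<and>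
          wt ?N (a0 * a) i * ?T $$ (?N - i, 0) = \<epsilon> * a ^ h * ?T $$ (i, 0)"
    proof cases
      case 1 thus ?thesis using root_pow_label[OF E a] N0 by (auto simp: Ti power_mult_distrib)
    next
      case 2 thus ?thesis using root_pow_label[OF E a] eps by (auto simp: Ti power_mult_distrib)
    next
      case 3 thus ?thesis by (simp add: Ti)
    qed
  qed
  have 2: "?T \<noteq> 0\<^sub>m (?N + 1) (deg E)"
    using Ti[of ?N] deg by (auto dest: arg_cong[where f = "\<lambda>A. A $$ (?N, 0)"])
  have 3: "T' = 0\<^sub>m (n + 1) (deg E)" if n: "n < ?N" and T': "intertwiner D E (sym_pow n) T'" for n T'
  proof -
    have c: "T' \<in> carrier_mat (n + 1) 1" using T' deg by (simp add: intertwiner_def)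
    have "T' $$ (i, 0) = 0" if i: "i \<le> n" for i
    proof (rule ccontr)
      assume "T' $$ (i, 0) \<noteq> 0"
      thus False
        using one_form_support(1)[OF E less_imp_le[OF n] T'[unfolded intertwiner_one[OF E c]] i] n by simp
    qed
    thus ?thesis using c deg by (intro eq_matI) auto
  qed
  have 4: "\<exists>c. T' = c \<cdot>\<^sub>m ?T" if T': "intertwiner D E (sym_pow ?N) T'" for T'
  proof -
    have c: "T' \<in> carrier_mat (?N + 1) 1" using T' deg by (simp add: intertwiner_def)
    note T'' = T'[unfolded intertwiner_one[OF E c]]
    have supp: "i = 0 \<or> i = ?N" if i: "i \<le> ?N" "T' $$ (i, 0) \<noteq> 0" for i
      using one_form_support(2)[OF E order_refl T'' i] .
    have "T' $$ (i, 0) = T' $$ (?N, 0) * ?T $$ (i, 0)" if i: "i \<le> ?N" for i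
    proof -
      consider "i = ?N" | "i = 0" "?N > 0" | "0 < i" "i < ?N" using i by linarith
      thus ?thesis
      proof cases
        case 2
        have "wt ?N (a0 * 1) 0 * T' $$ (?N - 0, 0) = \<epsilon> * 1 ^ h * T' $$ (0, 0)"
          using T''[rule_format, of 1 0] by simp
        hence "\<epsilon> * (inverse (a0 ^ ?N) * T' $$ (?N, 0)) = \<epsilon> * (\<epsilon> * T' $$ (0, 0))" by simp
        hence "\<epsilon> * (inverse (a0 ^ ?N) * T' $$ (?N, 0)) = T' $$ (0, 0)" using eps by (simp flip: mult.assoc)
        moreover have "?T $$ (i, 0) = \<epsilon> * inverse (a0 ^ ?N)" using 2 by (simp add: Ti)
        ultimately show ?thesis using 2 by (metis mult.assoc mult.commute)
      qed (use supp[of i] in \<open>auto simp: Ti\<close>)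
    qed
    note ent = this
    have "T' = T' $$ (?N, 0) \<cdot>\<^sub>m ?T"
    proof (rule eq_matI)
      fix i j assume "i < dim_row (T' $$ (?N, 0) \<cdot>\<^sub>m ?T)" "j < dim_col (T' $$ (?N, 0) \<cdot>\<^sub>m ?T)"
      hence "i \<le> ?N" "j = 0" using T by auto
      thus "T' $$ (i, j) = (T' $$ (?N, 0) \<cdot>\<^sub>m ?T) $$ (i, j)" using ent[of i] T by simp
    qed (use c T in auto)
    thus ?thesis by blast
  qed
  show ?thesis unfolding first_copy_def using 1 2 3 4 by blast
qed

text \<open>The matrix Q carries E to the monomial model, so intertwiners from E are the T * Q with
  T an intertwiner from the model; for T the conditions are read off entry by entry.\<close>

lemma two_form_intertwiner:
  assumes E: "two_form E k P Q" and T: "T \<in> carrier_mat (n + 1) 2"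
  shows "intertwiner D E (sym_pow n) (T * Q) \<longleftrightarrow> (\<forall>a. a ^ m = 1 \<longrightarrow> (\<forall>i\<le>n.
     wt n a i * T $$ (i, 0) = a ^ k * T $$ (i, 0) \<and>
     wt n a i * T $$ (i, 1) = inverse (a ^ k) * T $$ (i, 1) \<and>
     wt n (a0 * a) i * T $$ (n - i, 0) = inverse (a ^ k) * T $$ (i, 1) \<and>
     wt n (a0 * a) i * T $$ (n - i, 1) = a ^ k * T $$ (i, 0)))"
proof -
  have deg: "deg E = 2" and P: "P \<in> carrier_mat 2 2" and Q: "Q \<in> carrier_mat 2 2"
    and PQ: "P * Q = 1\<^sub>m 2" and QP: "Q * P = 1\<^sub>m 2" using E by (auto simp: two_form_def)
  have conj: "(T * Q) * (P * X * Q) = sym_pow n g * (T * Q) \<longleftrightarrow> T * X = sym_pow n g * T"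
    if X: "X \<in> carrier_mat 2 2" for X g
  proof -
    note S = sym_pow_carrier[of n g]
    have TX: "T * X \<in> carrier_mat (n + 1) 2" "sym_pow n g * T \<in> carrier_mat (n + 1) 2" using T X S by auto
    have "P * X * Q = P * (X * Q)" by (rule assoc_mult_mat[OF P X Q])
    hence "(T * Q) * (P * X * Q) = T * (Q * (P * (X * Q)))"
      using assoc_mult_mat[OF T Q, of "P * (X * Q)" 2] P X Q by simp
    also have "Q * (P * (X * Q)) = (Q * P) * (X * Q)" using Q P X by (simp add: assoc_mult_mat[of _ 2 2 _ 2 _ 2])
    also have "T * (Q * P * (X * Q)) = T * X * Q" using T Q X QP
      by (simp add: assoc_mult_mat[of _ "n+1" 2 _ 2 _ 2])
    finally have 1: "(T * Q) * (P * X * Q) = T * X * Q" .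
    have 2: "sym_pow n g * (T * Q) = (sym_pow n g * T) * Q" by (rule assoc_mult_mat[symmetric, OF S T Q])
    have canc: "A = B" if "A * Q = B * Q" "A \<in> carrier_mat (n + 1) 2" "B \<in> carrier_mat (n + 1) 2" for A B
    proof -
      have "C * Q * P = C" if "C \<in> carrier_mat (n + 1) 2" for C
        using assoc_mult_mat[OF that Q P] unfolding QP right_mult_one_mat[OF that] .
      from this[OF that(2)] this[OF that(3)] that(1) show ?thesis by (metis (no_types))
    qed
    show ?thesis unfolding 1 2 by (rule iffI[OF canc[OF _ TX]]) auto
  qed
  have e: "(T * mat2 p q r s) $$ (i, 0) = p * T $$ (i, 0) + r * T $$ (i, 1)"
     "(T * mat2 p q r s) $$ (i, 1) = q * T $$ (i, 0) + s * T $$ (i, 1)" if "i \<le> n" for i p q r s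
  proof -
    have "{0..<2::nat} = {0, 1}" by auto
    thus "(T * mat2 p q r s) $$ (i, 0) = p * T $$ (i, 0) + r * T $$ (i, 1)"
     "(T * mat2 p q r s) $$ (i, 1) = q * T $$ (i, 0) + s * T $$ (i, 1)"
      using T that by (simp_all add: scalar_prod_def mult.commute)
  qed
  have eq: "T * X = sym_pow n g * T \<longleftrightarrow> (\<forall>i\<le>n. (sym_pow n g * T) $$ (i, 0) = (T * X) $$ (i, 0)
      \<and> (sym_pow n g * T) $$ (i, 1) = (T * X) $$ (i, 1))" if "X \<in> carrier_mat 2 2" for X g
  proof
    assume A: "\<forall>i\<le>n. (sym_pow n g * T) $$ (i, 0) = (T * X) $$ (i, 0)
      \<and> (sym_pow n g * T) $$ (i, 1) = (T * X) $$ (i, 1)"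
    show "T * X = sym_pow n g * T"
      by (rule eq_matI) (use A T that sym_pow_carrier[of n g] in \<open>auto dest!: less_2_cases' simp del: index_mult_mat(1)\<close>)
  qed auto
  have e_rot: "(T * rot b) $$ (i, 0) = b * T $$ (i, 0)" "(T * rot b) $$ (i, 1) = inverse b * T $$ (i, 1)"
    and e_ref: "(T * ref b) $$ (i, 0) = inverse b * T $$ (i, 1)" "(T * ref b) $$ (i, 1) = b * T $$ (i, 0)"
    if "i \<le> n" for i b
    unfolding rot_def ref_def using e[OF that] by simp_all
  have eq_rot: "T * rot b = sym_pow n (rot a) * T \<longleftrightarrow> (\<forall>i\<le>n.
     wt n a i * T $$ (i, 0) = b * T $$ (i, 0) \<and> wt n a i * T $$ (i, 1) = inverse b * T $$ (i, 1))" for a b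
    unfolding eq[OF rot_carrier] using e_rot[of _ b] sym_rot_mult[OF T, of _ 0 a] sym_rot_mult[OF T, of _ 1 a]
    by (metis one_less_numeral_iff semiring_norm(76) zero_less_numeral)
  have eq_ref: "T * ref b = sym_pow n (ref a) * T \<longleftrightarrow> (\<forall>i\<le>n.
     wt n a i * T $$ (n - i, 0) = inverse b * T $$ (i, 1) \<and> wt n a i * T $$ (n - i, 1) = b * T $$ (i, 0))" for a b
    unfolding eq[OF ref_carrier] using e_ref[of _ b] sym_ref_mult[OF T, of _ 0 a] sym_ref_mult[OF T, of _ 1 a]
    by (metis one_less_numeral_iff semiring_norm(76) zero_less_numeral)
  have "intertwiner D E (sym_pow n) (T * Q) \<longleftrightarrow> (\<forall>a. a ^ m = 1 \<longrightarrow>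
      (T * Q) * (P * rot (a ^ k) * Q) = sym_pow n (rot a) * (T * Q) \<and>
      (T * Q) * (P * ref (a ^ k) * Q) = sym_pow n (ref (a0 * a)) * (T * Q))"
    using T Q deg E by (auto simp: intertwiner_def ball_D two_form_def)
  also have "\<dots> \<longleftrightarrow> (\<forall>a. a ^ m = 1 \<longrightarrow>
      T * rot (a ^ k) = sym_pow n (rot a) * T \<and> T * ref (a ^ k) = sym_pow n (ref (a0 * a)) * T)"
    by (simp add: conj)
  also have "\<dots> \<longleftrightarrow> (\<forall>a. a ^ m = 1 \<longrightarrow> (\<forall>i\<le>n.
     wt n a i * T $$ (i, 0) = a ^ k * T $$ (i, 0) \<and>
     wt n a i * T $$ (i, 1) = inverse (a ^ k) * T $$ (i, 1) \<and>
     wt n (a0 * a) i * T $$ (n - i, 0) = inverse (a ^ k) * T $$ (i, 1) \<and>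
     wt n (a0 * a) i * T $$ (n - i, 1) = a ^ k * T $$ (i, 0)))"
    unfolding eq_rot eq_ref by blast
  finally show ?thesis .
qed

text \<open>The columns are the forms e1^k and a0^(-k) * e2^k.\<close>

definition copy_two :: "nat \<Rightarrow> complex mat" where
  "copy_two k = mat (k + 1) 2 (\<lambda>(i, j). if j = 0 then if i = k then 1 else 0
     else if i = 0 then inverse (a0 ^ k) else 0)"

lemma first_copy_two:
  assumes E: "two_form E k P Q"
  shows "first_copy D E k (copy_two k * Q)"
proof -
  let ?T = "copy_two k"
  have deg: "deg E = 2" and P: "P \<in> carrier_mat 2 2" and Q: "Q \<in> carrier_mat 2 2"
    and PQ: "P * Q = 1\<^sub>m 2" and QP: "Q * P = 1\<^sub>m 2" and k: "0 < k" "2 * k < m"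
    using E by (auto simp: two_form_def)
  have T: "?T \<in> carrier_mat (k + 1) 2" by (simp add: copy_two_def)
  have Ti: "?T $$ (i, 0) = (if i = k then 1 else 0)" "?T $$ (i, 1) = (if i = 0 then inverse (a0 ^ k) else 0)"
    if "i \<le> k" for i using that by (simp_all add: copy_two_def)
  have 1: "intertwiner D E (sym_pow k) (?T * Q)"
    unfolding two_form_intertwiner[OF E T]
  proof (intro allI impI)
    fix a :: complex and i assume a: "a ^ m = 1" and i: "i \<le> k"
    have anz: "a \<noteq> 0" using root_nonzero[OF a] .
    consider "i = k" | "i = 0" | "0 < i" "i < k" using i by linarith
    thus "wt k a i * ?T $$ (i, 0) = a ^ k * ?T $$ (i, 0) \<and>
     wt k a i * ?T $$ (i, 1) = inverse (a ^ k) * ?T $$ (i, 1) \<and>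
     wt k (a0 * a) i * ?T $$ (k - i, 0) = inverse (a ^ k) * ?T $$ (i, 1) \<and>
     wt k (a0 * a) i * ?T $$ (k - i, 1) = a ^ k * ?T $$ (i, 0)"
      using k anz a0 by cases (auto simp: Ti[unfolded One_nat_def] power_mult_distrib)
  qed
  have lift: "\<exists>T1. T1 \<in> carrier_mat (n + 1) 2 \<and> T' = T1 * Q" if "intertwiner D E (sym_pow n) T'" for n T'
  proof (intro exI[of _ "T' * P"] conjI)
    have c: "T' \<in> carrier_mat (n + 1) 2" using that deg by (simp add: intertwiner_def)
    thus "T' * P \<in> carrier_mat (n + 1) 2" using P by simp
    show "T' = T' * P * Q" using c P Q PQ by (simp add: assoc_mult_mat[of _ "n+1" 2 _ 2 _ 2])
  qed
  \<comment> \<open>For i \<le> n \<le> k the absolute value of 2i - n - k is at most 2k < m. The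
    congruence is therefore an equality, and 2i = n + k forces i = n = k.\<close>
  have supp: "n = k \<and> i = n" if n: "n \<le> k" and T1: "T1 \<in> carrier_mat (n + 1) 2" "intertwiner D E (sym_pow n) (T1 * Q)"
      and i: "i \<le> n" "T1 $$ (i, 0) \<noteq> 0" for n T1 i
  proof -
    have "wt n w i = w ^ k"
      using T1(2)[unfolded two_form_intertwiner[OF E T1(1)], rule_format, of w i] i by simp
    hence "int m dvd 2 * int i - int n - int k" using wt_w_dvd i by blast
    moreover have "\<bar>2 * int i - int n - int k\<bar> < int m" using i n k by auto
    ultimately have "2 * int i - int n - int k = 0" using small_dvd by blast
    thus ?thesis using i n by auto
  qed
  have col1: "T1 $$ (i, 1) = wt n a0 i * T1 $$ (n - i, 0)"
    if T1: "T1 \<in> carrier_mat (n + 1) 2" "intertwiner D E (sym_pow n) (T1 * Q)" and i: "i \<le> n" for n T1 i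
    using T1(2)[unfolded two_form_intertwiner[OF E T1(1)], rule_format, of 1 i] i by simp
  have 3: "T' = 0\<^sub>m (n + 1) (deg E)" if n: "n < k" and T': "intertwiner D E (sym_pow n) T'" for n T'
  proof -
    obtain T1 where T1: "T1 \<in> carrier_mat (n + 1) 2" "T' = T1 * Q" using lift[OF T'] by blast
    have z: "T1 $$ (i, 0) = 0" if "i \<le> n" for i
      using supp[of n T1 i] n T1 T' that by auto
    have "T1 = 0\<^sub>m (n + 1) 2"
      by (rule eq_matI) (use T1 z col1[OF T1(1) T'[unfolded T1(2)]] in \<open>auto dest!: less_2_cases'\<close>)
    thus ?thesis using T1 Q deg by simp
  qed
  have 4: "\<exists>c. T' = c \<cdot>\<^sub>m (?T * Q)" if T': "intertwiner D E (sym_pow k) T'" for T'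
  proof -
    obtain T1 where T1: "T1 \<in> carrier_mat (k + 1) 2" "T' = T1 * Q" using lift[OF T'] by blast
    have z: "T1 $$ (i, 0) = T1 $$ (k, 0) * ?T $$ (i, 0)" if "i \<le> k" for i
      using supp[of k T1 i] T1 T' that by (auto simp: Ti)
    have z1: "T1 $$ (i, 1) = T1 $$ (k, 0) * ?T $$ (i, 1)" if i: "i \<le> k" for i
      using col1[OF T1(1) T'[unfolded T1(2)] i] z[of "k - i"] i by (auto simp: Ti[unfolded One_nat_def])
    have "T1 = T1 $$ (k, 0) \<cdot>\<^sub>m ?T"
    proof (rule eq_matI)
      fix i j assume "i < dim_row (T1 $$ (k, 0) \<cdot>\<^sub>m ?T)" "j < dim_col (T1 $$ (k, 0) \<cdot>\<^sub>m ?T)"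
      hence "i \<le> k" "j = 0 \<or> j = 1" using T by auto
      thus "T1 $$ (i, j) = (T1 $$ (k, 0) \<cdot>\<^sub>m ?T) $$ (i, j)" using z[of i] z1[of i] T by auto
    qed (use T1 T in auto)
    hence "T' = (T1 $$ (k, 0) \<cdot>\<^sub>m ?T) * Q" using T1(2) by simp
    also have "\<dots> = T1 $$ (k, 0) \<cdot>\<^sub>m (?T * Q)" using T Q by (rule mult_smult_assoc_mat)
    finally show ?thesis by blast
  qed
  have 2: "?T * Q \<noteq> 0\<^sub>m (k + 1) (deg E)"
  proof
    assume "?T * Q = 0\<^sub>m (k + 1) (deg E)"
    hence "?T * Q * P = 0\<^sub>m (k + 1) 2" using P deg by simp
    hence "?T = 0\<^sub>m (k + 1) 2" using T Q P QP by (simp add: assoc_mult_mat[of _ "k+1" 2 _ 2 _ 2])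
    thus False using Ti(1)[of k] by (auto dest: arg_cong[where f = "\<lambda>A. A $$ (k, 0)"])
  qed
  show ?thesis unfolding first_copy_def using 1 2 3 4 by blast
qed

lemma b_value_one: "one_form E h \<epsilon> \<Longrightarrow> b_value D E = label_one h \<epsilon>"
  using first_copy_one b_value_eq by blast

lemma b_value_two: "two_form E k P Q \<Longrightarrow> b_value D E = k"
  using first_copy_two b_value_eq by blast

lemma irr_first_copy: "irr D E \<Longrightarrow> \<exists>T. first_copy D E (b_value D E) T"
  by (erule irr_form) (metis first_copy_one b_value_eq, metis first_copy_two b_value_eq)

end

section \<open>Words and Coxeter generators\<close>

definition WP :: "complex mat list \<Rightarrow> complex mat" where "WP us = word_prod 2 id us"

lemma word_prod_simps [simp]:
  "word_prod n M [] = 1\<^sub>m n" "word_prod n M (s # us) = M s * word_prod n M us"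
  by (simp_all add: word_prod_def)

lemma word_prod_carrier:
  "(\<And>s. s \<in> set us \<Longrightarrow> M s \<in> carrier_mat n n) \<Longrightarrow> word_prod n M us \<in> carrier_mat n n"
  by (induction us) (auto intro!: mult_carrier_mat)

lemma word_prod_append:
  assumes "\<And>s. s \<in> set us \<union> set vs \<Longrightarrow> M s \<in> carrier_mat n n"
  shows "word_prod n M (us @ vs) = word_prod n M us * word_prod n M vs"
  using assms
proof (induction us)
  case Nil thus ?case using word_prod_carrier[of vs M n] by simp
next
  case (Cons s us)
  have "M s \<in> carrier_mat n n" "word_prod n M us \<in> carrier_mat n n" "word_prod n M vs \<in> carrier_mat n n"
    using Cons.prems word_prod_carrier[of us M n] word_prod_carrier[of vs M n] by auto
  thus ?case using Cons by (simp add: assoc_mult_mat[of _ n n _ n _ n])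
qed

lemma ref_one [simp]: "ref b * 1\<^sub>m 2 = ref b" "rot b * 1\<^sub>m 2 = rot b"
  by (rule right_mult_one_mat[OF ref_carrier], rule right_mult_one_mat[OF rot_carrier])
lemma WP_simps [simp]: "WP [] = 1\<^sub>m 2" "WP (s # us) = s * WP us"
  by (simp_all add: WP_def)
lemma WP_carrier: "set us \<subseteq> carrier_mat 2 2 \<Longrightarrow> WP us \<in> carrier_mat 2 2"
  unfolding WP_def by (rule word_prod_carrier) auto
lemma WP_append:
  "set us \<subseteq> carrier_mat 2 2 \<Longrightarrow> set vs \<subseteq> carrier_mat 2 2 \<Longrightarrow> WP (us @ vs) = WP us * WP vs"
  unfolding WP_def by (rule word_prod_append) auto

lemmas word_length_alt = word_length_def[folded WP_def]
lemmas reduced_alt = reduced_def[folded WP_def]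
lemmas coxeter_generators_alt = coxeter_generators_def[folded WP_def]

lemma length_alternating [simp]: "length (alternating k s t) = k"
  by (induction k arbitrary: s t) auto
lemma set_alternating: "set (alternating k s t) \<subseteq> {s, t}"
proof (induction k arbitrary: s t)
  case (Suc k) thus ?case using Suc.IH[of t s] by auto
qed auto
lemma alternating_Suc_Suc: "alternating (Suc (Suc k)) s t = s # t # alternating k s t" by simp
lemma take_alternating: "j \<le> k \<Longrightarrow> take j (alternating k s t) = alternating j s t"
proof (induction j arbitrary: k s t)
  case (Suc j) thus ?case by (cases k) auto
qed auto

lemma alternating_if_no_repeat:
  assumes "set us \<subseteq> {s, t}" "\<And>xs u ys. us \<noteq> xs @ [u, u] @ ys"
  shows "us = alternating (length us) s t \<or> us = alternating (length us) t s"
  using assms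
proof (induction us)
  case (Cons u us)
  have "us = alternating (length us) s t \<or> us = alternating (length us) t s"
  proof (rule Cons.IH)
    show "us \<noteq> xs @ [v, v] @ ys" for xs v ys using Cons.prems(2)[of "u # xs" v ys] by auto
  qed (use Cons.prems in auto)
  moreover have "us = [] \<or> hd us \<noteq> u"
    using Cons.prems(2)[of "[]" u "tl us"] by (cases us) auto
  ultimately show ?case using Cons.prems(1) by (cases us) auto
qed auto

lemma WP_alternating:
  assumes "b \<noteq> 0" "c \<noteq> 0"
  shows "WP (alternating (2 * p) (ref b) (ref c)) = rot ((b / c) ^ p)"
    "WP (alternating (Suc (2 * p)) (ref b) (ref c)) = ref ((b / c) ^ p * b)"
proof -
  show *: "WP (alternating (2 * p) (ref b) (ref c)) = rot ((b / c) ^ p)" for p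
  proof (induction p)
    case (Suc p)
    have "2 * Suc p = Suc (Suc (2 * p))" by simp
    hence "WP (alternating (2 * Suc p) (ref b) (ref c)) = ref b * (ref c * rot ((b / c) ^ p))"
      by (simp only: alternating_Suc_Suc WP_simps Suc)
    thus ?case by simp
  qed simp
  have "WP (alternating (Suc (2 * p)) (ref b) (ref c)) = ref (b / (c / b) ^ p)"
  proof -
    have "WP (alternating (2 * p) (ref c) (ref b)) = rot ((c / b) ^ p)"
    proof (induction p)
      case (Suc p)
      have "2 * Suc p = Suc (Suc (2 * p))" by simp
      hence "WP (alternating (2 * Suc p) (ref c) (ref b)) = ref c * (ref b * rot ((c / b) ^ p))"
        by (simp only: alternating_Suc_Suc WP_simps Suc)
      thus ?case by simp
    qed simp
    thus ?thesis by simp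
  qed
  also have "b / (c / b) ^ p = (b / c) ^ p * b" using assms by (simp add: power_divide)
  finally show "WP (alternating (Suc (2 * p)) (ref b) (ref c)) = ref ((b / c) ^ p * b)" .
qed

lemma word_length_le: "set us \<subseteq> S \<Longrightarrow> word_length S (WP us) \<le> length us"
  unfolding word_length_alt by (rule Least_le) blast

lemma reduced_word:
  assumes "set us \<subseteq> S"
  shows "\<exists>vs. reduced S vs \<and> WP vs = WP us"
proof -
  have "\<exists>vs. set vs \<subseteq> S \<and> length vs = word_length S (WP us) \<and> WP vs = WP us"
    unfolding word_length_alt by (rule LeastI) (use assms in blast)
  thus ?thesis unfolding reduced_alt by metis
qed

lemma reducedD: "reduced S us \<Longrightarrow> set us \<subseteq> S" "reduced S us \<Longrightarrow> word_length S (WP us) = length us"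
  by (auto simp: reduced_alt)

lemma generate_word:
  assumes "w \<in> generate (GL 2) S" "S \<subseteq> carrier_mat 2 2" "\<And>s. s \<in> S \<Longrightarrow> inv\<^bsub>GL 2\<^esub> s = s"
  shows "\<exists>us. set us \<subseteq> S \<and> WP us = w"
  using assms(1)
proof (induction rule: generate.induct)
  case one thus ?case by (intro exI[of _ "[]"]) auto
next
  case (incl h) thus ?case using assms(2) by (intro exI[of _ "[h]"]) auto
next
  case (inv h) thus ?case using assms(2,3) by (intro exI[of _ "[h]"]) auto
next
  case (eng g h)
  then obtain us vs where "set us \<subseteq> S" "WP us = g" "set vs \<subseteq> S" "WP vs = h" by auto
  thus ?case using assms(2) WP_append[of us vs] by (intro exI[of _ "us @ vs"]) auto
qed

lemma reduced_no_repeat: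
  assumes "reduced S us" "\<And>s. s \<in> S \<Longrightarrow> s * s = 1\<^sub>m 2" "S \<subseteq> carrier_mat 2 2"
  shows "us \<noteq> xs @ [u, u] @ ys"
proof
  assume us: "us = xs @ [u, u] @ ys"
  have S: "set xs \<subseteq> S" "set ys \<subseteq> S" "u \<in> S" using assms(1) us by (auto simp: reduced_alt)
  have c: "WP xs \<in> carrier_mat 2 2" "WP ys \<in> carrier_mat 2 2" "u \<in> carrier_mat 2 2"
    using S assms(3) by (auto intro!: WP_carrier)
  have "WP us = WP xs * WP ([u, u] @ ys)"
    unfolding us by (rule WP_append) (use S assms(3) in auto)
  also have "WP ([u, u] @ ys) = (u * u) * WP ys" using c by (simp add: assoc_mult_mat[of _ 2 2 _ 2 _ 2])
  also have "\<dots> = WP ys" using c S assms(2) by simp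
  also have "WP xs * WP ys = WP (xs @ ys)" by (rule WP_append[symmetric]) (use S assms(3) in auto)
  finally have "word_length S (WP us) \<le> length (xs @ ys)" using word_length_le[of "xs @ ys" S] S by auto
  thus False using reducedD(2)[OF assms(1)] us by simp
qed

definition refs :: "complex mat set" where "refs = {ref b | b. b \<noteq> 0}"

lemma refs_props: "s \<in> refs \<Longrightarrow> s \<in> carrier_mat 2 2" "s \<in> refs \<Longrightarrow> s * s = 1\<^sub>m 2"
  "s \<in> refs \<Longrightarrow> inv\<^bsub>GL 2\<^esub> s = s" "s \<in> refs \<Longrightarrow> s \<in> carrier (GL 2)"
  by (auto simp: refs_def)

lemma WP_parity:
  "set us \<subseteq> refs \<Longrightarrow> (even (length us) \<longrightarrow> (\<exists>a. a \<noteq> 0 \<and> WP us = rot a)) \<and>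
     (odd (length us) \<longrightarrow> (\<exists>a. a \<noteq> 0 \<and> WP us = ref a))"
proof (induction us)
  case (Cons s us)
  obtain b where b: "s = ref b" "b \<noteq> 0" using Cons.prems by (auto simp: refs_def)
  show ?case
  proof (cases "even (length us)")
    case True
    then obtain a where "a \<noteq> 0" "WP us = rot a" using Cons by auto
    thus ?thesis using b True by (auto intro!: exI[of _ "b / a"])
  next
    case False
    then obtain a where "a \<noteq> 0" "WP us = ref a" using Cons by auto
    thus ?thesis using b False by (auto intro!: exI[of _ "b / a"])
  qed
qed (auto intro: exI[of _ 1])

lemma same_parity:
  assumes "set us \<subseteq> refs" "set vs \<subseteq> refs" "WP us = WP vs"
  shows "even (length us) \<longleftrightarrow> even (length vs)"
  using WP_parity[OF assms(1)] WP_parity[OF assms(2)] assms(3)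
  by (metis ref_neq_rot)

lemma word_length_parity:
  assumes "S \<subseteq> refs" "set us \<subseteq> S"
  shows "even (word_length S (WP us)) \<longleftrightarrow> even (length us)"
proof -
  obtain vs where vs: "reduced S vs" "WP vs = WP us" using reduced_word[OF assms(2)] by blast
  thus ?thesis using same_parity[of vs us] assms reducedD[OF vs(1)] by force
qed

lemma word_length_0: "word_length S (WP us) = 0 \<Longrightarrow> set us \<subseteq> S \<Longrightarrow> WP us = 1\<^sub>m 2"
  using reduced_word[of us S] reducedD by fastforce

lemma WP_rev:
  assumes "set us \<subseteq> refs"
  shows "WP (rev us) = inv\<^bsub>GL 2\<^esub> (WP us)" "WP us \<in> carrier (GL 2)"
  using assms
proof (induction us)
  case Nil
  { case 1 show ?case using GL.inv_one[of 2] by simp }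
  { case 2 show ?case using GL.one_closed[of 2] by simp }
next
  case (Cons s us)
  { case 1
    have "WP (rev us @ [s]) = WP (rev us) * WP [s]"
      by (rule WP_append) (use 1 refs_props in auto)
    also have "\<dots> = inv\<^bsub>GL 2\<^esub> (WP us) \<otimes>\<^bsub>GL 2\<^esub> inv\<^bsub>GL 2\<^esub> s"
      using Cons.IH 1 refs_props(1,3)[of s] by simp
    also have "\<dots> = inv\<^bsub>GL 2\<^esub> (s \<otimes>\<^bsub>GL 2\<^esub> WP us)"
      by (rule GL.inv_mult_group[symmetric]) (use Cons.IH 1 refs_props(4) in auto)
    finally show ?case by simp }
  { case 2
    have "s \<otimes>\<^bsub>GL 2\<^esub> WP us \<in> carrier (GL 2)"
      by (rule GL.m_closed) (use Cons.IH 2 refs_props(4) in auto)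
    thus ?case by simp }
qed

lemma word_length_inv_le:
  assumes "S \<subseteq> refs" "set us \<subseteq> S"
  shows "word_length S (inv\<^bsub>GL 2\<^esub> (WP us)) \<le> word_length S (WP us)"
proof -
  obtain vs where vs: "reduced S vs" "WP vs = WP us" using reduced_word[OF assms(2)] by blast
  have v: "set vs \<subseteq> S" "set vs \<subseteq> refs" using reducedD(1)[OF vs(1)] assms by auto
  have "word_length S (WP (rev vs)) \<le> length vs" using word_length_le[of "rev vs" S] v by simp
  thus ?thesis using WP_rev(1)[OF v(2)] vs reducedD(2)[OF vs(1)] by simp
qed

lemma word_length_inv:
  assumes "S \<subseteq> refs" "set us \<subseteq> S"
  shows "word_length S (inv\<^bsub>GL 2\<^esub> (WP us)) = word_length S (WP us)"
proof -
  have r: "set us \<subseteq> refs" using assms by auto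
  have "inv\<^bsub>GL 2\<^esub> (WP (rev us)) = WP us" using WP_rev[OF r] by simp
  thus ?thesis using word_length_inv_le[OF assms] word_length_inv_le[of S "rev us"] assms WP_rev(1)[OF r]
    by simp
qed

text \<open>In the orthogonal group of the plane a product of three reflections is a reflection, so
  abc = cba. If a, b, c are distinct Coxeter generators, the exchange condition then makes them
  commute pairwise, so that all the products of two of them equal -1.\<close>

lemma coxeter_at_most_two:
  assumes S: "S \<subseteq> refs"
    and ex: "\<And>us s. s \<in> S \<Longrightarrow> reduced S us \<Longrightarrow> word_length S (WP (s # us)) \<le> length us \<Longrightarrow>
      \<exists>i<length us. WP (s # us) = WP (take i us @ drop (Suc i) us)"
    and abc: "{a, b, c} \<subseteq> S" "a \<noteq> b" "b \<noteq> c" "a \<noteq> c"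
  shows False
proof -
  have R: "\<exists>x. s = ref x \<and> x \<noteq> 0" if "s \<in> S" for s using S that by (auto simp: refs_def)
  have two: "reduced S [s, t]" if A: "s \<in> S" "t \<in> S" "s \<noteq> t" for s t
  proof -
    obtain x y where xy: "s = ref x" "t = ref y" "x \<noteq> 0" "y \<noteq> 0"
      using R[OF A(1)] R[OF A(2)] by blast
    have st: "set [s, t] \<subseteq> S" using that by auto
    have "word_length S (WP [s, t]) \<noteq> 0"
      using word_length_0[OF _ st] that xy by auto
    moreover have "word_length S (WP [s, t]) \<le> 2" using word_length_le[OF st] by simp
    moreover have "even (word_length S (WP [s, t]))" using word_length_parity[OF S st] by simp
    ultimately have "word_length S (WP [s, t]) = 2" by presburger
    thus ?thesis using st by (simp add: reduced_alt)
  qed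
  \<comment> \<open>Otherwise t * (u * t) would have length at most 1, and the exchange condition
    would delete a letter of ut, making s equal to t or u.\<close>
  have conj: "WP [t, u, t] \<noteq> s"
    if A: "s \<in> S" "t \<in> S" "u \<in> S" "s \<noteq> t" "t \<noteq> u" "s \<noteq> u" for s t u
  proof
    assume eq: "WP [t, u, t] = s"
    obtain x y v where xy: "s = ref x" "t = ref y" "u = ref v" "x \<noteq> 0" "y \<noteq> 0" "v \<noteq> 0"
      using R[OF A(1)] R[OF A(2)] R[OF A(3)] by blast
    have "word_length S s \<le> 1" using word_length_le[of "[s]" S] that(1) xy by simp
    hence "word_length S (WP (t # [u, t])) \<le> length [u, t]" using eq by simp
    then obtain i where i: "i < length [u, t]" "WP (t # [u, t]) = WP (take i [u, t] @ drop (Suc i) [u, t])"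
      using ex[OF A(2) two[OF A(3,2) A(5)[symmetric]]] by blast
    have "i = 0 \<or> i = 1" using i(1) by auto
    hence "s = t \<or> s = u" using eq xy i(2) by auto
    thus False using that by auto
  qed
  have three: "reduced S [s, t, u]"
    if A: "s \<in> S" "t \<in> S" "u \<in> S" "s \<noteq> t" "t \<noteq> u" "s \<noteq> u" for s t u
  proof -
    obtain x y v where xy: "s = ref x" "t = ref y" "u = ref v" "x \<noteq> 0" "y \<noteq> 0" "v \<noteq> 0"
      using R[OF A(1)] R[OF A(2)] R[OF A(3)] by blast
    have st: "set [s, t, u] \<subseteq> S" using that by auto
    have "odd (word_length S (WP [s, t, u]))" using word_length_parity[OF S st] by simp
    moreover have "word_length S (WP [s, t, u]) \<le> 3" using word_length_le[OF st] by simp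
    moreover have "\<not> word_length S (WP [s, t, u]) \<le> 2"
    proof
      assume "word_length S (WP [s, t, u]) \<le> 2"
      hence "word_length S (WP (s # [t, u])) \<le> length [t, u]" by simp
      then obtain i where i: "i < length [t, u]" "WP (s # [t, u]) = WP (take i [t, u] @ drop (Suc i) [t, u])"
        using ex[OF A(1) two[OF A(2,3,5)]] by blast
      have "i = 0 \<or> i = 1" using i(1) by auto
      hence "WP [s, t, u] = u \<or> WP [s, t, u] = t" using xy i(2) by auto
      thus False
      proof
        assume "WP [s, t, u] = u" thus False using xy that by (auto simp: field_simps)
      next
        assume "WP [s, t, u] = t"
        hence "WP [t, u, t] = s" using xy by (auto simp: field_simps)
        thus False using conj that by blast
      qed
    qed
    ultimately have "word_length S (WP [s, t, u]) = 3" by presburger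
    thus ?thesis using st by (simp add: reduced_alt)
  qed
  have anti: "y = - x" if A: "s \<in> S" "t \<in> S" "u \<in> S" "s \<noteq> t" "t \<noteq> u" "s \<noteq> u"
      and xy: "s = ref x" "t = ref y" "x \<noteq> 0" "y \<noteq> 0" for s t u x y
  proof -
    obtain v where v: "u = ref v" "v \<noteq> 0" using R[OF A(3)] by blast
    \<comment> \<open>From stu = uts the product u * (stu) is ts, of length at most 2, so the
      exchange condition applies to the reduced word stu.\<close>
    have ba: "WP (u # [s, t, u]) = WP [t, s]" using xy v by (simp add: field_simps)
    have "word_length S (WP (u # [s, t, u])) \<le> length [s, t, u]"
      unfolding ba using word_length_le[of "[t, s]" S] that by simp
    then obtain i where i: "i < length [s, t, u]"
      "WP (u # [s, t, u]) = WP (take i [s, t, u] @ drop (Suc i) [s, t, u])"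
      using ex[OF A(3) three[OF A(1-6)]] by blast
    note i = i[unfolded ba]
    have "i = 0 \<or> i = 1 \<or> i = 2" using i(1) by auto
    hence "WP [t, s] = WP [t, u] \<or> WP [t, s] = WP [s, u] \<or> WP [t, s] = WP [s, t]"
      using i(2) by (auto simp: numeral_2_eq_2)
    thus ?thesis
    proof (elim disjE)
      assume "WP [t, s] = WP [t, u]" thus ?thesis using xy v that by (auto simp: field_simps)
    next
      assume "WP [t, s] = WP [s, u]"
      hence "WP [s, t, s] = u" using xy v by (auto simp: field_simps)
      thus ?thesis using conj[of u s t] that by auto
    next
      assume "WP [t, s] = WP [s, t]"
      hence "y * y = x * x" using xy by (auto simp: field_simps)
      thus ?thesis using that by (metis square_eq_iff)
    qed
  qed
  \<comment> \<open>The parameters of b and of c are both minus that of a, so b = c.\<close>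
  obtain x y v where "a = ref x" "b = ref y" "c = ref v" "x \<noteq> 0" "y \<noteq> 0" "v \<noteq> 0"
    using R[of a] R[of b] R[of c] abc by blast
  thus False using anti[of a b c x y] anti[of a c b x v] abc by auto
qed

section \<open>Classification of the Coxeter generating sets of a dihedral group\<close>

context dihedral
begin

text \<open>The last condition says that the product of the two generators has order exactly m. For
  m = 1 the two reflections coincide.\<close>

definition cox_pair :: "complex mat set \<Rightarrow> complex \<Rightarrow> complex \<Rightarrow> bool" where
  "cox_pair S b c \<longleftrightarrow> S = {ref b, ref c} \<and> b \<noteq> 0 \<and> c \<noteq> 0 \<and> (b / a0) ^ m = 1 \<and> (c / a0) ^ m = 1 \<and>
     generate (GL 2) S = D \<and> (\<forall>i. (b / c) ^ i = 1 \<longleftrightarrow> m dvd i)"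

lemma cox_pair_sym: "cox_pair S b c \<Longrightarrow> cox_pair S c b"
proof -
  assume A: "cox_pair S b c"
  have "(c / b) ^ i = inverse ((b / c) ^ i)" for i by (simp add: power_inverse[symmetric])
  hence "(c / b) ^ i = 1 \<longleftrightarrow> (b / c) ^ i = 1" for i by simp
  thus ?thesis using A unfolding cox_pair_def by (auto simp: insert_commute)
qed

lemma cox_pair_generate: "cox_pair S b c \<Longrightarrow> generate (GL 2) S = D"
  unfolding cox_pair_def by (elim conjE)

lemma cox_pair_refs: "cox_pair S b c \<Longrightarrow> S \<subseteq> refs" by (auto simp: cox_pair_def refs_def)

lemma cox_pair_in_D: "cox_pair S b c \<Longrightarrow> s \<in> S \<Longrightarrow> s \<in> D"
  using m by (auto simp: cox_pair_def Dih_ref_iff)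

lemma reduced_alternating:
  assumes "S = {s, t}" "S \<subseteq> refs" "reduced S us"
  shows "us = alternating (length us) s t \<or> us = alternating (length us) t s"
proof (rule alternating_if_no_repeat)
  show "us \<noteq> xs @ [u, u] @ ys" for xs u ys
    by (rule reduced_no_repeat[OF assms(3)]) (use assms(2) refs_props in auto)
qed (use assms reducedD in auto)

lemma words_exist:
  assumes "cox_pair S b c" "v \<in> D"
  shows "\<exists>us. reduced S us \<and> WP us = v"
proof -
  have "v \<in> generate (GL 2) S" using assms by (simp only: cox_pair_generate)
  then obtain us where "set us \<subseteq> S" "WP us = v"
    using generate_word[of v S] cox_pair_refs[OF assms(1)] refs_props by blast
  thus ?thesis using reduced_word by metis
qed

text \<open>There are at most two generators. The rotation \<open>rot w\<close> is an alternating
  word of even length in them, so w is a power of the quotient of their parameters or of its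
  inverse, and that quotient has order m.\<close>

lemma coxeter_imp_pair:
  assumes cox: "coxeter_generators D S"
  shows "\<exists>b c. cox_pair S b c"
proof -
  have gen: "generate (GL 2) S = D" and refl: "\<And>s. s \<in> S \<Longrightarrow> reflection s"
    and ex: "\<And>us s. s \<in> S \<Longrightarrow> reduced S us \<Longrightarrow> word_length S (WP (s # us)) \<le> length us \<Longrightarrow>
      \<exists>i<length us. WP (s # us) = WP (take i us @ drop (Suc i) us)"
    using cox unfolding coxeter_generators_alt by blast+
  have "S \<subseteq> D" unfolding gen[symmetric] by (auto intro: generate.incl)
  hence SD: "S \<subseteq> {ref (a0 * a) | a. a ^ m = 1}" using refl reflections_Dih[OF m a0] by blast
  hence S: "S \<subseteq> refs" unfolding refs_def using root_nonzero by force
  have "D \<noteq> {1\<^sub>m 2}" using ref_in[of 1] ref_neq_1[of a0] by auto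
  hence "S \<noteq> {}" using gen generate_empty_GL by auto
  then obtain s where s: "s \<in> S" by blast
  have "\<exists>t\<in>S. S = {s, t}"
  proof (cases "S = {s}")
    case False
    then obtain t where t: "t \<in> S" "t \<noteq> s" using s by blast
    have "S \<subseteq> {s, t}"
    proof
      fix u assume "u \<in> S"
      thus "u \<in> {s, t}" using coxeter_at_most_two[OF S ex, of s t u] s t by blast
    qed
    thus ?thesis using s t by blast
  qed auto
  then obtain t where st: "S = {s, t}" by blast
  obtain x y where x: "s = ref (a0 * x)" "x ^ m = 1" and y: "t = ref (a0 * y)" "y ^ m = 1"
    using st SD by auto
  have nz: "x \<noteq> 0" "y \<noteq> 0" using root_nonzero x y by auto
  obtain us where us: "set us \<subseteq> S" "WP us = rot w"
    using generate_word[of "rot w" S] gen rot_in[OF w_pow_m] S refs_props by blast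
  then obtain vs where vs: "reduced S vs" "WP vs = rot w" using reduced_word by metis
  have vsr: "set vs \<subseteq> refs" using reducedD(1)[OF vs(1)] S by auto
  have "even (length vs)" using WP_parity[OF vsr] vs(2) rot_neq_ref[OF w_nonzero] by metis
  then obtain p where p: "length vs = 2 * p" by auto
  have "vs = alternating (2 * p) s t \<or> vs = alternating (2 * p) t s"
    using reduced_alternating[OF st S vs(1)] p by simp
  hence wp: "w = (x / y) ^ p \<or> w = (y / x) ^ p"
    using vs(2) WP_alternating(1)[of "a0 * x" "a0 * y" p] WP_alternating(1)[of "a0 * y" "a0 * x" p] nz x y
    by auto
  have "(x / y) ^ i = 1 \<longleftrightarrow> m dvd i" for i
  proof
    assume i: "(x / y) ^ i = 1"
    hence i': "(y / x) ^ i = 1" by (metis inverse_divide inverse_1 power_inverse)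
    have "w ^ i = 1" using wp
    proof
      assume "w = (x / y) ^ p"
      hence "w ^ i = ((x / y) ^ i) ^ p" by (simp add: power_mult[symmetric] mult.commute)
      thus ?thesis using i by simp
    next
      assume "w = (y / x) ^ p"
      hence "w ^ i = ((y / x) ^ i) ^ p" by (simp add: power_mult[symmetric] mult.commute)
      thus ?thesis using i' by simp
    qed
    thus "m dvd i" by (simp add: w_pow_eq_1_iff)
  next
    assume "m dvd i"
    thus "(x / y) ^ i = 1" using x y nz by (auto simp: power_mult power_divide)
  qed
  hence "cox_pair S (a0 * x) (a0 * y)" unfolding cox_pair_def using st x y nz gen by simp
  thus ?thesis by blast
qed

lemma braid_D:
  assumes "cox_pair S b c"
  shows "WP (alternating m (ref b) (ref c)) = WP (alternating m (ref c) (ref b))"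
proof -
  have bc: "b \<noteq> 0" "c \<noteq> 0" and one: "(b / c) ^ m = 1" using assms by (auto simp: cox_pair_def)
  have inv: "(c / b) ^ i = inverse ((b / c) ^ i)" for i by (simp add: power_inverse[symmetric])
  show ?thesis
  proof (cases "even m")
    case True
    then obtain p where p: "m = 2 * p" by auto
    hence "(b / c) ^ p * (b / c) ^ p = 1" using one by (simp add: mult_2 power_add)
    hence "inverse ((b / c) ^ p) = (b / c) ^ p" by (rule inverse_unique)
    thus ?thesis unfolding p using WP_alternating(1)[of b c p] WP_alternating(1)[of c b p] bc inv by simp
  next
    case False
    then obtain p where p: "m = Suc (2 * p)" by (auto elim: oddE)
    have "m = p + Suc p" using p by simp
    hence "(b / c) ^ p * (b / c) ^ Suc p = 1" using one by (simp only: power_add)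
    hence "inverse ((b / c) ^ p) = (b / c) ^ Suc p" by (rule inverse_unique)
    hence "inverse ((b / c) ^ p) = (b / c) ^ p * (b / c)" by (simp only: power_Suc2)
    hence "(b / c) ^ p * b = (c / b) ^ p * c" using bc inv[of p] by simp
    thus ?thesis unfolding p using WP_alternating(2)[of b c p] WP_alternating(2)[of c b p] bc by simp
  qed
qed

text \<open>A shorter reduced word is alternating too and has the same parity. Comparing the
  products gives (b/c)^j = 1 for some j with 0 < j < m.\<close>

lemma length_alt:
  assumes cp: "cox_pair S b c" and k: "k \<le> m"
  shows "word_length S (WP (alternating k (ref b) (ref c))) = k"
proof (rule ccontr)
  let ?A = "alternating k (ref b) (ref c)"
  have bc: "b \<noteq> 0" "c \<noteq> 0" and S: "S = {ref b, ref c}" and prim: "\<And>i. (b / c) ^ i = 1 \<longleftrightarrow> m dvd i"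
    using cp by (auto simp: cox_pair_def)
  have small: "(b / c) ^ i \<noteq> 1" if "0 < i" "i < m" for i using that prim by (auto dest: dvd_imp_le)
  have z: "b / c \<noteq> 0" using bc by simp
  have inv: "(c / b) ^ i = inverse ((b / c) ^ i)" for i by (simp add: power_inverse[symmetric])
  assume ne: "word_length S (WP ?A) \<noteq> k"
  have As: "set ?A \<subseteq> S" using set_alternating[of k "ref b" "ref c"] S by simp
  obtain vs where vs: "reduced S vs" "WP vs = WP ?A" using reduced_word[OF As] by blast
  define j where "j = length vs"
  have j: "j < k" using word_length_le[OF As] ne reducedD(2)[OF vs(1)] vs(2) by (simp add: j_def)
  have par: "even j \<longleftrightarrow> even k"
    using same_parity[of vs ?A] reducedD(1)[OF vs(1)] As cox_pair_refs[OF cp] vs(2) by (auto simp: j_def)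
  have alt: "vs = alternating j (ref b) (ref c) \<or> vs = alternating j (ref c) (ref b)"
    using reduced_alternating[OF S cox_pair_refs[OF cp] vs(1)] by (simp add: j_def)
  show False
  proof (cases "even k")
    case True
    then obtain p i where p: "k = 2 * p" "j = 2 * i" using par by (auto elim!: evenE)
    have eq: "(b / c) ^ p = (b / c) ^ i \<or> (b / c) ^ p = inverse ((b / c) ^ i)"
      using alt vs(2) WP_alternating(1)[of b c p] WP_alternating(1)[of b c i] WP_alternating(1)[of c b i] bc p inv
      by auto
    define x where "x = b / c"
    have "x ^ p = x ^ i * x ^ (p - i)" using j p by (simp flip: power_add)
    hence "x ^ (p - i) = 1 \<or> x ^ (p + i) = 1" using eq z unfolding x_def[symmetric]
      by (auto simp: power_add field_simps)
    hence "(b / c) ^ (p - i) = 1 \<or> (b / c) ^ (p + i) = 1" by (simp only: x_def)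
    thus False using small[of "p - i"] small[of "p + i"] j p k by auto
  next
    case False
    then obtain p i where p: "k = Suc (2 * p)" "j = Suc (2 * i)" using par by (auto elim!: oddE)
    have eq: "(b / c) ^ p * b = (b / c) ^ i * b \<or> (b / c) ^ p * b = inverse ((b / c) ^ i) * c"
      using alt vs(2) WP_alternating(2)[of b c p] WP_alternating(2)[of b c i] WP_alternating(2)[of c b i] bc p inv
      by auto
    define x where "x = b / c"
    have cx: "c = b / x" using bc by (simp add: x_def)
    have xnz: "x \<noteq> 0" using z by (simp add: x_def)
    have eq': "x ^ p * b = x ^ i * b \<or> x ^ p * b = inverse (x ^ i) * (b / x)"
      using eq unfolding x_def[symmetric] cx[symmetric] .
    have "x ^ p = x ^ i * x ^ (p - i)" using j p by (simp flip: power_add)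
    hence "x ^ (p - i) = 1 \<or> x ^ Suc (p + i) = 1" using eq' xnz bc
      by (auto simp: power_add field_simps)
    hence "(b / c) ^ (p - i) = 1 \<or> (b / c) ^ Suc (p + i) = 1" by (simp only: x_def)
    thus False using small[of "p - i"] small[of "Suc (p + i)"] j p k by auto
  qed
qed

text \<open>In an alternating prefix of length m + 1 the braid relation lets the last m letters
  start with the first letter, and two letters cancel.\<close>

lemma reduced_length_le:
  assumes cp: "cox_pair S b c" and us: "reduced S us"
  shows "length us \<le> m"
proof (rule ccontr)
  assume n: "\<not> length us \<le> m"
  have S: "S = {ref b, ref c}" using cp by (simp add: cox_pair_def)
  have main: False if cp: "cox_pair S b c" and us: "us = alternating (length us) (ref b) (ref c)" for b c
  proof -
    have S: "S = {ref b, ref c}" and bc: "b \<noteq> 0" "c \<noteq> 0" using cp by (auto simp: cox_pair_def)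
    have Sc: "S \<subseteq> carrier_mat 2 2" using S by auto
    have usS: "set us \<subseteq> S" using reducedD(1)[OF \<open>reduced S us\<close>] .
    define ys where "ys = drop (Suc m) us"
    have tk: "take (Suc m) us = alternating (Suc m) (ref b) (ref c)"
      using n us take_alternating[of "Suc m" "length us" "ref b" "ref c"] by simp
    have ysS: "set ys \<subseteq> S" unfolding ys_def using usS set_drop_subset[of "Suc m" us] by blast
    have eq: "us = alternating (Suc m) (ref b) (ref c) @ ys" unfolding ys_def tk[symmetric] by simp
    have A: "set (alternating (Suc m) (ref b) (ref c)) \<subseteq> S"
      using set_alternating[of "Suc m" "ref b" "ref c"] S by simp
    obtain n' where n': "m = Suc n'" using m by (cases m) auto
    have "WP (alternating (Suc m) (ref b) (ref c)) = ref b * WP (alternating m (ref b) (ref c))"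
      using braid_D[OF cp] by simp
    also have "\<dots> = ref b * (ref b * WP (alternating n' (ref c) (ref b)))" by (simp add: n')
    also have "\<dots> = (ref b * ref b) * WP (alternating n' (ref c) (ref b))"
      by (rule assoc_mult_mat[symmetric, of _ 2 2 _ 2 _ 2])
        (use set_alternating[of n' "ref c" "ref b"] in \<open>auto intro!: WP_carrier\<close>)
    also have "\<dots> = WP (alternating n' (ref c) (ref b))"
    proof -
      have "WP (alternating n' (ref c) (ref b)) \<in> carrier_mat 2 2"
        using set_alternating[of n' "ref c" "ref b"] by (auto intro!: WP_carrier)
      thus ?thesis using bc by simp
    qed
    finally have short: "WP (alternating (Suc m) (ref b) (ref c)) = WP (alternating n' (ref c) (ref b))" .
    have A': "set (alternating n' (ref c) (ref b)) \<subseteq> S"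
      using set_alternating[of n' "ref c" "ref b"] S by auto
    have "WP us = WP (alternating n' (ref c) (ref b)) * WP ys"
      unfolding eq short[symmetric] by (rule WP_append) (use A ysS Sc in auto)
    also have "\<dots> = WP (alternating n' (ref c) (ref b) @ ys)"
      by (rule WP_append[symmetric]) (use A' ysS Sc in auto)
    finally have "word_length S (WP us) \<le> n' + length ys"
      using word_length_le[of "alternating n' (ref c) (ref b) @ ys" S] A' ysS by simp
    moreover have "length us = Suc m + length ys" using eq by (metis length_append length_alternating)
    ultimately show False using reducedD(2)[OF \<open>reduced S us\<close>] n' by simp
  qed
  show False
    using reduced_alternating[OF S cox_pair_refs[OF cp] us] main[OF cp] main[OF cox_pair_sym[OF cp]] by blast
qed

text \<open>In the exchange condition, if \<open>us\<close> starts with s then two letters cancel.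
  Otherwise \<open>s # us\<close> alternates and is too short, so \<open>us\<close> has length m; by
  the braid relation its product also starts with s, and multiplying by s amounts to deleting its
  last letter.\<close>

lemma cox_pair_coxeter:
  assumes cp: "cox_pair S b c"
  shows "coxeter_generators D S"
proof -
  have S: "S = {ref b, ref c}" and bc: "b \<noteq> 0" "c \<noteq> 0" and gen: "generate (GL 2) S = D"
    using cp by (auto simp: cox_pair_def)
  have "\<exists>i<length us. WP (s # us) = WP (take i us @ drop (Suc i) us)"
    if red: "reduced S us" and len: "word_length S (WP (s # us)) \<le> length us" and s: "s \<in> S" for us s
  proof (cases us)
    case Nil
    have "WP [s] = 1\<^sub>m 2" using word_length_0[of S "[s]"] len Nil s by simp
    thus ?thesis using s S bc right_mult_one_mat[OF ref_carrier] by auto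
  next
    case (Cons u us')
    have usS: "set us \<subseteq> S" using reducedD(1)[OF red] .
    have ss: "s * s = 1\<^sub>m 2" using s S bc by auto
    show ?thesis
    proof (cases "u = s")
      case True
      have c: "s \<in> carrier_mat 2 2" "WP us' \<in> carrier_mat 2 2"
        using s usS S Cons by (auto intro!: WP_carrier)
      have "WP (s # us) = (s * s) * WP us'" using c Cons True by (simp add: assoc_mult_mat[of _ 2 2 _ 2 _ 2])
      also have "\<dots> = WP us'" unfolding ss using c by simp
      finally show ?thesis using Cons by (intro exI[of _ 0]) simp
    next
      case False
      obtain b' c' where b': "cox_pair S b' c'" "s = ref b'" "u = ref c'"
      proof -
        have "u \<in> S" using usS Cons by simp
        hence "s = ref b \<and> u = ref c \<or> s = ref c \<and> u = ref b" using s S False by auto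
        thus thesis using that cp cox_pair_sym[OF cp] by blast
      qed
      define k where "k = length us"
      have S': "S = {ref b', ref c'}" using b'(1) by (simp add: cox_pair_def)
      have ne: "ref b' \<noteq> ref c'" using False b' by simp
      have alt: "us = alternating k u s"
      proof -
        obtain k' where k': "k = Suc k'" using Cons by (simp add: k_def)
        have "us = alternating k s u \<or> us = alternating k u s"
          using reduced_alternating[OF S' cox_pair_refs[OF cp] red] unfolding k_def b'(2,3) .
        moreover have "us \<noteq> alternating k s u"
        proof
          assume "us = alternating k s u"
          hence "hd us = s" unfolding k' by simp
          thus False using False Cons by simp
        qed
        ultimately show ?thesis by blast
      qed
      have km: "k \<le> m" using reduced_length_le[OF cp red] by (simp add: k_def)
      have salt: "s # us = alternating (Suc k) s u" using alt by simp
      have "\<not> Suc k \<le> m"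
      proof
        assume "Suc k \<le> m"
        hence "word_length S (WP (alternating (Suc k) s u)) = Suc k"
          unfolding b'(2,3) by (rule length_alt[OF b'(1)])
        hence "word_length S (WP (s # us)) = Suc k" by (simp only: salt)
        thus False using len by (simp add: k_def)
      qed
      hence k: "k = m" using km by simp
      obtain n where n: "m = Suc n" using m by (cases m) auto
      have A: "WP (alternating n u s) \<in> carrier_mat 2 2"
        using set_alternating[of n u s] b' by (auto intro!: WP_carrier)
      have "WP us = WP (alternating m s u)" using braid_D[OF b'(1)] alt k b' by simp
      hence "WP us = s * WP (alternating n u s)" by (simp add: n)
      hence "WP (s # us) = s * (s * WP (alternating n u s))" by simp
      also have "\<dots> = (s * s) * WP (alternating n u s)"
        by (rule assoc_mult_mat[symmetric, of _ 2 2 _ 2 _ 2]) (use A in \<open>simp_all add: b'(2)\<close>)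
      also have "\<dots> = WP (alternating n u s)" unfolding ss using A by simp
      also have "alternating n u s = take n us @ drop (Suc n) us"
      proof -
        have "take n us = alternating n u s" using alt k n take_alternating[of n k u s] by simp
        moreover have "drop (Suc n) us = []" using k n by (simp add: k_def)
        ultimately show ?thesis by simp
      qed
      finally show ?thesis using k n by (intro exI[of _ n]) (simp add: k_def)
    qed
  qed
  moreover have "\<forall>s\<in>S. reflection s \<and> s * s = 1\<^sub>m 2" using S bc by auto
  ultimately show ?thesis unfolding coxeter_generators_alt using finite_Dih[OF m] gen by blast
qed

lemma cox_pair_exists: "cox_pair {ref a0, ref (a0 * w)} a0 (a0 * w)"
proof -
  have "generate (GL 2) {ref a0, ref (a0 * w)} = D"
    using generate_two[OF m a0 w_pow_m] roots by metis
  moreover have "a0 / (a0 * w) = inverse w" by (simp add: field_simps)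
  hence "(a0 / (a0 * w)) ^ i = inverse (w ^ i)" for i by (simp add: power_inverse)
  hence "(a0 / (a0 * w)) ^ i = 1 \<longleftrightarrow> m dvd i" for i using w_pow_eq_1_iff by simp
  ultimately show ?thesis by (simp add: cox_pair_def)
qed

end

section \<open>Recurrences for two-dimensional representations of Hecke algebras\<close>

lemma hecke_q_altdef: "hecke_q = to_fract [:0, 1:]"
  by (simp add: hecke_q_def to_fract_def)

definition const_fract :: "complex \<Rightarrow> complex poly fract" where
  "const_fract x = to_fract [:x:]"

lemma const_fract_simps [simp]:
  "const_fract 0 = 0" "const_fract 1 = 1" "const_fract (x + y) = const_fract x + const_fract y"
  "const_fract (x * y) = const_fract x * const_fract y" "const_fract (x - y) = const_fract x - const_fract y"
  "const_fract (- x) = - const_fract x"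
  "const_fract (x ^ n) = const_fract x ^ n"
proof -
  show m: "const_fract (x * y) = const_fract x * const_fract y" for x y
    unfolding const_fract_def by (subst to_fract_mult[symmetric]) simp
  show a: "const_fract 1 = 1" by (simp add: const_fract_def flip: one_pCons)
  show "const_fract (x ^ n) = const_fract x ^ n" by (induction n) (auto simp: m a)
  show "const_fract (- x) = - const_fract x"
    unfolding const_fract_def by (subst to_fract_uminus[symmetric]) simp
qed (auto simp: const_fract_def to_fract_add[symmetric] to_fract_diff[symmetric])

lemma const_fract_eq_iff [simp]: "const_fract x = const_fract y \<longleftrightarrow> x = y"
  by (simp add: const_fract_def to_fract_eq_iff)

lemma const_fract_numeral [simp]: "const_fract (numeral n) = numeral n"
proof -
  have "const_fract (of_nat k) = of_nat k" for k by (induction k) simp_all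
  from this[of "numeral n"] show ?thesis by simp
qed

lemma hecke_q_nonzero [simp]: "hecke_q \<noteq> 0"
  by (simp add: hecke_q_altdef to_fract_eq_0_iff)

lemma to_fract_power: "to_fract (p ^ n) = to_fract p ^ n"
  by (induction n) auto

lemma to_fract_sum: "to_fract (sum f A) = (\<Sum>x\<in>A. to_fract (f x))"
  by (induction A rule: infinite_finite_induct) auto

lemma value_at_1_to_fract: "value_at_1 (to_fract p) (poly p 1)"
  unfolding value_at_1_def to_fract_def by (intro exI[of _ p] exI[of _ 1]) simp

lemma value_at_1_unique: assumes "value_at_1 f y" "value_at_1 f z" shows "y = z"
proof -
  obtain a b c d where 1: "f = Fract a b" "poly b 1 \<noteq> 0" "y = poly a 1 / poly b 1"
    "f = Fract c d" "poly d 1 \<noteq> 0" "z = poly c 1 / poly d 1"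
    using assms unfolding value_at_1_def by blast
  have "b \<noteq> 0" "d \<noteq> 0" using 1 by auto
  hence "a * d = c * b" using eq_fract(1)[of b d a c] 1 by metis
  hence "poly a 1 * poly d 1 = poly c 1 * poly b 1" by (metis poly_mult)
  thus ?thesis using 1 by (simp add: frac_eq_eq)
qed

lemma value_at_1_mult: assumes "value_at_1 f y" "value_at_1 g z" shows "value_at_1 (f * g) (y * z)"
proof -
  obtain a b c d where 1: "f = Fract a b" "poly b 1 \<noteq> 0" "y = poly a 1 / poly b 1"
    "g = Fract c d" "poly d 1 \<noteq> 0" "z = poly c 1 / poly d 1"
    using assms unfolding value_at_1_def by blast
  show ?thesis unfolding value_at_1_def
    by (intro exI[of _ "a * c"] exI[of _ "b * d"]) (use 1 in auto)
qed

lemma value_at_1_to_fractI: "poly p 1 = z \<Longrightarrow> value_at_1 (to_fract p) z"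
  using value_at_1_to_fract by blast

lemma value_at_1_q: "value_at_1 hecke_q 1"
  unfolding hecke_q_altdef by (rule value_at_1_to_fractI) simp
lemma value_at_1_const: "value_at_1 (const_fract c) c"
  unfolding const_fract_def by (rule value_at_1_to_fractI) simp
lemma value_at_1_minus_1: "value_at_1 (- 1) (- 1)"
  using value_at_1_const[of "-1"] by simp
lemma value_at_1_q_pow: "value_at_1 (hecke_q ^ n) 1"
  unfolding hecke_q_altdef to_fract_power[symmetric] by (rule value_at_1_to_fractI) simp

lemma order_eq_0: "poly p a \<noteq> 0 \<Longrightarrow> Polynomial.order a p = 0"
  using order_root by blast

lemma vanishing_order_iff:
  assumes "f = Fract a b" "a \<noteq> 0" "b \<noteq> 0"
  shows "vanishing_order_at_0 f k \<longleftrightarrow> k = int (Polynomial.order 0 a) - int (Polynomial.order 0 b)"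
proof
  assume "vanishing_order_at_0 f k"
  then obtain c d where 1: "f = Fract c d" "c \<noteq> 0" "d \<noteq> 0"
    "k = int (Polynomial.order 0 c) - int (Polynomial.order 0 d)"
    unfolding vanishing_order_at_0_def by blast
  hence "a * d = c * b" using eq_fract(1)[of b d a c] assms by auto
  hence "Polynomial.order 0 (a * d) = Polynomial.order 0 (c * b)" by simp
  hence "Polynomial.order 0 a + Polynomial.order 0 d = Polynomial.order 0 c + Polynomial.order 0 b"
    using 1 assms by (simp add: order_mult)
  thus "k = int (Polynomial.order 0 a) - int (Polynomial.order 0 b)" using 1 by simp
qed (use assms in \<open>auto simp: vanishing_order_at_0_def\<close>)

lemma order_X_power: "Polynomial.order 0 ([:0, 1:] ^ N :: complex poly) = N"
  using order_power_n_n[of "0::complex" N] by simp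

text \<open>Applied with P the Poincare polynomial and S the sum in the denominator of the generic degree.\<close>

lemma vanishing_order_quotient:
  assumes P: "P = to_fract p" "poly p 0 \<noteq> 0" and S: "S * hecke_q ^ N = to_fract r" "poly r 0 \<noteq> 0"
    and n: "n > 0"
  shows "vanishing_order_at_0 (P * of_nat n / S) k \<longleftrightarrow> k = int N"
proof -
  have r0: "r \<noteq> 0" and p0: "p \<noteq> 0" using P S by auto
  have "S = to_fract r / hecke_q ^ N" using S(1) by (simp add: field_simps)
  moreover have "(of_nat n :: complex poly fract) = to_fract (of_nat n)"
    by (induction n) simp_all
  ultimately have "P * of_nat n / S = to_fract (p * of_nat n * [:0, 1:] ^ N) / to_fract r"
    unfolding P(1) by (simp add: hecke_q_altdef to_fract_power)
  also have "\<dots> = Fract (p * of_nat n * [:0, 1:] ^ N) r"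
    using r0 by (simp add: to_fract_def)
  finally have eq: "P * of_nat n / S = Fract (p * of_nat n * [:0, 1:] ^ N) r" .
  have nz: "p * of_nat n \<noteq> 0" "p * of_nat n * [:0, 1:] ^ N \<noteq> 0" using p0 n by auto
  have "poly (p * of_nat n) 0 \<noteq> 0" using P(2) n by simp
  hence "Polynomial.order 0 (p * of_nat n) = 0" by (rule order_eq_0)
  hence "Polynomial.order 0 (p * of_nat n * [:0, 1:] ^ N) = N"
    using order_mult[OF nz(2)] order_X_power[of N] by simp
  moreover have "Polynomial.order 0 r = 0" using S(2) by (rule order_eq_0)
  ultimately show ?thesis using vanishing_order_iff[OF eq nz(2) r0, of k] by simp
qed

section \<open>Two by two matrices and the recurrences for alternating products\<close>

definition tr2 :: "'a::comm_ring_1 mat \<Rightarrow> 'a" where "tr2 X = X $$ (0,0) + X $$ (1,1)"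
definition dt2 :: "'a::comm_ring_1 mat \<Rightarrow> 'a" where
  "dt2 X = X $$ (0,0) * X $$ (1,1) - X $$ (0,1) * X $$ (1,0)"

lemma mat_trace_2: "X \<in> carrier_mat 2 2 \<Longrightarrow> mat_trace X = tr2 X"
  by (simp add: mat_trace_def tr2_def numeral_2_eq_2)

lemma index_mult_2':
  fixes A B :: "'a::comm_ring_1 mat"
  assumes "A \<in> carrier_mat 2 2" "B \<in> carrier_mat 2 2"
  shows "(A * B) $$ (0, 0) = A $$ (0, 0) * B $$ (0, 0) + A $$ (0, 1) * B $$ (1, 0)"
    "(A * B) $$ (0, 1) = A $$ (0, 0) * B $$ (0, 1) + A $$ (0, 1) * B $$ (1, 1)"
    "(A * B) $$ (1, 0) = A $$ (1, 0) * B $$ (0, 0) + A $$ (1, 1) * B $$ (1, 0)"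
    "(A * B) $$ (1, 1) = A $$ (1, 0) * B $$ (0, 1) + A $$ (1, 1) * B $$ (1, 1)"
proof -
  have "{0..<2::nat} = {0, 1}" by auto
  thus "(A * B) $$ (0, 0) = A $$ (0, 0) * B $$ (0, 0) + A $$ (0, 1) * B $$ (1, 0)"
    "(A * B) $$ (0, 1) = A $$ (0, 0) * B $$ (0, 1) + A $$ (0, 1) * B $$ (1, 1)"
    "(A * B) $$ (1, 0) = A $$ (1, 0) * B $$ (0, 0) + A $$ (1, 1) * B $$ (1, 0)"
    "(A * B) $$ (1, 1) = A $$ (1, 0) * B $$ (0, 1) + A $$ (1, 1) * B $$ (1, 1)"
    using assms by (simp_all add: scalar_prod_def)
qed

lemma tr2_comm: "A \<in> carrier_mat 2 2 \<Longrightarrow> B \<in> carrier_mat 2 2 \<Longrightarrow> tr2 (A * B) = tr2 (B * A)"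
  unfolding tr2_def index_mult_2' by (simp add: algebra_simps)
lemma dt2_mult: "A \<in> carrier_mat 2 2 \<Longrightarrow> B \<in> carrier_mat 2 2 \<Longrightarrow> dt2 (A * B) = dt2 A * dt2 B"
  unfolding dt2_def index_mult_2' by (simp add: algebra_simps)

lemma cayley_hamilton_2:
  fixes C W :: "'a::comm_ring_1 mat"
  assumes "C \<in> carrier_mat 2 2" "W \<in> carrier_mat 2 2" "i \<in> {0, 1}" "j \<in> {0, 1}"
  shows "(C * (C * W)) $$ (i, j) = tr2 C * (C * W) $$ (i, j) - dt2 C * W $$ (i, j)"
  using assms(3,4)
  by (auto simp: index_mult_2'[OF assms(1) mult_carrier_mat[OF assms(1,2)], unfolded One_nat_def]
      index_mult_2'[OF assms(1,2), unfolded One_nat_def] tr2_def dt2_def algebra_simps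
      simp del: index_mult_mat(1))

text \<open>Cayley-Hamilton in the form A B A = tr(AB) A - det(A) adj(B), with adj(B) = tr(B) -
  B.\<close>

lemma triple_product_2:
  fixes A B :: "'a::comm_ring_1 mat"
  assumes A: "A \<in> carrier_mat 2 2" and B: "B \<in> carrier_mat 2 2" and ij: "i \<in> {0, 1}" "j \<in> {0, 1}"
  shows "(A * (B * A)) $$ (i, j) = tr2 (A * B) * A $$ (i, j) + dt2 A * B $$ (i, j)
      - (if i = j then dt2 A * tr2 B else 0)"
  using ij
  by (auto simp: index_mult_2'[OF A mult_carrier_mat[OF B A], unfolded One_nat_def]
      index_mult_2'[OF B A, unfolded One_nat_def] index_mult_2'[OF A B, unfolded One_nat_def]
      tr2_def dt2_def algebra_simps simp del: index_mult_mat(1))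

text \<open>Chebyshev-type sequences. For c = y + 1/y they are y^p + y^(-p), (y^(p+1) - y^(-p)) / (y
  - 1) and (y^p - y^(-p)) / (y - 1/y), up to vanishing denominators. \<open>seq_t\<close> and
  \<open>seq_u\<close> give traces of even and odd alternating products, \<open>seq_s\<close> and
  \<open>seq_u\<close> measure the failure of the braid relation for even and odd m.\<close>

fun seq_t :: "'a::comm_ring_1 \<Rightarrow> nat \<Rightarrow> 'a" where
  "seq_t c 0 = 2" | "seq_t c (Suc 0) = c" | "seq_t c (Suc (Suc p)) = c * seq_t c (Suc p) - seq_t c p"
fun seq_u :: "'a::comm_ring_1 \<Rightarrow> nat \<Rightarrow> 'a" where
  "seq_u c 0 = 1" | "seq_u c (Suc 0) = c + 1" | "seq_u c (Suc (Suc p)) = c * seq_u c (Suc p) - seq_u c p"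
fun seq_s :: "'a::comm_ring_1 \<Rightarrow> nat \<Rightarrow> 'a" where
  "seq_s c 0 = 0" | "seq_s c (Suc 0) = 1" | "seq_s c (Suc (Suc p)) = c * seq_s c (Suc p) - seq_s c p"

lemma seq_const:
  "seq_t (const_fract c) p = const_fract (seq_t c p)"
  "seq_u (const_fract c) p = const_fract (seq_u c p)"
  "seq_s (const_fract c) p = const_fract (seq_s c p)"
  by (induction c p rule: seq_t.induct) auto

lemma seq_u_of_real: "seq_u (complex_of_real c) p = of_real (seq_u c p)"
  by (induction c p rule: seq_u.induct) auto

lemma seq_2: "seq_s (2::complex) p = of_nat p" "seq_u (2::complex) p = 2 * of_nat p + 1"
proof -
  have "seq_s (2::complex) p = of_nat p \<and> seq_s (2::complex) (Suc p) = of_nat (Suc p)"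
    by (induction p) (auto simp: algebra_simps)
  thus "seq_s (2::complex) p = of_nat p" by simp
  have "seq_u (2::complex) p = 2 * of_nat p + 1 \<and> seq_u (2::complex) (Suc p) = 2 * of_nat (Suc p) + 1"
    by (induction p) (auto simp: algebra_simps)
  thus "seq_u (2::complex) p = 2 * of_nat p + 1" by simp
qed

lemma seq_t_root: assumes "y \<noteq> 0" shows "seq_t (y + inverse y :: 'a::field) p = y ^ p + inverse y ^ p"
proof -
  let ?c = "y + inverse y"
  have "seq_t ?c p = y ^ p + inverse y ^ p \<and> seq_t ?c (Suc p) = y ^ Suc p + inverse y ^ Suc p"
    by (induction p) (use assms in \<open>auto simp: field_simps\<close>)
  thus ?thesis by simp
qed

lemma seq_s_root:
  assumes "y \<noteq> 0" shows "(y - inverse y) * seq_s (y + inverse y :: 'a::field) p = y ^ p - inverse y ^ p"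
proof -
  let ?c = "y + inverse y"
  have "(y - inverse y) * seq_s ?c p = y ^ p - inverse y ^ p \<and>
    (y - inverse y) * seq_s ?c (Suc p) = y ^ Suc p - inverse y ^ Suc p"
  proof (induction p)
    case (Suc p)
    have "(y - inverse y) * seq_s ?c (Suc (Suc p)) =
      ?c * ((y - inverse y) * seq_s ?c (Suc p)) - (y - inverse y) * seq_s ?c p"
      by (simp add: algebra_simps)
    also have "\<dots> = ?c * (y ^ Suc p - inverse y ^ Suc p) - (y ^ p - inverse y ^ p)" using Suc by simp
    also have "\<dots> = y ^ Suc (Suc p) - inverse y ^ Suc (Suc p)" using assms by (simp add: field_simps)
    finally show ?case using Suc by simp
  qed simp
  thus ?thesis by simp
qed

lemma seq_u_root:
  assumes "y \<noteq> 0" shows "(y - 1) * seq_u (y + inverse y :: 'a::field) p = y * y ^ p - inverse y ^ p"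
proof -
  let ?c = "y + inverse y"
  have "(y - 1) * seq_u ?c p = y * y ^ p - inverse y ^ p \<and>
    (y - 1) * seq_u ?c (Suc p) = y * y ^ Suc p - inverse y ^ Suc p"
  proof (induction p)
    case 0 show ?case using assms by (simp add: field_simps)
  next
    case (Suc p)
    have "(y - 1) * seq_u ?c (Suc (Suc p)) =
      ?c * ((y - 1) * seq_u ?c (Suc p)) - (y - 1) * seq_u ?c p"
      by (simp add: algebra_simps)
    also have "\<dots> = ?c * (y * y ^ Suc p - inverse y ^ Suc p) - (y * y ^ p - inverse y ^ p)" using Suc by simp
    also have "\<dots> = y * y ^ Suc (Suc p) - inverse y ^ Suc (Suc p)" using assms by (simp add: field_simps)
    finally show ?case using Suc by simp
  qed
  thus ?thesis by simp
qed

text \<open>A nonzero complex polynomial splits into linear factors over the complex numbers, so it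
  acquires no new roots in the field of rational functions.\<close>

lemma constant_root:
  assumes "r \<noteq> 0" "poly (map_poly const_fract r) c = 0"
  shows "\<exists>g. c = const_fract g"
proof -
  interpret h: comm_ring_hom const_fract by standard auto
  interpret mp: map_poly_comm_ring_hom const_fract ..
  show ?thesis using assms
  proof (induction "degree r" arbitrary: r)
    case 0
    then obtain a where "r = [:a:]" "a \<noteq> 0" by (metis degree_0_id pCons_0_0 degree_eq_zeroE)
    thus ?case using 0(3) const_fract_eq_iff[of a 0] by (simp add: h.map_poly_pCons_hom)
  next
    case (Suc n)
    hence "\<not> constant (poly r)" by (simp add: constant_degree)
    then obtain z where "poly r z = 0" using fundamental_theorem_of_algebra by blast
    then obtain s where s: "r = [:- z, 1:] * s" by (auto simp: poly_eq_0_iff_dvd)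
    have s0: "s \<noteq> 0" using s Suc(3) by auto
    have "degree r = Suc (degree s)" unfolding s using s0 by (subst degree_mult_eq) auto
    hence ds: "n = degree s" using Suc(2) by simp
    have "map_poly const_fract r = map_poly const_fract [:- z, 1:] * map_poly const_fract s"
      unfolding s by (rule mp.hom_mult)
    also have "map_poly const_fract [:- z, 1:] = [:- const_fract z, 1:]"
      by (simp add: h.map_poly_pCons_hom)
    finally have "map_poly const_fract r = [:- const_fract z, 1:] * map_poly const_fract s" .
    hence "poly (map_poly const_fract r) c = poly [:- const_fract z, 1:] c * poly (map_poly const_fract s) c"
      by (simp only: poly_mult)
    hence "(c - const_fract z) * poly (map_poly const_fract s) c = 0" using Suc(4) by simp
    thus ?case using Suc(1)[OF ds s0] by auto
  qed
qed

lemma seq_poly: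
  shows "poly (map_poly const_fract (seq_s [:0, 1:] p)) c = seq_s c p"
    "poly (map_poly const_fract (seq_u [:0, 1:] p)) c = seq_u c p"
    "poly (seq_s [:0, 1:] p) z = seq_s (z::complex) p" "poly (seq_u [:0, 1:] p) z = seq_u z p"
proof -
  interpret h: comm_ring_hom const_fract by standard auto
  interpret mp: map_poly_comm_ring_hom const_fract ..
  have X: "map_poly const_fract [:0, 1:] = [:0, 1:]" by (simp add: h.map_poly_pCons_hom)
  have "poly (map_poly const_fract (seq_s [:0, 1:] p)) c = seq_s c p \<and>
    poly (map_poly const_fract (seq_s [:0, 1:] (Suc p))) c = seq_s c (Suc p)"
    by (induction p) (auto simp: mp.hom_mult mp.hom_minus X simp del: mult_pCons_left)
  thus "poly (map_poly const_fract (seq_s [:0, 1:] p)) c = seq_s c p" by simp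
  have "poly (map_poly const_fract (seq_u [:0, 1:] p)) c = seq_u c p \<and>
    poly (map_poly const_fract (seq_u [:0, 1:] (Suc p))) c = seq_u c (Suc p)"
    by (induction p) (auto simp: mp.hom_mult mp.hom_minus mp.hom_add X simp del: mult_pCons_left)
  thus "poly (map_poly const_fract (seq_u [:0, 1:] p)) c = seq_u c p" by simp
  have "poly (seq_s [:0, 1:] p) z = seq_s z p \<and> poly (seq_s [:0, 1:] (Suc p)) z = seq_s z (Suc p)"
    by (induction p) auto
  thus "poly (seq_s [:0, 1:] p) z = seq_s z p" by simp
  have "poly (seq_u [:0, 1:] p) z = seq_u z p \<and> poly (seq_u [:0, 1:] (Suc p)) z = seq_u z (Suc p)"
    by (induction p) auto
  thus "poly (seq_u [:0, 1:] p) z = seq_u z p" by simp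
qed

text \<open>As polynomials in c with complex coefficients these sequences are nonzero, because at c
  = 2 they take the values p and 2p + 1. Their roots are therefore constant.\<close>

lemma seq_zero_constant:
  assumes "(p > 0 \<and> seq_s c p = 0) \<or> seq_u c p = 0"
  shows "\<exists>g. c = const_fract g"
  using assms
proof
  assume A: "p > 0 \<and> seq_s c p = 0"
  hence "poly (seq_s [:0, 1:] p) (2::complex) \<noteq> 0" by (simp add: seq_poly seq_2)
  hence "(seq_s [:0, 1:] p :: complex poly) \<noteq> 0" by auto
  thus ?thesis using constant_root A by (metis seq_poly(1))
next
  assume A: "seq_u c p = 0"
  have "(2 * of_nat p + 1 :: complex) \<noteq> 0"
  proof -
    have "(of_nat (2 * p + 1) :: complex) \<noteq> 0" by (simp only: of_nat_eq_0_iff)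
    thus ?thesis by (simp add: add.commute)
  qed
  hence "poly (seq_u [:0, 1:] p) (2::complex) \<noteq> 0" by (simp add: seq_poly seq_2)
  hence "(seq_u [:0, 1:] p :: complex poly) \<noteq> 0" by auto
  thus ?thesis using constant_root A by (metis seq_poly(2))
qed

text \<open>Scaling by q^p reduces the recurrence with trace q * c and determinant q^2 to the one
  with trace c and determinant 1.\<close>

lemma seq_solution:
  fixes f g :: "nat \<Rightarrow> 'a::comm_ring_1"
  assumes "\<And>p. f (Suc (Suc p)) = q * c * f (Suc p) - q * q * f p"
    and "f 0 = K * g 0" "f 1 = K * q * g 1"
    and "\<And>p. g (Suc (Suc p)) = c * g (Suc p) - g p"
  shows "f p = K * q ^ p * g p"
proof -
  have "f p = K * q ^ p * g p \<and> f (Suc p) = K * q ^ Suc p * g (Suc p)"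
  proof (induction p)
    case (Suc p)
    have "f (Suc (Suc p)) = q * c * (K * q ^ Suc p * g (Suc p)) - q * q * (K * q ^ p * g p)"
      using assms(1)[of p] Suc by simp
    also have "\<dots> = K * q ^ Suc (Suc p) * (c * g (Suc p) - g p)" by (simp add: algebra_simps)
    finally show ?case using Suc assms(4)[of p] by simp
  qed (use assms in auto)
  thus ?thesis by simp
qed

text \<open>A and B stand for the images of the two generators in a two-dimensional representation of the
  Hecke algebra, with eigenvalues q and -1.\<close>

locale hecke_pair =
  fixes q c :: "'a::field" and A B :: "'a mat"
  assumes A: "A \<in> carrier_mat 2 2" and B: "B \<in> carrier_mat 2 2"
    and trA: "tr2 A = q - 1" and trB: "tr2 B = q - 1" and dtA: "dt2 A = - q" and dtB: "dt2 B = - q"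
    and trAB: "tr2 (A * B) = q * c"
begin

lemma flip: "hecke_pair q c B A"
  using A B trA trB dtA dtB trAB tr2_comm[OF A B] by unfold_locales auto

fun alt :: "nat \<Rightarrow> 'a mat" where
  "alt 0 = 1\<^sub>m 2" | "alt (Suc 0) = A" | "alt (Suc (Suc k)) = (A * B) * alt k"

lemma alt_carrier [simp]: "alt k \<in> carrier_mat 2 2"
  by (induction k rule: alt.induct) (use A B in auto)

lemma dtAB: "dt2 (A * B) = q * q"
  by (simp add: dt2_mult A B dtA dtB)

lemma alt_rec:
  assumes "i \<in> {0, 1}" "j \<in> {0, 1}"
  shows "alt (k + 4) $$ (i, j) = q * c * alt (k + 2) $$ (i, j) - q * q * alt k $$ (i, j)"
proof -
  have "alt (k + 4) = (A * B) * ((A * B) * alt k)" "alt (k + 2) = (A * B) * alt k"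
    by (simp_all only: add_Suc_right eval_nat_numeral add_0_right alt.simps One_nat_def BitM.simps)
  thus ?thesis
    using cayley_hamilton_2[OF mult_carrier_mat[OF A B] alt_carrier, of i j k] assms by (simp only: trAB dtAB)
qed

lemma tr_alt_rec: "tr2 (alt (k + 4)) = q * c * tr2 (alt (k + 2)) - q * q * tr2 (alt k)"
  unfolding tr2_def by (simp add: alt_rec algebra_simps)

lemma tr_ABA: "tr2 (A * B * A) = (q - 1) * (q * (c + 1))"
proof -
  have "tr2 (A * B * A) = tr2 A * tr2 (A * B) - dt2 A * tr2 B"
    using A B unfolding tr2_def dt2_def
    by (simp add: index_mult_2'[OF A mult_carrier_mat[OF B A]] index_mult_2'[OF A B] index_mult_2'[OF B A]
       algebra_simps del: index_mult_mat(1) One_nat_def)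
  thus ?thesis by (simp add: trA trB dtA trAB algebra_simps)
qed

lemma tr_alt: "tr2 (alt (2 * p)) = q ^ p * seq_t c p" "tr2 (alt (Suc (2 * p))) = (q - 1) * q ^ p * seq_u c p"
proof -
  have e: "2 * p + 4 = 2 * Suc (Suc p)" "2 * p + 2 = 2 * Suc p"
    "Suc (2 * p) + 4 = Suc (2 * Suc (Suc p))" "Suc (2 * p) + 2 = Suc (2 * Suc p)" for p by auto
  have "tr2 (alt (2 * 0)) = 1 * seq_t c 0" "tr2 (alt (2 * 1)) = 1 * q * seq_t c 1"
    using A B by (simp_all add: trAB numeral_2_eq_2) (simp add: tr2_def)
  from seq_solution[where f = "\<lambda>p. tr2 (alt (2 * p))" and g = "seq_t c" and p = p, OF tr_alt_rec[of "2 * p" for p, unfolded e] this]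
  show "tr2 (alt (2 * p)) = q ^ p * seq_t c p" by simp
  have "tr2 (alt (Suc (2 * 0))) = (q - 1) * seq_u c 0" "tr2 (alt (Suc (2 * 1))) = (q - 1) * q * seq_u c 1"
    using A B tr_ABA by (simp_all add: trA numeral_2_eq_2 algebra_simps)
  from seq_solution[where f = "\<lambda>p. tr2 (alt (Suc (2 * p)))" and g = "seq_u c" and p = p,
      OF tr_alt_rec[of "Suc (2 * p)" for p, unfolded e] this]
  show "tr2 (alt (Suc (2 * p))) = (q - 1) * q ^ p * seq_u c p" by simp
qed

end

context hecke_pair
begin

interpretation f: hecke_pair q c B A by (rule flip)

text \<open>The difference of the two alternating products satisfies the same recurrence, starting
  from AB - BA or from A - B. In the even case the factor q on the left keeps the solution formula
  free of division by q.\<close>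

lemma braid_entry:
  assumes "i \<in> {0, 1}" "j \<in> {0, 1}"
  shows "q * (alt (2 * p) $$ (i, j) - f.alt (2 * p) $$ (i, j)) =
      q ^ p * seq_s c p * ((A * B) $$ (i, j) - (B * A) $$ (i, j))"
    "alt (Suc (2 * p)) $$ (i, j) - f.alt (Suc (2 * p)) $$ (i, j) =
      q ^ p * seq_u c p * (A $$ (i, j) - B $$ (i, j))"
proof -
  define d where "d k = alt k $$ (i, j) - f.alt k $$ (i, j)" for k
  have rec: "d (k + 4) = q * c * d (k + 2) - q * q * d k" for k
    unfolding d_def alt_rec[OF assms] f.alt_rec[OF assms] by (simp add: algebra_simps)
  have d2: "d 2 = (A * B) $$ (i, j) - (B * A) $$ (i, j)"
    using A B by (simp add: d_def numeral_2_eq_2)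
  have e: "2 * p + 4 = 2 * Suc (Suc p)" "2 * p + 2 = 2 * Suc p"
    "Suc (2 * p) + 4 = Suc (2 * Suc (Suc p))" "Suc (2 * p) + 2 = Suc (2 * Suc p)" for p by auto
  have "q * d (2 * p) = d 2 * q ^ p * seq_s c p"
  proof (rule seq_solution[where f = "\<lambda>p. q * d (2 * p)" and g = "seq_s c"])
    show "q * d (2 * Suc (Suc p)) = q * c * (q * d (2 * Suc p)) - q * q * (q * d (2 * p))" for p
      unfolding rec[of "2 * p", unfolded e] by (simp only: right_diff_distrib mult.left_commute)
    show "q * d (2 * 0) = d 2 * seq_s c 0" by (simp add: d_def)
  qed auto
  thus "q * (alt (2 * p) $$ (i, j) - f.alt (2 * p) $$ (i, j)) =
      q ^ p * seq_s c p * ((A * B) $$ (i, j) - (B * A) $$ (i, j))"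
    unfolding d2[symmetric] unfolding d_def[symmetric] by (simp only: mult.commute mult.left_commute)
  have d1: "d 1 = A $$ (i, j) - B $$ (i, j)" by (simp add: d_def)
  have d3: "d 3 = q * (c + 1) * d 1"
  proof -
    have "d 3 = (A * (B * A)) $$ (i, j) - (B * (A * B)) $$ (i, j)"
      using A B by (simp add: d_def numeral_3_eq_3)
    also have "\<dots> = (q * c + q) * (A $$ (i, j) - B $$ (i, j))"
      unfolding triple_product_2[OF A B assms] triple_product_2[OF B A assms]
      by (simp add: trAB f.trAB trA trB dtA dtB algebra_simps)
    finally have "d 3 = (q * c + q) * d 1" unfolding d1[symmetric] .
    thus ?thesis by (simp add: algebra_simps)
  qed
  have "d (Suc (2 * p)) = d 1 * q ^ p * seq_u c p"
  proof (rule seq_solution[where f = "\<lambda>p. d (Suc (2 * p))" and g = "seq_u c"])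
    show "d (Suc (2 * Suc (Suc p))) = q * c * d (Suc (2 * Suc p)) - q * q * d (Suc (2 * p))" for p
      using rec[of "Suc (2 * p)", unfolded e] .
    show "d (Suc (2 * 1)) = d 1 * q * seq_u c 1" using d3 by (simp add: numeral_3_eq_3 mult_ac)
  qed auto
  thus "alt (Suc (2 * p)) $$ (i, j) - f.alt (Suc (2 * p)) $$ (i, j) =
      q ^ p * seq_u c p * (A $$ (i, j) - B $$ (i, j))"
    unfolding d1[symmetric] unfolding d_def[symmetric] by (simp only: mult.commute mult.left_commute)
qed

text \<open>Commuting matrices with eigenvalues q and -1 have a product of trace q^2 + 1 or -2q. The
  proof avoids eigenvectors by a polynomial identity.\<close>

lemma commuting:
  assumes "A * B = B * A"
  shows "(q * c - (q * q + 1)) * (q * c + 2 * q) = 0"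
proof -
  obtain a1 a2 a3 a4 where a: "A $$ (0,0) = a1" "A $$ (0,1) = a2" "A $$ (1,0) = a3" "A $$ (1,1) = a4" by auto
  obtain b1 b2 b3 b4 where b: "B $$ (0,0) = b1" "B $$ (0,1) = b2" "B $$ (1,0) = b3" "B $$ (1,1) = b4" by auto
  have t: "a4 = q - 1 - a1" "b4 = q - 1 - b1" using trA trB by (auto simp: tr2_def a b algebra_simps simp del: One_nat_def)
  have dt: "a2 * a3 = a1 * a4 + q" "b2 * b3 = b1 * b4 + q"
    using dtA dtB by (auto simp: dt2_def a b algebra_simps simp del: One_nat_def)
  have s: "q * c = a1 * b1 + a2 * b3 + a3 * b2 + a4 * b4"
    using trAB A B by (simp add: tr2_def index_mult_2' a b add.assoc del: index_mult_mat(1) One_nat_def)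
  have e1: "a1 * b1 + a2 * b3 = b1 * a1 + b2 * a3" "a1 * b2 + a2 * b4 = b1 * a2 + b2 * a4"
     "a3 * b1 + a4 * b3 = b3 * a1 + b4 * a3"
    using arg_cong[OF assms, of "\<lambda>X. X $$ (0,0)"] arg_cong[OF assms, of "\<lambda>X. X $$ (0,1)"]
      arg_cong[OF assms, of "\<lambda>X. X $$ (1,0)"] A B
    by (simp_all add: index_mult_2' a b del: index_mult_mat(1) One_nat_def)
  define \<sigma> where "\<sigma> = a1 * b1 + a2 * b3 + a3 * b2 + a4 * b4"
  \<comment> \<open>The left side is -det(AB - BA); the right side is its expression in the traces
    and determinants of A and B and the trace of AB.\<close>
  have "(a2 * b3 - b2 * a3)\<^sup>2 +
      (a1 * b2 + a2 * b4 - b1 * a2 - b2 * a4) * (a3 * b1 + a4 * b3 - b3 * a1 - b4 * a3) =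
    \<sigma>\<^sup>2 - \<sigma> * (a1 + a4) * (b1 + b4) + (a1 * a4 - a2 * a3) * (b1 + b4)\<^sup>2
      + (b1 * b4 - b2 * b3) * (a1 + a4)\<^sup>2 - 4 * (a1 * a4 - a2 * a3) * (b1 * b4 - b2 * b3)"
    unfolding \<sigma>_def by (simp add: algebra_simps power2_eq_square)
  moreover have "a2 * b3 - b2 * a3 = 0" "a1 * b2 + a2 * b4 - b1 * a2 - b2 * a4 = 0"
    using e1 by (auto simp: algebra_simps)
  moreover have "a1 + a4 = q - 1" "b1 + b4 = q - 1" "a1 * a4 - a2 * a3 = - q" "b1 * b4 - b2 * b3 = - q"
    using t(1,2) dt by auto
  ultimately have "\<sigma>\<^sup>2 - \<sigma> * (q - 1) * (q - 1) + (- q) * (q - 1)\<^sup>2 + (- q) * (q - 1)\<^sup>2 - 4 * (- q) * (- q) = 0"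
    by simp
  thus ?thesis unfolding s \<sigma>_def[symmetric] by (simp add: algebra_simps power2_eq_square)
qed

end

section \<open>Generic degrees\<close>

lemma mat_trace_1: "X \<in> carrier_mat 1 1 \<Longrightarrow> mat_trace X = X $$ (0, 0)"
  by (simp add: mat_trace_def)

text \<open>Applied to constant terms: being nonnegative reals, they cannot cancel, so the order of
  vanishing of a sum is that of its lowest summand.\<close>

lemma sum_nonneg_neq_0:
  assumes "finite A" "\<And>v. v \<in> A \<Longrightarrow> \<exists>y::real. y \<ge> 0 \<and> f v = complex_of_real y" "v0 \<in> A" "f v0 \<noteq> 0"
  shows "sum f A \<noteq> 0"
proof -
  have f: "f v = of_real (Re (f v)) \<and> Re (f v) \<ge> 0" if "v \<in> A" for v using assms(2)[OF that] by auto
  hence "sum f A = (\<Sum>v\<in>A. complex_of_real (Re (f v)))" by (intro sum.cong) auto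
  also have "\<dots> = of_real (\<Sum>v\<in>A. Re (f v))" by simp
  finally have 1: "sum f A = of_real (\<Sum>v\<in>A. Re (f v))" .
  have "Re (f v0) \<noteq> 0" using f[OF assms(3)] assms(4) by auto
  hence "Re (f v0) > 0" using f[OF assms(3)] by auto
  hence "(\<Sum>v\<in>A. Re (f v)) > 0" using f assms(1,3) by (intro sum_pos2[of A v0]) auto
  thus ?thesis unfolding 1 of_real_eq_0_iff by linarith
qed

lemma prod_list_alternating:
  fixes x :: "'b \<Rightarrow> 'a::comm_monoid_mult"
  shows "prod_list (map x (alternating (2 * p) s t)) = (x s * x t) ^ p"
    "prod_list (map x (alternating (Suc (2 * p)) s t)) = (x s * x t) ^ p * x s"
proof -
  show 1: "prod_list (map x (alternating (2 * p) s t)) = (x s * x t) ^ p" for s t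
    by (induction p) (auto simp: ac_simps)
  show "prod_list (map x (alternating (Suc (2 * p)) s t)) = (x s * x t) ^ p * x s"
    using 1[of t s] by (simp add: ac_simps)
qed

lemma word_prod_1:
  assumes "\<And>s. s \<in> set us \<Longrightarrow> M s \<in> carrier_mat 1 1"
  shows "word_prod 1 M us \<in> carrier_mat 1 1 \<and>
    word_prod 1 M us $$ (0, 0) = prod_list (map (\<lambda>s. M s $$ (0, 0)) us)"
  using assms
proof (induction us)
  case (Cons s us)
  hence "M s \<in> carrier_mat 1 1" "word_prod 1 M us \<in> carrier_mat 1 1"
    "word_prod 1 M us $$ (0, 0) = prod_list (map (\<lambda>s. M s $$ (0, 0)) us)" by auto
  thus ?case by (simp add: scalar_prod_def)
qed simp

text \<open>If the trace is not q - 1, the relation makes X diagonal with both entries q or both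
  entries -1. Its trace would specialize to 2 or -2 instead of 0.\<close>

lemma quadratic_2:
  fixes X :: "complex poly fract mat"
  assumes X: "X \<in> carrier_mat 2 2"
    and quad: "(X - hecke_q \<cdot>\<^sub>m 1\<^sub>m 2) * (X + 1\<^sub>m 2) = 0\<^sub>m 2 2" and val: "value_at_1 (tr2 X) 0"
  shows "tr2 X = hecke_q - 1" "dt2 X = - hecke_q"
proof -
  define x1 x2 x3 x4 where x: "x1 = X $$ (0,0)" "x2 = X $$ (0,1)" "x3 = X $$ (1,0)" "x4 = X $$ (1,1)"
  have c: "X - hecke_q \<cdot>\<^sub>m 1\<^sub>m 2 \<in> carrier_mat 2 2" "X + 1\<^sub>m 2 \<in> carrier_mat 2 2" using X by auto
  have e: "(x1 - hecke_q) * (x1 + 1) + x2 * x3 = 0" "(x1 - hecke_q) * x2 + x2 * (x4 + 1) = 0"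
    "x3 * (x1 + 1) + (x4 - hecke_q) * x3 = 0" "x3 * x2 + (x4 - hecke_q) * (x4 + 1) = 0"
    using arg_cong[OF quad, of "\<lambda>X. X $$ (0,0)"] arg_cong[OF quad, of "\<lambda>X. X $$ (0,1)"]
      arg_cong[OF quad, of "\<lambda>X. X $$ (1,0)"] arg_cong[OF quad, of "\<lambda>X. X $$ (1,1)"] X
    unfolding index_mult_2'[OF c] by (simp_all add: x)
  have t: "x1 + x4 = hecke_q - 1"
  proof (rule ccontr)
    assume n: "x1 + x4 \<noteq> hecke_q - 1"
    have "x2 * (x1 + x4 - (hecke_q - 1)) = 0" "x3 * (x1 + x4 - (hecke_q - 1)) = 0"
      using e(2,3) by (auto simp: algebra_simps)
    hence "x2 = 0" "x3 = 0" using n by auto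
    hence "x1 = hecke_q \<or> x1 = -1" "x4 = hecke_q \<or> x4 = -1"
      using e(1,4) by (auto simp: add_eq_0_iff2)
    hence "x1 + x4 = 2 * hecke_q \<or> x1 + x4 = - 2" using n by auto
    hence "value_at_1 (x1 + x4) 2 \<or> value_at_1 (x1 + x4) (- 2)"
      using value_at_1_mult[OF value_at_1_const[of 2] value_at_1_q] value_at_1_const[of "-2"] by auto
    moreover have "value_at_1 (x1 + x4) 0" using val by (simp add: tr2_def x)
    ultimately show False using value_at_1_unique by (metis zero_neq_numeral neg_equal_0_iff_equal)
  qed
  show "tr2 X = hecke_q - 1" using t by (simp add: tr2_def x)
  have x4: "x4 = hecke_q - 1 - x1" using t by (simp add: algebra_simps)
  have "x2 * x3 = - ((x1 - hecke_q) * (x1 + 1))" using e(1) by (simp add: eq_neg_iff_add_eq_0 add.commute)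
  hence "x1 * x4 - x2 * x3 = - hecke_q" unfolding x4 by (simp add: algebra_simps)
  thus "dt2 X = - hecke_q" by (simp add: dt2_def x)
qed

context dihedral
begin

text \<open>The conditions of \<open>a_value\<close> on S and M, without the order of
  vanishing.\<close>

definition hecke_lift :: "complex mat set \<Rightarrow> (complex mat \<Rightarrow> complex mat) \<Rightarrow> (complex mat \<Rightarrow> complex poly fract mat) \<Rightarrow> bool"
  where "hecke_lift S E M \<longleftrightarrow> coxeter_generators D S \<and> hecke_rep S (deg E) M \<and>
     (\<forall>v\<in>D. value_at_1 (hecke_char S (deg E) M v) (mat_trace (E v)))"

definition chosen :: "complex mat set \<Rightarrow> complex mat \<Rightarrow> complex mat list" where
  "chosen S v = (SOME us. reduced S us \<and> WP us = v)"

lemma hecke_char_alt: "hecke_char S n M v = mat_trace (word_prod n M (chosen S v))"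
  by (simp add: hecke_char_def chosen_def WP_def)

lemma chosen:
  assumes "cox_pair S b c" "v \<in> D"
  shows "reduced S (chosen S v)" "WP (chosen S v) = v" "length (chosen S v) = word_length S v"
    "set (chosen S v) \<subseteq> S"
proof -
  show *: "reduced S (chosen S v)" "WP (chosen S v) = v"
    using someI_ex[OF words_exist[OF assms]] by (auto simp: chosen_def)
  show "length (chosen S v) = word_length S v" "set (chosen S v) \<subseteq> S"
    using reducedD[OF *(1)] *(2) by auto
qed

lemma inv_in_D: "v \<in> D \<Longrightarrow> inv\<^bsub>GL 2\<^esub> v \<in> D"
  using subgroup.m_inv_closed[OF Dih_subgroup[OF m a0]] .

lemma word_length_inv_D:
  assumes "cox_pair S b c" "v \<in> D"
  shows "word_length S (inv\<^bsub>GL 2\<^esub> v) = word_length S v"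
  using word_length_inv[OF cox_pair_refs[OF assms(1)] chosen(4)[OF assms]] chosen(2)[OF assms] by simp

lemma WP_in_D: assumes "cox_pair S b c" "set us \<subseteq> S" shows "WP us \<in> D"
  using assms(2)
proof (induction us)
  case (Cons s us)
  have "s \<otimes>\<^bsub>GL 2\<^esub> WP us \<in> D"
    using subgroup.m_closed[OF Dih_subgroup[OF m a0]] Cons cox_pair_in_D[OF assms(1)] by auto
  thus ?case by simp
qed (simp add: one_in)

lemma odd_self_inverse:
  assumes "cox_pair S b c" "v \<in> D" "odd (word_length S v)"
  shows "inv\<^bsub>GL 2\<^esub> v = v"
proof -
  have "set (chosen S v) \<subseteq> refs" using chosen(4)[OF assms(1,2)] cox_pair_refs[OF assms(1)] by blast
  then obtain a where "a \<noteq> 0" "v = ref a"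
    using WP_parity[of "chosen S v"] chosen[OF assms(1,2)] assms(3) by auto
  thus ?thesis by simp
qed

lemma chosen_generator: assumes cp: "cox_pair S b c" and s: "s \<in> S" shows "chosen S s = [s]"
proof -
  have sD: "s \<in> D" using cox_pair_in_D[OF cp s] .
  obtain b' c' where b': "cox_pair S b' c'" "s = ref b'"
  proof -
    have "s = ref b \<or> s = ref c" using cp s by (auto simp: cox_pair_def)
    thus thesis using that cp cox_pair_sym[OF cp] by blast
  qed
  have "word_length S (WP (alternating 1 (ref b') (ref c'))) = 1"
    using length_alt[OF b'(1), of 1] m by simp
  hence "length (chosen S s) = 1" using chosen(3)[OF cp sD] b' by simp
  then obtain u where u: "chosen S s = [u]" by (auto simp: length_Suc_conv)
  hence "u \<in> refs" using chosen(4)[OF cp sD] cox_pair_refs[OF cp] by auto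
  thus ?thesis using chosen(2)[OF cp sD] u by (auto simp: refs_def)
qed

lemma chosen_alternating:
  assumes cp: "cox_pair S b c" and v: "v \<in> D"
  shows "chosen S v = alternating (word_length S v) (ref b) (ref c) \<or>
    chosen S v = alternating (word_length S v) (ref c) (ref b)"
  using reduced_alternating[OF _ cox_pair_refs[OF cp] chosen(1)[OF cp v], of "ref b" "ref c"] cp
  unfolding chosen(3)[OF cp v] by (simp add: cox_pair_def)

lemma ord_pair: assumes "cox_pair S b c" shows "group.ord (GL 2) (ref b * ref c) = m"
proof -
  have bc: "b \<noteq> 0" "c \<noteq> 0" "\<And>i. (b / c) ^ i = 1 \<longleftrightarrow> m dvd i" using assms by (auto simp: cox_pair_def)
  have "m = group.ord (GL 2) (rot (b / c))"
    using GL.ord_unique[of "rot (b / c)" 2 m] bc by simp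
  thus ?thesis by simp
qed

text \<open>The definite description needs one lift and the same order for all lifts. After
  multiplication by q^N the summands of the denominator are polynomials whose constant terms are
  nonnegative reals, not all zero, and the Poincare polynomial has nonzero constant term; so the
  generic degree vanishes to order N.\<close>

lemma a_valueI:
  assumes deg: "deg E > 0" and ex: "\<exists>S M. hecke_lift S E M"
    and terms: "\<And>S b c M. cox_pair S b c \<Longrightarrow> hecke_lift S E M \<Longrightarrow>
      \<exists>f. (\<forall>v\<in>D. hecke_char S (deg E) M v * hecke_char S (deg E) M (inv\<^bsub>GL 2\<^esub> v) /
              hecke_q ^ word_length S v * hecke_q ^ N = to_fract (f v) \<and>
            (\<exists>y::real. y \<ge> 0 \<and> poly (f v) 0 = complex_of_real y)) \<and> (\<exists>v\<in>D. poly (f v) 0 \<noteq> 0)"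
  shows "a_value D E = int N"
proof -
  have fin: "finite D" using finite_Dih[OF m] .
  have key: "vanishing_order_at_0 (generic_degree D S (deg E) M) k \<longleftrightarrow> k = int N"
    if hecke_lift: "hecke_lift S E M" for S M k
  proof -
    obtain b c where cp: "cox_pair S b c" using coxeter_imp_pair hecke_lift unfolding hecke_lift_def by blast
    obtain f v0 where f: "\<And>v. v \<in> D \<Longrightarrow> hecke_char S (deg E) M v * hecke_char S (deg E) M (inv\<^bsub>GL 2\<^esub> v) /
              hecke_q ^ word_length S v * hecke_q ^ N = to_fract (f v)"
        "\<And>v. v \<in> D \<Longrightarrow> \<exists>y::real. y \<ge> 0 \<and> poly (f v) 0 = complex_of_real y"
        "v0 \<in> D" "poly (f v0) 0 \<noteq> 0"
      using terms[OF cp hecke_lift] by blast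
    have S: "(\<Sum>v\<in>D. hecke_char S (deg E) M v * hecke_char S (deg E) M (inv\<^bsub>GL 2\<^esub> v) / hecke_q ^ word_length S v)
        * hecke_q ^ N = to_fract (\<Sum>v\<in>D. f v)"
      unfolding sum_distrib_right to_fract_sum by (rule sum.cong) (use f(1) in auto)
    have S0: "poly (\<Sum>v\<in>D. f v) 0 \<noteq> 0"
      unfolding poly_sum by (rule sum_nonneg_neq_0[OF fin, of _ v0]) (use f(2,3,4) in auto)
    have P: "(\<Sum>v\<in>D. hecke_q ^ word_length S v) = to_fract (\<Sum>v\<in>D. [:0, 1:] ^ word_length S v)"
      unfolding to_fract_sum to_fract_power hecke_q_altdef ..
    have l1: "word_length S (1\<^sub>m 2) = 0" using word_length_le[of "[]" S] by simp
    have P0: "poly (\<Sum>v\<in>D. [:0, 1:] ^ word_length S v) (0::complex) \<noteq> 0"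
      unfolding poly_sum
    proof (rule sum_nonneg_neq_0[OF fin _ one_in])
      show "\<exists>y\<ge>0. poly ([:0, 1:] ^ word_length S v) 0 = complex_of_real y" for v
        by (intro exI[of _ "0 ^ word_length S v"]) auto
    qed (simp add: l1)
    show ?thesis unfolding generic_degree_def
      by (rule vanishing_order_quotient[OF P P0 S S0 deg])
  qed
  show ?thesis unfolding a_value_def
  proof (rule the_equality)
    obtain S M where "hecke_lift S E M" using ex by blast
    thus "\<exists>S M. coxeter_generators D S \<and> hecke_rep S (deg E) M \<and>
      (\<forall>w\<in>D. value_at_1 (hecke_char S (deg E) M w) (mat_trace (E w))) \<and>
      vanishing_order_at_0 (generic_degree D S (deg E) M) (int N)"
      using key unfolding hecke_lift_def by blast
  next
    fix k assume "\<exists>S M. coxeter_generators D S \<and> hecke_rep S (deg E) M \<and>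
      (\<forall>w\<in>D. value_at_1 (hecke_char S (deg E) M w) (mat_trace (E w))) \<and>
      vanishing_order_at_0 (generic_degree D S (deg E) M) k"
    thus "k = int N" using key unfolding hecke_lift_def by blast
  qed
qed

section \<open>The values of a for one-dimensional representations\<close>

lemma one_form_ref:
  assumes "one_form E h \<epsilon>" "(b / a0) ^ m = 1"
  shows "E (ref b) = mat 1 1 (\<lambda>_. \<epsilon> * (b / a0) ^ h)"
proof -
  have "E (ref (a0 * (b / a0))) = mat 1 1 (\<lambda>_. \<epsilon> * (b / a0) ^ h)"
    using assms unfolding one_form_def by blast
  thus ?thesis by simp
qed

lemma one_form_sign:
  assumes E: "one_form E h \<epsilon>" and cp: "cox_pair S b c" and s: "s \<in> S"
  shows "E s \<in> carrier_mat 1 1" "E s $$ (0, 0) = 1 \<or> E s $$ (0, 0) = -1"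
proof -
  obtain x where x: "s = ref x" "(x / a0) ^ m = 1" using cp s by (auto simp: cox_pair_def)
  have "((x / a0) ^ h)\<^sup>2 = 1"
    using E x by (auto simp: one_form_def mult.commute simp flip: power_mult)
  hence "(x / a0) ^ h = 1 \<or> (x / a0) ^ h = -1" by (simp add: power2_eq_1_iff)
  thus "E s \<in> carrier_mat 1 1" "E s $$ (0, 0) = 1 \<or> E s $$ (0, 0) = -1"
    using one_form_ref[OF E x(2)] x E by (auto simp: one_form_def)
qed

text \<open>The quadratic relation allows q or -1 for each generator, and specialization at q = 1
  decides between them.\<close>

lemma hecke_lift_one:
  assumes E: "one_form E h \<epsilon>" and cp: "cox_pair S b c" and hecke_lift: "hecke_lift S E M"
  shows "\<And>s. s \<in> S \<Longrightarrow> M s $$ (0, 0) = (if E s $$ (0, 0) = 1 then hecke_q else - 1)"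
    "\<And>v. v \<in> D \<Longrightarrow> hecke_char S 1 M v = prod_list (map (\<lambda>s. M s $$ (0, 0)) (chosen S v))"
proof -
  have deg: "deg E = 1" using E by (simp add: one_form_def)
  have M: "M s \<in> carrier_mat 1 1" "(M s - hecke_q \<cdot>\<^sub>m 1\<^sub>m 1) * (M s + 1\<^sub>m 1) = 0\<^sub>m 1 1" if "s \<in> S" for s
    using hecke_lift that unfolding hecke_lift_def hecke_rep_def deg by auto
  show char: "hecke_char S 1 M v = prod_list (map (\<lambda>s. M s $$ (0, 0)) (chosen S v))" if v: "v \<in> D" for v
  proof -
    have "word_prod 1 M (chosen S v) \<in> carrier_mat 1 1 \<and>
      word_prod 1 M (chosen S v) $$ (0, 0) = prod_list (map (\<lambda>s. M s $$ (0, 0)) (chosen S v))"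
      by (rule word_prod_1) (use chosen(4)[OF cp v] M in auto)
    thus ?thesis using mat_trace_1[of "word_prod 1 M (chosen S v)"] by (simp add: hecke_char_alt)
  qed
  show "M s $$ (0, 0) = (if E s $$ (0, 0) = 1 then hecke_q else - 1)" if s: "s \<in> S" for s
  proof -
    have sD: "s \<in> D" using cox_pair_in_D[OF cp s] .
    have "value_at_1 (hecke_char S 1 M s) (mat_trace (E s))" using hecke_lift sD unfolding hecke_lift_def deg by auto
    hence val: "value_at_1 (M s $$ (0, 0)) (E s $$ (0, 0))"
      using char[OF sD] chosen_generator[OF cp s] mat_trace_1[OF one_form_sign(1)[OF E cp s]] by simp
    have "((M s - hecke_q \<cdot>\<^sub>m 1\<^sub>m 1) * (M s + 1\<^sub>m 1)) $$ (0, 0) = 0" using M(2)[OF s] by simp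
    hence "(M s $$ (0,0) - hecke_q) * (M s $$ (0,0) + 1) = 0"
      using M(1)[OF s] by (simp add: scalar_prod_def)
    hence "M s $$ (0,0) = hecke_q \<or> M s $$ (0,0) = - 1" by (auto simp: add_eq_0_iff2)
    thus ?thesis using val value_at_1_q value_at_1_minus_1 value_at_1_unique one_form_sign(2)[OF E cp s]
      by (metis one_neq_neg_one)
  qed
qed

text \<open>As b/c has exact order m = 2h, its h-th power is -1.\<close>

lemma one_form_opposite:
  assumes E: "one_form E h \<epsilon>" and h: "2 * h = m" and cp: "cox_pair S b c"
  shows "E (ref b) $$ (0, 0) = - E (ref c) $$ (0, 0)"
proof -
  have bc: "(b / a0) ^ m = 1" "(c / a0) ^ m = 1" "c \<noteq> 0" and prim: "\<And>i. (b / c) ^ i = 1 \<longleftrightarrow> m dvd i"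
    using cp by (auto simp: cox_pair_def)
  have "(b / c) ^ h \<noteq> 1" using prim[of h] h m by (auto dest: dvd_imp_le)
  moreover have "((b / c) ^ h)\<^sup>2 = 1" using prim[of m] h by (simp add: mult.commute flip: power_mult)
  ultimately have "(b / c) ^ h = -1" by (simp add: power2_eq_1_iff)
  hence "(b / a0) ^ h = - ((c / a0) ^ h)" using bc(3) by (simp add: power_divide field_simps)
  thus ?thesis using one_form_ref[OF E bc(1)] one_form_ref[OF E bc(2)] by simp
qed

lemma one_form_equal:
  assumes E: "one_form E 0 \<epsilon>" and cp: "cox_pair S b c" and s: "s \<in> S"
  shows "E s $$ (0, 0) = \<epsilon>"
proof -
  obtain x where x: "s = ref x" "(x / a0) ^ m = 1" using cp s by (auto simp: cox_pair_def)
  thus ?thesis using one_form_ref[OF E x(2)] by simp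
qed

text \<open>Replace the value 1 on a generator by q and keep -1. The braid relation is automatic for
  even m; for odd m only h = 0 is possible, and both generators have the same value.\<close>

lemma hecke_lift_one_exists:
  assumes E: "one_form E h \<epsilon>" and irr: "irr D E"
  shows "\<exists>S M. hecke_lift S E M"
proof -
  obtain S b c where cp: "cox_pair S b c" using cox_pair_exists by blast
  have deg: "deg E = 1" using E by (simp add: one_form_def)
  have rep: "rep D E" using irr by (simp add: irr_def)
  have S: "S = {ref b, ref c}" using cp by (simp add: cox_pair_def)
  define x where "x s = (if E s $$ (0, 0) = 1 then hecke_q else - 1)" for s
  define M where "M s = mat 1 1 (\<lambda>_. x s)" for s
  have Mc: "M s \<in> carrier_mat 1 1" "M s $$ (0, 0) = x s" for s by (auto simp: M_def)
  have wp: "word_prod 1 M us \<in> carrier_mat 1 1 \<and> word_prod 1 M us $$ (0, 0) = prod_list (map x us)" for us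
    using word_prod_1[of us M] Mc by simp
  have wp_eqI: "word_prod 1 M us = word_prod 1 M vs" if "prod_list (map x us) = prod_list (map x vs)" for us vs
    using wp[of us] wp[of vs] that by (intro eq_matI) auto
  have quad: "(M s - hecke_q \<cdot>\<^sub>m 1\<^sub>m 1) * (M s + 1\<^sub>m 1) = 0\<^sub>m 1 1" for s
    by (rule eq_matI) (auto simp: M_def x_def scalar_prod_def)
  have xbraid: "prod_list (map x (alternating m (ref b) (ref c))) = prod_list (map x (alternating m (ref c) (ref b)))"
  proof (cases "even m")
    case True
    then obtain p where p: "m = 2 * p" by auto
    show ?thesis unfolding p prod_list_alternating by (simp add: mult.commute)
  next
    case False
    hence "h = 0" using E by (auto simp: one_form_def)
    hence "x (ref b) = x (ref c)" using one_form_equal[OF E[unfolded \<open>h = 0\<close>] cp] S by (simp add: x_def)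
    moreover obtain p where p: "m = Suc (2 * p)" using False by (auto elim: oddE)
    ultimately show ?thesis unfolding p prod_list_alternating by simp
  qed
  have hr: "hecke_rep S 1 M"
    unfolding hecke_rep_def Let_def
  proof (intro conjI ballI impI)
    fix s t assume st: "s \<in> S" "t \<in> S" "s \<noteq> t"
    hence "s = ref b \<and> t = ref c \<or> s = ref c \<and> t = ref b" using S by auto
    thus "word_prod 1 M (alternating (group.ord (GL 2) (s * t)) s t) =
      word_prod 1 M (alternating (group.ord (GL 2) (s * t)) t s)"
    proof
      assume "s = ref b \<and> t = ref c"
      hence "group.ord (GL 2) (s * t) = m" "s = ref b" "t = ref c" using ord_pair[OF cp] by simp_all
      thus ?thesis using wp_eqI[OF xbraid] by simp
    next
      assume "s = ref c \<and> t = ref b"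
      hence "group.ord (GL 2) (s * t) = m" "s = ref c" "t = ref b" using ord_pair[OF cox_pair_sym[OF cp]] by simp_all
      thus ?thesis using wp_eqI[OF xbraid] by simp
    qed
  qed (use quad Mc in auto)
  have Eword: "E (WP us) \<in> carrier_mat 1 1 \<and> value_at_1 (prod_list (map x us)) (E (WP us) $$ (0, 0))"
    if "set us \<subseteq> S" for us
    using that
  proof (induction us)
    case Nil
    show ?case using rep_one[OF rep] value_at_1_const[of 1] deg by simp
  next
    case (Cons s us)
    have sS: "s \<in> S" "set us \<subseteq> S" using Cons.prems by auto
    have IH: "E (WP us) \<in> carrier_mat 1 1" "value_at_1 (prod_list (map x us)) (E (WP us) $$ (0, 0))"
      using Cons.IH sS by auto
    have Es: "E s \<in> carrier_mat 1 1" "E s $$ (0, 0) = 1 \<or> E s $$ (0, 0) = -1"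
      using one_form_sign[OF E cp sS(1)] by auto
    have "E (s * WP us) = E s * E (WP us)"
      by (rule rep_mult[OF rep cox_pair_in_D[OF cp sS(1)] WP_in_D[OF cp sS(2)]])
    moreover have "(E s * E (WP us)) $$ (0, 0) = E s $$ (0, 0) * E (WP us) $$ (0, 0)"
      using Es IH by (simp add: scalar_prod_def)
    moreover have "value_at_1 (x s) (E s $$ (0, 0))"
      using Es(2) value_at_1_q value_at_1_minus_1 by (auto simp: x_def)
    ultimately show ?case using value_at_1_mult[OF _ IH(2)] Es(1) IH(1) by simp
  qed
  have "value_at_1 (hecke_char S 1 M v) (mat_trace (E v))" if v: "v \<in> D" for v
    using Eword[OF chosen(4)[OF cp v]] wp[of "chosen S v"] unfolding chosen(2)[OF cp v] hecke_char_alt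
    using mat_trace_1[of "word_prod 1 M (chosen S v)"] mat_trace_1[of "E v"] by simp
  hence "hecke_lift S E M" unfolding hecke_lift_def deg using hr cox_pair_coxeter[OF cp] by blast
  thus ?thesis by blast
qed

lemma prod_list_const: "(\<And>s. s \<in> set us \<Longrightarrow> x s = (y::'a::comm_monoid_mult)) \<Longrightarrow> prod_list (map x us) = y ^ length us"
  by (induction us) auto

text \<open>The summand of v is q^l(v), with lowest term at the identity.\<close>

lemma a_value_trivial:
  assumes E: "one_form E 0 1" and irr: "irr D E"
  shows "a_value D E = 0"
proof -
  have deg: "deg E = 1" using E by (simp add: one_form_def)
  have "a_value D E = int 0"
  proof (rule a_valueI[OF _ hecke_lift_one_exists[OF E irr]])
    fix S b c M assume cp: "cox_pair S b c" and hecke_lift: "hecke_lift S E M"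
    have char: "hecke_char S 1 M v = hecke_q ^ word_length S v" if v: "v \<in> D" for v
      unfolding hecke_lift_one(2)[OF E cp hecke_lift v] chosen(3)[OF cp v, symmetric]
      by (rule prod_list_const)
        (use chosen(4)[OF cp v] hecke_lift_one(1)[OF E cp hecke_lift] one_form_equal[OF E cp] in auto)
    show "\<exists>f. (\<forall>v\<in>D. hecke_char S (deg E) M v * hecke_char S (deg E) M (inv\<^bsub>GL 2\<^esub> v) /
              hecke_q ^ word_length S v * hecke_q ^ 0 = to_fract (f v) \<and>
            (\<exists>y::real. y \<ge> 0 \<and> poly (f v) 0 = complex_of_real y)) \<and> (\<exists>v\<in>D. poly (f v) 0 \<noteq> 0)"
    proof (intro exI[of _ "\<lambda>v. [:0, 1:] ^ word_length S v"] conjI ballI bexI)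
      fix v assume v: "v \<in> D"
      show "hecke_char S (deg E) M v * hecke_char S (deg E) M (inv\<^bsub>GL 2\<^esub> v) /
              hecke_q ^ word_length S v * hecke_q ^ 0 = to_fract ([:0, 1:] ^ word_length S v)"
        unfolding deg char[OF v] char[OF inv_in_D[OF v]] word_length_inv_D[OF cp v] to_fract_power
          hecke_q_altdef[symmetric] by simp
      show "\<exists>y::real. y \<ge> 0 \<and> poly ([:0, 1:] ^ word_length S v) 0 = complex_of_real y"
        by (intro exI[of _ "0 ^ word_length S v"]) auto
    next
      show "poly ([:0, 1:] ^ word_length S (1\<^sub>m 2)) (0::complex) \<noteq> 0"
        using word_length_le[of "[]" S] by simp
    qed (rule one_in)
  qed (simp add: deg)
  thus ?thesis by simp
qed

text \<open>The summand of v is q^(-l(v)), with lowest term at the longest element, of length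
  m.\<close>

lemma a_value_sign:
  assumes E: "one_form E 0 (-1)" and irr: "irr D E"
  shows "a_value D E = int m"
proof -
  have deg: "deg E = 1" using E by (simp add: one_form_def)
  show ?thesis
  proof (rule a_valueI[OF _ hecke_lift_one_exists[OF E irr]])
    fix S b c M assume cp: "cox_pair S b c" and hecke_lift: "hecke_lift S E M"
    have char: "hecke_char S 1 M v = (- 1) ^ word_length S v" if v: "v \<in> D" for v
      unfolding hecke_lift_one(2)[OF E cp hecke_lift v] chosen(3)[OF cp v, symmetric]
      by (rule prod_list_const)
        (use chosen(4)[OF cp v] hecke_lift_one(1)[OF E cp hecke_lift] one_form_equal[OF E cp] in auto)
    let ?w0 = "WP (alternating m (ref b) (ref c))"
    have w0: "?w0 \<in> D" "word_length S ?w0 = m"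
      using WP_in_D[OF cp, of "alternating m (ref b) (ref c)"] set_alternating[of m "ref b" "ref c"]
        length_alt[OF cp order_refl] cp by (auto simp: cox_pair_def)
    show "\<exists>f. (\<forall>v\<in>D. hecke_char S (deg E) M v * hecke_char S (deg E) M (inv\<^bsub>GL 2\<^esub> v) /
              hecke_q ^ word_length S v * hecke_q ^ m = to_fract (f v) \<and>
            (\<exists>y::real. y \<ge> 0 \<and> poly (f v) 0 = complex_of_real y)) \<and> (\<exists>v\<in>D. poly (f v) 0 \<noteq> 0)"
    proof (intro exI[of _ "\<lambda>v. [:0, 1:] ^ (m - word_length S v)"] conjI ballI bexI)
      fix v assume v: "v \<in> D"
      have le: "word_length S v \<le> m"
        using reduced_length_le[OF cp chosen(1)[OF cp v]] chosen(3)[OF cp v] by simp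
      have "((- 1) ^ word_length S v * (- 1) ^ word_length S v :: complex poly fract) = 1"
        by (simp flip: power_mult_distrib)
      thus "hecke_char S (deg E) M v * hecke_char S (deg E) M (inv\<^bsub>GL 2\<^esub> v) /
              hecke_q ^ word_length S v * hecke_q ^ m = to_fract ([:0, 1:] ^ (m - word_length S v))"
        unfolding deg char[OF v] char[OF inv_in_D[OF v]] word_length_inv_D[OF cp v] to_fract_power
          hecke_q_altdef[symmetric] using le by (simp add: power_diff)
      show "\<exists>y::real. y \<ge> 0 \<and> poly ([:0, 1:] ^ (m - word_length S v)) 0 = complex_of_real y"
        by (intro exI[of _ "0 ^ (m - word_length S v)"]) auto
    next
      show "poly ([:0, 1:] ^ (m - word_length S ?w0)) (0::complex) \<noteq> 0" by (simp add: w0)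
    qed (rule w0)
  qed (simp add: deg)
qed

text \<open>One generator acts by q, the other by -1. Multiplied by q, the summands are q in even
  length and q^2 or 1 in odd length; 1 is attained at the generator acting by -1.\<close>

lemma a_value_mixed:
  assumes E: "one_form E h \<epsilon>" and irr: "irr D E" and h: "2 * h = m"
  shows "a_value D E = 1"
proof -
  have deg: "deg E = 1" using E by (simp add: one_form_def)
  have "a_value D E = int 1"
  proof (rule a_valueI[OF _ hecke_lift_one_exists[OF E irr]])
    fix S b c M assume cp0: "cox_pair S b c" and hecke_lift: "hecke_lift S E M"
    obtain b c where cp: "cox_pair S b c" and Eb: "E (ref b) $$ (0, 0) = 1" and Ec: "E (ref c) $$ (0, 0) = - 1"
    proof -
      have "ref b \<in> S" using cp0 by (simp add: cox_pair_def)
      hence "E (ref b) $$ (0, 0) = 1 \<or> E (ref b) $$ (0, 0) = - 1"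
        using one_form_sign(2)[OF E cp0] by blast
      thus thesis
      proof
        assume 1: "E (ref b) $$ (0, 0) = 1"
        show thesis
          by (rule that[OF cp0 1]) (use one_form_opposite[OF E h cox_pair_sym[OF cp0]] 1 in simp)
      next
        assume 1: "E (ref b) $$ (0, 0) = - 1"
        show thesis
          by (rule that[OF cox_pair_sym[OF cp0] _ 1])
            (use one_form_opposite[OF E h cox_pair_sym[OF cp0]] 1 in simp)
      qed
    qed
    define x where "x s = M s $$ (0, 0)" for s
    have S: "ref b \<in> S" "ref c \<in> S" using cp by (auto simp: cox_pair_def)
    have x: "x (ref b) = hecke_q" "x (ref c) = - 1"
      using hecke_lift_one(1)[OF E cp hecke_lift] S Eb Ec by (auto simp: x_def)
    have char: "hecke_char S 1 M v = prod_list (map x (chosen S v))" if "v \<in> D" for v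
      using hecke_lift_one(2)[OF E cp hecke_lift that] by (simp add: x_def[abs_def])
    have even: "hecke_char S 1 M v = (- hecke_q) ^ p" if "v \<in> D" "word_length S v = 2 * p" for v p
      using chosen_alternating[OF cp that(1)] unfolding char[OF that(1)] that(2)
      by (elim disjE) (simp_all only: prod_list_alternating x mult_minus_right mult_minus_left mult_1_right mult_1_left)
    have odd: "hecke_char S 1 M v = (- hecke_q) ^ p * hecke_q \<or> hecke_char S 1 M v = (- hecke_q) ^ p * (- 1)"
      if "v \<in> D" "word_length S v = Suc (2 * p)" for v p
      using chosen_alternating[OF cp that(1)] unfolding char[OF that(1)] that(2)
      by (elim disjE) (simp_all only: prod_list_alternating x mult_minus_right mult_minus_left
          mult_1_right mult_1_left simp_thms)
    define T where "T v = hecke_char S 1 M v * hecke_char S 1 M (inv\<^bsub>GL 2\<^esub> v) / hecke_q ^ word_length S v * hecke_q" for v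
    have T: "T v = hecke_q \<or> T v = hecke_q\<^sup>2 \<or> T v = 1" if v: "v \<in> D" for v
    proof (cases "even (word_length S v)")
      case True
      then obtain p where p: "word_length S v = 2 * p" by auto
      have "(- hecke_q) ^ p * (- hecke_q) ^ p = hecke_q ^ (2 * p)"
        by (simp add: power_mult power2_eq_square flip: power_mult_distrib)
      thus ?thesis unfolding T_def even[OF v p] even[OF inv_in_D[OF v] word_length_inv_D[OF cp v, unfolded p]] p
        by simp
    next
      case False
      then obtain p where p: "word_length S v = Suc (2 * p)" by (auto elim: oddE)
      have "(- hecke_q) ^ p * (- hecke_q) ^ p = hecke_q ^ (2 * p)"
        by (simp add: power_mult power2_eq_square flip: power_mult_distrib)
      hence q: "(- hecke_q) ^ p * y * ((- hecke_q) ^ p * y) / hecke_q ^ Suc (2 * p) * hecke_q = y * y" for y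
        by (simp add: mult_ac)
      have "T v = hecke_q * hecke_q \<or> T v = (- 1) * (- 1)"
        unfolding T_def p odd_self_inverse[OF cp v False]
        using odd[OF v p] by (elim disjE) (simp_all only: q simp_thms)
      thus ?thesis by (auto simp: power2_eq_square)
    qed
    define f where "f v = (if T v = 1 then 1 else if T v = hecke_q then [:0, 1:] else [:0, 1:]\<^sup>2 :: complex poly)" for v
    have cD: "ref c \<in> D" using cox_pair_in_D[OF cp S(2)] .
    show "\<exists>f. (\<forall>v\<in>D. hecke_char S (deg E) M v * hecke_char S (deg E) M (inv\<^bsub>GL 2\<^esub> v) /
              hecke_q ^ word_length S v * hecke_q ^ 1 = to_fract (f v) \<and>
            (\<exists>y::real. y \<ge> 0 \<and> poly (f v) 0 = complex_of_real y)) \<and> (\<exists>v\<in>D. poly (f v) 0 \<noteq> 0)"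
    proof (intro exI[of _ f] conjI ballI bexI)
      fix v assume v: "v \<in> D"
      show "hecke_char S (deg E) M v * hecke_char S (deg E) M (inv\<^bsub>GL 2\<^esub> v) /
              hecke_q ^ word_length S v * hecke_q ^ 1 = to_fract (f v)"
        using T[OF v] unfolding deg power_one_right T_def[symmetric] f_def
        by (auto simp: hecke_q_altdef to_fract_power simp del: to_fract_mult)
      show "\<exists>y::real. y \<ge> 0 \<and> poly (f v) 0 = complex_of_real y"
        by (auto simp: f_def intro: exI[of _ 0] exI[of _ 1])
    next
      have l: "word_length S (ref c) = 1"
        using chosen(3)[OF cp cD] chosen_generator[OF cp S(2)] by simp
      have "hecke_char S 1 M (ref c) = - 1" using char[OF cD] chosen_generator[OF cp S(2)] x by simp
      moreover have "inv\<^bsub>GL 2\<^esub> (ref c) = ref c" using odd_self_inverse[OF cp cD] l by simp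
      ultimately have "T (ref c) = 1" unfolding T_def l by simp
      thus "poly (f (ref c)) 0 \<noteq> 0" by (simp add: f_def)
    qed (rule cD)
  qed (simp add: deg)
  thus ?thesis by simp
qed


section \<open>The value of a for two-dimensional representations\<close>

lemma two_form_ref:
  assumes E: "two_form E k P Q" and b: "(b / a0) ^ m = 1"
  shows "E (ref b) = P * ref ((b / a0) ^ k) * Q"
proof -
  have "E (ref (a0 * (b / a0))) = P * ref ((b / a0) ^ k) * Q" using E b unfolding two_form_def by blast
  thus ?thesis by simp
qed

lemma tr2_conj:
  fixes X :: "complex mat"
  assumes "P \<in> carrier_mat 2 2" "Q \<in> carrier_mat 2 2" "Q * P = 1\<^sub>m 2" "X \<in> carrier_mat 2 2"
  shows "tr2 (P * X * Q) = tr2 X" "P * X * Q \<in> carrier_mat 2 2"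
proof -
  have "tr2 (P * X * Q) = tr2 (Q * (P * X))" using assms by (intro tr2_comm) auto
  also have "Q * (P * X) = (Q * P) * X" by (rule assoc_mult_mat[symmetric, of _ 2 2 _ 2 _ 2]) (use assms in auto)
  also have "\<dots> = X" using assms by simp
  finally show "tr2 (P * X * Q) = tr2 X" .
qed (use assms in auto)

lemma two_form_trace:
  assumes E: "two_form E k P Q"
  shows "a ^ m = 1 \<Longrightarrow> mat_trace (E (rot a)) = a ^ k + inverse (a ^ k)"
    "(b / a0) ^ m = 1 \<Longrightarrow> mat_trace (E (ref b)) = 0"
proof -
  have PQ: "P \<in> carrier_mat 2 2" "Q \<in> carrier_mat 2 2" "Q * P = 1\<^sub>m 2" using E by (auto simp: two_form_def)
  { assume "a ^ m = 1"
    hence "E (rot a) = P * rot (a ^ k) * Q" using E unfolding two_form_def by blast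
    thus "mat_trace (E (rot a)) = a ^ k + inverse (a ^ k)"
      using tr2_conj[OF PQ rot_carrier, of "a ^ k"] mat_trace_2[of "P * rot (a ^ k) * Q"]
      by (simp add: tr2_def rot_def) }
  { assume "(b / a0) ^ m = 1"
    from two_form_ref[OF E this] show "mat_trace (E (ref b)) = 0"
      using tr2_conj[OF PQ ref_carrier, of "(b / a0) ^ k"] mat_trace_2[of "P * ref ((b / a0) ^ k) * Q"]
      by (simp add: tr2_def ref_def) }
qed

lemma pair_root:
  assumes cp: "cox_pair S b c" and k: "0 < k" "2 * k < m"
  defines "y \<equiv> (b / c) ^ k"
  shows "y \<noteq> 0" "y \<noteq> 1" "y \<noteq> -1" "y ^ m = 1" "(b / c) ^ m = 1" "b / c \<noteq> 0"
proof -
  have bc: "b \<noteq> 0" "c \<noteq> 0" "\<And>i. (b / c) ^ i = 1 \<longleftrightarrow> m dvd i" using cp by (auto simp: cox_pair_def)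
  show "b / c \<noteq> 0" "y \<noteq> 0" using bc by (auto simp: y_def)
  show 1: "(b / c) ^ m = 1" using bc(3)[of m] by simp
  show "y ^ m = 1" using bc(3)[of "k * m"] by (simp add: y_def flip: power_mult)
  have "y\<^sup>2 \<noteq> 1" using bc(3)[of "k * 2"] k by (auto simp: y_def mult.commute simp flip: power_mult dest: dvd_imp_le)
  thus "y \<noteq> 1" "y \<noteq> -1" by auto
qed

lemma word_prod_alt:
  assumes "hecke_pair hecke_q c0 (M s) (M t)"
  shows "word_prod 2 M (alternating n s t) = hecke_pair.alt (M s) (M t) n"
proof -
  interpret hecke_pair hecke_q c0 "M s" "M t" by fact
  show ?thesis
  proof (induction n rule: alt.induct)
    case 1 show ?case by simp
  next
    case 2 show ?case using A by simp
  next
    case (3 n)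
    have "word_prod 2 M (alternating (Suc (Suc n)) s t) = M s * (M t * alt n)" using 3 by simp
    also have "\<dots> = (M s * M t) * alt n" by (rule assoc_mult_mat[symmetric, OF A B alt_carrier])
    finally show ?case by simp
  qed
qed

text \<open>Both alternating words of a given length have the same trace, so the choice of the
  reduced word does not affect the value.\<close>

lemma hecke_char_pair:
  assumes cp: "cox_pair S b c" and hp: "hecke_pair hecke_q c0 (M (ref b)) (M (ref c))" and v: "v \<in> D"
  shows "word_length S v = 2 * p \<Longrightarrow> hecke_char S 2 M v = hecke_q ^ p * seq_t c0 p"
    "word_length S v = Suc (2 * p) \<Longrightarrow> hecke_char S 2 M v = (hecke_q - 1) * hecke_q ^ p * seq_u c0 p"
proof -
  interpret h: hecke_pair hecke_q c0 "M (ref b)" "M (ref c)" by fact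
  interpret f: hecke_pair hecke_q c0 "M (ref c)" "M (ref b)" by (rule h.flip)
  have char: "hecke_char S 2 M v = tr2 (h.alt (word_length S v)) \<or>
     hecke_char S 2 M v = tr2 (f.alt (word_length S v))"
    using chosen_alternating[OF cp v] unfolding hecke_char_alt
    by (elim disjE) (simp_all add: word_prod_alt[OF hp] word_prod_alt[OF h.flip] mat_trace_2
        del: alternating.simps h.alt.simps f.alt.simps)
  { assume "word_length S v = 2 * p"
    thus "hecke_char S 2 M v = hecke_q ^ p * seq_t c0 p" using char h.tr_alt(1) f.tr_alt(1) by metis }
  { assume "word_length S v = Suc (2 * p)"
    thus "hecke_char S 2 M v = (hecke_q - 1) * hecke_q ^ p * seq_u c0 p"
      using char h.tr_alt(2) f.tr_alt(2) by metis }
qed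

text \<open>With c = y + 1/y for y = (b/c)^k, the condition y^m = 1 makes the braid obstruction
  vanish. Even words then specialize to y^p + y^(-p), and odd ones carry a factor q - 1, matching
  the zero trace of reflections.\<close>

lemma hecke_lift_two_exists:
  assumes E: "two_form E k P Q"
  shows "\<exists>S M. hecke_lift S E M"
proof -
  obtain S b c where cp: "cox_pair S b c" using cox_pair_exists by blast
  have deg: "deg E = 2" and k: "0 < k" "2 * k < m" using E by (auto simp: two_form_def)
  have S: "S = {ref b, ref c}" and bc: "(b / a0) ^ m = 1" "(c / a0) ^ m = 1" "b \<noteq> 0" "c \<noteq> 0"
    using cp by (auto simp: cox_pair_def)
  have ne: "ref b \<noteq> ref c"
  proof
    assume "ref b = ref c"
    hence "(b / c) ^ 1 = 1" using bc by simp
    hence "m dvd 1" using cp unfolding cox_pair_def by blast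
    thus False using k by simp
  qed
  define y where "y = (b / c) ^ k"
  note y = pair_root[OF cp k, folded y_def]
  define g where "g = y + inverse y"
  \<comment> \<open>Triangular matrices with diagonal entries q and -1 in opposite order. The
    off-diagonal product q * (g + 2) compensates the diagonal contribution -2q and yields tr(AB) = q
    * g.\<close>
  define A where "A = mat 2 2 (\<lambda>(i, j). if i = 0 then if j = 0 then hecke_q else hecke_q * (const_fract g + 2)
       else if j = 0 then 0 else - 1)"
  define B where "B = mat 2 2 (\<lambda>(i, j). if i = 0 then if j = 0 then - 1 else 0
       else if j = 0 then 1 else hecke_q)"
  have AB: "A \<in> carrier_mat 2 2" "B \<in> carrier_mat 2 2" by (simp_all add: A_def B_def)
  have Ae: "A $$ (0,0) = hecke_q" "A $$ (0,1) = hecke_q * (const_fract g + 2)" "A $$ (1,0) = 0" "A $$ (1,1) = - 1"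
    and Be: "B $$ (0,0) = - 1" "B $$ (0,1) = 0" "B $$ (1,0) = 1" "B $$ (1,1) = hecke_q"
    by (simp_all add: A_def B_def)
  have pair: "hecke_pair hecke_q (const_fract g) A B"
  proof
    show "tr2 (A * B) = hecke_q * const_fract g"
      unfolding tr2_def index_mult_2'[OF AB] Ae Be by (simp add: algebra_simps)
  qed (simp_all add: AB tr2_def dt2_def Ae Be del: One_nat_def)
  interpret h: hecke_pair hecke_q "const_fract g" A B by (rule pair)
  interpret f: hecke_pair hecke_q "const_fract g" B A by (rule h.flip)
  define M where "M s = (if s = ref b then A else B)" for s
  have M: "M (ref b) = A" "M (ref c) = B" using ne by (auto simp: M_def)
  have quad: "(X - hecke_q \<cdot>\<^sub>m 1\<^sub>m 2) * (X + 1\<^sub>m 2) = 0\<^sub>m 2 2" if "X = A \<or> X = B" for X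
  proof -
    have X: "X \<in> carrier_mat 2 2" using that AB by auto
    have c: "X - hecke_q \<cdot>\<^sub>m 1\<^sub>m 2 \<in> carrier_mat 2 2" "X + 1\<^sub>m 2 \<in> carrier_mat 2 2" using X by auto
    have e: "((X - hecke_q \<cdot>\<^sub>m 1\<^sub>m 2) * (X + 1\<^sub>m 2)) $$ (0, 0) = 0"
      "((X - hecke_q \<cdot>\<^sub>m 1\<^sub>m 2) * (X + 1\<^sub>m 2)) $$ (0, 1) = 0"
      "((X - hecke_q \<cdot>\<^sub>m 1\<^sub>m 2) * (X + 1\<^sub>m 2)) $$ (1, 0) = 0"
      "((X - hecke_q \<cdot>\<^sub>m 1\<^sub>m 2) * (X + 1\<^sub>m 2)) $$ (1, 1) = 0"
      unfolding index_mult_2'[OF c] using that X Ae Be by (auto simp: algebra_simps simp del: One_nat_def)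
    show ?thesis
    proof (rule eq_matI)
      fix i j assume "i < dim_row (0\<^sub>m 2 2 :: complex poly fract mat)" "j < dim_col (0\<^sub>m 2 2 :: complex poly fract mat)"
      hence ij: "i = 0 \<or> i = 1" "j = 0 \<or> j = 1" by auto
      show "((X - hecke_q \<cdot>\<^sub>m 1\<^sub>m 2) * (X + 1\<^sub>m 2)) $$ (i, j) = 0\<^sub>m 2 2 $$ (i, j)"
        using ij by (elim disjE) (use e in simp_all)
    qed (use X in auto)
  qed
  have braid: "h.alt m = f.alt m"
  proof (rule eq_matI)
    fix i j assume "i < dim_row (f.alt m)" "j < dim_col (f.alt m)"
    hence ij: "i \<in> {0, 1}" "j \<in> {0, 1}" using carrier_matD[OF f.alt_carrier[of m]] by auto
    show "h.alt m $$ (i, j) = f.alt m $$ (i, j)"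
    proof (cases "even m")
      case True
      then obtain p where p: "m = 2 * p" by auto
      have "y ^ p * y ^ p = 1" using y(4) p by (simp add: mult_2 power_add)
      hence "inverse y ^ p = y ^ p" unfolding power_inverse by (rule inverse_unique)
      hence "(y - inverse y) * seq_s g p = 0" unfolding g_def seq_s_root[OF y(1)] by simp
      moreover have "y - inverse y \<noteq> 0"
      proof
        assume "y - inverse y = 0"
        hence "y * y = 1" using y(1) by (simp add: field_simps)
        thus False using y by (metis square_eq_1_iff)
      qed
      ultimately have "seq_s g p = 0" by simp
      hence "hecke_q * (h.alt m $$ (i, j) - f.alt m $$ (i, j)) = 0"
        unfolding p h.braid_entry(1)[OF ij] seq_const by simp
      thus ?thesis by simp
    next
      case False
      then obtain p where p: "m = Suc (2 * p)" by (auto elim: oddE)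
      have "m = p + Suc p" using p by simp
      hence "y ^ p * y ^ Suc p = 1" using y(4) by (simp only: power_add)
      hence "y ^ p * (y * y ^ p) = 1" by (simp only: power_Suc)
      hence "inverse y ^ p = y * y ^ p" unfolding power_inverse by (rule inverse_unique)
      hence "(y - 1) * seq_u g p = 0" unfolding g_def seq_u_root[OF y(1)] by simp
      hence "seq_u g p = 0" using y(2) by simp
      thus ?thesis using h.braid_entry(2)[OF ij, of p] unfolding p seq_const by simp
    qed
  qed (use carrier_matD[OF f.alt_carrier[of m]] carrier_matD[OF h.alt_carrier[of m]] in auto)
  have hpM: "hecke_pair hecke_q (const_fract g) (M (ref b)) (M (ref c))" using pair by (simp add: M)
  have hpM': "hecke_pair hecke_q (const_fract g) (M (ref c)) (M (ref b))" using h.flip by (simp add: M)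
  have wbraid: "word_prod 2 M (alternating m (ref b) (ref c)) = word_prod 2 M (alternating m (ref c) (ref b))"
    unfolding word_prod_alt[OF hpM] word_prod_alt[OF hpM'] using braid by (simp add: M)
  have hr: "hecke_rep S 2 M"
    unfolding hecke_rep_def Let_def
  proof (intro conjI ballI impI)
    fix s assume "s \<in> S"
    show "M s \<in> carrier_mat 2 2" using AB by (simp add: M_def)
    show "(M s - hecke_q \<cdot>\<^sub>m 1\<^sub>m 2) * (M s + 1\<^sub>m 2) = 0\<^sub>m 2 2" by (rule quad) (simp add: M_def)
  next
    fix s t assume st: "s \<in> S" "t \<in> S" "s \<noteq> t"
    hence "s = ref b \<and> t = ref c \<or> s = ref c \<and> t = ref b" using S by auto
    thus "word_prod 2 M (alternating (group.ord (GL 2) (s * t)) s t) =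
      word_prod 2 M (alternating (group.ord (GL 2) (s * t)) t s)"
    proof
      assume "s = ref b \<and> t = ref c"
      hence "group.ord (GL 2) (s * t) = m" "s = ref b" "t = ref c" using ord_pair[OF cp] by simp_all
      thus ?thesis using wbraid by simp
    next
      assume "s = ref c \<and> t = ref b"
      hence "group.ord (GL 2) (s * t) = m" "s = ref c" "t = ref b" using ord_pair[OF cox_pair_sym[OF cp]] by simp_all
      thus ?thesis using wbraid by simp
    qed
  qed
  have "value_at_1 (hecke_char S 2 M v) (mat_trace (E v))" if v: "v \<in> D" for v
  proof (cases "even (word_length S v)")
    case True
    then obtain p where p: "word_length S v = 2 * p" by auto
    have "chosen S v = alternating (2 * p) (ref b) (ref c) \<or> chosen S v = alternating (2 * p) (ref c) (ref b)"
      using chosen_alternating[OF cp v] p by simp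
    hence "v = rot ((b / c) ^ p) \<or> v = rot ((c / b) ^ p)"
      using chosen(2)[OF cp v] WP_alternating(1)[OF bc(3,4), of p] WP_alternating(1)[OF bc(4,3), of p]
      by metis
    hence "mat_trace (E v) = y ^ p + inverse y ^ p"
    proof
      assume v: "v = rot ((b / c) ^ p)"
      have r1: "((b / c) ^ p) ^ m = 1" using y(5) by (metis mult.commute power_mult power_one)
      thus ?thesis unfolding v two_form_trace(1)[OF E r1] y_def
        by (simp add: power_inverse mult.commute flip: power_mult)
    next
      assume v: "v = rot ((c / b) ^ p)"
      have cb: "c / b = inverse (b / c)" by simp
      have r1: "((c / b) ^ p) ^ m = 1" using y(5) unfolding cb
        by (metis mult.commute power_mult power_one power_inverse inverse_1)
      thus ?thesis unfolding v two_form_trace(1)[OF E r1] y_def unfolding cb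
        by (simp add: power_inverse mult.commute del: inverse_divide flip: power_mult)
    qed
    also have "\<dots> = seq_t g p" unfolding g_def using seq_t_root[OF y(1)] by simp
    finally have tr: "mat_trace (E v) = seq_t g p" .
    show ?thesis unfolding hecke_char_pair(1)[OF cp hpM v p] tr seq_const
      using value_at_1_mult[OF value_at_1_q_pow value_at_1_const] by simp
  next
    case False
    then obtain p where p: "word_length S v = Suc (2 * p)" by (auto elim: oddE)
    have "set (chosen S v) \<subseteq> refs" using chosen(4)[OF cp v] cox_pair_refs[OF cp] by blast
    then obtain x where x: "x \<noteq> 0" "v = ref x"
      using WP_parity[of "chosen S v"] chosen[OF cp v] False by auto
    have "(x / a0) ^ m = 1" using v x Dih_ref_iff[OF m a0] by simp
    hence tr: "mat_trace (E v) = 0" unfolding x(2) by (rule two_form_trace(2)[OF E])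
    have "value_at_1 (hecke_q - 1) 0"
    proof -
      have "hecke_q - 1 = to_fract ([:0, 1:] - 1)" by (simp add: hecke_q_altdef)
      thus ?thesis using value_at_1_to_fractI[of "[:0, 1:] - 1" 0] by simp
    qed
    from value_at_1_mult[OF value_at_1_mult[OF this value_at_1_q_pow] value_at_1_const]
    show ?thesis unfolding hecke_char_pair(2)[OF cp hpM v p] tr seq_const by simp
  qed
  hence "hecke_lift S E M" unfolding hecke_lift_def deg using hr cox_pair_coxeter[OF cp] by blast
  thus ?thesis by blast
qed

text \<open>The braid relation forces the trace of the product of the two generators, divided by q,
  to be a constant; specialization at q = 1 then identifies it.\<close>

lemma hecke_lift_two:
  assumes E: "two_form E k P Q" and cp: "cox_pair S b c" and hecke_lift: "hecke_lift S E M"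
  defines "y \<equiv> (b / c) ^ k"
  shows "hecke_pair hecke_q (const_fract (y + inverse y)) (M (ref b)) (M (ref c))"
proof -
  have deg: "deg E = 2" and k: "0 < k" "2 * k < m" using E by (auto simp: two_form_def)
  have S: "S = {ref b, ref c}" and bc: "(b / a0) ^ m = 1" "(c / a0) ^ m = 1" "b \<noteq> 0" "c \<noteq> 0"
    using cp by (auto simp: cox_pair_def)
  have ne: "ref b \<noteq> ref c"
  proof
    assume "ref b = ref c"
    hence "(b / c) ^ 1 = 1" using bc by simp
    hence "m dvd 1" using cp unfolding cox_pair_def by blast
    thus False using k by simp
  qed
  note y = pair_root[OF cp k, folded y_def]
  have hr: "hecke_rep S 2 M" using hecke_lift by (simp add: hecke_lift_def deg)
  have val: "value_at_1 (hecke_char S 2 M v) (mat_trace (E v))" if "v \<in> D" for v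
    using hecke_lift that by (auto simp: hecke_lift_def deg)
  have gen: "tr2 (M s) = hecke_q - 1 \<and> dt2 (M s) = - hecke_q \<and> M s \<in> carrier_mat 2 2" if s: "s \<in> S" for s
  proof -
    have Ms: "M s \<in> carrier_mat 2 2" "(M s - hecke_q \<cdot>\<^sub>m 1\<^sub>m 2) * (M s + 1\<^sub>m 2) = 0\<^sub>m 2 2"
      using hr s unfolding hecke_rep_def by auto
    have sD: "s \<in> D" using cox_pair_in_D[OF cp s] .
    have "hecke_char S 2 M s = tr2 (M s)"
      using Ms by (simp add: hecke_char_alt chosen_generator[OF cp s] mat_trace_2)
    moreover have "mat_trace (E s) = 0" using s S two_form_trace(2)[OF E] bc by auto
    ultimately have "value_at_1 (tr2 (M s)) 0" using val[OF sD] by simp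
    thus ?thesis using quadratic_2[OF Ms] Ms by blast
  qed
  define A where "A = M (ref b)"
  define B where "B = M (ref c)"
  have AB: "tr2 A = hecke_q - 1" "dt2 A = - hecke_q" "A \<in> carrier_mat 2 2"
    "tr2 B = hecke_q - 1" "dt2 B = - hecke_q" "B \<in> carrier_mat 2 2"
    using gen S by (auto simp: A_def B_def)
  define c0 where "c0 = tr2 (A * B) / hecke_q"
  have trAB: "tr2 (A * B) = hecke_q * c0" by (simp add: c0_def)
  have hp: "hecke_pair hecke_q c0 A B" by unfold_locales (use AB trAB in auto)
  interpret h: hecke_pair hecke_q c0 A B by (rule hp)
  interpret f: hecke_pair hecke_q c0 B A by (rule h.flip)
  have hpM: "hecke_pair hecke_q c0 (M (ref b)) (M (ref c))" using hp by (simp add: A_def B_def)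
  have hpM': "hecke_pair hecke_q c0 (M (ref c)) (M (ref b))" using h.flip by (simp add: A_def B_def)
  have rD: "rot (b / c) \<in> D" using y(5) rot_in by simp
  \<comment> \<open>As m \<ge> 2, the rotation by b/c has length 2, so its character value is tr(AB)
    and can be compared with E at q = 1.\<close>
  have "word_length S (WP (alternating (2 * 1) (ref b) (ref c))) = 2 * 1"
    by (rule length_alt[OF cp]) (use k in simp)
  hence l2: "word_length S (rot (b / c)) = 2 * 1"
    unfolding WP_alternating(1)[OF bc(3,4)] by (simp only: power_one_right)
  have val2: "value_at_1 (hecke_q * c0) (y + inverse y)"
    using val[OF rD] hecke_char_pair(1)[OF cp hpM rD l2] two_form_trace(1)[OF E y(5)] by (simp add: y_def)
  have "word_prod 2 M (alternating m (ref b) (ref c)) = word_prod 2 M (alternating m (ref c) (ref b))"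
    using hr ord_pair[OF cp] ne S unfolding hecke_rep_def Let_def by (metis insert_iff)
  hence braid: "h.alt m = f.alt m"
    unfolding word_prod_alt[OF hpM] word_prod_alt[OF hpM'] by (simp add: A_def B_def)
  \<comment> \<open>Otherwise tr(AB) would be q^2 + 1 or -2q and specialize to 2 or -2, forcing y =
    1 or y = -1. Thus the braid relation can hold only through the vanishing of a sequence.\<close>
  have noncomm: "A * B \<noteq> B * A"
  proof
    assume "A * B = B * A"
    hence "(hecke_q * c0 - (hecke_q * hecke_q + 1)) * (hecke_q * c0 + 2 * hecke_q) = 0" by (rule h.commuting)
    hence "hecke_q * c0 = hecke_q * hecke_q + 1 \<or> hecke_q * c0 = - 2 * hecke_q"
      by (auto simp: add_eq_0_iff2)
    moreover have "value_at_1 (hecke_q * hecke_q + 1) 2"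
    proof -
      have "hecke_q * hecke_q + 1 = to_fract ([:0, 1:] * [:0, 1:] + 1)" by (simp only: hecke_q_altdef to_fract_mult to_fract_add to_fract_1)
      thus ?thesis using value_at_1_to_fractI[of "[:0, 1:] * [:0, 1:] + 1" 2] by simp
    qed
    moreover have "value_at_1 (- 2 * hecke_q) (- 2)"
      using value_at_1_mult[OF value_at_1_const[of "-2"] value_at_1_q] by simp
    ultimately have "y + inverse y = 2 \<or> y + inverse y = - 2" using val2 value_at_1_unique by metis
    moreover have "(y - 1) * (y - 1) = (y + inverse y - 2) * y" "(y + 1) * (y + 1) = (y + inverse y + 2) * y"
      using y(1) by (simp_all add: algebra_simps)
    ultimately have "(y - 1) * (y - 1) = 0 \<or> (y + 1) * (y + 1) = 0" by auto
    thus False using y(2,3) by (auto simp: add_eq_0_iff2)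
  qed
  have entries: "A * B = B * A" if "\<And>i j. i \<in> {0,1} \<Longrightarrow> j \<in> {0,1} \<Longrightarrow> (A * B) $$ (i, j) = (B * A) $$ (i, j)"
  proof (rule eq_matI)
    fix i j assume "i < dim_row (B * A)" "j < dim_col (B * A)"
    hence "i \<in> {0,1}" "j \<in> {0,1}" using AB by auto
    thus "(A * B) $$ (i, j) = (B * A) $$ (i, j)" by (rule that)
  qed (use AB in auto)
  obtain p where p: "(p > 0 \<and> seq_s c0 p = 0) \<or> seq_u c0 p = 0"
  proof (cases "even m")
    case True
    then obtain p where p: "m = 2 * p" by auto
    have p0: "p > 0" using p m by simp
    have "seq_s c0 p = 0"
    proof (rule ccontr)
      assume n: "seq_s c0 p \<noteq> 0"
      have "A * B = B * A"
      proof (rule entries)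
        fix i j :: nat assume ij: "i \<in> {0,1}" "j \<in> {0,1}"
        have "hecke_q ^ p * seq_s c0 p * ((A * B) $$ (i, j) - (B * A) $$ (i, j)) = 0"
          using h.braid_entry(1)[OF ij, of p] braid unfolding p by simp
        thus "(A * B) $$ (i, j) = (B * A) $$ (i, j)" using n by simp
      qed
      thus False using noncomm by blast
    qed
    thus thesis using that p0 by blast
  next
    case False
    then obtain p where p: "m = Suc (2 * p)" by (auto elim: oddE)
    have "seq_u c0 p = 0"
    proof (rule ccontr)
      assume n: "seq_u c0 p \<noteq> 0"
      have "A = B"
      proof (rule eq_matI)
        fix i j assume "i < dim_row B" "j < dim_col B"
        hence ij: "i \<in> {0,1}" "j \<in> {0,1}" using AB by auto
        have "hecke_q ^ p * seq_u c0 p * (A $$ (i, j) - B $$ (i, j)) = 0"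
          using h.braid_entry(2)[OF ij, of p] braid unfolding p by simp
        thus "A $$ (i, j) = B $$ (i, j)" using n by simp
      qed (use AB in auto)
      thus False using noncomm by simp
    qed
    thus thesis using that by blast
  qed
  then obtain g where g: "c0 = const_fract g" using seq_zero_constant by blast
  have "value_at_1 (hecke_q * c0) g"
    unfolding g using value_at_1_mult[OF value_at_1_q value_at_1_const[of g]] by simp
  hence "g = y + inverse y" using val2 value_at_1_unique by blast
  thus ?thesis using hpM g by simp
qed

text \<open>Multiplied by q, the summands are q * t^2 in even length and (q - 1)^2 * u^2 in odd
  length, with t and u constant. The constant terms are 0 or u^2, and u = 1 for a generator.\<close>

lemma a_value_two:
  assumes E: "two_form E k P Q"
  shows "a_value D E = 1"
proof -
  have deg: "deg E = 2" and k: "0 < k" "2 * k < m" using E by (auto simp: two_form_def)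
  have "a_value D E = int 1"
  proof (rule a_valueI[OF _ hecke_lift_two_exists[OF E]])
    fix S b c M assume cp: "cox_pair S b c" and hecke_lift: "hecke_lift S E M"
    define y where "y = (b / c) ^ k"
    note y = pair_root[OF cp k, folded y_def]
    have hp: "hecke_pair hecke_q (const_fract (y + inverse y)) (M (ref b)) (M (ref c))"
      using hecke_lift_two[OF E cp hecke_lift] by (simp add: y_def)
    \<comment> \<open>As y lies on the unit circle, y + 1/y is real; hence u is real and u^2 is
      nonnegative.\<close>
    have "norm y ^ m = 1" using y(4) by (simp add: norm_power[symmetric])
    hence "norm y = 1" using m by (metis norm_ge_zero power_eq_imp_eq_base power_one zero_le_one)
    hence "y * cnj y = 1" by (simp add: complex_norm_square[symmetric])
    hence "inverse y = cnj y" by (rule inverse_unique)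
    then obtain r where r: "y + inverse y = complex_of_real r"
      using complex_add_cnj[of y] by metis
    define p where "p v = word_length S v div 2" for v
    define f where "f v = (if even (word_length S v) then [:0, (seq_t (y + inverse y) (p v))\<^sup>2:]
        else [:- 1, 1:]\<^sup>2 * [:(complex_of_real (seq_u r (p v)))\<^sup>2:])" for v
    have bS: "ref b \<in> S" using cp by (simp add: cox_pair_def)
    have bD: "ref b \<in> D" using cox_pair_in_D[OF cp bS] .
    show "\<exists>f. (\<forall>v\<in>D. hecke_char S (deg E) M v * hecke_char S (deg E) M (inv\<^bsub>GL 2\<^esub> v) /
              hecke_q ^ word_length S v * hecke_q ^ 1 = to_fract (f v) \<and>
            (\<exists>y::real. y \<ge> 0 \<and> poly (f v) 0 = complex_of_real y)) \<and> (\<exists>v\<in>D. poly (f v) 0 \<noteq> 0)"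
    proof (intro exI[of _ f] conjI ballI bexI)
      fix v assume v: "v \<in> D"
      note vi = inv_in_D[OF v]
      show "hecke_char S (deg E) M v * hecke_char S (deg E) M (inv\<^bsub>GL 2\<^esub> v) /
              hecke_q ^ word_length S v * hecke_q ^ 1 = to_fract (f v)"
      proof (cases "even (word_length S v)")
        case True
        hence l: "word_length S v = 2 * p v" by (simp add: p_def)
        let ?t = "const_fract (seq_t (y + inverse y) (p v))"
        have c: "hecke_char S 2 M v = hecke_q ^ p v * ?t" "hecke_char S 2 M (inv\<^bsub>GL 2\<^esub> v) = hecke_q ^ p v * ?t"
          using hecke_char_pair(1)[OF cp hp v l] hecke_char_pair(1)[OF cp hp vi] word_length_inv_D[OF cp v] l
          by (simp_all only: seq_const)
        have "to_fract (f v) = hecke_q * ?t ^ 2"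
        proof -
          have "f v = [:0, 1:] * [:(seq_t (y + inverse y) (p v))\<^sup>2:]" using True by (simp add: f_def)
          hence "to_fract (f v) = to_fract [:0, 1:] * to_fract [:(seq_t (y + inverse y) (p v))\<^sup>2:]"
            by (simp only: to_fract_mult)
          thus ?thesis by (simp only: hecke_q_altdef const_fract_def[symmetric] const_fract_simps)
        qed
        thus ?thesis unfolding deg c l
          by (simp add: power_mult power2_eq_square power_mult_distrib field_simps)
      next
        case False
        hence l: "word_length S v = Suc (2 * p v)" by (simp add: p_def)
        let ?u = "const_fract (seq_u (y + inverse y) (p v))"
        have c: "hecke_char S 2 M v = (hecke_q - 1) * hecke_q ^ p v * ?u"
          "hecke_char S 2 M (inv\<^bsub>GL 2\<^esub> v) = (hecke_q - 1) * hecke_q ^ p v * ?u"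
          using hecke_char_pair(2)[OF cp hp v l] hecke_char_pair(2)[OF cp hp vi] word_length_inv_D[OF cp v] l
          by (simp_all only: seq_const)
        have "to_fract (f v) = (hecke_q - 1)\<^sup>2 * ?u ^ 2"
        proof -
          have "[:- 1, 1:] = [:0, 1:] - (1 :: complex poly)" by (simp add: one_pCons)
          hence "f v = ([:0, 1:] - 1)\<^sup>2 * [:(seq_u (y + inverse y) (p v))\<^sup>2:]"
            using False by (simp only: f_def if_False r seq_u_of_real)
          hence "to_fract (f v) = (to_fract [:0, 1:] - 1)\<^sup>2 * to_fract [:(seq_u (y + inverse y) (p v))\<^sup>2:]"
            by (simp only: to_fract_mult to_fract_power to_fract_diff to_fract_1)
          thus ?thesis by (simp only: hecke_q_altdef const_fract_def[symmetric] const_fract_simps)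
        qed
        thus ?thesis unfolding deg c l
          by (simp add: power_mult power2_eq_square power_mult_distrib)
      qed
      show "\<exists>y::real. y \<ge> 0 \<and> poly (f v) 0 = complex_of_real y"
        by (cases "even (word_length S v)")
          (auto simp: f_def power2_eq_square intro: exI[of _ 0] exI[of _ "(seq_u r (p v))\<^sup>2"] simp flip: of_real_mult)
    next
      have "word_length S (ref b) = 1" using chosen(3)[OF cp bD] chosen_generator[OF cp bS] by simp
      thus "poly (f (ref b)) 0 \<noteq> 0" by (simp add: f_def p_def)
    qed (rule bD)
  qed (simp add: deg)
  thus ?thesis by simp
qed

end

section \<open>Special representations and truncated induction\<close>

lemma det_2: assumes A: "(A :: complex mat) \<in> carrier_mat 2 2"
  shows "det A = A $$ (0,0) * A $$ (1,1) - A $$ (0,1) * A $$ (1,0)"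
proof -
  have s: "{..<2::nat} = {0, 1}" by auto
  have c: "mat_delete A 0 j \<in> carrier_mat 1 1" for j using mat_delete_carrier[OF A, of 0 j] by simp
  have "det A = (\<Sum>j<2. A $$ (0, j) * cofactor A 0 j)" by (rule laplace_expansion_row[OF A]) simp
  also have "\<dots> = A $$ (0, 0) * det (mat_delete A 0 0) - A $$ (0, 1) * det (mat_delete A 0 1)"
    unfolding s by (simp add: cofactor_def)
  also have "det (mat_delete A 0 0) = A $$ (1, 1)"
    unfolding det_single[OF c] using A by (simp add: mat_delete_def)
  also have "det (mat_delete A 0 1) = A $$ (1, 0)"
    unfolding det_single[OF c] using A by (simp add: mat_delete_def)
  finally show ?thesis .
qed

lemma sign_rep_values:
  "a \<noteq> 0 \<Longrightarrow> sign_rep (rot a) = mat 1 1 (\<lambda>_. 1)" "a \<noteq> 0 \<Longrightarrow> sign_rep (ref a) = mat 1 1 (\<lambda>_. - 1)"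
  by (simp_all add: sign_rep_def det_2 rot_def ref_def)

lemma deg_sign_rep [simp]: "deg sign_rep = 1"
  by (simp add: deg_def sign_rep_def)

lemma inj_from_kernel:
  assumes R: "(R :: complex mat) \<in> carrier_mat N n"
    and "\<And>u. u \<in> carrier_vec n \<Longrightarrow> R *\<^sub>v u = 0\<^sub>v N \<Longrightarrow> u = 0\<^sub>v n"
  shows "inj_on (\<lambda>u. R *\<^sub>v u) (carrier_vec n)"
proof (rule inj_onI)
  fix u v assume uv: "u \<in> carrier_vec n" "v \<in> carrier_vec n" "R *\<^sub>v u = R *\<^sub>v v"
  have "R *\<^sub>v (u - v) = R *\<^sub>v u - R *\<^sub>v v" by (rule mult_minus_distrib_mat_vec[OF R uv(1,2)])
  also have "\<dots> = 0\<^sub>v N" using uv R by (intro eq_vecI) auto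
  finally have z: "u - v = 0\<^sub>v n" using assms(2) uv by auto
  show "u = v"
  proof (rule eq_vecI)
    fix i assume "i < dim_vec v"
    thus "u $ i = v $ i" using arg_cong[OF z, of "\<lambda>v. v $ i"] uv by auto
  qed (use uv in auto)
qed

lemma mat_zero_from_kernel:
  assumes R: "(R :: complex mat) \<in> carrier_mat N n" and "\<And>u. u \<in> carrier_vec n \<Longrightarrow> R *\<^sub>v u = 0\<^sub>v N"
  shows "R = 0\<^sub>m N n"
proof (rule eq_matI)
  fix i j assume ij: "i < dim_row (0\<^sub>m N n :: complex mat)" "j < dim_col (0\<^sub>m N n :: complex mat)"
  have "R *\<^sub>v unit_vec n j = col R j" using R ij by (intro eq_vecI) auto
  hence "col R j = 0\<^sub>v N" using assms(2)[of "unit_vec n j"] by simp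
  hence "col R j $ i = 0" using ij by simp
  thus "R $$ (i, j) = 0\<^sub>m N n $$ (i, j)" using R ij by simp
qed (use R in auto)

lemma subspaceD:
  assumes "VectorSpace.subspace class_ring U (module_vec TYPE(complex) n)"
  shows "U \<subseteq> carrier_vec n" "0\<^sub>v n \<in> U" "\<And>c u. u \<in> U \<Longrightarrow> c \<cdot>\<^sub>v u \<in> U"
  using assms unfolding VectorSpace.subspace_def submodule_def
  by (auto simp: module_vec_simps)

text \<open>The trivial group arises from classes fixed by no reflection. It is not of the form
  \<open>Dih m a0\<close> with m > 0 and nonzero a0, so its invariants are computed
  separately.\<close>

lemma irr_trivial_group:
  assumes E: "irr {1\<^sub>m 2} E"
  shows "deg E = 1" "E (1\<^sub>m 2) = 1\<^sub>m 1"
proof -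
  have rep: "rep {1\<^sub>m 2} E" and pos: "deg E > 0" using E by (auto simp: irr_def)
  have "subgroup {1\<^sub>m 2} (GL 2)" using GL.triv_subgroup[of 2] by simp
  from subgroup.subgroup_is_group[OF this group_GL]
  have one: "E (1\<^sub>m 2) = 1\<^sub>m (deg E)"
    using hom_one[OF _ _ group_GL, of E "(GL 2)\<lparr>carrier := {1\<^sub>m 2}\<rparr>" "deg E"] rep by (simp add: rep_def)
  define e0 where "e0 = (unit_vec (deg E) 0 :: complex vec)"
  define U where "U = {c \<cdot>\<^sub>v e0 | c. True}"
  have e0: "e0 \<in> carrier_vec (deg E)" by (simp add: e0_def)
  have "VectorSpace.subspace class_ring U (module_vec TYPE(complex) (deg E))"
  proof (rule subspaceI)
    show "0\<^sub>v (deg E) \<in> U" using e0 by (auto simp: U_def intro!: exI[of _ 0])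
  qed (use e0 in \<open>auto simp: U_def smult_smult_assoc simp flip: add_smult_distrib_vec\<close>)
  moreover have "\<forall>g\<in>{1\<^sub>m 2}. \<forall>u\<in>U. E g *\<^sub>v u \<in> U" using one e0 by (auto simp: U_def)
  ultimately have "U = {0\<^sub>v (deg E)} \<or> U = carrier_vec (deg E)" using E unfolding irr_def by blast
  moreover have "e0 \<in> U" using e0 by (auto simp: U_def intro!: exI[of _ 1])
  moreover have "e0 \<noteq> 0\<^sub>v (deg E)"
  proof
    assume "e0 = 0\<^sub>v (deg E)"
    hence "e0 $ 0 = 0" using pos by simp
    thus False using pos by (simp add: e0_def)
  qed
  ultimately have all: "U = carrier_vec (deg E)" by auto
  show "deg E = 1"
  proof (rule ccontr)
    assume "deg E \<noteq> 1"
    hence 1: "1 < deg E" using pos by simp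
    have "unit_vec (deg E) 1 \<in> U" unfolding all by simp
    then obtain c where c: "unit_vec (deg E) 1 = c \<cdot>\<^sub>v e0" by (auto simp: U_def)
    show False using arg_cong[OF c, of "\<lambda>v. v $ 1"] 1 e0 by (simp add: e0_def)
  qed
  thus "E (1\<^sub>m 2) = 1\<^sub>m 1" using one by simp
qed

lemma b_value_trivial_group: assumes E: "irr {1\<^sub>m 2} E" shows "b_value {1\<^sub>m 2} E = 0"
proof -
  have "sym_pow 0 (1\<^sub>m 2) = 1\<^sub>m 1"
    by (rule eq_matI) (auto simp: sym_pow_def)
  hence "intertwiner {1\<^sub>m 2} E (sym_pow 0) (1\<^sub>m 1)"
    using irr_trivial_group[OF E] by (simp add: intertwiner_def)
  moreover have "1\<^sub>m 1 \<noteq> (0\<^sub>m (0 + 1) (deg E) :: complex mat)"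
    using irr_trivial_group[OF E] by (auto dest: arg_cong[where f = "\<lambda>A. A $$ (0,0)"])
  ultimately show ?thesis unfolding b_value_def by (intro Least_eq_0) blast
qed

lemma a_value_trivial_group: assumes E: "irr {1\<^sub>m 2} E" shows "a_value {1\<^sub>m 2} E = 0"
proof -
  have deg: "deg E = 1" and E1: "E (1\<^sub>m 2) = 1\<^sub>m 1" using irr_trivial_group[OF E] by auto
  have l: "word_length {} (1\<^sub>m 2) = 0" using word_length_le[of "[]" "{}"] by simp
  have "(SOME us. reduced {} us \<and> word_prod 2 id us = 1\<^sub>m 2) = []"
    by (rule some_equality) (auto simp: reduced_def l)
  hence char: "hecke_char {} 1 M (1\<^sub>m 2) = 1" for M
    by (simp add: hecke_char_def mat_trace_def)
  have inv: "inv\<^bsub>GL 2\<^esub> (1\<^sub>m 2) = 1\<^sub>m 2" using GL.inv_one[of 2] by simp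
  have gd: "generic_degree {1\<^sub>m 2} {} 1 M = Fract 1 1" for M
    unfolding generic_degree_def by (simp only: sum.insert sum.empty finite.emptyI empty_iff not_False_eq_True)
      (simp add: char inv l One_fract_def[symmetric] del: One_nat_def)
  have van: "vanishing_order_at_0 (generic_degree {1\<^sub>m 2} {} 1 M) k \<longleftrightarrow> k = 0" for M k
    using vanishing_order_iff[OF gd, of M k] by simp
  have cox: "coxeter_generators {1\<^sub>m 2} S \<longleftrightarrow> S = {}" for S
  proof
    assume c: "coxeter_generators {1\<^sub>m 2} S"
    show "S = {}"
    proof (rule ccontr)
      assume "S \<noteq> {}"
      then obtain s where s: "s \<in> S" by blast
      hence "s \<in> generate (GL 2) S" by (rule generate.incl)
      hence "s = 1\<^sub>m 2" using c by (auto simp: coxeter_generators_def)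
      thus False using c s by (auto simp: coxeter_generators_def reflection_def)
    qed
  next
    assume "S = {}"
    thus "coxeter_generators {1\<^sub>m 2} S" by (simp add: coxeter_generators_def generate_empty_GL)
  qed
  have val: "value_at_1 (hecke_char {} 1 M (1\<^sub>m 2)) (mat_trace (E (1\<^sub>m 2)))" for M
    using value_at_1_const[of 1] by (simp only: char E1) (simp add: mat_trace_def)
  have hr: "hecke_rep {} 1 M" for M by (simp add: hecke_rep_def)
  show ?thesis unfolding a_value_def deg cox
    using van val hr by (intro the_equality) blast+
qed

lemma spetsial_trivial_group: "spetsial {1\<^sub>m 2}"
  unfolding spetsial_def
  using reflection_group_trivial a_value_trivial_group b_value_trivial_group by simp

section \<open>Special representations of dihedral groups\<close>

context dihedral
begin

lemma irr_cases:
  assumes E: "irr D E"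
  obtains "one_form E 0 1" "b_value D E = 0" "a_value D E = 0"
  | "one_form E 0 (-1)" "b_value D E = m" "a_value D E = int m"
  | h \<epsilon> where "one_form E h \<epsilon>" "2 * h = m" "b_value D E = h" "a_value D E = 1"
  | k P Q where "two_form E k P Q" "b_value D E = k" "a_value D E = 1"
proof (rule irr_form[OF E])
  fix h \<epsilon> assume o: "one_form E h \<epsilon>"
  have b: "b_value D E = label_one h \<epsilon>" using b_value_one[OF o] .
  have h: "h = 0 \<or> 2 * h = m" and eps: "\<epsilon> = 1 \<or> \<epsilon> = - 1" using o by (auto simp: one_form_def)
  show thesis
  proof (cases "h = 0")
    case True
    show thesis using eps
    proof
      assume "\<epsilon> = 1" thus thesis using that(1) o b a_value_trivial E True by (simp add: label_one_def)
    next
      assume "\<epsilon> = - 1" thus thesis using that(2) o b a_value_sign E True by (simp add: label_one_def)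
    qed
  next
    case False
    hence 2: "2 * h = m" using h by simp
    thus thesis using that(3)[OF o 2] b a_value_mixed[OF o E 2] False by (simp add: label_one_def)
  qed
next
  fix k P Q assume "two_form E k P Q"
  thus thesis using that(4) b_value_two a_value_two by blast
qed

lemma spetsial_D: "spetsial D"
  unfolding spetsial_def
proof (intro conjI allI impI)
  fix E assume E: "irr D E"
  show "a_value D E \<le> int (b_value D E)"
    by (cases rule: irr_cases[OF E]) (use m in \<open>auto simp: two_form_def\<close>)
qed (use reflection_group_Dih m in simp)

text \<open>Apart from the trivial and the sign representation one has a = 1 and 0 < b < m, so a = b
  just means b = 1.\<close>

lemma special_iff:
  "special D E \<longleftrightarrow> irr D E \<and> (b_value D E = 0 \<or> b_value D E = 1 \<or> b_value D E = m)"
proof (cases "irr D E")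
  case True
  show ?thesis
    by (cases rule: irr_cases[OF True]) (use m True in \<open>auto simp: special_def two_form_def\<close>)
qed (auto simp: special_def)

lemma label_sign:
  assumes E: "irr D E" and b: "b_value D E = m" "m > 1 \<or> m \<noteq> b_value D E"
  shows "one_form E 0 (-1)"
  by (cases rule: irr_cases[OF E]) (use m b in \<open>auto simp: two_form_def\<close>)

lemma one_form_sign_rep: "one_form sign_rep 0 (-1)"
  unfolding one_form_def using root_nonzero by (auto simp: sign_rep_values)

lemma irr_sign_rep: "irr D sign_rep"
proof -
  have sq: "sign_rep g * sign_rep g = 1\<^sub>m 1 \<and> sign_rep g \<in> carrier_mat 1 1" if "g \<in> D" for g
    using that root_nonzero by (auto elim!: D_cases simp: sign_rep_values scalar_prod_def intro!: eq_matI)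
  have "rep D sign_rep"
    unfolding rep_def hom_def
  proof (intro CollectI conjI ballI funcsetI)
    fix g assume "g \<in> carrier ((GL 2)\<lparr>carrier := D\<rparr>)"
    thus "sign_rep g \<in> carrier (GL (deg sign_rep))" using sq[of g] by (auto simp: carrier_GL)
  next
    fix g h assume "g \<in> carrier ((GL 2)\<lparr>carrier := D\<rparr>)" "h \<in> carrier ((GL 2)\<lparr>carrier := D\<rparr>)"
    hence "g \<in> carrier_mat 2 2" "h \<in> carrier_mat 2 2" by (auto elim!: D_cases)
    hence "det (g * h) = det g * det h" by (rule det_mult)
    thus "sign_rep (g \<otimes>\<^bsub>(GL 2)\<lparr>carrier := D\<rparr>\<^esub> h) = sign_rep g \<otimes>\<^bsub>GL (deg sign_rep)\<^esub> sign_rep h"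
      by (auto simp: sign_rep_def scalar_prod_def intro!: eq_matI)
  qed
  moreover have "U = {0\<^sub>v 1} \<or> U = carrier_vec 1"
    if U: "VectorSpace.subspace class_ring U (module_vec TYPE(complex) 1)" for U
  proof (cases "U \<subseteq> {0\<^sub>v 1}")
    case True thus ?thesis using subspaceD(2)[OF U] by auto
  next
    case False
    then obtain u where u: "u \<in> U" "u \<noteq> 0\<^sub>v 1" by blast
    have uc: "u \<in> carrier_vec 1" using subspaceD(1)[OF U] u by auto
    have u0: "u $ 0 \<noteq> 0"
    proof
      assume "u $ 0 = 0"
      hence "u = 0\<^sub>v 1" using uc by (intro eq_vecI) auto
      thus False using u by simp
    qed
    have "v \<in> U" if v: "v \<in> carrier_vec 1" for v
    proof -
      have "v = (v $ 0 / u $ 0) \<cdot>\<^sub>v u" using v uc u0 by (intro eq_vecI) auto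
      thus ?thesis using subspaceD(3)[OF U u(1)] by metis
    qed
    thus ?thesis using subspaceD(1)[OF U] by blast
  qed
  ultimately show ?thesis unfolding irr_def by simp
qed

lemma b_value_sign_rep: "b_value D sign_rep = m"
  using b_value_one[OF one_form_sign_rep] m by (simp add: label_one_def)

lemma special_sign_rep: "special D sign_rep"
  using special_iff[of sign_rep] irr_sign_rep b_value_sign_rep by simp

section \<open>Truncated induction\<close>

lemma intertwiner_vec:
  assumes R: "intertwiner D E F R" and E: "rep D E" and g: "g \<in> D" and u: "u \<in> carrier_vec (deg E)"
    and F: "F g \<in> carrier_mat (deg F) (deg F)"
  shows "F g *\<^sub>v (R *\<^sub>v u) = R *\<^sub>v (E g *\<^sub>v u)"
proof -
  have Rc: "R \<in> carrier_mat (deg F) (deg E)" and eq: "R * E g = F g * R"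
    using R g by (auto simp: intertwiner_def)
  have "F g *\<^sub>v (R *\<^sub>v u) = (F g * R) *\<^sub>v u" by (rule assoc_mult_mat_vec[symmetric, OF F Rc u])
  also have "\<dots> = R *\<^sub>v (E g *\<^sub>v u)" unfolding eq[symmetric]
    by (rule assoc_mult_mat_vec[OF Rc rep_carrier[OF E g] u])
  finally show ?thesis .
qed

lemma intertwiner_sym_vec:
  assumes "intertwiner D E (sym_pow n) R" "rep D E" "g \<in> D" "u \<in> carrier_vec (deg E)"
  shows "sym_pow n g *\<^sub>v (R *\<^sub>v u) = R *\<^sub>v (E g *\<^sub>v u)"
  using intertwiner_vec[OF assms] sym_pow_carrier[of n g] by simp

lemma intertwiner_inj:
  assumes E: "irr D E" and R: "intertwiner D E (sym_pow n) R" "R \<noteq> 0\<^sub>m (n + 1) (deg E)"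
  shows "inj_on (\<lambda>u. R *\<^sub>v u) (carrier_vec (deg E))"
proof -
  have rep: "rep D E" using E by (simp add: irr_def)
  have Rc: "R \<in> carrier_mat (n + 1) (deg E)" using R(1) by (simp add: intertwiner_def)
  define U where "U = {u \<in> carrier_vec (deg E). R *\<^sub>v u = 0\<^sub>v (n + 1)}"
  show ?thesis
  proof (rule inj_from_kernel[OF Rc], rule ccontr)
    fix u assume u: "u \<in> carrier_vec (deg E)" "R *\<^sub>v u = 0\<^sub>v (n + 1)" "u \<noteq> 0\<^sub>v (deg E)"
    have "U = carrier_vec (deg E)"
    proof (rule irr_invariant[OF E, of U u])
      show "0\<^sub>v (deg E) \<in> U" using mult_zero_vec[OF Rc] by (simp add: U_def)
      show "x + y \<in> U" if "x \<in> U" "y \<in> U" for x y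
        using that mult_add_distrib_mat_vec[OF Rc, of x y] by (auto simp: U_def)
      show "c \<cdot>\<^sub>v x \<in> U" if "x \<in> U" for c x
        using that mult_mat_vec[OF Rc, of x c] by (auto simp: U_def)
      fix g x assume g: "g \<in> D" and x: "x \<in> U"
      have xc: "x \<in> carrier_vec (deg E)" "R *\<^sub>v x = 0\<^sub>v (n + 1)" using x by (auto simp: U_def)
      have "R *\<^sub>v (E g *\<^sub>v x) = sym_pow n g *\<^sub>v 0\<^sub>v (n + 1)"
        using intertwiner_sym_vec[OF R(1) rep g xc(1)] xc by simp
      also have "\<dots> = 0\<^sub>v (n + 1)" by (rule mult_zero_vec[OF sym_pow_carrier])
      finally show "E g *\<^sub>v x \<in> U" using rep_carrier[OF rep g] xc by (simp add: U_def)
    qed (use u in \<open>auto simp: U_def\<close>)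
    hence "R = 0\<^sub>m (n + 1) (deg E)" by (intro mat_zero_from_kernel[OF Rc]) (auto simp: U_def)
    thus False using R(2) by simp
  qed
qed

lemma image_closed:
  assumes R: "(R :: complex mat) \<in> carrier_mat N n"
  defines "U \<equiv> (\<lambda>u. R *\<^sub>v u) ` carrier_vec n"
  shows "U \<subseteq> carrier_vec N" "0\<^sub>v N \<in> U" "\<And>u v. u \<in> U \<Longrightarrow> v \<in> U \<Longrightarrow> u + v \<in> U"
    "\<And>c u. u \<in> U \<Longrightarrow> c \<cdot>\<^sub>v u \<in> U"
proof -
  show "U \<subseteq> carrier_vec N" using R by (auto simp: U_def)
  show "0\<^sub>v N \<in> U" unfolding U_def using mult_zero_vec[OF R] by (metis imageI zero_carrier_vec)
  show "u + v \<in> U" if uv: "u \<in> U" "v \<in> U" for u v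
  proof -
    obtain x y where "x \<in> carrier_vec n" "u = R *\<^sub>v x" "y \<in> carrier_vec n" "v = R *\<^sub>v y"
      using uv unfolding U_def by blast
    thus ?thesis unfolding U_def using mult_add_distrib_mat_vec[OF R, of x y]
      by (intro image_eqI[of _ _ "x + y"]) auto
  qed
  show "c \<cdot>\<^sub>v u \<in> U" if cu: "u \<in> U" for c u
  proof -
    obtain x where "x \<in> carrier_vec n" "u = R *\<^sub>v x" using cu unfolding U_def by blast
    thus ?thesis unfolding U_def using mult_mat_vec[OF R, of x c]
      by (intro image_eqI[of _ _ "c \<cdot>\<^sub>v x"]) auto
  qed
qed

text \<open>The whole group is pseudoparabolic (x = 0), so this makes every special representation a
  Springer representation.\<close>

lemma trunc_ind_self:
  assumes E: "irr D E"
  shows "trunc_ind D D E E"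
proof -
  define n where "n = b_value D E"
  obtain T where T: "first_copy D E n T" using irr_first_copy[OF E] by (auto simp: n_def)
  have rep: "rep D E" using E by (simp add: irr_def)
  have Ti: "intertwiner D E (sym_pow n) T" "T \<noteq> 0\<^sub>m (n + 1) (deg E)"
    "\<forall>T'. intertwiner D E (sym_pow n) T' \<longrightarrow> (\<exists>c. T' = c \<cdot>\<^sub>m T)"
    using T by (auto simp: first_copy_def)
  have Tc: "T \<in> carrier_mat (n + 1) (deg E)" using Ti(1) by (simp add: intertwiner_def)
  let ?S = "{sym_pow n g *\<^sub>v (T *\<^sub>v u) | g u. g \<in> D \<and> u \<in> carrier_vec (deg E)}"
  let ?U = "(\<lambda>u. T *\<^sub>v u) ` carrier_vec (deg E)"
  have "LinearCombinations.module.span class_ring (module_vec TYPE(complex) (n + 1)) ?S = ?U"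
  proof (rule span_eqI[OF image_closed[OF Tc]])
    show "?S \<subseteq> ?U"
    proof
      fix s assume "s \<in> ?S"
      then obtain g u where gu: "s = sym_pow n g *\<^sub>v (T *\<^sub>v u)" "g \<in> D" "u \<in> carrier_vec (deg E)" by blast
      hence "s = T *\<^sub>v (E g *\<^sub>v u)" using intertwiner_sym_vec[OF Ti(1) rep] by simp
      moreover have "E g *\<^sub>v u \<in> carrier_vec (deg E)" using rep_carrier[OF rep gu(2)] gu(3) by simp
      ultimately show "s \<in> ?U" by blast
    qed
    fix s assume "s \<in> ?U"
    then obtain u where u: "s = T *\<^sub>v u" "u \<in> carrier_vec (deg E)" by blast
    have "s = sym_pow n (1\<^sub>m 2) *\<^sub>v (T *\<^sub>v u)"
      using intertwiner_sym_vec[OF Ti(1) rep one_in u(2)] rep_one[OF rep] u by simp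
    hence "s \<in> ?S" using one_in u(2) by blast
    moreover have "s = 1 \<cdot>\<^sub>v s + 0 \<cdot>\<^sub>v s" using u Tc by (intro eq_vecI) auto
    ultimately show "\<exists>a b s' t. s' \<in> ?S \<and> t \<in> ?S \<and> s = a \<cdot>\<^sub>v s' + b \<cdot>\<^sub>v t" by blast
  qed
  thus ?thesis unfolding trunc_ind_def Let_def n_def[symmetric]
    using E rep Ti intertwiner_inj[OF E Ti(1,2)] by blast
qed

text \<open>Since E' occurs in the restriction of E, a copy of E in degree n contains a copy of E'.\<close>

lemma trunc_ind_b_value:
  assumes E: "irr D E" and sub: "W' \<subseteq> D" and one: "1\<^sub>m 2 \<in> W'" and tr: "trunc_ind D W' E' E"
    and E'c: "\<And>g. g \<in> W' \<Longrightarrow> E' g \<in> carrier_mat (deg E') (deg E')"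
  shows "b_value D E = b_value W' E'"
proof -
  define n where "n = b_value W' E'"
  have rep: "rep D E" using E by (simp add: irr_def)
  obtain T R where T: "intertwiner W' E' (sym_pow n) T" "T \<noteq> 0\<^sub>m (n + 1) (deg E')"
    and R: "intertwiner D E (sym_pow n) R" "inj_on (\<lambda>u. R *\<^sub>v u) (carrier_vec (deg E))"
      "(\<lambda>u. R *\<^sub>v u) ` carrier_vec (deg E) =
           LinearCombinations.module.span class_ring (module_vec TYPE(complex) (n + 1))
             {sym_pow n g *\<^sub>v (T *\<^sub>v u) | g u. g \<in> D \<and> u \<in> carrier_vec (deg E')}" (is "_ = LinearCombinations.module.span _ _ ?S")
    using tr unfolding trunc_ind_def Let_def n_def[symmetric] by blast
  have Tc: "T \<in> carrier_mat (n + 1) (deg E')" using T(1) by (simp add: intertwiner_def)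
  have Rc: "R \<in> carrier_mat (n + 1) (deg E)" using R(1) by (simp add: intertwiner_def)
  have TS: "T *\<^sub>v u \<in> (\<lambda>u. R *\<^sub>v u) ` carrier_vec (deg E)" if u: "u \<in> carrier_vec (deg E')" for u
  proof -
    interpret vs: vec_space "TYPE(complex)" "n + 1" .
    have Sc: "?S \<subseteq> carrier_vec (n + 1)" using sym_pow_carrier Tc by (auto intro!: mult_mat_vec_carrier)
    have "sym_pow n (1\<^sub>m 2) = 1\<^sub>m (n + 1)"
      by (rule eq_matI) (use sym_pow_rot[of _ n _ 1] sym_pow_carrier[of n "1\<^sub>m 2"] in auto)
    hence "T *\<^sub>v u = sym_pow n (1\<^sub>m 2) *\<^sub>v (T *\<^sub>v u)" using Tc u by simp
    hence "T *\<^sub>v u \<in> ?S" using one_in u by blast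
    thus ?thesis unfolding R(3) using vs.in_own_span[OF Sc] by blast
  qed
  have "\<exists>q. \<forall>j. q j \<in> carrier_vec (deg E) \<and> (j < deg E' \<longrightarrow> R *\<^sub>v q j = T *\<^sub>v unit_vec (deg E') j)"
  proof -
    have "\<exists>v. v \<in> carrier_vec (deg E) \<and> (j < deg E' \<longrightarrow> R *\<^sub>v v = T *\<^sub>v unit_vec (deg E') j)" for j
      using TS[of "unit_vec (deg E') j"] by force
    thus ?thesis by metis
  qed
  then obtain q where q: "\<And>j. q j \<in> carrier_vec (deg E)"
    "\<And>j. j < deg E' \<Longrightarrow> R *\<^sub>v q j = T *\<^sub>v unit_vec (deg E') j" by blast
  \<comment> \<open>Its columns are preimages under R of the columns of T, so T = R * Q. As R is
    injective, Q intertwines E' with the restriction of E.\<close>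
  define Q where "Q = mat (deg E) (deg E') (\<lambda>(i, j). q j $ i)"
  have Qc: "Q \<in> carrier_mat (deg E) (deg E')" by (simp add: Q_def)
  have colQ: "col Q j = q j" if "j < deg E'" for j
    using that q(1)[of j] by (intro eq_vecI) (auto simp: Q_def)
  have RQ: "R * Q = T"
  proof (rule eq_matI)
    fix i j assume ij: "i < dim_row T" "j < dim_col T"
    have "(R * Q) $$ (i, j) = (R *\<^sub>v q j) $ i" using ij Rc Tc Qc colQ by simp
    also have "\<dots> = (T *\<^sub>v unit_vec (deg E') j) $ i" using q(2) ij Tc by simp
    also have "\<dots> = T $$ (i, j)" using ij Tc by auto
    finally show "(R * Q) $$ (i, j) = T $$ (i, j)" .
  qed (use Rc Qc Tc in auto)
  have cancel: "X = Y" if "R * X = R * Y" "X \<in> carrier_mat (deg E) k" "Y \<in> carrier_mat (deg E) k" for X Y k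
  proof (rule eq_matI)
    fix i j assume ij: "i < dim_row Y" "j < dim_col Y"
    hence jk: "j < k" using that by simp
    have "R *\<^sub>v col X j = R *\<^sub>v col Y j"
      unfolding col_mult2[OF Rc that(2) jk, symmetric] col_mult2[OF Rc that(3) jk, symmetric] that(1) ..
    hence "col X j = col Y j" using R(2) that ij by (auto dest!: inj_onD)
    hence "col X j $ i = col Y j $ i" by simp
    thus "X $$ (i, j) = Y $$ (i, j)" using that ij by simp
  qed (use that in auto)
  have Qi: "Q * E' g = E g * Q" if g: "g \<in> W'" for g
  proof (rule cancel)
    note gD = subsetD[OF sub g]
    have "R * (Q * E' g) = (R * Q) * E' g" by (rule assoc_mult_mat[symmetric, OF Rc Qc E'c[OF g]])
    also have "\<dots> = sym_pow n g * (R * Q)" using T(1) g RQ by (simp add: intertwiner_def)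
    also have "\<dots> = (sym_pow n g * R) * Q" by (rule assoc_mult_mat[symmetric, OF sym_pow_carrier Rc Qc])
    also have "\<dots> = (R * E g) * Q" using R(1) gD by (simp add: intertwiner_def)
    also have "\<dots> = R * (E g * Q)" by (rule assoc_mult_mat[OF Rc rep_carrier[OF rep gD] Qc])
    finally show "R * (Q * E' g) = R * (E g * Q)" .
    show "Q * E' g \<in> carrier_mat (deg E) (deg E')" using Qc E'c[OF g] by simp
    show "E g * Q \<in> carrier_mat (deg E) (deg E')" using Qc rep_carrier[OF rep gD] by simp
  qed
  have Qnz: "Q \<noteq> 0\<^sub>m (deg E) (deg E')" using RQ T(2) Rc by auto
  have Rnz: "R \<noteq> 0\<^sub>m (n + 1) (deg E)" using RQ T(2) Qc by auto
  have le: "b_value D E \<le> n"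
    unfolding b_value_def by (rule Least_le) (use R(1) Rnz in blast)
  have "\<exists>T. intertwiner D E (sym_pow (b_value D E)) T \<and> T \<noteq> 0\<^sub>m (b_value D E + 1) (deg E)"
    unfolding b_value_def by (rule LeastI[of _ n]) (use R(1) Rnz in blast)
  then obtain X where X: "intertwiner D E (sym_pow (b_value D E)) X" "X \<noteq> 0\<^sub>m (b_value D E + 1) (deg E)"
    by blast
  define k where "k = b_value D E"
  note X = X[folded k_def]
  have Xc: "X \<in> carrier_mat (k + 1) (deg E)" using X(1) by (simp add: intertwiner_def)
  have inj: "inj_on (\<lambda>u. X *\<^sub>v u) (carrier_vec (deg E))" by (rule intertwiner_inj[OF E X])
  \<comment> \<open>Composing the copy X of E in degree b(E) with Q gives a nonzero copy of E',
    whence b(E') \<le> b(E); the other inequality comes from R.\<close>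
  have XQ: "intertwiner W' E' (sym_pow k) (X * Q)"
    unfolding intertwiner_def
  proof (intro conjI ballI)
    show "X * Q \<in> carrier_mat (deg (sym_pow k)) (deg E')" using Xc Qc by simp
    fix g assume g: "g \<in> W'"
    note gD = subsetD[OF sub g]
    have "X * Q * E' g = X * (Q * E' g)" by (rule assoc_mult_mat[OF Xc Qc E'c[OF g]])
    also have "\<dots> = (X * E g) * Q" unfolding Qi[OF g]
      by (rule assoc_mult_mat[symmetric, OF Xc rep_carrier[OF rep gD] Qc])
    also have "\<dots> = (sym_pow k g * X) * Q" using X(1) gD by (simp add: intertwiner_def)
    also have "\<dots> = sym_pow k g * (X * Q)" by (rule assoc_mult_mat[OF sym_pow_carrier Xc Qc])
    finally show "X * Q * E' g = sym_pow k g * (X * Q)" .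
  qed
  have "X * Q \<noteq> 0\<^sub>m (k + 1) (deg E')"
  proof
    assume z: "X * Q = 0\<^sub>m (k + 1) (deg E')"
    have "Q = 0\<^sub>m (deg E) (deg E')"
    proof (rule eq_matI)
      fix i j assume ij: "i < dim_row (0\<^sub>m (deg E) (deg E') :: complex mat)" "j < dim_col (0\<^sub>m (deg E) (deg E') :: complex mat)"
      have "X *\<^sub>v col Q j = col (X * Q) j" 
        by (rule col_mult2[OF Xc Qc, symmetric]) (use ij in simp)
      also have "\<dots> = 0\<^sub>v (k + 1)" unfolding z using ij by auto
      also have "\<dots> = X *\<^sub>v 0\<^sub>v (deg E)" by (rule mult_zero_vec[OF Xc, symmetric])
      finally have "X *\<^sub>v col Q j = X *\<^sub>v 0\<^sub>v (deg E)" .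
      hence "col Q j = 0\<^sub>v (deg E)" using inj_onD[OF inj, of "col Q j"] colQ[of j] q(1)[of j] ij by simp
      hence "col Q j $ i = 0" using ij by simp
      thus "Q $$ (i, j) = 0\<^sub>m (deg E) (deg E') $$ (i, j)" using Qc ij by simp
    qed (use Qc in auto)
    thus False using Qnz by simp
  qed
  hence "b_value W' E' \<le> k" unfolding b_value_def[of W' E'] by (intro Least_le) (use XQ in blast)
  thus ?thesis using le by (simp add: k_def n_def)
qed

end

lemma Dih_subset:
  assumes "d dvd e" "d > 0" "b ^ e = 1"
  shows "Dih d b \<subseteq> Dih e 1"
proof -
  obtain k where e: "e = d * k" using assms(1) by auto
  have "a ^ e = 1" if "a ^ d = 1" for a :: complex using that by (simp add: e power_mult)
  thus ?thesis using assms(3) by (auto simp: Dih_def power_mult_distrib)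
qed

text \<open>The sign representation of the subgroup sits in degree d as the line of e1^d - e2^d.
  Since 2 * d < e, a rotation of the whole group moves this line, and the two lines span e1^d and
  e2^d, which is the copy of E.\<close>

lemma trunc_ind_sign:
  assumes e: "e = d * q" "2 * d < e" "d > 0" and E: "irr (Dih e 1) E" and b: "b_value (Dih e 1) E = d"
  shows "trunc_ind (Dih e 1) (Dih d 1) sign_rep E"
proof -
  interpret W: dihedral e 1 by unfold_locales (use e in auto)
  interpret H: dihedral d 1 by unfold_locales (use e in auto)
  have rep: "rep W.D E" using E by (simp add: irr_def)
  obtain P Q where two: "W.two_form E d P Q"
    by (cases rule: W.irr_cases[OF E]) (use b e in auto)
  have deg: "deg E = 2" and PQ: "P \<in> carrier_mat 2 2" "Q \<in> carrier_mat 2 2" "P * Q = 1\<^sub>m 2" "Q * P = 1\<^sub>m 2"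
    using two by (auto simp: W.two_form_def)
  define C where "C = W.copy_two d"
  define R where "R = C * Q"
  have C: "C \<in> carrier_mat (d + 1) 2" by (simp add: C_def W.copy_two_def)
  have R: "intertwiner W.D E (sym_pow d) R" "R \<noteq> 0\<^sub>m (d + 1) (deg E)"
    using W.first_copy_two[OF two] by (auto simp: first_copy_def R_def C_def)
  have Rc: "R \<in> carrier_mat (d + 1) 2" using C PQ by (simp add: R_def)
  define T where "T = H.copy_one d (-1)"
  have bH: "b_value H.D sign_rep = d" by (rule H.b_value_sign_rep)
  have "H.label_one 0 (-1) = d" using H.m by (simp add: H.label_one_def)
  hence T: "first_copy H.D sign_rep d T" using H.first_copy_one[OF H.one_form_sign_rep] by (simp add: T_def)
  have Tc: "T \<in> carrier_mat (d + 1) 1" by (simp add: T_def H.copy_one_def)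
  define U where "U = (\<lambda>u. R *\<^sub>v u) ` carrier_vec 2"
  have CU: "C *\<^sub>v z \<in> U" if z: "z \<in> carrier_vec 2" for z
  proof -
    have "R *\<^sub>v (P *\<^sub>v z) = (R * P) *\<^sub>v z" by (rule assoc_mult_mat_vec[symmetric, OF Rc PQ(1) z])
    also have "R * P = C * (Q * P)" unfolding R_def by (rule assoc_mult_mat[OF C PQ(2,1)])
    also have "\<dots> = C" using C PQ by simp
    finally show ?thesis unfolding U_def using PQ z by (metis imageI mult_mat_vec_carrier)
  qed
  have Cz: "(C *\<^sub>v z) $ i = (if i = d then z $ 0 else if i = 0 then z $ 1 else 0)"
    if "z \<in> carrier_vec 2" "i \<le> d" for z i
  proof -
    have "{0..<2::nat} = {0, 1}" by auto
    thus ?thesis using that e(3) by (auto simp: C_def W.copy_two_def scalar_prod_def)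
  qed
  have Tu: "T *\<^sub>v u = C *\<^sub>v vec2 (u $ 0) (- (u $ 0))" if u: "u \<in> carrier_vec 1" for u
  proof (rule eq_vecI)
    fix i assume "i < dim_vec (C *\<^sub>v vec2 (u $ 0) (- (u $ 0)))"
    hence i: "i \<le> d" using C by simp
    have "(T *\<^sub>v u) $ i = T $$ (i, 0) * u $ 0" using i Tc u by (simp add: scalar_prod_def)
    also have "\<dots> = (C *\<^sub>v vec2 (u $ 0) (- (u $ 0))) $ i"
      using i e(3) Cz[of "vec2 (u $ 0) (- (u $ 0))" i] by (simp add: T_def H.copy_one_def)
    finally show "(T *\<^sub>v u) $ i = (C *\<^sub>v vec2 (u $ 0) (- (u $ 0))) $ i" .
  qed (use C Tc in simp)
  let ?S = "{sym_pow d g *\<^sub>v (T *\<^sub>v u) | g u. g \<in> W.D \<and> u \<in> carrier_vec (deg sign_rep)}"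
  have Uinv: "sym_pow d g *\<^sub>v v \<in> U" if g: "g \<in> W.D" and v: "v \<in> U" for g v
  proof -
    obtain u where u: "u \<in> carrier_vec 2" "v = R *\<^sub>v u" using v by (auto simp: U_def)
    hence "sym_pow d g *\<^sub>v v = R *\<^sub>v (E g *\<^sub>v u)"
      using W.intertwiner_sym_vec[OF R(1) rep g, of u] deg by simp
    thus ?thesis unfolding U_def using W.rep_carrier[OF rep g] u deg by auto
  qed
  have "LinearCombinations.module.span class_ring (module_vec TYPE(complex) (d + 1)) ?S = U"
    unfolding U_def
  proof (rule span_eqI[OF W.image_closed[OF Rc]], unfold U_def[symmetric])
    show "?S \<subseteq> U" using Uinv Tu CU by auto
    fix v assume "v \<in> U"
    then obtain u where u: "u \<in> carrier_vec 2" "v = R *\<^sub>v u" by (auto simp: U_def)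
    define z where "z = Q *\<^sub>v u"
    have z: "z \<in> carrier_vec 2" using PQ u by (simp add: z_def)
    have vz: "v = C *\<^sub>v z" unfolding u(2) R_def z_def by (rule assoc_mult_mat_vec[OF C PQ(2) u(1)])
    have "W.w ^ (2 * d) \<noteq> 1" using W.w_pow_eq_1_iff[of "2 * d"] e by (auto dest: dvd_imp_le)
    hence "W.w ^ d * W.w ^ d \<noteq> 1" by (simp add: mult_2 power_add)
    hence wne: "W.w ^ d - inverse (W.w ^ d) \<noteq> 0" by (auto simp: field_simps)
    \<comment> \<open>Solves (z0, z1) = x * (1, -1) + y * (w^d, -w^(-d)); adding the two coordinates
      isolates y.\<close>
    define y where "y = (z $ 0 + z $ 1) / (W.w ^ d - inverse (W.w ^ d))"
    define x where "x = z $ 0 - y * W.w ^ d"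
    have yeq: "y * (W.w ^ d - inverse (W.w ^ d)) = z $ 0 + z $ 1" using wne by (simp add: y_def)
    define one where "one = vec 1 (\<lambda>_. 1 :: complex)"
    have one: "one \<in> carrier_vec 1" "one $ 0 = 1" by (auto simp: one_def)
    define s where "s = sym_pow d (rot 1) *\<^sub>v (T *\<^sub>v one)"
    define t where "t = sym_pow d (rot W.w) *\<^sub>v (T *\<^sub>v one)"
    have st: "s \<in> ?S" "t \<in> ?S" using W.rot_in[of 1] W.rot_in[OF W.w_pow_m] one unfolding s_def t_def by fastforce+
    have Tone: "T *\<^sub>v one = C *\<^sub>v vec2 1 (- 1)" "T *\<^sub>v one \<in> carrier_vec (d + 1)"
      using Tu[OF one(1)] one(2) mult_mat_vec_carrier[OF Tc one(1)] by simp_all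
    have stc: "s \<in> carrier_vec (d + 1)" "t \<in> carrier_vec (d + 1)"
      unfolding s_def t_def by (rule mult_mat_vec_carrier[OF sym_pow_carrier Tone(2)])+
    have "v = x \<cdot>\<^sub>v s + y \<cdot>\<^sub>v t"
    proof (rule eq_vecI)
      fix i assume "i < dim_vec (x \<cdot>\<^sub>v s + y \<cdot>\<^sub>v t)"
      hence i: "i \<le> d" using stc by auto
      have st_i: "s $ i = wt d 1 i * (T *\<^sub>v one) $ i" "t $ i = wt d W.w i * (T *\<^sub>v one) $ i"
        unfolding s_def t_def by (rule sym_rot_vec[OF Tone(2) i])+
      hence si: "s $ i = (T *\<^sub>v one) $ i" by (simp add: wt_def)
      have "(x \<cdot>\<^sub>v s + y \<cdot>\<^sub>v t) $ i = (x + y * wt d W.w i) * (C *\<^sub>v vec2 1 (- 1)) $ i"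
        using stc i si st_i(2) Tone by (simp add: algebra_simps)
      also have "\<dots> = (C *\<^sub>v z) $ i"
        using Cz[OF _ i, of "vec2 1 (- 1)"] Cz[OF z i] yeq by (auto simp: x_def algebra_simps)
      finally show "v $ i = (x \<cdot>\<^sub>v s + y \<cdot>\<^sub>v t) $ i" by (simp add: vz)
    qed (use stc C vz in auto)
    thus "\<exists>a b s t. s \<in> ?S \<and> t \<in> ?S \<and> v = a \<cdot>\<^sub>v s + b \<cdot>\<^sub>v t" using st by blast
  qed
  hence im: "(\<lambda>u. R *\<^sub>v u) ` carrier_vec (deg E) =
      LinearCombinations.module.span class_ring (module_vec TYPE(complex) (d + 1)) ?S"
    by (simp add: U_def deg)
  have Ti: "intertwiner H.D sign_rep (sym_pow d) T" "T \<noteq> 0\<^sub>m (d + 1) (deg sign_rep)"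
    "\<forall>T'. intertwiner H.D sign_rep (sym_pow d) T' \<longrightarrow> (\<exists>c. T' = c \<cdot>\<^sub>m T)"
    using T by (simp_all add: first_copy_def)
  show ?thesis unfolding trunc_ind_def Let_def bH
    by (intro conjI exI[of _ T] exI[of _ R]) (fact H.irr_sign_rep rep Ti R(1) W.intertwiner_inj[OF E R] im)+
qed

text \<open>The sign representation of the subgroup of index 2 occurs as the line of e1^n - a0^n *
  e2^n, which the whole group already preserves. The action of \<open>ref 1\<close> on it depends on
  a0^n and so separates the two induced representations.\<close>

lemma trunc_ind_sign_half:
  assumes e: "e = 2 * n" "n > 0" and a0: "a0 ^ e = 1" and E: "irr (Dih e 1) E"
    and tr: "trunc_ind (Dih e 1) (Dih n a0) sign_rep E" and u: "u \<in> carrier_vec (deg E)"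
  shows "E (ref 1) *\<^sub>v u = (- (a0 ^ n)) \<cdot>\<^sub>v u"
proof -
  have a0nz: "a0 \<noteq> 0" using a0 e by (auto simp: power_0_left)
  interpret W: dihedral e 1 by unfold_locales (use e in auto)
  interpret H: dihedral n a0 by unfold_locales (use e a0nz in auto)
  have rep: "rep W.D E" using E by (simp add: irr_def)
  have sq: "a ^ n * a ^ n = 1" if "a ^ e = 1" for a :: complex using that e by (simp add: mult_2 power_add)
  have inv: "inverse (a ^ n) = a ^ n" if "a ^ e = 1" for a :: complex using inverse_unique[OF sq[OF that]] .
  obtain T R where T: "intertwiner H.D sign_rep (sym_pow n) T" "T \<noteq> 0\<^sub>m (n + 1) 1"
    and R: "intertwiner W.D E (sym_pow n) R" "inj_on (\<lambda>u. R *\<^sub>v u) (carrier_vec (deg E))"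
      "(\<lambda>u. R *\<^sub>v u) ` carrier_vec (deg E) =
           LinearCombinations.module.span class_ring (module_vec TYPE(complex) (n + 1))
             {sym_pow n g *\<^sub>v (T *\<^sub>v u) | g u. g \<in> W.D \<and> u \<in> carrier_vec (deg sign_rep)}" (is "_ = LinearCombinations.module.span _ _ ?S")
    using tr unfolding trunc_ind_def Let_def H.b_value_sign_rep by auto
  have Rc: "R \<in> carrier_mat (n + 1) (deg E)" using R(1) by (simp add: intertwiner_def)
  have "H.label_one 0 (-1) = n" using H.m by (simp add: H.label_one_def)
  hence "first_copy H.D sign_rep n (H.copy_one n (-1))" using H.first_copy_one[OF H.one_form_sign_rep] by simp
  then obtain c where c: "T = c \<cdot>\<^sub>m H.copy_one n (-1)" using T(1) unfolding first_copy_def by blast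
  define f where "f = vec (n + 1) (\<lambda>i. if i = n then 1 else if i = 0 then - (a0 ^ n) else 0)"
  have fc: "f \<in> carrier_vec (n + 1)" by (simp add: f_def)
  have fi: "f $ i = (if i = n then 1 else if i = 0 then - (a0 ^ n) else 0)" if "i \<le> n" for i
    using that by (simp add: f_def)
  have Tu: "T *\<^sub>v v = (c * v $ 0) \<cdot>\<^sub>v f" if v: "v \<in> carrier_vec 1" for v
    using v e inv[OF a0] by (intro eq_vecI) (auto simp: c H.copy_one_def f_def scalar_prod_def)
  define U where "U = {x \<cdot>\<^sub>v f | x. True}"
  have rotf: "sym_pow n (rot a) *\<^sub>v f = a ^ n \<cdot>\<^sub>v f" if a: "a ^ e = 1" for a
  proof (rule eq_vecI)
    fix i assume "i < dim_vec (a ^ n \<cdot>\<^sub>v f)"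
    hence i: "i \<le> n" using fc by auto
    thus "(sym_pow n (rot a) *\<^sub>v f) $ i = (a ^ n \<cdot>\<^sub>v f) $ i"
      using sym_rot_vec[OF fc i, of a] fi[OF i] inv[OF a] fc by auto
  qed (use fc sym_pow_carrier[of n "rot a"] in auto)
  have reff: "sym_pow n (ref a) *\<^sub>v f = (- (a ^ n * a0 ^ n)) \<cdot>\<^sub>v f" if a: "a ^ e = 1" for a
  proof (rule eq_vecI)
    fix i assume "i < dim_vec ((- (a ^ n * a0 ^ n)) \<cdot>\<^sub>v f)"
    hence i: "i \<le> n" using fc by auto
    consider "i = n" | "i = 0" | "0 < i" "i < n" using i by linarith
    thus "(sym_pow n (ref a) *\<^sub>v f) $ i = ((- (a ^ n * a0 ^ n)) \<cdot>\<^sub>v f) $ i"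
    proof cases
      case 1 thus ?thesis using sym_ref_vec[OF fc i, of a] fi[of n] fi[of 0] e fc by auto
    next
      case 2 thus ?thesis using sym_ref_vec[OF fc i, of a] fi[of n] fi[of 0] e fc inv[OF a] sq[OF a0]
        by (auto simp: mult.assoc)
    next
      case 3 thus ?thesis using sym_ref_vec[OF fc i, of a] fi[of i] fi[of "n - i"] fc by auto
    qed
  qed (use fc sym_pow_carrier[of n "ref a"] in auto)
  have imU: "R *\<^sub>v v \<in> U" if v: "v \<in> carrier_vec (deg E)" for v
  proof -
    interpret vs: vec_space "TYPE(complex)" "n + 1" .
    have sub: "submodule class_ring U vs.V"
    proof -
      have "VectorSpace.subspace class_ring U vs.V"
      proof (rule subspaceI)
        show "0\<^sub>v (n + 1) \<in> U" using fc by (auto simp: U_def intro!: exI[of _ 0])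
      qed (use fc in \<open>auto simp: U_def smult_smult_assoc simp flip: add_smult_distrib_vec\<close>)
      thus ?thesis by (simp add: VectorSpace.subspace_def)
    qed
    have "?S \<subseteq> U"
    proof
      fix s assume "s \<in> ?S"
      then obtain g x where gx: "s = sym_pow n g *\<^sub>v (T *\<^sub>v x)" "g \<in> W.D" "x \<in> carrier_vec 1" by auto
      have "\<exists>y. sym_pow n g *\<^sub>v f = y \<cdot>\<^sub>v f"
        using gx(2) rotf reff by (auto elim!: W.D_cases)
      then obtain y where "sym_pow n g *\<^sub>v f = y \<cdot>\<^sub>v f" by blast
      hence "s = (c * x $ 0 * y) \<cdot>\<^sub>v f"
        unfolding gx(1) Tu[OF gx(3)] using mult_mat_vec[OF sym_pow_carrier fc] by (simp add: smult_smult_assoc)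
      thus "s \<in> U" by (auto simp: U_def)
    qed
    hence "vs.span ?S \<subseteq> U" by (rule vs.span_is_subset[OF _ sub])
    thus ?thesis using v R(3) by blast
  qed
  have g1: "ref 1 \<in> W.D" using W.ref_in[of 1] by simp
  obtain x where x: "R *\<^sub>v u = x \<cdot>\<^sub>v f" using imU[OF u] by (auto simp: U_def)
  have "R *\<^sub>v (E (ref 1) *\<^sub>v u) = sym_pow n (ref 1) *\<^sub>v (x \<cdot>\<^sub>v f)"
    using W.intertwiner_sym_vec[OF R(1) rep g1 u] x by simp
  also have "\<dots> = x \<cdot>\<^sub>v (sym_pow n (ref 1) *\<^sub>v f)" by (rule mult_mat_vec[OF sym_pow_carrier fc])
  also have "\<dots> = (- (a0 ^ n)) \<cdot>\<^sub>v (x \<cdot>\<^sub>v f)"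
    using reff[of 1] by (simp add: smult_smult_assoc mult.commute)
  also have "\<dots> = R *\<^sub>v ((- (a0 ^ n)) \<cdot>\<^sub>v u)" unfolding x[symmetric] by (rule mult_mat_vec[OF Rc u, symmetric])
  finally show ?thesis using R(2) u W.rep_carrier[OF rep g1] by (auto dest!: inj_onD)
qed

lemma trunc_ind_cong:
  assumes tr: "trunc_ind W W' E' E" and deg: "deg E' = deg F'" and eq: "\<And>g. g \<in> W' \<Longrightarrow> E' g = F' g"
    and irr: "irr W' F'"
  shows "trunc_ind W W' F' E"
proof -
  have i: "intertwiner W' E' F T \<longleftrightarrow> intertwiner W' F' F T" for F T
    using deg eq by (simp add: intertwiner_def)
  have "b_value W' E' = b_value W' F'" unfolding b_value_def i deg ..
  thus ?thesis using tr irr unfolding trunc_ind_def i deg by simp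
qed

section \<open>Springer representations\<close>

lemma (in group) involution_int_pow:
  assumes x: "x \<in> carrier G" "x \<otimes> x = \<one>"
  shows "x [^] (k::int) = \<one> \<or> x [^] k = x"
proof (cases "even k")
  case True
  then obtain l where k: "k = 2 * l" by auto
  have "x [^] (2::int) = \<one>" using int_pow_mult[of x 1 1] x by (simp add: int_pow_1)
  thus ?thesis using int_pow_pow[OF x(1), of 2 l] x by (simp add: k)
next
  case False
  then obtain l where k: "k = 2 * l + 1" by (auto elim: oddE)
  have "x [^] (2::int) = \<one>" using int_pow_mult[of x 1 1] x by (simp add: int_pow_1)
  hence "x [^] (2 * l) = \<one>" using int_pow_pow[OF x(1), of 2 l] x by simp
  thus ?thesis using int_pow_mult[OF x(1), of "2 * l" 1] x by (simp add: k int_pow_1)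
qed

lemma full_in_Gee2:
  assumes e: "e > 0" and H: "H \<subseteq> Gee2 e" "reflection_group H"
  shows "full (Gee2 e) H"
  unfolding full_def
proof (intro conjI ballI impI allI)
  fix s and a :: int assume s: "s \<in> Gee2 e" "reflection s"
    and a: "s [^]\<^bsub>GL 2\<^esub> a \<in> H \<and> s [^]\<^bsub>GL 2\<^esub> a \<noteq> 1\<^sub>m 2"
  have "s \<in> {s \<in> Dih e 1. reflection s}" using s e by (simp add: Gee2_eq_Dih)
  then obtain b where b: "s = ref b" "b ^ e = 1" using e by (auto simp: reflections_Dih)
  hence "b \<noteq> 0" using e by (auto simp: power_0_left)
  hence "s [^]\<^bsub>GL 2\<^esub> a = \<one>\<^bsub>GL 2\<^esub> \<or> s [^]\<^bsub>GL 2\<^esub> a = s"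
    using b by (intro GL.involution_int_pow) auto
  thus "s \<in> H" using a by auto
qed (use H in auto)

context cyclotomic
begin

lemma is_stab_reflE:
  assumes "is_stab_refl H"
  obtains "H = {1\<^sub>m 2}"
  | m i where "H = Dih m (\<zeta> ^ i)" "m dvd e" "m > 0" "m = 1 \<or> m = e \<or> primepow m"
proof -
  obtain v where v: "H = stab_refl v" using assms by (auto simp: is_stab_refl_def)
  show thesis
  proof (cases rule: stab_refl_cases[of v])
    case 1 thus thesis using that v by simp
  next
    case (2 i g)
    have "e div g dvd e" "e div g > 0" "e div g = 1 \<or> e div g = e \<or> primepow (e div g)"
      using 2(2,3) e_pos by (auto intro: div_dvd_iff_mult[THEN iffD2])
    thus thesis using that(2)[of "e div g" i] 2(1) v by blast
  qed
qed

lemma is_stab_refl_props: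
  assumes "is_stab_refl H"
  shows "H \<subseteq> Gee2 e" "reflection_group H" "spetsial H"
proof -
  have "H \<subseteq> Gee2 e \<and> reflection_group H \<and> spetsial H"
  proof (cases rule: is_stab_reflE[OF assms])
    case 1
    thus ?thesis using reflection_group_trivial spetsial_trivial_group subgroup.one_closed[OF Dih_subgroup, of e 1] e_pos
      by (simp add: Gee2_eq_Dih)
  next
    case (2 m i)
    interpret H: dihedral m "\<zeta> ^ i" by unfold_locales (use 2 in auto)
    have "(\<zeta> ^ i) ^ e = 1" by (metis mult.commute power_mult power_one zeta_pow_e)
    thus ?thesis using 2 Dih_subset[of m e "\<zeta> ^ i"] H.spetsial_D reflection_group_Dih e_pos
      by (simp add: Gee2_eq_Dih)
  qed
  thus "H \<subseteq> Gee2 e" "reflection_group H" "spetsial H" by auto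
qed

lemma pseudoparabolic_Gee2_iff: "pseudoparabolic_Gee2 e \<zeta> H \<longleftrightarrow> is_stab_refl H"
proof -
  have full: "full (Gee2 e) R" if "is_stab_refl R" for R
    using full_in_Gee2[OF e_pos] is_stab_refl_props[OF that] by blast
  have sub: "P \<subseteq> R" if "parabolic (space_V \<zeta>) R P" for P R using that by (auto simp: parabolic_def)
  \<comment> \<open>The empty set of vectors exhibits R as a parabolic subgroup of itself, so the
    maximal full parabolic subgroup is R.\<close>
  have self: "parabolic (space_V \<zeta>) R R" for R unfolding parabolic_def by (intro exI[of _ "{}"]) auto
  have plein: "plein (space_V \<zeta>) (Gee2 e) R P \<longleftrightarrow> P = R" if "is_stab_refl R" for R P
    using full[OF that] sub[of R] self[of R] unfolding plein_def by blast
  have spets: "largest_full_spetsial (Gee2 e) R Q \<longleftrightarrow> Q = R" if "is_stab_refl R" for R Q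
    using full[OF that] is_stab_refl_props(3)[OF that] unfolding largest_full_spetsial_def by blast
  have R: "is_stab_refl (stab_refl (x $ 0))" if "x \<in> space_V0 \<zeta>" for x
    using that by (auto simp: is_stab_refl_def)
  show ?thesis
  proof
    assume "pseudoparabolic_Gee2 e \<zeta> H"
    then obtain x where x: "x \<in> space_V0 \<zeta>" "H = Gee2 e \<inter> stab_refl (x $ 0)"
      unfolding pseudoparabolic_Gee2_def pseudoparabolic_def
      using refl_part_stabilizer plein[OF R] spets[OF R] by metis
    thus "is_stab_refl H" using R[OF x(1)] is_stab_refl_props(1)[OF R[OF x(1)]] by (simp add: Int_absorb1)
  next
    assume H: "is_stab_refl H"
    then obtain x where x: "x \<in> space_V0 \<zeta>" "H = stab_refl (x $ 0)" by (auto simp: is_stab_refl_def)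
    have "H = Gee2 e \<inter> H" using is_stab_refl_props(1)[OF H] by blast
    thus "pseudoparabolic_Gee2 e \<zeta> H"
      unfolding pseudoparabolic_Gee2_def pseudoparabolic_def
      using x refl_part_stabilizer[OF x(1)] plein[OF H, of H] spets[OF H, of H] by metis
  qed
qed

lemma springer_reps_iff:
  "E \<in> springer_reps e \<zeta> \<longleftrightarrow> irr (Dih e 1) E \<and>
     (\<exists>W' E'. is_stab_refl W' \<and> special W' E' \<and> trunc_ind (Dih e 1) W' E' E)"
  using e_pos by (simp add: springer_reps_def pseudoparabolic_Gee2_iff Gee2_eq_Dih)

lemma chi_iff:
  assumes "k dvd e"
  shows "E \<in> chi e \<zeta> k \<longleftrightarrow> irr (Dih e 1) E \<and> b_value (Dih e 1) E = k \<and>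
     (2 * k = e \<longrightarrow> trunc_ind (Dih e 1) (Dih k 1) sign_rep E)"
  using e_pos Gdd2_eq[OF assms] by (simp add: chi_def Gee2_eq_Dih)

sublocale W: dihedral e 1 by unfold_locales (use e_pos in auto)

lemma special_in_springer_reps: "special W.D E \<Longrightarrow> E \<in> springer_reps e \<zeta>"
  using W.trunc_ind_self is_stab_refl_full by (auto simp: springer_reps_iff special_def)

text \<open>For d = e the representation is special. For 2 * d = e the truncated induction is part
  of the definition of \<open>chi\<close>, and for 2 * d < e it is
  \<open>trunc_ind_sign\<close>.\<close>

lemma primepow_in_springer_reps:
  assumes d: "d dvd e" "primepow d" and E: "E \<in> chi e \<zeta> d"
  shows "E \<in> springer_reps e \<zeta>"
proof -
  have d0: "d > 0" using d(2) primepow_gt_0_nat by blast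
  have irr: "irr W.D E" and b: "b_value W.D E = d"
    and half: "2 * d = e \<Longrightarrow> trunc_ind W.D (Dih d 1) sign_rep E"
    using E d(1) by (auto simp: chi_iff)
  interpret H: dihedral d 1 by unfold_locales (use d0 in auto)
  obtain q where q: "e = d * q" using d(1) by auto
  show ?thesis
  proof (cases "q = 1")
    case True
    thus ?thesis using special_in_springer_reps[of E] W.special_iff[of E] irr b q by simp
  next
    case False
    have q2: "q \<ge> 2" using False q e_pos by (cases q) auto
    have "trunc_ind W.D (Dih d 1) sign_rep E"
    proof (cases "q = 2")
      case True thus ?thesis using half q by simp
    next
      case False
      hence "2 * d < e" using q2 q d0 by simp
      thus ?thesis using trunc_ind_sign[OF q _ d0 irr b] by simp
    qed
    moreover have "is_stab_refl (Dih d 1)" using is_stab_refl_iff[OF d(1)] d(2) primepow_gt_Suc_0[OF d(2)] by auto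
    ultimately show ?thesis using irr H.special_sign_rep unfolding springer_reps_iff by blast
  qed
qed

text \<open>A special E' of a dihedral subgroup of order 2m has b equal to 0, 1 or m, and b is
  preserved. The value determines the class except when 2 * m = e, where the subgroup and E' have to
  be identified.\<close>

lemma springer_reps_cases:
  assumes e2: "e > 2" and E: "E \<in> springer_reps e \<zeta>"
  obtains k where "E \<in> chi e \<zeta> k" "k = 0 \<or> k = 1 \<or> k = e \<or> (k dvd e \<and> primepow k)"
proof -
  note chiI = that
  obtain W' E' where irr: "irr W.D E" and W': "is_stab_refl W'" and sp: "special W' E'"
    and tr: "trunc_ind W.D W' E' E" using E by (auto simp: springer_reps_iff)
  have sub: "W' \<subseteq> W.D" using is_stab_refl_props(1)[OF W'] e_pos by (simp add: Gee2_eq_Dih)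
  have irr': "irr W' E'" using sp by (simp add: special_def)
  have small: thesis if "b_value W.D E = 0 \<or> b_value W.D E = 1"
    by (rule chiI[of "b_value W.D E"]) (use that irr e2 in \<open>auto simp: chi_def Gee2_eq_Dih[OF e_pos]\<close>)
  show thesis
  proof (cases rule: is_stab_reflE[OF W'])
    case 1
    have "b_value W.D E = b_value W' E'"
      by (rule W.trunc_ind_b_value[OF irr sub _ tr]) (use 1 irr_trivial_group[of E'] irr' in auto)
    thus thesis using small b_value_trivial_group[of E'] irr' 1 by simp
  next
    case (2 m i)
    interpret H: dihedral m "\<zeta> ^ i" by unfold_locales (use 2 in auto)
    have b: "b_value W.D E = b_value W' E'"
      by (rule W.trunc_ind_b_value[OF irr sub _ tr]) (use 2 irr' H.one_in H.rep_carrier in \<open>auto simp: irr_def\<close>)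
    show thesis
    proof (cases "b_value W' E' \<le> 1")
      case True thus thesis using small b by force
    next
      case False
      have bm: "b_value W' E' = m" "m > 1" using False sp H.special_iff[of E'] 2(1) by auto
      have half: "trunc_ind W.D (Dih m 1) sign_rep E" if m: "2 * m = e"
      proof -
        \<comment> \<open>When 2 * m = e, the group \<open>Dih m (\<zeta> ^ i)\<close> depends only
          on the parity of i. Odd i gives G'(e/2,e/2,2), which is not pseudoparabolic for m >
          1.\<close>
        have W1: "W' = Dih m 1"
        proof (cases "even i")
          case True
          then obtain j where "i = 2 * j" by auto
          hence "i * m = e * j" using m by simp
          hence "(\<zeta> ^ i / 1) ^ m = 1" by (metis power_mult power_one zeta_pow_e div_by_1)
          thus ?thesis unfolding 2(1) using 2(3) by (subst Dih_eq_iff) auto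
        next
          case False
          then obtain j where j: "i = 2 * j + 1" by (auto elim: oddE)
          have "2 * j * m = e * j" using m by simp
          hence "(\<zeta> ^ (2 * j)) ^ m = 1" by (metis power_mult power_one zeta_pow_e)
          hence "W' = Dih m \<zeta>" unfolding 2(1) using 2(3) j by (subst Dih_eq_iff) auto
          moreover have "e div m = 2" using m 2(3) by auto
          ultimately show ?thesis using W' is_stab_refl_iff'[OF 2(2)] bm(2) m by simp
        qed
        interpret H1: dihedral m 1 by unfold_locales (use 2 in auto)
        \<comment> \<open>With b equal to m, only the sign representation is left.\<close>
        have o: "H1.one_form E' 0 (-1)"
          by (rule H1.label_sign) (use irr' bm W1 in auto)
        show ?thesis
        proof (rule trunc_ind_cong[OF tr[unfolded W1]])
          show "irr (Dih m 1) sign_rep" by (rule H1.irr_sign_rep)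
          show "deg E' = deg sign_rep" using o by (simp add: H1.one_form_def)
          fix g assume "g \<in> Dih m 1"
          thus "E' g = sign_rep g" using o H1.one_form_sign_rep
            by (auto elim!: H1.D_cases simp: H1.one_form_def)
        qed
      qed
      have "E \<in> chi e \<zeta> m" using half irr b bm 2(2) by (simp add: chi_iff)
      thus thesis using chiI 2(2,4) by blast
    qed
  qed
qed

lemma springer_reps_eq:
  assumes e2: "e > 2"
  shows "springer_reps e \<zeta> =
    chi e \<zeta> 0 \<union> chi e \<zeta> 1 \<union> chi e \<zeta> e \<union> (\<Union>d\<in>{d. d dvd e \<and> primepow d}. chi e \<zeta> d)"
proof
  show "springer_reps e \<zeta> \<subseteq>
    chi e \<zeta> 0 \<union> chi e \<zeta> 1 \<union> chi e \<zeta> e \<union> (\<Union>d\<in>{d. d dvd e \<and> primepow d}. chi e \<zeta> d)"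
  proof
    fix E assume "E \<in> springer_reps e \<zeta>"
    thus "E \<in> chi e \<zeta> 0 \<union> chi e \<zeta> 1 \<union> chi e \<zeta> e \<union> (\<Union>d\<in>{d. d dvd e \<and> primepow d}. chi e \<zeta> d)"
      by (rule springer_reps_cases[OF e2]) auto
  qed
  have "E \<in> springer_reps e \<zeta>" if "E \<in> chi e \<zeta> k" "k = 0 \<or> k = 1 \<or> k = e" for E k
    using that by (intro special_in_springer_reps) (auto simp: W.special_iff chi_def Gee2_eq_Dih[OF e_pos])
  thus "chi e \<zeta> 0 \<union> chi e \<zeta> 1 \<union> chi e \<zeta> e \<union> (\<Union>d\<in>{d. d dvd e \<and> primepow d}. chi e \<zeta> d)
    \<subseteq> springer_reps e \<zeta>"
    using primepow_in_springer_reps by blast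
qed

text \<open>The truncated inductions of the sign from the two subgroups of index 2 live in degree \<open>e div 2\<close>,
  where \<open>ref 1\<close> acts on them by \<open>-1\<close> and by \<open>1\<close>, because \<open>\<zeta> ^ (e div 2) = -1\<close>.\<close>

lemma chi'_disjoint:
  assumes e2: "e > 2" and ev: "even e"
  shows "chi' e \<zeta> \<inter> springer_reps e \<zeta> = {}"
proof (rule ccontr)
  assume "chi' e \<zeta> \<inter> springer_reps e \<zeta> \<noteq> {}"
  then obtain E where E': "E \<in> chi' e \<zeta>" and E: "E \<in> springer_reps e \<zeta>" by blast
  define n where "n = e div 2"
  have n: "e = 2 * n" "n > 1" "n dvd e" using e2 ev by (auto simp: n_def)
  have irr: "irr W.D E" and tr': "trunc_ind W.D (Dih n \<zeta>) sign_rep E"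
    using E' n(3) e_pos by (auto simp: chi'_def Gee2_eq_Dih Gdd2'_eq n_def)
  have half: "\<zeta> ^ n = -1"
  proof -
    have "\<zeta> ^ n \<noteq> 1" using primitive n by (auto simp: primitive_root_of_unity_def)
    moreover have "(\<zeta> ^ n)\<^sup>2 = 1" using zeta_pow_e n(1) by (simp add: power_mult mult.commute flip: power_mult)
    ultimately show ?thesis by (simp add: power2_eq_1_iff)
  qed
  interpret H: dihedral n \<zeta> by unfold_locales (use n in auto)
  have "Dih n \<zeta> \<subseteq> W.D" using Dih_subset[of n e \<zeta>] n zeta_pow_e by simp
  hence "b_value W.D E = n"
    using W.trunc_ind_b_value[OF irr _ _ tr'] H.irr_sign_rep H.b_value_sign_rep H.one_in H.rep_carrier[of sign_rep]
    by (auto simp: irr_def)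
  hence tr: "trunc_ind W.D (Dih n 1) sign_rep E"
  proof (cases rule: springer_reps_cases[OF e2 E])
    case (1 k)
    hence "k = n" using \<open>b_value W.D E = n\<close> e_pos by (simp add: chi_def Gee2_eq_Dih)
    thus ?thesis using 1(1) n(1) chi_iff[OF n(3)] by simp
  qed
  have pos: "deg E > 0" using irr by (simp add: irr_def)
  define u where "u = (unit_vec (deg E) 0 :: complex vec)"
  have u: "u \<in> carrier_vec (deg E)" by (simp add: u_def)
  have "E (ref 1) *\<^sub>v u = (- (1 ^ n)) \<cdot>\<^sub>v u"
    by (rule trunc_ind_sign_half[OF n(1) _ _ irr tr u]) (use n in auto)
  moreover have "E (ref 1) *\<^sub>v u = (- (\<zeta> ^ n)) \<cdot>\<^sub>v u"
    by (rule trunc_ind_sign_half[OF n(1) _ _ irr tr' u]) (use n zeta_pow_e in auto)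
  ultimately have "(- 1 \<cdot>\<^sub>v u) $ 0 = (1 \<cdot>\<^sub>v u) $ 0" by (simp add: half)
  thus False using pos by (simp add: u_def)
qed

text \<open>For e = 2 there is no k with 0 < 2 * k < e, so all irreducible representations are
  one-dimensional, with b equal to 0, 1 or 2, and all are special.\<close>

lemma springer_reps_2:
  assumes e2: "e = 2" and E: "irr W.D E"
  shows "E \<in> springer_reps e \<zeta>"
proof (rule special_in_springer_reps)
  show "special W.D E" unfolding W.special_iff
  proof (cases rule: W.irr_cases[OF E])
    case (4 k P Q)
    hence "0 < k" "2 * k < e" by (simp_all add: W.two_form_def)
    thus "irr W.D E \<and> (b_value W.D E = 0 \<or> b_value W.D E = 1 \<or> b_value W.D E = e)" using e2 by simp
  qed (use e2 E in auto)
qed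

end

theorem mainTheorem2:
  fixes e :: nat and \<zeta> :: complex
  assumes "e > 0" and "primitive_root_of_unity e \<zeta>"
  shows
    "(\<forall>d. d dvd e \<and> (e, d) \<noteq> (2, 1) \<longrightarrow>
        (pseudoparabolic_Gee2 e \<zeta> (Gdd2 e \<zeta> d) \<longleftrightarrow> d = 1 \<or> d = e \<or> (d dvd e \<and> primepow d))) \<and>
     (even e \<longrightarrow> (\<forall>d. d dvd e \<and> even (e div d) \<longrightarrow>
        (pseudoparabolic_Gee2 e \<zeta> (Gdd2' e \<zeta> d) \<longleftrightarrow>
           even (e div d) \<and> (d = 1 \<or> (2 * d < e \<and> primepow d))))) \<and>
     (e > 2 \<longrightarrow>
        springer_reps e \<zeta> =
          chi e \<zeta> 0 \<union> chi e \<zeta> 1 \<union> chi e \<zeta> e \<union> (\<Union>d\<in>{d. d dvd e \<and> primepow d}. chi e \<zeta> d) \<and>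
        (even e \<longrightarrow> chi' e \<zeta> \<inter> springer_reps e \<zeta> = {})) \<and>
     (e = 2 \<longrightarrow> (\<forall>E. irr (Gee2 2) E \<longrightarrow> E \<in> springer_reps 2 \<zeta>))"
proof -
  interpret cyclotomic e \<zeta> by unfold_locales (rule assms)+
  show ?thesis
  proof (intro conjI allI impI)
    fix d assume "d dvd e \<and> (e, d) \<noteq> (2, 1)"
    thus "pseudoparabolic_Gee2 e \<zeta> (Gdd2 e \<zeta> d) \<longleftrightarrow> d = 1 \<or> d = e \<or> (d dvd e \<and> primepow d)"
      using is_stab_refl_iff[of d] by (simp add: pseudoparabolic_Gee2_iff Gdd2_eq)
  next
    fix d assume "d dvd e \<and> even (e div d)"
    thus "pseudoparabolic_Gee2 e \<zeta> (Gdd2' e \<zeta> d) \<longleftrightarrow>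
        even (e div d) \<and> (d = 1 \<or> (2 * d < e \<and> primepow d))"
      using is_stab_refl_iff'[of d] by (simp add: pseudoparabolic_Gee2_iff Gdd2'_eq)
  next
    assume "2 < e"
    thus "springer_reps e \<zeta> =
        chi e \<zeta> 0 \<union> chi e \<zeta> 1 \<union> chi e \<zeta> e \<union> (\<Union>d\<in>{d. d dvd e \<and> primepow d}. chi e \<zeta> d)"
      by (rule springer_reps_eq)
  next
    assume "2 < e" "even e"
    thus "chi' e \<zeta> \<inter> springer_reps e \<zeta> = {}" by (rule chi'_disjoint)
  next
    fix E assume e: "e = 2" and E: "irr (Gee2 2) E"
    have "irr (Dih e 1) E" using E Gee2_eq_Dih[of 2] by (simp add: e)
    thus "E \<in> springer_reps 2 \<zeta>" using springer_reps_2[OF e] e by simp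
  qed
qed

end
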